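(* Assume the following. (Dyadic dependence) For any two disjoint index sets $S_1,S_2\subset\{1,\dots,N\}$, the families $\{(\mathbf{x}_n,u_n)\}_{n\in S_1}$ and $\{(\mathbf{x}_m,u_m)\}_{m\in S_2}$ are independent whenever $\psi(n)\cap\psi(m)=\emptyset$ for every $n\in S_1$ and $m\in S_2$. (Bounded support) There are finite constants $C_x,C_u$ with $\|\mathbf{x}_n\|\le C_x$ and $|u_n|\le C_u$ almost surely for all $n$ and $N$. (Identification) $\mathbb{E}[\mathbf{x}_nu_n]=\mathbf{0}$ for all $n$, and there is a constant $c_Q$ with $\lambda_{\min}(Q_N)\ge c_Q>0$ for all $N$. (Variance accumulation) $\Omega_N$ is positive definite and $\delta_N:=N(\mathcal{M}^{H})^{3}/\lambda_{\min}(\Omega_N)^{2}\to0$. (Configuration) $K$ is fixed and $\mathcal{M}^{L}\ge1$ as $G\to\infty$. (Dyad multiplicity) $\mathcal{J}_N/\lambda_{\min}(\Omega_N)\to0$. Let $\{R_N\}$ be an arbitrary sequence of nonrandom $K\times q$ matrices of full column rank $q\le K$. Write $\mathcal{V}_N:=R_N'V_NR_N$ and $\widehat{\mathcal{V}}^{J}_N:=R_N'\widehat{V}^{J}R_N$. Then, as $G\to\infty$: (a) $\mathcal{V}_N^{-1/2}\widehat{\mathcal{V}}^{J}_N\mathcal{V}_N^{-1/2}\to_p I_q$, uniformly over restriction sequences, i.e. $\sup_{R}\big\|(R'V_NR)^{-1/2}R'\widehat{V}^{J}R(R'V_NR)^{-1/2}-I_q\big\|\to_p0$, the supremum being over all nonrandom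 $K\times q$ matrices $R$ of full column rank; (b) $\widehat{\mathcal{V}}^{J}_N\succeq0$ on $\mathcal{E}^{J}_N$, and $\mathbb{P}(\mathcal{E}^{J}_N)\to1$, $\mathbb{P}(\widehat{\mathcal{V}}^{J}_N\succ0)\to1$; (c) on the event $\{\widehat{\mathcal{V}}^{J}_N\succ0\}$, $(\widehat{\mathcal{V}}^{J}_N)^{-1/2}R_N'(\widehat{\boldsymbol{\beta}}-\boldsymbol{\beta})\to_d N(\mathbf{0},I_q)$; (d) under $H_0:R_N'\boldsymbol{\beta}=\mathbf{r}$, $$W^{J}_N:=\big(R_N'\widehat{\boldsymbol{\beta}}-\mathbf{r}\big)'\big(\widehat{\mathcal{V}}^{J}_N\big)^{-1}\big(R_N'\widehat{\boldsymbol{\beta}}-\mathbf{r}\big)\to_d\chi^2_q .$$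
   Context: Setting. Units are indexed $g=1,\dots,G$ and all limits are as $G\to\infty$. For each $G$ there are observations $n=1,\dots,N$, $N=N_G$. Each observation carries a nonrandom support (its dyad) $\psi(n)\subset\{1,\dots,G\}$ with $|\psi(n)|=2$; $\psi$ need not be injective. Everything may form a triangular array (the configuration and the joint law of the data may change with $G$). Put $M_g:=\#\{n:g\in\psi(n)\}$, $\mathcal{M}^{H}:=\max_gM_g$, $\mathcal{M}^{L}:=\min_gM_g$; for a dyad $d$, $L_d:=\#\{n:\psi(n)=d\}$, and $\mathcal{J}_N:=\sum_dL_d^2$. Model: $y_n=\boldsymbol{\beta}'\mathbf{x}_n+u_n$, with $\mathbf{x}_n\in\mathbb{R}^K$ and $u_n\in\mathbb{R}$ random and $\boldsymbol\beta\in\mathbb{R}^K$. Define $S_N:=\sum_n\mathbf{x}_nu_n$, $\Omega_N:=\operatorname{Var}(S_N)$, $Q_N:=N^{-1}\sum_n\mathbb{E}[\mathbf{x}_n\mathbf{x}_n']$, and $V_N:=N^{-2}Q_N^{-1}\Omega_NQ_N^{-1}$. Estimators: let $A:=\sum_n\mathbf{x}_n\mathbf{x}_n'$. If $A$ is invertible, $\widehat{\boldsymbol{\beta}}:=A^{-1}\sum_n\mathbf{x}_ny_n$; otherwise $\widehat{\boldsymbol{\beta}}:=\mathbf{0}$. Let $\mathcal{N}_g:=\{n:g\in\psi(n)\}$, $A_g:=\sum_{n\in\mathcal{N}_g}\mathbf{x}_n\mathbf{x}_n'$, $A_{(g)}:=A-A_g$, and let $\mathcal{E}^{J}_N$ be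 the event that every $A_{(g)}$, $g=1,\dots,G$, is invertible. On $\mathcal{E}^{J}_N$ set $\widehat{\boldsymbol{\beta}}_{(g)}:=A_{(g)}^{-1}\sum_{n\notin\mathcal{N}_g}\mathbf{x}_ny_n$, $\bar{\boldsymbol{\beta}}:=G^{-1}\sum_g\widehat{\boldsymbol{\beta}}_{(g)}$, and the delete-one-unit jackknife $$\widehat{V}^{J}:=\frac{G-1}{G}\sum_{g=1}^G\big(\widehat{\boldsymbol{\beta}}_{(g)}-\bar{\boldsymbol{\beta}}\big)\big(\widehat{\boldsymbol{\beta}}_{(g)}-\bar{\boldsymbol{\beta}}\big)',$$ with $\widehat{V}^{J}:=\mathbf{0}$ on $(\mathcal{E}^{J}_N)^c$. The statistic $W^{J}_N$ is set to $0$ whenever $\widehat{\mathcal{V}}^{J}_N$ is singular. Notation: $\lambda_{\min}$ is the smallest eigenvalue; $\|\cdot\|$ is the Euclidean norm for vectors and the spectral norm for matrices; for symmetric positive definite $B$, $B^{1/2}$ is the symmetric square root and $B^{-1/2}:=(B^{1/2})^{-1}$; $\succ0$, $\succeq0$ mean positive definite and positive semidefinite. A distributional convergence "on an event" whose probability tends to one means that the statistic may be defined arbitrarily off the event. *)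

theory Defs
  imports "HOL-Probability.Probability"
begin

section \<open>Matrices\<close>

definition outer :: "real ^ 'm \<Rightarrow> real ^ 'n \<Rightarrow> real ^ 'n ^ 'm" where
  "outer v w = (\<chi> i j. v $ i * w $ j)"

definition pos_semidef :: "real ^ 'n ^ 'n \<Rightarrow> bool" where
  "pos_semidef A \<longleftrightarrow> transpose A = A \<and> (\<forall>v. 0 \<le> v \<bullet> (A *v v))"

definition pos_def :: "real ^ 'n ^ 'n \<Rightarrow> bool" where
  "pos_def A \<longleftrightarrow> transpose A = A \<and> (\<forall>v. v \<noteq> 0 \<longrightarrow> 0 < v \<bullet> (A *v v))"

definition eigenvalue :: "real ^ 'n ^ 'n \<Rightarrow> real \<Rightarrow> bool" where
  "eigenvalue A c \<longleftrightarrow> (\<exists>v. v \<noteq> 0 \<and> A *v v = c *\<^sub>R v)"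

text \<open>Only used for symmetric matrices, which have at least one and at most finitely many
  real eigenvalues, so that the minimum exists.\<close>
definition lambda_min :: "real ^ 'n ^ 'n \<Rightarrow> real" where
  "lambda_min A = (LEAST c. eigenvalue A c)"

text \<open>The norm of the type of matrices is the Frobenius norm; the spectral norm is
  the operator norm for the Euclidean norms.\<close>
definition spectral_norm :: "real ^ 'n ^ 'm \<Rightarrow> real" where
  "spectral_norm A = onorm ((*v) A)"

definition sqrt_mat :: "real ^ 'n ^ 'n \<Rightarrow> real ^ 'n ^ 'n" where
  "sqrt_mat B = (THE S. pos_semidef S \<and> S ** S = B)"

definition inv_sqrt_mat :: "real ^ 'n ^ 'n \<Rightarrow> real ^ 'n ^ 'n" where
  "inv_sqrt_mat B = matrix_inv (sqrt_mat B)"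

definition sandwich :: "real ^ 'q ^ 'k \<Rightarrow> real ^ 'k ^ 'k \<Rightarrow> real ^ 'q ^ 'q" where
  "sandwich R V = transpose R ** V ** R"

text \<open>The deviation of \<open>(R' V R)\<^sup>-\<^sup>1\<^sup>/\<^sup>2 (R' V\<^sub>1 R) (R' V R)\<^sup>-\<^sup>1\<^sup>/\<^sup>2\<close> from the identity in spectral norm.\<close>
definition rel_deviation :: "real ^ 'q ^ 'k \<Rightarrow> real ^ 'k ^ 'k \<Rightarrow> real ^ 'k ^ 'k \<Rightarrow> real" where
  "rel_deviation R V V\<^sub>1 =
     spectral_norm (inv_sqrt_mat (sandwich R V) ** sandwich R V\<^sub>1 ** inv_sqrt_mat (sandwich R V) - mat 1)"


section \<open>Dyadic configurations\<close>

text \<open>Units are \<open>1, \<dots>, G\<close>, observations are \<open>1, \<dots>, N\<close>, and \<open>psi n\<close> is the dyad of observation \<open>n\<close>.\<close>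

definition incident :: "nat \<Rightarrow> (nat \<Rightarrow> nat set) \<Rightarrow> nat \<Rightarrow> nat set" where
  "incident N psi g = {n \<in> {1..N}. g \<in> psi n}"

definition max_degree :: "nat \<Rightarrow> nat \<Rightarrow> (nat \<Rightarrow> nat set) \<Rightarrow> nat" where
  "max_degree G N psi = Max ((\<lambda>g. card (incident N psi g)) ` {1..G})"

definition min_degree :: "nat \<Rightarrow> nat \<Rightarrow> (nat \<Rightarrow> nat set) \<Rightarrow> nat" where
  "min_degree G N psi = Min ((\<lambda>g. card (incident N psi g)) ` {1..G})"

definition multiplicity_sum :: "nat \<Rightarrow> nat \<Rightarrow> (nat \<Rightarrow> nat set) \<Rightarrow> nat" where
  "multiplicity_sum G N psi =
     (\<Sum>d \<in> {d. d \<subseteq> {1..G} \<and> card d = 2}. (card {n \<in> {1..N}. psi n = d})\<^sup>2)"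

definition dyadic_dependence ::
  "'a measure \<Rightarrow> nat \<Rightarrow> (nat \<Rightarrow> nat set) \<Rightarrow> (nat \<Rightarrow> 'a \<Rightarrow> real ^ 'k) \<Rightarrow> (nat \<Rightarrow> 'a \<Rightarrow> real) \<Rightarrow> bool" where
  "dyadic_dependence M N psi x u \<longleftrightarrow>
     (\<forall>S\<^sub>1 S\<^sub>2. S\<^sub>1 \<subseteq> {1..N} \<longrightarrow> S\<^sub>2 \<subseteq> {1..N} \<longrightarrow> S\<^sub>1 \<inter> S\<^sub>2 = {} \<longrightarrow>
        (\<forall>n\<in>S\<^sub>1. \<forall>m\<in>S\<^sub>2. psi n \<inter> psi m = {}) \<longrightarrow>
        prob_space.indep_var M
          (PiM S\<^sub>1 (\<lambda>_. borel)) (\<lambda>\<omega>. \<lambda>n\<in>S\<^sub>1. (x n \<omega>, u n \<omega>))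
          (PiM S\<^sub>2 (\<lambda>_. borel)) (\<lambda>\<omega>. \<lambda>m\<in>S\<^sub>2. (x m \<omega>, u m \<omega>)))"


section \<open>Population quantities\<close>

definition covariance_matrix :: "'a measure \<Rightarrow> ('a \<Rightarrow> real ^ 'k) \<Rightarrow> real ^ 'k ^ 'k" where
  "covariance_matrix M S =
     (LINT \<omega>|M. outer (S \<omega> - (LINT \<omega>'|M. S \<omega>')) (S \<omega> - (LINT \<omega>'|M. S \<omega>')))"

definition score_variance ::
  "'a measure \<Rightarrow> nat \<Rightarrow> (nat \<Rightarrow> 'a \<Rightarrow> real ^ 'k) \<Rightarrow> (nat \<Rightarrow> 'a \<Rightarrow> real) \<Rightarrow> real ^ 'k ^ 'k" where
  "score_variance M N x u = covariance_matrix M (\<lambda>\<omega>. \<Sum>n\<in>{1..N}. u n \<omega> *\<^sub>R x n \<omega>)"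

definition design_matrix :: "'a measure \<Rightarrow> nat \<Rightarrow> (nat \<Rightarrow> 'a \<Rightarrow> real ^ 'k) \<Rightarrow> real ^ 'k ^ 'k" where
  "design_matrix M N x = (1 / real N) *\<^sub>R (\<Sum>n\<in>{1..N}. LINT \<omega>|M. outer (x n \<omega>) (x n \<omega>))"

definition sandwich_variance ::
  "'a measure \<Rightarrow> nat \<Rightarrow> (nat \<Rightarrow> 'a \<Rightarrow> real ^ 'k) \<Rightarrow> (nat \<Rightarrow> 'a \<Rightarrow> real) \<Rightarrow> real ^ 'k ^ 'k" where
  "sandwich_variance M N x u =
     (1 / (real N)\<^sup>2) *\<^sub>R (matrix_inv (design_matrix M N x) ** score_variance M N x u
                           ** matrix_inv (design_matrix M N x))"


section \<open>Estimators, as functions of the realised data\<close>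

definition gram :: "nat set \<Rightarrow> (nat \<Rightarrow> real ^ 'k) \<Rightarrow> real ^ 'k ^ 'k" where
  "gram I xs = (\<Sum>n\<in>I. outer (xs n) (xs n))"

definition ols :: "nat \<Rightarrow> (nat \<Rightarrow> real ^ 'k) \<Rightarrow> (nat \<Rightarrow> real) \<Rightarrow> real ^ 'k" where
  "ols N xs ys =
     (if invertible (gram {1..N} xs)
      then matrix_inv (gram {1..N} xs) *v (\<Sum>n\<in>{1..N}. ys n *\<^sub>R xs n) else 0)"

definition gram_del :: "nat \<Rightarrow> (nat \<Rightarrow> nat set) \<Rightarrow> (nat \<Rightarrow> real ^ 'k) \<Rightarrow> nat \<Rightarrow> real ^ 'k ^ 'k" where
  "gram_del N psi xs g = gram {1..N} xs - gram (incident N psi g) xs"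

definition ols_del ::
  "nat \<Rightarrow> (nat \<Rightarrow> nat set) \<Rightarrow> (nat \<Rightarrow> real ^ 'k) \<Rightarrow> (nat \<Rightarrow> real) \<Rightarrow> nat \<Rightarrow> real ^ 'k" where
  "ols_del N psi xs ys g =
     matrix_inv (gram_del N psi xs g) *v (\<Sum>n \<in> {1..N} - incident N psi g. ys n *\<^sub>R xs n)"

definition jackknife_defined ::
  "nat \<Rightarrow> nat \<Rightarrow> (nat \<Rightarrow> nat set) \<Rightarrow> (nat \<Rightarrow> real ^ 'k) \<Rightarrow> bool" where
  "jackknife_defined G N psi xs \<longleftrightarrow> (\<forall>g\<in>{1..G}. invertible (gram_del N psi xs g))"

definition jackknife_mean ::
  "nat \<Rightarrow> nat \<Rightarrow> (nat \<Rightarrow> nat set) \<Rightarrow> (nat \<Rightarrow> real ^ 'k) \<Rightarrow> (nat \<Rightarrow> real) \<Rightarrow> real ^ 'k" where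
  "jackknife_mean G N psi xs ys = (1 / real G) *\<^sub>R (\<Sum>g\<in>{1..G}. ols_del N psi xs ys g)"

definition jackknife_variance ::
  "nat \<Rightarrow> nat \<Rightarrow> (nat \<Rightarrow> nat set) \<Rightarrow> (nat \<Rightarrow> real ^ 'k) \<Rightarrow> (nat \<Rightarrow> real) \<Rightarrow> real ^ 'k ^ 'k" where
  "jackknife_variance G N psi xs ys =
     (if jackknife_defined G N psi xs
      then ((real G - 1) / real G) *\<^sub>R
             (\<Sum>g\<in>{1..G}. outer (ols_del N psi xs ys g - jackknife_mean G N psi xs ys)
                               (ols_del N psi xs ys g - jackknife_mean G N psi xs ys))
      else 0)"

definition wald_statistic ::
  "real ^ 'q ^ 'k \<Rightarrow> real ^ 'q \<Rightarrow> real ^ 'k \<Rightarrow> real ^ 'k ^ 'k \<Rightarrow> real" where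
  "wald_statistic R r b V =
     (if invertible (sandwich R V)
      then (transpose R *v b - r) \<bullet> (matrix_inv (sandwich R V) *v (transpose R *v b - r))
      else 0)"


section \<open>Stochastic convergence along a triangular array\<close>

text \<open>The value of \<^const>\<open>measure\<close> at a non-measurable set is 0 and the integral of a
  non-integrable function is 0. The notions below therefore include measurability for all
  large indices. The first one takes values in \<^typ>\<open>ennreal\<close> because it is also applied
  to suprema over unbounded families.\<close>

definition tendsto_in_prob_zero :: "(nat \<Rightarrow> 'a measure) \<Rightarrow> (nat \<Rightarrow> 'a \<Rightarrow> ennreal) \<Rightarrow> bool" where
  "tendsto_in_prob_zero M Z \<longleftrightarrow>
     (\<forall>\<^sub>F G in sequentially. Z G \<in> borel_measurable (M G)) \<and>
     (\<forall>\<epsilon>>0. (\<lambda>G. measure (M G) {\<omega> \<in> space (M G). Z G \<omega> > ennreal \<epsilon>}) \<longlonglongrightarrow> 0)"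

text \<open>Weak convergence of laws, tested on bounded continuous functions
  (\<^const>\<open>weak_conv_m\<close> only covers laws on the real line).\<close>
definition tendsto_in_dist ::
  "(nat \<Rightarrow> 'a measure) \<Rightarrow> (nat \<Rightarrow> 'a \<Rightarrow> 'b::euclidean_space) \<Rightarrow> 'b measure \<Rightarrow> bool" where
  "tendsto_in_dist M X \<mu> \<longleftrightarrow>
     (\<forall>\<^sub>F G in sequentially. X G \<in> borel_measurable (M G)) \<and>
     (\<forall>f :: 'b \<Rightarrow> real. continuous_on UNIV f \<longrightarrow> bounded (range f) \<longrightarrow>
        (\<lambda>G. LINT \<omega>|M G. f (X G \<omega>)) \<longlonglongrightarrow> (LINT z|\<mu>. f z))"

definition std_normal_vec :: "(real ^ 'q) measure" where
  "std_normal_vec =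
     density lborel (\<lambda>z. ennreal (exp (- (norm z)\<^sup>2 / 2) / sqrt (2 * pi) ^ CARD('q)))"

text \<open>The law of the sum of the squares of \<open>q\<close> independent standard normal variables.\<close>
definition chi_squared :: "nat \<Rightarrow> real measure" where
  "chi_squared q =
     distr (PiM {..<q} (\<lambda>_. density lborel (\<lambda>t. ennreal (std_normal_density t)))) borel
       (\<lambda>z. \<Sum>i<q. (z i)\<^sup>2)"

end

theory Submission
  imports Defs
begin

text \<open>
  Central limit theorem: let \<open>W\<close> be a normalised linear combination of the scores \<open>x\<^sub>n u\<^sub>n\<close>, with
  variance \<open>\<sigma>\<^sup>2\<close>. Expanding twice over dependency neighbourhoods gives
  \<open>E[W e\<^sup>z\<^sup>W] = (\<sigma>\<^sup>2 z + \<kappa> z\<^sup>2 + small) E[e\<^sup>z\<^sup>W]\<close>, hence \<open>E[e\<^sup>\<i>\<^sup>W]\<close> is close to \<open>exp (- \<sigma>\<^sup>2/2 - \<i> \<kappa>/3)\<close>.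
  The accumulation condition makes the remainder small but does not bound the third-order
  coefficient \<open>\<kappa>\<close> directly; that \<open>\<kappa>\<close> vanishes follows from Jensen's inequality \<open>E[e\<^sup>t\<^sup>W] \<ge> 1\<close> for real \<open>t\<close>.

  Jackknife: the identity \<open>A\<^sub>(\<^sub>g\<^sub>) (b - b\<^sub>(\<^sub>g\<^sub>)) = e\<^sub>g\<close> is exact, where \<open>e\<^sub>g\<close> is the sum of the residual
  scores incident to \<open>g\<close>, and \<open>\<Sum>\<^sub>g e\<^sub>g = 0\<close>. Hence \<open>V\<^sub>J\<close> is a perturbation of the sandwich built
  from \<open>\<Sum>\<^sub>g e\<^sub>g e\<^sub>g'\<close>. This sum counts a pair of observations as often as their dyads share units, which
  is once except for pairs with a common dyad; the latter are negligible by the multiplicity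
  condition. All bounds are relative to the quadratic form of \<open>V\<close>, so they are uniform in \<open>R\<close>.
\<close>

section \<open>Matrices and square roots\<close>

text \<open>Normalised scores are bounded by b of order lam^(-1/2), so the remainder N D^3 b^4 of
  the double expansion is, up to constants, the accumulation ratio. The trivial bound N D^2 b^3 for
  \<kappa> is that ratio times sqrt(lam) / D, a factor that tends to infinity. Homogeneity closes
  the gap: replacing W by l W multiplies the variance, \<kappa> and the remainder by l^2, l^3 and
  l^4, and the expansion stays valid while |l| D b \<le> 1. Jensen's inequality for both signs of l
  gives |\<kappa>| / 3 \<le> \<sigma>^2 / (2 l) + l \<eta>, and a large fixed l suffices because D b
  tends to 0, which follows from the same condition by D \<le> N. The matrices R' V R may degenerate
  at any rate, so studentisation cannot rely on continuity of the inverse square root on a compact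
  set. It uses a perturbation bound whose constant depends on the dimension only. On one realisation
  the jackknife remainder is governed by a single quantity \<open>\<Psi>\<close>, whose expectation
  is of order D and which is therefore small against sqrt(lam).\<close>

lemma inner_matrix_vector_transpose:
  fixes A :: "real ^ 'n ^ 'm"
  shows "x \<bullet> (A *v y) = (transpose A *v x) \<bullet> y"
  by (simp add: dot_lmul_matrix flip: vector_transpose_matrix)

lemma inner_matrix_vector_sym:
  fixes A :: "real ^ 'n ^ 'n"
  assumes "transpose A = A"
  shows "x \<bullet> (A *v y) = (A *v x) \<bullet> y"
  using inner_matrix_vector_transpose[of x A y] assms by simp

lemma norm_matrix_vector_le:
  fixes A :: "real ^ 'n ^ 'm"
  shows "norm (A *v x) \<le> norm A * norm x"
proof -
  have "norm (A *v x) \<le> L2_set (\<lambda>i. norm (A $ i) * norm x) UNIV"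
    unfolding norm_vec_def[of "A *v x"]
    by (intro L2_set_mono) (auto simp: Cauchy_Schwarz_ineq2 matrix_mult_dot)
  also have "\<dots> = norm A * norm x"
    unfolding norm_vec_def[of A] by (simp add: L2_set_right_distrib[of "norm x"] mult.commute L2_set_left_distrib)
  finally show ?thesis .
qed

lemma spectral_norm_bound:
  assumes "0 \<le> c" "\<And>v. norm (A *v v) \<le> c * norm v"
  shows "spectral_norm A \<le> c"
  unfolding spectral_norm_def by (rule onorm_bound) (use assms in auto)

lemma spectral_norm_apply: "norm (A *v v) \<le> spectral_norm A * norm v"
  for A :: "real ^ 'n ^ 'm"
  unfolding spectral_norm_def by (rule onorm) simp

text \<open>The Frobenius norm dominates the operator norm, which makes the spectral norm
  1-Lipschitz for the norm of the type.\<close>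

lemma continuous_spectral_norm: "continuous_on UNIV (spectral_norm :: real ^ 'n ^ 'm \<Rightarrow> real)"
proof -
  have *: "spectral_norm A \<le> spectral_norm B + norm (A - B)" for A B :: "real ^ 'n ^ 'm"
  proof (rule spectral_norm_bound)
    have "0 \<le> spectral_norm B" unfolding spectral_norm_def by (rule onorm_pos_le) simp
    then show "0 \<le> spectral_norm B + norm (A - B)" by simp
    fix v
    have "norm (A *v v) \<le> norm (B *v v) + norm ((A - B) *v v)"
      using norm_triangle_ineq[of "B *v v" "(A - B) *v v"] by (simp add: matrix_vector_mult_diff_rdistrib)
    then show "norm (A *v v) \<le> (spectral_norm B + norm (A - B)) * norm v"
      using spectral_norm_apply[of B v] norm_matrix_vector_le[of "A - B" v] by (simp add: algebra_simps)
  qed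
  have "\<bar>spectral_norm A - spectral_norm B\<bar> \<le> 1 * norm (A - B)" for A B :: "real ^ 'n ^ 'm"
    using *[of A B] *[of B A] by (simp add: norm_minus_commute)
  then have "1-lipschitz_on UNIV (spectral_norm :: real ^ 'n ^ 'm \<Rightarrow> real)"
    by (intro lipschitz_onI) (auto simp: dist_norm)
  then show ?thesis by (rule lipschitz_on_continuous_on)
qed

text \<open>Polarisation: rescale \<open>E *v v\<close> to a vector x of the length of v. Then 4 x .
  E v is the difference of the quadratic form at x + v and at x - v, and the parallelogram law
  bounds it by 4 c |v|^2.\<close>

lemma sym_norm_le:
  fixes E :: "real ^ 'n ^ 'n"
  assumes sym: "transpose E = E" and le: "\<And>v. \<bar>v \<bullet> (E *v v)\<bar> \<le> c * (v \<bullet> v)"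
  shows "norm (E *v v) \<le> c * norm v"
proof (cases "E *v v = 0 \<or> v = 0")
  case True
  \<comment> \<open>Any unit vector shows that c is nonnegative; \<open>undefined\<close> merely
    names an index.\<close>
  have "0 \<le> c" 
  proof -
    have "0 \<le> c * (axis undefined 1 \<bullet> (axis undefined 1 :: real ^ 'n))"
      using le[of "axis undefined 1"] abs_ge_zero order_trans by blast
    then show ?thesis by (simp add: inner_axis_axis)
  qed
  then show ?thesis using True by auto
next
  case False
  define x where "x = (norm v / norm (E *v v)) *\<^sub>R (E *v v)"
  have nx: "x \<bullet> x = v \<bullet> v" using False by (simp add: x_def power2_norm_eq_inner flip: power2_norm_eq_inner) 
  have xE: "x \<bullet> (E *v v) = norm v * norm (E *v v)"
    using False by (simp add: x_def power2_eq_square flip: power2_norm_eq_inner)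
  have "v \<bullet> (E *v x) = x \<bullet> (E *v v)"
    using inner_matrix_vector_sym[OF sym, of v x] by (simp add: inner_commute)
  then have "4 * (x \<bullet> (E *v v)) = (x + v) \<bullet> (E *v (x + v)) - (x - v) \<bullet> (E *v (x - v))"
    by (simp add: matrix_vector_right_distrib matrix_vector_mult_diff_distrib inner_simps)
  also have "\<dots> \<le> c * ((x + v) \<bullet> (x + v)) + c * ((x - v) \<bullet> (x - v))"
    using le[of "x + v"] le[of "x - v"] by linarith
  also have "\<dots> = 4 * (c * (v \<bullet> v))"
    by (simp add: inner_simps nx algebra_simps)
  finally have "norm v * norm (E *v v) \<le> norm v * (c * norm v)"
    unfolding xE by (simp add: power2_eq_square flip: power2_norm_eq_inner) (simp add: algebra_simps)
  then show ?thesis using False by simp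
qed

text \<open>Cauchy-Schwarz for a semidefinite form: moving from v in the direction of -A v would
  make the form negative unless A v = 0.\<close>

lemma psd_null:
  fixes A :: "real ^ 'n ^ 'n"
  assumes sym: "transpose A = A" and pos: "\<And>v. 0 \<le> v \<bullet> (A *v v)" and z: "v \<bullet> (A *v v) = 0"
  shows "A *v v = 0"
proof -
  define w where "w = A *v v"
  define a where "a = w \<bullet> w"
  define c where "c = w \<bullet> (A *v w)"
  \<comment> \<open>The exact minimiser would be a / c; adding 1 avoids the division by zero at c =
    0.\<close>
  define t where "t = a / (c + 1)"
  have c0: "0 \<le> c" unfolding c_def by (rule pos)
  have vw: "v \<bullet> (A *v w) = a" "w \<bullet> (A *v v) = a"
    using inner_matrix_vector_sym[OF sym, of v w] by (simp_all add: w_def a_def)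
  have "0 \<le> (v - t *\<^sub>R w) \<bullet> (A *v (v - t *\<^sub>R w))" by (rule pos)
  also have "\<dots> = - 2 * t * a + t\<^sup>2 * c"
    by (simp add: matrix_vector_mult_diff_distrib matrix_vector_mult_scaleR inner_simps z vw c_def[symmetric] power2_eq_square algebra_simps)
  also have "\<dots> = - (a\<^sup>2 * (c + 2) / (c + 1)\<^sup>2)"
    using c0 by (simp add: t_def divide_simps) (simp add: algebra_simps power2_eq_square)
  finally have "a\<^sup>2 * (c + 2) / (c + 1)\<^sup>2 \<le> 0" by simp
  then have "a\<^sup>2 * (c + 2) \<le> 0" using c0 by (simp add: divide_le_0_iff)
  then have "a = 0" using c0
    by (metis add_strict_increasing less_eq_real_def mult_le_0_iff not_less power_zero_numeral zero_less_numeral zero_less_power2 add.commute)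
  then show ?thesis by (simp add: a_def w_def)
qed

text \<open>The form attains its minimum m on the unit sphere. A - m I is then semidefinite and its
  form vanishes at the minimiser, so \<open>psd_null\<close> makes the minimiser an eigenvector.
  Every eigenvalue is a value of the form at a unit vector, so \<open>LEAST\<close> is m.\<close>

lemma lambda_min_properties:
  fixes A :: "real ^ 'n ^ 'n"
  assumes sym: "transpose A = A"
  shows "eigenvalue A (lambda_min A)" "lambda_min A * (v \<bullet> v) \<le> v \<bullet> (A *v v)"
proof -
  have "continuous_on (sphere 0 1) (\<lambda>v. v \<bullet> (A *v v))"
    by (intro continuous_intros linear_continuous_on) simp_all
  moreover have "sphere 0 (1::real) \<noteq> ({} :: (real ^ 'n) set)" by simp
  ultimately obtain v0 where v0: "v0 \<in> sphere 0 1" "\<And>v. v \<in> sphere 0 1 \<Longrightarrow> v0 \<bullet> (A *v v0) \<le> v \<bullet> (A *v v)"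
    using continuous_attains_inf[of "sphere 0 1 :: (real ^ 'n) set" "\<lambda>v. v \<bullet> (A *v v)"] by auto
  define m where "m = v0 \<bullet> (A *v v0)"
  have ge: "m * (v \<bullet> v) \<le> v \<bullet> (A *v v)" for v
  proof (cases "v = 0")
    case False
    have "m \<le> ((1 / norm v) *\<^sub>R v) \<bullet> (A *v ((1 / norm v) *\<^sub>R v))"
      unfolding m_def by (rule v0(2)) (use False in simp)
    also have "\<dots> = (v \<bullet> (A *v v)) / (v \<bullet> v)"
      using False by (simp add: matrix_vector_mult_scaleR power2_eq_square flip: power2_norm_eq_inner)
    finally show ?thesis using False by (simp add: pos_le_divide_eq)
  qed simp
  define B where "B = A - m *\<^sub>R mat 1"
  have Bv: "B *v v = A *v v - m *\<^sub>R v" for v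
    by (simp add: B_def matrix_vector_mult_diff_rdistrib flip: scaleR_matrix_vector_assoc)
  have "transpose B = B" using sym by (simp add: B_def transpose_def vec_eq_iff mat_def eq_commute)
  moreover have "\<And>v. 0 \<le> v \<bullet> (B *v v)" using ge by (simp add: Bv inner_simps)
  moreover have "v0 \<bullet> (B *v v0) = 0" using v0(1) by (simp add: Bv inner_simps m_def norm_eq_1)
  ultimately have "B *v v0 = 0" by (rule psd_null)
  then have em: "eigenvalue A m" unfolding eigenvalue_def
    using v0(1) by (intro exI[of _ v0]) (auto simp: Bv)
  have least: "m \<le> c" if "eigenvalue A c" for c
  proof -
    from that obtain v where "v \<noteq> 0" "A *v v = c *\<^sub>R v" by (auto simp: eigenvalue_def)
    with ge[of v] show ?thesis by simp
  qed
  have "lambda_min A = m" unfolding lambda_min_def by (rule Least_equality) (use em least in auto)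
  with em ge show "eigenvalue A (lambda_min A)" "lambda_min A * (v \<bullet> v) \<le> v \<bullet> (A *v v)" by auto
qed

lemma lambda_min_pos:
  fixes A :: "real ^ 'n ^ 'n"
  assumes "pos_def A" shows "0 < lambda_min A"
proof -
  have "eigenvalue A (lambda_min A)" using assms lambda_min_properties(1) by (auto simp: pos_def_def)
  then obtain v where v: "v \<noteq> 0" "A *v v = lambda_min A *\<^sub>R v" by (auto simp: eigenvalue_def)
  with assms have "0 < v \<bullet> (A *v v)" by (auto simp: pos_def_def)
  with v show ?thesis using inner_ge_zero[of v] by (auto simp: zero_less_mult_iff not_less)
qed

lemma matrix_inv_right: "invertible A \<Longrightarrow> A ** matrix_inv A = mat 1"
  and matrix_inv_left: "invertible A \<Longrightarrow> matrix_inv A ** A = mat 1"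
  unfolding invertible_def matrix_inv_def by (metis (mono_tags, lifting) someI_ex)+

lemma matrix_inv_unique_right:
  fixes A :: "real ^ 'n ^ 'n"
  assumes "A ** B = mat 1" shows "invertible A" "matrix_inv A = B"
proof -
  show i: "invertible A" using assms invertible_right_inverse by blast
  have "matrix_inv A = matrix_inv A ** (A ** B)" by (simp add: assms)
  also have "\<dots> = B" by (simp add: matrix_mul_assoc matrix_inv_left[OF i])
  finally show "matrix_inv A = B" .
qed

lemma matrix_inv_apply_cancel:
  fixes A :: "real ^ 'n ^ 'n"
  assumes "invertible A"
  shows "matrix_inv A *v (A *v v) = v" "A *v (matrix_inv A *v v) = v"
  using matrix_inv_left[OF assms] matrix_inv_right[OF assms] by (simp_all add: matrix_vector_mul_assoc)

lemma transpose_matrix_inv: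
  fixes A :: "real ^ 'n ^ 'n"
  assumes "invertible A" shows "transpose (matrix_inv A) = matrix_inv (transpose A)"
proof -
  have "transpose A ** transpose (matrix_inv A) = mat 1"
    using matrix_inv_left[OF assms] by (metis matrix_transpose_mul transpose_mat)
  then show ?thesis by (rule matrix_inv_unique_right(2)[symmetric])
qed

text \<open>Coercivity excludes a kernel, and for w = A^-1 v it gives c |w|^2 \<le> w . v, whence
  the norm bound by Cauchy-Schwarz. The Gram matrices of the estimators are inverted in this
  way.\<close>

lemma invertible_of_lower_bound:
  fixes A :: "real ^ 'n ^ 'n"
  assumes "0 < c" "\<And>v. c * (v \<bullet> v) \<le> v \<bullet> (A *v v)"
  shows "invertible A" "norm (matrix_inv A *v v) \<le> norm v / c"
proof -
  have "v = 0" if "A *v v = 0" for v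
    using assms(2)[of v] that assms(1) by (simp add: mult_le_0_iff not_le) (metis inner_eq_zero_iff inner_ge_zero order_antisym)
  then show i: "invertible A" using matrix_left_invertible_ker invertible_left_inverse by blast
  define w where "w = matrix_inv A *v v"
  have "A *v w = v" by (simp add: w_def matrix_inv_apply_cancel i)
  then have "c * (w \<bullet> w) \<le> norm w * norm v" using assms(2)[of w] norm_cauchy_schwarz[of w v] by simp
  then have "norm w * (c * norm w) \<le> norm w * norm v" by (simp add: power2_eq_square mult_ac flip: power2_norm_eq_inner)
  then have "c * norm w \<le> norm v" by (cases "w = 0") auto
  then show "norm (matrix_inv A *v v) \<le> norm v / c"
    using assms(1) by (simp add: w_def pos_le_divide_eq mult.commute)
qed

lemma pos_def_lower_bound:
  assumes "pos_def A" shows "invertible A" 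
  using invertible_of_lower_bound(1)[of "lambda_min A" A] lambda_min_pos[OF assms]
    lambda_min_properties(2)[of A] assms by (auto simp: pos_def_def)

lemma pos_def_if_lower_bound:
  assumes "transpose A = A" "0 < c" "\<And>v. c * (v \<bullet> v) \<le> v \<bullet> (A *v v)"
  shows "pos_def A"
  unfolding pos_def_def using assms
  by (metis inner_gt_zero_iff less_le_trans mult_pos_pos)

section \<open>Matrix limits and the square root of a positive definite matrix\<close>

lemma tendsto_matrix_iff:
  fixes f :: "'a \<Rightarrow> real ^ 'n ^ 'm"
  shows "(f \<longlongrightarrow> L) F \<longleftrightarrow> (\<forall>i j. ((\<lambda>x. f x $ i $ j) \<longlongrightarrow> L $ i $ j) F)"
proof
  show "\<forall>i j. ((\<lambda>x. f x $ i $ j) \<longlongrightarrow> L $ i $ j) F" if "(f \<longlongrightarrow> L) F"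
    by (intro allI tendsto_vec_nth that)
  show "(f \<longlongrightarrow> L) F" if "\<forall>i j. ((\<lambda>x. f x $ i $ j) \<longlongrightarrow> L $ i $ j) F"
    by (intro vec_tendstoI) (use that in blast)
qed

lemma tendsto_matrix_mult [tendsto_intros]:
  fixes f :: "'a \<Rightarrow> real ^ 'n ^ 'm" and g :: "'a \<Rightarrow> real ^ 'l ^ 'n"
  assumes "(f \<longlongrightarrow> A) F" "(g \<longlongrightarrow> B) F"
  shows "((\<lambda>x. f x ** g x) \<longlongrightarrow> A ** B) F"
  using assms unfolding tendsto_matrix_iff by (auto simp: matrix_matrix_mult_def intro!: tendsto_sum tendsto_mult)

lemma transpose_diff: "transpose (A - B) = transpose A - transpose (B :: real ^ 'n ^ 'm)"
  and transpose_add: "transpose (A + B) = transpose A + transpose (B :: real ^ 'n ^ 'm)"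
  and transpose_scaleR: "transpose (c *\<^sub>R A) = c *\<^sub>R transpose (A :: real ^ 'n ^ 'm)"
  by (simp_all add: transpose_def vec_eq_iff)

lemma matrix_scaleR_left: "(c *\<^sub>R A) ** B = c *\<^sub>R (A ** B)"
  and matrix_scaleR_right: "A ** (c *\<^sub>R B) = c *\<^sub>R (A ** B)"
  for A :: "real ^ 'n ^ 'm" and B :: "real ^ 'l ^ 'n"
  by (simp_all add: matrix_matrix_mult_def vec_eq_iff sum_distrib_left mult_ac)

lemma matrix_add_rdistrib': "(A + B) ** C = A ** C + B ** C"
  and matrix_diff_rdistrib: "(A - B) ** C = A ** C - B ** C"
  and matrix_diff_ldistrib: "D ** (A - B) = D ** A - D ** B"
  for A B :: "real ^ 'n ^ 'm" and C :: "real ^ 'l ^ 'n" and D :: "real ^ 'm ^ 'l"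
  by (simp_all add: matrix_matrix_mult_def vec_eq_iff sum.distrib sum_subtractf algebra_simps)

lemmas matrix_algebra = matrix_add_ldistrib matrix_add_rdistrib' matrix_diff_rdistrib matrix_diff_ldistrib
  matrix_scaleR_left matrix_scaleR_right matrix_mul_assoc

lemmas matrix_vector_algebra = matrix_vector_mult_add_rdistrib matrix_vector_mult_diff_rdistrib
  matrix_vector_right_distrib matrix_vector_mult_diff_distrib matrix_vector_mult_scaleR
  scaleR_matrix_vector_assoc[symmetric] matrix_vector_mul_assoc[symmetric]

text \<open>The limit \<open>Y\<close> of this iteration solves \<open>2 Y = A + Y\<^sup>2\<close>, i.e. \<open>(I - Y)\<^sup>2 = I - A\<close>.\<close>
primrec sqrt_iter :: "real ^ 'n ^ 'n \<Rightarrow> nat \<Rightarrow> real ^ 'n ^ 'n" where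
  "sqrt_iter A 0 = 0"
| "sqrt_iter A (Suc n) = (1/2) *\<^sub>R (A + sqrt_iter A n ** sqrt_iter A n)"

text \<open>r is the smaller root of \<rho> + r^2 = 2 r, so the bound r on the iterates reproduces
  itself. Each consecutive difference is half a sum of two terms, both of which carry a factor r
  times the preceding difference, so the iteration converges geometrically.\<close>

lemma sqrt_iter_limit:
  fixes A :: "real ^ 'n ^ 'n"
  assumes rho: "0 \<le> \<rho>" "\<rho> < 1" and bd: "\<And>v. norm (A *v v) \<le> \<rho> * norm v"
  defines "r \<equiv> 1 - sqrt (1 - \<rho>)"
  obtains Y where "sqrt_iter A \<longlonglongrightarrow> Y" "2 *\<^sub>R Y = A + Y ** Y" "\<And>v. norm (Y *v v) \<le> r * norm v"
proof -
  have r: "0 \<le> r" "r < 1" using rho by (auto simp: r_def)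
  have r2: "\<rho> + r * r = 2 * r" using rho by (simp add: r_def algebra_simps)
  let ?Y = "sqrt_iter A"
  have bY: "norm (?Y n *v v) \<le> r * norm v" for n v
  proof (induction n arbitrary: v)
    case 0
    then show ?case using r by simp
  next
    case (Suc n)
    have "norm (?Y n *v (?Y n *v v)) \<le> r * (r * norm v)"
      using Suc.IH[of "?Y n *v v"] mult_left_mono[OF Suc.IH[of v] r(1)] by linarith
    moreover have "?Y (Suc n) *v v = (1/2) *\<^sub>R (A *v v + ?Y n *v (?Y n *v v))"
      by (simp add: matrix_vector_algebra)
    ultimately have "norm (?Y (Suc n) *v v) \<le> (1/2) * (\<rho> * norm v + r * (r * norm v))"
      using norm_triangle_ineq[of "A *v v" "?Y n *v (?Y n *v v)"] bd[of v] by simp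
    also have "\<dots> = (1/2) * ((\<rho> + r * r) * norm v)" by (simp add: algebra_simps)
    finally show ?case by (simp add: r2)
  qed
  have diff: "norm ((?Y (Suc n) - ?Y n) *v v) \<le> r ^ n * norm v" for n v
  proof (induction n arbitrary: v)
    case 0
    have "\<rho> * norm v \<le> 1 * norm v" using rho by (intro mult_right_mono) auto
    then have "norm (A *v v) \<le> norm v" using bd[of v] by linarith
    moreover have "(?Y (Suc 0) - ?Y 0) *v v = (1/2) *\<^sub>R (A *v v)" by (simp add: scaleR_matrix_vector_assoc)
    ultimately show ?case using norm_ge_zero[of "A *v v"] by (simp del: norm_ge_zero sqrt_iter.simps)
  next
    case (Suc n)
    \<comment> \<open>This splitting of P^2 - Q^2 is valid for noncommuting P and Q.\<close>
    have "P ** P - Q ** Q = P ** (P - Q) + (P - Q) ** Q" for P Q :: "real ^ 'n ^ 'n"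
      by (simp add: matrix_diff_ldistrib matrix_diff_rdistrib)
    moreover have "?Y (Suc (Suc n)) - ?Y (Suc n) = (1/2) *\<^sub>R (?Y (Suc n) ** ?Y (Suc n) - ?Y n ** ?Y n)"
    proof -
      have "(1/2) *\<^sub>R (A + P) - (1/2) *\<^sub>R (A + Q) = (1/2) *\<^sub>R (P - Q)" for P Q :: "real ^ 'n ^ 'n"
        by (simp add: scaleR_diff_right[symmetric])
      from this[of "?Y (Suc n) ** ?Y (Suc n)" "?Y n ** ?Y n"] show ?thesis
        by (simp only: sqrt_iter.simps(2)[symmetric])
    qed
    ultimately have "?Y (Suc (Suc n)) - ?Y (Suc n) =
       (1/2) *\<^sub>R (?Y (Suc n) ** (?Y (Suc n) - ?Y n) + (?Y (Suc n) - ?Y n) ** ?Y n)" by metis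
    then have "(?Y (Suc (Suc n)) - ?Y (Suc n)) *v v =
       (1/2) *\<^sub>R (?Y (Suc n) *v ((?Y (Suc n) - ?Y n) *v v) + (?Y (Suc n) - ?Y n) *v (?Y n *v v))"
      by (simp only: matrix_vector_mul_assoc[symmetric] scaleR_matrix_vector_assoc[symmetric] matrix_vector_mult_add_rdistrib)
    moreover have "norm (?Y (Suc n) *v ((?Y (Suc n) - ?Y n) *v v)) \<le> r * (r ^ n * norm v)"
      using bY[of "Suc n" "(?Y (Suc n) - ?Y n) *v v"] mult_left_mono[OF Suc.IH[of v] r(1)] by linarith
    moreover have "norm ((?Y (Suc n) - ?Y n) *v (?Y n *v v)) \<le> r ^ n * (r * norm v)"
      using Suc.IH[of "?Y n *v v"] mult_left_mono[OF bY[of n v], of "r ^ n"] r by simp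
    ultimately show ?case
      using norm_triangle_ineq[of "?Y (Suc n) *v ((?Y (Suc n) - ?Y n) *v v)" "(?Y (Suc n) - ?Y n) *v (?Y n *v v)"]
      by (simp del: sqrt_iter.simps add: mult_ac)
  qed
  \<comment> \<open>Applying the differences to basis vectors turns the operator bound into a
    summable bound for each entry.\<close>
  have "convergent (\<lambda>n. ?Y n $ i $ j)" for i j
  proof -
    have "norm (?Y (Suc n) $ i $ j - ?Y n $ i $ j) \<le> r ^ n" for n
    proof -
      have "\<bar>((?Y (Suc n) - ?Y n) *v axis j 1) $ i\<bar> \<le> r ^ n * norm (axis j 1 :: real ^ 'n)"
        using component_le_norm_cart[of "(?Y (Suc n) - ?Y n) *v axis j 1" i] diff[of n "axis j 1"] by linarith
      then show ?thesis by (simp add: matrix_vector_mult_basis column_def del: sqrt_iter.simps)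
    qed
    then have "summable (\<lambda>n. ?Y (Suc n) $ i $ j - ?Y n $ i $ j)"
      by (intro summable_comparison_test[OF _ summable_geometric[of r]]) (use r in auto)
    then have "convergent (\<lambda>n. \<Sum>k<n. ?Y (Suc k) $ i $ j - ?Y k $ i $ j)"
      by (simp only: summable_iff_convergent)
    then show ?thesis unfolding sum_lessThan_telescope[of "\<lambda>k. ?Y k $ i $ j"] by simp
  qed
  then obtain y where y: "\<And>i j. (\<lambda>n. ?Y n $ i $ j) \<longlonglongrightarrow> y i j" unfolding convergent_def by metis
  define Y where "Y = (\<chi> i j. y i j)"
  have lim: "?Y \<longlonglongrightarrow> Y" by (simp add: tendsto_matrix_iff Y_def y)
  have "(\<lambda>n. ?Y (Suc n)) \<longlonglongrightarrow> (1/2) *\<^sub>R (A + Y ** Y)"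
    unfolding sqrt_iter.simps by (intro tendsto_intros lim)
  moreover have "(\<lambda>n. ?Y (Suc n)) \<longlonglongrightarrow> Y" using lim by (rule LIMSEQ_Suc)
  ultimately have "Y = (1/2) *\<^sub>R (A + Y ** Y)" by (rule LIMSEQ_unique[symmetric])
  then have "2 *\<^sub>R Y = 2 *\<^sub>R ((1/2) *\<^sub>R (A + Y ** Y))" by (rule arg_cong)
  then have eq: "2 *\<^sub>R Y = A + Y ** Y" by simp
  have "norm (Y *v v) \<le> r * norm v" for v
  proof (rule LIMSEQ_le_const2)
    show "(\<lambda>n. norm (?Y n *v v)) \<longlonglongrightarrow> norm (Y *v v)"
    proof (intro tendsto_norm vec_tendstoI)
      fix i show "(\<lambda>n. (?Y n *v v) $ i) \<longlonglongrightarrow> (Y *v v) $ i"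
        unfolding matrix_vector_mult_def vec_lambda_beta
        by (intro tendsto_sum tendsto_mult tendsto_const) (use lim tendsto_matrix_iff in blast)
    qed
  qed (use bY in auto)
  with lim eq that show ?thesis by blast
qed

lemma sqrt_iter_sym: "transpose A = A \<Longrightarrow> transpose (sqrt_iter A n) = sqrt_iter A n"
  by (induction n) (simp_all add: transpose_scaleR transpose_add matrix_transpose_mul, simp add: transpose_def vec_eq_iff)

text \<open>Makes the limiting square root commute with everything that commutes with the given
  matrix, on which the uniqueness of the root rests.\<close>

lemma sqrt_iter_commute: "C ** A = A ** C \<Longrightarrow> C ** sqrt_iter A n = sqrt_iter A n ** C"
proof (induction n)
  case (Suc n)
  let ?Y = "sqrt_iter A n"
  have IH: "C ** ?Y = ?Y ** C" by (rule Suc.IH[OF Suc.prems])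
  have "C ** (?Y ** ?Y) = (C ** ?Y) ** ?Y" by (simp only: matrix_mul_assoc)
  also have "\<dots> = (?Y ** C) ** ?Y" by (simp only: IH)
  also have "\<dots> = ?Y ** (C ** ?Y)" by (simp only: matrix_mul_assoc)
  also have "\<dots> = ?Y ** (?Y ** C)" by (simp only: IH)
  also have "\<dots> = (?Y ** ?Y) ** C" by (simp only: matrix_mul_assoc)
  finally show ?case
    using Suc.prems by (simp add: matrix_scaleR_left matrix_scaleR_right matrix_add_ldistrib matrix_add_rdistrib')
qed simp

text \<open>The scaling constant \<open>1 + norm B\<close> is continuous in \<open>B\<close>, which gives measurability
  of the square root.\<close>
lemma pos_def_sqrt:
  fixes B :: "real ^ 'n ^ 'n"
  assumes pd: "pos_def B"
  defines "c \<equiv> 1 + norm B"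
  obtains S where "pos_def S" "S ** S = B" "\<And>C. C ** B = B ** C \<Longrightarrow> C ** S = S ** C"
    "(\<lambda>n. sqrt c *\<^sub>R (mat 1 - sqrt_iter (mat 1 - (1/c) *\<^sub>R B) n)) \<longlonglongrightarrow> S"
proof -
  have c: "c > 0" unfolding c_def by (simp add: add_pos_nonneg)
  have symB: "transpose B = B" using pd by (simp add: pos_def_def)
  define A where "A = mat 1 - (1/c) *\<^sub>R B"
  have symA: "transpose A = A" by (simp add: A_def transpose_diff transpose_scaleR symB transpose_mat)
  \<comment> \<open>Relative to v . v the form of A lies between 0 and 1 - \<mu>; the minimum with 1
    keeps 1 - \<mu> nonnegative.\<close>
  define \<mu> where "\<mu> = min 1 (lambda_min B / c)"
  have mu: "0 < \<mu>" "\<mu> \<le> 1" using lambda_min_pos[OF pd] c by (auto simp: \<mu>_def)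
  have Av: "v \<bullet> (A *v v) = v \<bullet> v - (v \<bullet> (B *v v)) / c" for v
    by (simp add: A_def matrix_vector_algebra inner_simps)
  have "norm (A *v v) \<le> (1 - \<mu>) * norm v" for v
  proof (rule sym_norm_le[OF symA])
    fix v
    have "v \<bullet> (B *v v) \<le> norm v * (norm B * norm v)"
      using norm_cauchy_schwarz[of v "B *v v"] mult_left_mono[OF norm_matrix_vector_le[of B v], of "norm v"] by simp
    also have "\<dots> \<le> c * (v \<bullet> v)" 
      by (simp add: c_def power2_eq_square algebra_simps flip: power2_norm_eq_inner)
    finally have "v \<bullet> (B *v v) / c \<le> v \<bullet> v" using c by (simp add: pos_divide_le_eq mult.commute)
    moreover have "\<mu> * (v \<bullet> v) \<le> (v \<bullet> (B *v v)) / c"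
    proof -
      have "\<mu> * (v \<bullet> v) \<le> (lambda_min B / c) * (v \<bullet> v)" by (rule mult_right_mono) (auto simp: \<mu>_def)
      also have "\<dots> \<le> (v \<bullet> (B *v v)) / c"
        using lambda_min_properties(2)[OF symB, of v] c by (simp add: divide_right_mono)
      finally show ?thesis .
    qed
    ultimately show "\<bar>v \<bullet> (A *v v)\<bar> \<le> (1 - \<mu>) * (v \<bullet> v)" by (simp add: Av algebra_simps)
  qed
  then obtain Y where Y: "sqrt_iter A \<longlonglongrightarrow> Y" "2 *\<^sub>R Y = A + Y ** Y"
      "\<And>v. norm (Y *v v) \<le> (1 - sqrt (1 - (1 - \<mu>))) * norm v"
    using sqrt_iter_limit[of "1 - \<mu>" A] mu by auto
  define S where "S = sqrt c *\<^sub>R (mat 1 - Y)"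
  have lim: "(\<lambda>n. sqrt c *\<^sub>R (mat 1 - sqrt_iter A n)) \<longlonglongrightarrow> S"
    unfolding S_def by (intro tendsto_intros Y)
  have symY: "transpose Y = Y"
  proof (rule LIMSEQ_unique[OF _ Y(1)])
    have "(\<lambda>n. transpose (sqrt_iter A n)) \<longlonglongrightarrow> transpose Y"
      using Y(1) by (simp add: tendsto_matrix_iff transpose_def)
    then show "sqrt_iter A \<longlonglongrightarrow> transpose Y" by (simp add: sqrt_iter_sym symA)
  qed
  have symS: "transpose S = S" by (simp add: S_def transpose_scaleR transpose_diff symY transpose_mat)
  \<comment> \<open>The equation 2 Y = A + Y^2 turns the right-hand side into c (I - A), which is
    B.\<close>
  have "S ** S = c *\<^sub>R (mat 1 - 2 *\<^sub>R Y + Y ** Y)"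
    using c by (simp add: S_def matrix_algebra scaleR_2 algebra_simps)
  also have "\<dots> = c *\<^sub>R (mat 1 - A)" by (simp add: Y(2))
  also have "\<dots> = B" using c by (simp add: A_def)
  finally have SS: "S ** S = B" .
  have pdS: "pos_def S"
  proof (rule pos_def_if_lower_bound[OF symS])
    \<comment> \<open>Y has operator norm at most 1 - sqrt \<mu>, which leaves sqrt \<mu> as a lower
      bound for I - Y.\<close>
    show "0 < sqrt c * sqrt \<mu>" using c mu by simp
    fix v
    have "v \<bullet> (Y *v v) \<le> (1 - sqrt \<mu>) * (v \<bullet> v)"
      using norm_cauchy_schwarz[of v "Y *v v"] mult_left_mono[OF Y(3)[of v], of "norm v"]
      by (simp add: power2_eq_square mult_ac flip: power2_norm_eq_inner)
    then have "sqrt c * (sqrt \<mu> * (v \<bullet> v)) \<le> sqrt c * (v \<bullet> v - v \<bullet> (Y *v v))"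
      using c by (intro mult_left_mono) (auto simp: algebra_simps)
    then show "sqrt c * sqrt \<mu> * (v \<bullet> v) \<le> v \<bullet> (S *v v)"
      by (simp add: S_def matrix_vector_algebra inner_simps algebra_simps)
  qed
  have comm: "C ** S = S ** C" if "C ** B = B ** C" for C
  proof -
    have "C ** A = A ** C" using that by (simp add: A_def matrix_algebra)
    then have "C ** sqrt_iter A n = sqrt_iter A n ** C" for n by (rule sqrt_iter_commute)
    moreover have "(\<lambda>n. C ** sqrt_iter A n) \<longlonglongrightarrow> C ** Y" "(\<lambda>n. sqrt_iter A n ** C) \<longlonglongrightarrow> Y ** C"
      by (intro tendsto_intros Y(1))+
    ultimately have "C ** Y = Y ** C" using LIMSEQ_unique by simp
    then show ?thesis by (simp add: S_def matrix_algebra)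
  qed
  show ?thesis by (rule that[OF pdS SS comm]) (use lim A_def in auto)
qed

lemma pos_def_imp_semidef: "pos_def A \<Longrightarrow> pos_semidef A"
  unfolding pos_def_def pos_semidef_def by (metis inner_zero_left less_eq_real_def)

text \<open>Uniqueness: a semidefinite root S' commutes with B = S' S', hence with S, so (S + S')(S'
  - S) = 0, and S + S' is positive definite and can be cancelled.\<close>

lemma sqrt_mat_properties:
  fixes B :: "real ^ 'n ^ 'n"
  assumes pd: "pos_def B"
  shows "pos_def (sqrt_mat B)" "sqrt_mat B ** sqrt_mat B = B"
    "(\<lambda>n. sqrt (1 + norm B) *\<^sub>R (mat 1 - sqrt_iter (mat 1 - (1 / (1 + norm B)) *\<^sub>R B) n)) \<longlonglongrightarrow> sqrt_mat B"
proof -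
  obtain S where S: "pos_def S" "S ** S = B" "\<And>C. C ** B = B ** C \<Longrightarrow> C ** S = S ** C"
    "(\<lambda>n. sqrt (1 + norm B) *\<^sub>R (mat 1 - sqrt_iter (mat 1 - (1/(1 + norm B)) *\<^sub>R B) n)) \<longlonglongrightarrow> S"
    using pos_def_sqrt[OF pd] by blast
  have "S' = S" if S': "pos_semidef S'" "S' ** S' = B" for S'
  proof -
    have "S' ** B = B ** S'" unfolding S'(2)[symmetric] by (simp only: matrix_mul_assoc)
    then have comm: "S' ** S = S ** S'" by (rule S(3))
    have "(S + S') ** (S' - S) = 0" by (simp add: matrix_algebra S(2) S'(2) comm)
    then have "(S + S') *v ((S' - S) *v v) = 0" for v by (simp add: matrix_vector_mul_assoc)
    moreover have "pos_def (S + S')"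
      using S(1) S'(1) unfolding pos_def_def pos_semidef_def
      by (auto simp: transpose_add matrix_vector_algebra inner_simps add_pos_nonneg)
    ultimately have "(S' - S) *v v = 0" for v
      using pos_def_lower_bound matrix_inv_apply_cancel(1) by (metis matrix_vector_mult_0_right)
    then have "S' - S = 0" by (metis matrix_eq matrix_vector_mult_0)
    then show ?thesis by simp
  qed
  then have "sqrt_mat B = S" unfolding sqrt_mat_def
    by (intro the_equality) (use S(1,2) pos_def_imp_semidef in auto)
  with S(1,2,4) show "pos_def (sqrt_mat B)" "sqrt_mat B ** sqrt_mat B = B"
    "(\<lambda>n. sqrt (1 + norm B) *\<^sub>R (mat 1 - sqrt_iter (mat 1 - (1 / (1 + norm B)) *\<^sub>R B) n)) \<longlonglongrightarrow> sqrt_mat B"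
    by auto
qed

lemma inv_sqrt_mat_properties:
  fixes B :: "real ^ 'n ^ 'n"
  assumes pd: "pos_def B"
  shows "invertible (sqrt_mat B)" "transpose (inv_sqrt_mat B) = inv_sqrt_mat B"
    "sqrt_mat B ** inv_sqrt_mat B = mat 1" "inv_sqrt_mat B ** sqrt_mat B = mat 1"
    "inv_sqrt_mat B ** B ** inv_sqrt_mat B = mat 1"
    "inv_sqrt_mat B ** inv_sqrt_mat B = matrix_inv B"
    "pos_def (inv_sqrt_mat B)"
proof -
  let ?S = "sqrt_mat B" and ?T = "inv_sqrt_mat B"
  note S = sqrt_mat_properties[OF pd]
  show i: "invertible ?S" using S(1) by (rule pos_def_lower_bound)
  show sym: "transpose ?T = ?T"
    unfolding inv_sqrt_mat_def using S(1) by (simp add: transpose_matrix_inv i pos_def_def)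
  show 1: "?S ** ?T = mat 1" "?T ** ?S = mat 1"
    by (simp_all add: inv_sqrt_mat_def matrix_inv_right matrix_inv_left i)
  have "?T ** B ** ?T = (?T ** ?S) ** (?S ** ?T)" by (subst S(2)[symmetric]) (simp only: matrix_mul_assoc)
  then show "?T ** B ** ?T = mat 1" by (simp add: 1)
  have "B ** (?T ** ?T) = ?S ** (?S ** ?T) ** ?T"
    by (subst S(2)[symmetric]) (simp only: matrix_mul_assoc)
  then have "B ** (?T ** ?T) = mat 1" by (simp add: 1)
  then show "?T ** ?T = matrix_inv B" using matrix_inv_unique_right(2) by metis
  show "pos_def ?T" unfolding pos_def_def
  proof (intro conjI allI impI sym)
    fix v :: "real ^ 'n" assume "v \<noteq> 0"
    have v: "v = ?S *v (?T *v v)" by (simp add: matrix_vector_mul_assoc 1)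
    have "?T *v v \<noteq> 0"
    proof
      assume "?T *v v = 0"
      then have "?S *v (?T *v v) = 0" by simp
      with v \<open>v \<noteq> 0\<close> show False by argo
    qed
    then have "0 < (?T *v v) \<bullet> (?S *v (?T *v v))" using S(1) by (simp add: pos_def_def)
    then show "0 < v \<bullet> (?T *v v)" using arg_cong[OF v, of "\<lambda>x. x \<bullet> (?T *v v)"] by (simp add: inner_commute)
  qed
qed

section \<open>Outer products and Borel measurability of matrix operations\<close>

lemma outer_apply: "outer v w *v z = (w \<bullet> z) *\<^sub>R v"
  by (simp add: outer_def matrix_vector_mult_def vec_eq_iff inner_vec_def sum_distrib_left sum_distrib_right mult_ac)

lemma transpose_outer: "transpose (outer v w) = outer w v"
  by (simp add: outer_def transpose_def vec_eq_iff mult.commute)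

lemma norm_outer: "norm (outer v w) = norm v * norm w"
proof -
  have "norm (outer v w) = L2_set (\<lambda>i. norm w * \<bar>v $ i\<bar>) UNIV"
    unfolding norm_vec_def[of "outer v w"]
  proof (rule L2_set_cong[OF refl])
    fix i
    have "outer v w $ i = v $ i *\<^sub>R w" by (simp add: outer_def vec_eq_iff)
    then show "norm (outer v w $ i) = norm w * \<bar>v $ i\<bar>" by simp
  qed
  also have "\<dots> = norm v * norm w"
    by (simp add: norm_vec_def[of v] L2_set_right_distrib[symmetric] mult.commute)
  finally show ?thesis .
qed

lemma borel_measurable_vecI:
  fixes f :: "'a \<Rightarrow> 'b::euclidean_space ^ 'n"
  assumes "\<And>i. (\<lambda>x. f x $ i) \<in> borel_measurable M"
  shows "f \<in> borel_measurable M"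
  unfolding borel_measurable_euclidean_space[of f]
  using assms by (auto simp: Basis_vec_def inner_axis intro!: borel_measurable_inner)

lemma borel_measurable_vec_nth [measurable (raw)]:
  fixes f :: "'a \<Rightarrow> 'b::euclidean_space ^ 'n"
  assumes "f \<in> borel_measurable M"
  shows "(\<lambda>x. f x $ i) \<in> borel_measurable M"
  by (rule borel_measurable_continuous_on[OF _ assms, of "\<lambda>v. v $ i"]) (intro continuous_intros)

lemma borel_measurable_matrix_mult [measurable (raw)]:
  fixes f :: "'a \<Rightarrow> real ^ 'n ^ 'm" and g :: "'a \<Rightarrow> real ^ 'l ^ 'n"
  assumes [measurable]: "f \<in> borel_measurable M" "g \<in> borel_measurable M"
  shows "(\<lambda>x. f x ** g x) \<in> borel_measurable M"
  by (intro borel_measurable_vecI) (simp add: matrix_matrix_mult_def)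

lemma borel_measurable_matrix_vector_mult [measurable (raw)]:
  fixes f :: "'a \<Rightarrow> real ^ 'n ^ 'm" and g :: "'a \<Rightarrow> real ^ 'n"
  assumes [measurable]: "f \<in> borel_measurable M" "g \<in> borel_measurable M"
  shows "(\<lambda>x. f x *v g x) \<in> borel_measurable M"
  by (intro borel_measurable_vecI) (simp add: matrix_vector_mult_def)

lemma borel_measurable_outer [measurable (raw)]:
  fixes f :: "'a \<Rightarrow> real ^ 'm" and g :: "'a \<Rightarrow> real ^ 'n"
  assumes [measurable]: "f \<in> borel_measurable M" "g \<in> borel_measurable M"
  shows "(\<lambda>x. outer (f x) (g x)) \<in> borel_measurable M"
  by (intro borel_measurable_vecI) (simp add: outer_def)

lemma borel_measurable_det [measurable (raw)]:
  fixes f :: "'a \<Rightarrow> real ^ 'n ^ 'n"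
  assumes [measurable]: "f \<in> borel_measurable M"
  shows "(\<lambda>x. det (f x)) \<in> borel_measurable M"
  unfolding det_def by measurable

text \<open>On singular matrices \<^const>\<open>matrix_inv\<close> is a Hilbert choice from the empty set, hence constant;
  elsewhere Cramer's rule gives the entries.\<close>
lemma borel_measurable_matrix_inv [measurable (raw)]:
  fixes f :: "'a \<Rightarrow> real ^ 'n ^ 'n"
  assumes [measurable]: "f \<in> borel_measurable M"
  shows "(\<lambda>x. matrix_inv (f x)) \<in> borel_measurable M"
proof -
  define C :: "real ^ 'n ^ 'n" where "C = (SOME _. False)"
  have sing: "matrix_inv A = C" if "det A = 0" for A :: "real ^ 'n ^ 'n"
  proof -
    have "\<not> invertible A" using that by (simp add: invertible_det_nz)
    then have "(\<lambda>A'. A ** A' = mat 1 \<and> A' ** A = mat 1) = (\<lambda>_. False)" by (auto simp: invertible_def)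
    then show ?thesis by (simp add: matrix_inv_def C_def)
  qed
  have nonsing: "matrix_inv A $ i $ j = det (\<chi> k l. if l = i then axis j 1 $ k else A $ k $ l) / det A"
    if "det A \<noteq> 0" for A :: "real ^ 'n ^ 'n" and i j
  proof -
    have "A *v (matrix_inv A *v axis j 1) = axis j 1"
      using that by (simp add: matrix_inv_apply_cancel invertible_det_nz)
    then have "matrix_inv A *v axis j 1 = (\<chi> i. det (\<chi> k l. if l = i then axis j 1 $ k else A $ k $ l) / det A)"
      using cramer[OF that, of "matrix_inv A *v axis j 1" "axis j 1"] by blast
    then show ?thesis by (simp add: matrix_vector_mult_basis column_def vec_eq_iff)
  qed
  have "(\<lambda>x. if det (f x) = 0 then C $ i $ j else
      det (\<chi> k l. if l = i then axis j 1 $ k else f x $ k $ l) / det (f x)) \<in> borel_measurable M" for i j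
  proof -
    have [measurable]: "(\<lambda>x. (\<chi> k l. if l = i then axis j 1 $ k else f x $ k $ l) :: real ^ 'n ^ 'n) \<in> borel_measurable M"
      by (intro borel_measurable_vecI) simp
    show ?thesis by measurable
  qed
  also have "(\<lambda>x. if det (f x) = 0 then C $ i $ j else
      det (\<chi> k l. if l = i then axis j 1 $ k else f x $ k $ l) / det (f x)) = (\<lambda>x. matrix_inv (f x) $ i $ j)" for i j
    by (auto simp: sing nonsing)
  finally show ?thesis by (intro borel_measurable_vecI)
qed

lemma measurable_invertible [measurable]:
  fixes f :: "'a \<Rightarrow> real ^ 'n ^ 'n"
  assumes [measurable]: "f \<in> borel_measurable M"
  shows "Measurable.pred M (\<lambda>x. invertible (f x))"
  unfolding invertible_det_nz by measurable

text \<open>The positive definite matrices are a countable union of closed sets, indexed by a lower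
  bound 1 / (n + 1) for the quadratic form on unit vectors.\<close>

lemma measurable_pos_def [measurable]:
  fixes f :: "'a \<Rightarrow> real ^ 'n ^ 'n"
  assumes f[measurable]: "f \<in> borel_measurable M"
  shows "Measurable.pred M (\<lambda>x. pos_def (f x))"
proof -
  define E :: "nat \<Rightarrow> (real ^ 'n ^ 'n) set"
    where "E n = {A. transpose A = A \<and> (\<forall>v. inverse (Suc n) * (v \<bullet> v) \<le> v \<bullet> (A *v v))}" for n
  have "continuous_on UNIV (\<lambda>A :: real ^ 'n ^ 'n. v \<bullet> (A *v v))" for v
    unfolding matrix_vector_mult_def by (intro continuous_intros)
  then have 1: "closed {A. inverse (Suc n) * (v \<bullet> v) \<le> v \<bullet> (A *v v)}" for v :: "real ^ 'n" and n
    by (intro closed_Collect_le continuous_on_const) auto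
  have "continuous_on UNIV (\<lambda>A :: real ^ 'n ^ 'n. transpose A)"
    unfolding transpose_def by (intro continuous_intros)
  then have 2: "closed {A :: real ^ 'n ^ 'n. transpose A = A}"
    by (intro closed_Collect_eq continuous_on_id) auto
  have "closed (E n)" for n unfolding E_def
    by (intro closed_Collect_conj closed_Collect_all 1 2)
  then have [measurable]: "(\<Union>n. E n) \<in> sets borel" by (intro sets.countable_UN) auto
  have *: "pos_def A \<longleftrightarrow> A \<in> (\<Union>n. E n)" for A
  proof
    assume pd: "pos_def A"
    then obtain n where "inverse (real (Suc n)) < lambda_min A"
      using lambda_min_pos reals_Archimedean by blast
    then have "inverse (real (Suc n)) * (v \<bullet> v) \<le> v \<bullet> (A *v v)" for v
      using lambda_min_properties(2)[of A v] pd mult_right_mono[of "inverse (real (Suc n))" "lambda_min A" "v \<bullet> v"]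
      by (auto simp: pos_def_def)
    then show "A \<in> (\<Union>n. E n)" using pd by (auto simp: E_def pos_def_def)
  next
    assume "A \<in> (\<Union>n. E n)"
    then obtain n where "A \<in> E n" by auto
    then show "pos_def A" unfolding E_def by (intro pos_def_if_lower_bound[of _ "inverse (Suc n)"]) auto
  qed
  show ?thesis unfolding * by measurable
qed

text \<open>\<open>sqrt_mat\<close> is a definite description that is controlled on positive
  definite matrices, where it is a limit of measurable iterates; elsewhere the value 0 is
  substituted.\<close>

lemma borel_measurable_sqrt_mat:
  fixes f :: "'a \<Rightarrow> real ^ 'n ^ 'n"
  assumes f[measurable]: "f \<in> borel_measurable M"
  shows "(\<lambda>x. if pos_def (f x) then sqrt_mat (f x) else 0) \<in> borel_measurable M"
proof (rule borel_measurable_LIMSEQ_metric[where f = "\<lambda>n x. if pos_def (f x) then sqrt (1 + norm (f x)) *\<^sub>R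
       (mat 1 - sqrt_iter (mat 1 - (1 / (1 + norm (f x))) *\<^sub>R f x) n) else 0"])
  have [measurable]: "(\<lambda>x. sqrt_iter (g x) n) \<in> borel_measurable M"
    if [measurable]: "g \<in> borel_measurable M" for g :: "'a \<Rightarrow> real ^ 'n ^ 'n" and n
    by (induction n) simp_all
  show "(\<lambda>x. if pos_def (f x) then sqrt (1 + norm (f x)) *\<^sub>R
       (mat 1 - sqrt_iter (mat 1 - (1 / (1 + norm (f x))) *\<^sub>R f x) n) else 0) \<in> borel_measurable M" for n
    by measurable
qed (auto simp: sqrt_mat_properties(3))

lemma borel_measurable_inv_sqrt_mat:
  fixes f :: "'a \<Rightarrow> real ^ 'n ^ 'n"
  assumes f[measurable]: "f \<in> borel_measurable M"
  shows "(\<lambda>x. if pos_def (f x) then inv_sqrt_mat (f x) else 0) \<in> borel_measurable M"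
proof -
  note borel_measurable_sqrt_mat[OF f, measurable]
  have "(\<lambda>x. if pos_def (f x) then matrix_inv (if pos_def (f x) then sqrt_mat (f x) else 0) else 0) \<in> borel_measurable M"
    by measurable
  then show ?thesis by (simp add: inv_sqrt_mat_def if_distrib cong: if_cong)
qed

section \<open>Sandwich forms and the relative deviation\<close>

lemma transpose_sandwich: "transpose V = V \<Longrightarrow> transpose (sandwich R V) = sandwich R V"
  by (simp add: sandwich_def matrix_transpose_mul matrix_mul_assoc)

lemma sandwich_form: "v \<bullet> (sandwich R V *v v) = (R *v v) \<bullet> (V *v (R *v v))"
proof -
  have "v \<bullet> (transpose R *v w) = (R *v v) \<bullet> w" for w
    using inner_matrix_vector_transpose[of v "transpose R" w] by (simp only: transpose_transpose)
  then show ?thesis unfolding sandwich_def matrix_vector_mul_assoc[symmetric] by (simp only:)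
qed

lemma full_rank_nonzero: "rank R = CARD('q) \<Longrightarrow> v \<noteq> 0 \<Longrightarrow> R *v v \<noteq> 0" for R :: "real ^ 'q ^ 'k"
  using full_rank_injective[of R] injD[of "(*v) R" v 0] by auto

lemma pos_def_sandwich:
  fixes R :: "real ^ 'q ^ 'k"
  assumes "pos_def V" "rank R = CARD('q)"
  shows "pos_def (sandwich R V)"
  using assms full_rank_nonzero[OF assms(2)] unfolding pos_def_def by (simp add: transpose_sandwich sandwich_form)

lemma sandwich_comp: "sandwich B (sandwich R V) = sandwich (R ** B) V"
  by (simp add: sandwich_def matrix_transpose_mul matrix_mul_assoc)

lemma sandwich_diff: "sandwich R (V - W) = sandwich R V - sandwich R W"
  by (simp add: sandwich_def matrix_diff_ldistrib matrix_diff_rdistrib)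

text \<open>Reduces the deviation to the quadratic form of V1 - V in directions that
  \<open>normalised_direction\<close> shows to have V-length |t|.\<close>

lemma rel_deviation_sandwich:
  fixes R :: "real ^ 'q ^ 'k"
  assumes V: "pos_def V" and R: "rank R = CARD('q)"
  shows "inv_sqrt_mat (sandwich R V) ** sandwich R V1 ** inv_sqrt_mat (sandwich R V) - mat 1
       = sandwich (R ** inv_sqrt_mat (sandwich R V)) (V1 - V)"
proof -
  let ?B = "inv_sqrt_mat (sandwich R V)"
  note p = inv_sqrt_mat_properties[OF pos_def_sandwich[OF V R]]
  have "sandwich (R ** ?B) W = ?B ** sandwich R W ** ?B" for W
    by (simp only: sandwich_comp[symmetric] sandwich_def[of ?B] p(2))
  then show ?thesis by (simp add: sandwich_diff p(5))
qed

lemma normalised_direction: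
  fixes R :: "real ^ 'q ^ 'k"
  assumes V: "pos_def V" and R: "rank R = CARD('q)"
  defines "B \<equiv> R ** inv_sqrt_mat (sandwich R V)"
  shows "(B *v t) \<bullet> (V *v (B *v t)) = t \<bullet> t"
proof -
  let ?B = "inv_sqrt_mat (sandwich R V)"
  note p = inv_sqrt_mat_properties[OF pos_def_sandwich[OF V R]]
  have "sandwich B V = ?B ** sandwich R V ** ?B"
    by (simp only: B_def sandwich_comp[symmetric] sandwich_def[of ?B] p(2))
  then show ?thesis using sandwich_form[of t B V] by (simp add: p(5))
qed

text \<open>In normalised directions the hypothesis reads |t . E t| \<le> c |t|^2 for the symmetric
  deviation matrix E. The constant c does not depend on R, which is what later bounds the supremum
  over R.\<close>

lemma rel_deviation_le:
  fixes R :: "real ^ 'q ^ 'k"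
  assumes V: "pos_def V" and R: "rank R = CARD('q)" and sym: "transpose V1 = V1"
    and le: "\<And>v. \<bar>v \<bullet> (V1 *v v) - v \<bullet> (V *v v)\<bar> \<le> c * (v \<bullet> (V *v v))" and c: "0 \<le> c"
  shows "rel_deviation R V V1 \<le> c"
  unfolding rel_deviation_def rel_deviation_sandwich[OF V R]
proof (rule spectral_norm_bound[OF c], rule sym_norm_le)
  let ?B = "R ** inv_sqrt_mat (sandwich R V)"
  have "transpose V = V" using V by (simp add: pos_def_def)
  then show "transpose (sandwich ?B (V1 - V)) = sandwich ?B (V1 - V)"
    by (simp add: transpose_sandwich transpose_diff sym)
  fix t
  show "\<bar>t \<bullet> (sandwich ?B (V1 - V) *v t)\<bar> \<le> c * (t \<bullet> t)"
    using le[of "?B *v t"] normalised_direction[OF V R, of t]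
    by (simp add: sandwich_form matrix_vector_mult_diff_rdistrib inner_diff_right)
qed

lemma continuous_rel_deviation: "continuous_on UNIV (rel_deviation R V)"
proof -
  have "continuous_on UNIV (\<lambda>V1. inv_sqrt_mat (sandwich R V) ** sandwich R V1 ** inv_sqrt_mat (sandwich R V) - mat 1)"
    unfolding continuous_on_def sandwich_def by (intro ballI tendsto_intros)
  then show ?thesis unfolding rel_deviation_def
    by (rule continuous_on_compose2[OF continuous_spectral_norm]) auto
qed

lemma borel_measurable_rel_deviation [measurable (raw)]:
  "f \<in> borel_measurable M \<Longrightarrow> (\<lambda>x. rel_deviation R V (f x)) \<in> borel_measurable M"
  by (rule borel_measurable_continuous_on[OF continuous_rel_deviation])

text \<open>A supremum of continuous functions, however many, is lower semicontinuous.\<close>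
lemma borel_measurable_SUP_rel_deviation:
  assumes f: "f \<in> borel_measurable M"
  shows "(\<lambda>x. SUP R\<in>\<R>. ennreal (rel_deviation R V (f x))) \<in> borel_measurable M"
proof -
  have "open ((\<lambda>W. SUP R\<in>\<R>. ennreal (rel_deviation R V W)) -` {y<..})" for y
  proof -
    have "(\<lambda>W. SUP R\<in>\<R>. ennreal (rel_deviation R V W)) -` {y<..}
        = (\<Union>R\<in>\<R>. (\<lambda>W. ennreal (rel_deviation R V W)) -` {y<..})"
      by (auto simp: less_SUP_iff)
    moreover have "open ((\<lambda>W. ennreal (rel_deviation R V W)) -` {y<..})" for R
      by (intro open_vimage open_greaterThan continuous_on_ennreal continuous_rel_deviation)
    ultimately show ?thesis by (simp only:) (intro open_UN ballI)
  qed
  then have "(\<lambda>W. SUP R\<in>\<R>. ennreal (rel_deviation R V W)) \<in> borel_measurable borel"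
    by (intro borel_measurableI_greater) (simp add: borel_open vimage_def)
  from measurable_compose[OF f this] show ?thesis .
qed

section \<open>Traces and perturbation of the inverse square root\<close>

lemma trace_matrix_mult_inner: "trace (A ** B) = A \<bullet> transpose B"
  for A :: "real ^ 'n ^ 'm" and B :: "real ^ 'm ^ 'n"
  by (simp add: trace_def matrix_matrix_mult_def inner_vec_def transpose_def)

lemma norm_transpose: "norm (transpose A) = norm A" for A :: "real ^ 'n ^ 'm"
proof -
  have "(norm (transpose A))\<^sup>2 = trace (transpose A ** A)"
    unfolding power2_norm_eq_inner trace_matrix_mult_inner by simp
  also have "\<dots> = trace (A ** transpose A)" by (rule trace_mul_sym)
  also have "\<dots> = (norm A)\<^sup>2"
    unfolding power2_norm_eq_inner trace_matrix_mult_inner by simp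
  finally show ?thesis by simp
qed

lemma norm_matrix_mult_le: "norm (A ** B) \<le> norm A * norm B"
  for A :: "real ^ 'n ^ 'm" and B :: "real ^ 'l ^ 'n"
proof -
  have row: "(A ** B) $ i = transpose B *v (A $ i)" for i
    unfolding vec_eq_iff
    by (simp add: matrix_matrix_mult_def matrix_vector_mult_def transpose_def mult.commute del: transpose_matrix_vector)
  have "norm ((A ** B) $ i) \<le> norm B * norm (A $ i)" for i
    unfolding row using norm_matrix_vector_le[of "transpose B" "A $ i"] by (simp only: norm_transpose)
  then have "norm (A ** B) \<le> L2_set (\<lambda>i. norm B * norm (A $ i)) UNIV"
    unfolding norm_vec_def[of "A ** B"] by (intro L2_set_mono) auto
  also have "\<dots> = norm A * norm B"
    unfolding norm_vec_def[of A] by (simp add: L2_set_right_distrib mult.commute)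
  finally show ?thesis .
qed

lemma trace_mult_le: "\<bar>trace (A ** B)\<bar> \<le> norm A * norm B"
  for A :: "real ^ 'n ^ 'm" and B :: "real ^ 'm ^ 'n"
  using Cauchy_Schwarz_ineq2[of A "transpose B"] by (simp add: trace_matrix_mult_inner norm_transpose)

lemma trace_le: "\<bar>trace A\<bar> \<le> real CARD('n) * norm A" for A :: "real ^ 'n ^ 'n"
proof -
  have "\<bar>trace A\<bar> \<le> (\<Sum>i\<in>UNIV. \<bar>A $ i $ i\<bar>)" unfolding trace_def by (rule sum_abs)
  also have "\<dots> \<le> (\<Sum>i\<in>(UNIV :: 'n set). norm A)"
    by (intro sum_mono order_trans[OF component_le_norm_cart Finite_Cartesian_Product.norm_nth_le])
  finally show ?thesis by simp
qed

lemma pos_def_matrix_inv: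
  fixes S :: "real ^ 'n ^ 'n"
  assumes "pos_def S" shows "pos_def (matrix_inv S)"
proof -
  have i: "invertible S" by (rule pos_def_lower_bound[OF assms])
  have sym: "transpose S = S" using assms by (simp add: pos_def_def)
  show ?thesis unfolding pos_def_def
  proof (intro conjI allI impI)
    show "transpose (matrix_inv S) = matrix_inv S" by (simp add: transpose_matrix_inv i sym)
    fix v :: "real ^ 'n" assume v: "v \<noteq> 0"
    define w where "w = matrix_inv S *v v"
    have Sw: "S *v w = v" by (simp add: w_def matrix_inv_apply_cancel i)
    with v have "w \<noteq> 0" by auto
    then have "0 < w \<bullet> (S *v w)" using assms by (simp add: pos_def_def)
    then show "0 < v \<bullet> (matrix_inv S *v v)" by (simp add: Sw flip: w_def) (simp add: inner_commute)
  qed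
qed

text \<open>The matrix form of x + 1/x \<ge> 2. With Z = T - S and L^2 = S^-1 the excess is the
  trace of (Z L)' T^-1 (Z L), which is nonnegative.\<close>

lemma trace_add_trace_inv_ge:
  fixes S T :: "real ^ 'n ^ 'n"
  assumes S: "pos_def S" and T: "pos_def T"
  shows "2 * real CARD('n) \<le> trace (matrix_inv S ** T) + trace (matrix_inv T ** S)"
proof -
  let ?Si = "matrix_inv S" and ?Ti = "matrix_inv T"
  define Z where "Z = T - S"
  define L where "L = sqrt_mat ?Si"
  have L: "pos_def L" "L ** L = ?Si"
    unfolding L_def using sqrt_mat_properties pos_def_matrix_inv[OF S] by blast+
  have symL: "transpose L = L" and symZ: "transpose Z = Z"
    using L(1) S T by (simp_all add: pos_def_def Z_def transpose_diff)
  have Ti: "?Ti ** T = mat 1" "T ** ?Ti = mat 1" and Si: "?Si ** S = mat 1"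
    using pos_def_lower_bound[OF T] pos_def_lower_bound[OF S] by (simp_all add: matrix_inv_left matrix_inv_right)
  have "?Si ** (Z ** ?Ti ** Z) = ?Si ** (T ** ?Ti ** T - T ** ?Ti ** S - S ** ?Ti ** T + S ** ?Ti ** S)"
    unfolding Z_def by (rule arg_cong[where f = "(**) ?Si"]) (simp add: matrix_diff_ldistrib matrix_diff_rdistrib)
  also have "\<dots> = ?Si ** (T - S - S + S ** ?Ti ** S)"
    by (simp add: Ti matrix_mul_assoc[of S, symmetric])
  also have "\<dots> = ?Si ** T - mat 1 - mat 1 + (?Si ** S) ** ?Ti ** S"
    by (simp only: matrix_diff_ldistrib matrix_add_ldistrib Si matrix_mul_assoc)
  also have "\<dots> = ?Si ** T - mat 1 - mat 1 + ?Ti ** S" by (simp add: Si)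
  finally have "trace (?Si ** (Z ** ?Ti ** Z)) = trace (?Si ** T) - real CARD('n) - real CARD('n) + trace (?Ti ** S)"
    by (simp only: trace_add trace_sub trace_I)
  then have "trace (?Si ** T) + trace (?Ti ** S) - 2 * real CARD('n) = trace (?Si ** (Z ** ?Ti ** Z))"
    by linarith
  also have "\<dots> = trace (L ** (L ** (Z ** ?Ti ** Z)))" by (simp add: L(2)[symmetric] matrix_mul_assoc)
  also have "\<dots> = trace (sandwich (Z ** L) ?Ti)"
    by (subst trace_mul_sym) (simp add: sandwich_def matrix_transpose_mul symZ symL matrix_mul_assoc)
  also have "\<dots> = (\<Sum>i\<in>UNIV. axis i 1 \<bullet> (sandwich (Z ** L) ?Ti *v axis i 1))"
    by (simp add: trace_def matrix_vector_mult_basis column_def inner_axis')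
  also have "\<dots> \<ge> 0"
    unfolding sandwich_form using pos_def_imp_semidef[OF pos_def_matrix_inv[OF T]]
    by (intro sum_nonneg) (simp add: pos_semidef_def)
  finally show ?thesis by simp
qed

text \<open>\<open>C = S\<^sup>-\<^sup>1 T\<close> satisfies \<open>C C' = I + E\<close>, which by itself only makes it nearly orthogonal.
  Being similar to a positive definite matrix it has \<open>tr C + tr C\<^sup>-\<^sup>1 \<ge> 2q\<close>, and this forces it
  to be near the identity, whatever the conditioning of \<open>S\<close>.\<close>
lemma inv_sqrt_perturbation:
  fixes P P1 :: "real ^ 'q ^ 'q"
  assumes P: "pos_def P" and P1: "pos_def P1"
    and e: "norm (inv_sqrt_mat P ** P1 ** inv_sqrt_mat P - mat 1) \<le> e" "e \<le> 1/2"
  shows "norm (inv_sqrt_mat P1 *v z - inv_sqrt_mat P *v z) \<le> sqrt (5 * real CARD('q) * e) * norm (inv_sqrt_mat P1 *v z)"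
proof -
  let ?q = "real CARD('q)"
  define S where "S = sqrt_mat P"
  define T where "T = sqrt_mat P1"
  define Si where "Si = inv_sqrt_mat P"
  define Ti where "Ti = inv_sqrt_mat P1"
  define E where "E = Si ** P1 ** Si - mat 1"
  \<comment> \<open>C and D are mutually inverse, and C C' = I + E is the only smallness available
    at the start.\<close>
  define C where "C = Si ** T"
  define D where "D = Ti ** S"
  note pS = inv_sqrt_mat_properties[OF P, folded S_def Si_def]
  note pT = inv_sqrt_mat_properties[OF P1, folded T_def Ti_def]
  have pd: "pos_def S" "pos_def T" and TT: "T ** T = P1"
    unfolding S_def T_def using sqrt_mat_properties P P1 by blast+
  have symT: "transpose T = T" using pd by (simp add: pos_def_def)
  have q1: "1 \<le> ?q" by (simp add: Suc_leI)
  have eE: "norm E \<le> e" using e(1) by (simp add: E_def Si_def)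
  then have e0: "0 \<le> e" using norm_ge_zero order_trans by blast
  have CC: "C ** transpose C = mat 1 + E"
    by (simp add: C_def matrix_transpose_mul symT pS(2) matrix_mul_assoc E_def TT[symmetric])
  have DC: "D ** C = mat 1"
  proof -
    have "D ** C = Ti ** (S ** Si) ** T" by (simp add: D_def C_def matrix_mul_assoc)
    then show ?thesis by (simp add: pS(3) pT(4))
  qed
  \<comment> \<open>Multiplying C C' = I + E by D = C^-1 compares C' with the inverse, and so the
    traces of C and D.\<close>
  have CD: "transpose C = D + D ** E"
  proof -
    have "transpose C = (D ** C) ** transpose C" by (simp add: DC)
    also have "\<dots> = D ** (C ** transpose C)" by (simp add: matrix_mul_assoc)
    finally show ?thesis by (simp add: CC matrix_add_ldistrib)
  qed
  have "(norm C)\<^sup>2 = trace (C ** transpose C)"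
    unfolding power2_norm_eq_inner trace_matrix_mult_inner by simp
  then have nC: "(norm C)\<^sup>2 = ?q + trace E" by (simp add: CC trace_add trace_I)
  have tE: "\<bar>trace E\<bar> \<le> ?q * e" using trace_le[of E] eE mult_left_mono[OF eE, of ?q] by linarith
  have "?q * e \<le> ?q * 1" using e(2) by (intro mult_left_mono) auto
  then have "(norm C)\<^sup>2 \<le> 2 * ?q" using nC tE by linarith
  also have "\<dots> \<le> (2 * ?q)\<^sup>2" by (intro self_le_power) (use q1 in linarith, simp)
  finally have nC': "norm C \<le> 2 * ?q" by (rule power2_le_imp_le) simp
  have "norm D \<le> norm (transpose C) + norm (D ** E)"
    using norm_triangle_ineq4[of "transpose C" "D ** E"] by (simp add: CD)
  also have "\<dots> \<le> norm C + norm D * (1/2)"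
    using norm_matrix_mult_le[of D E] mult_left_mono[of "norm E" "1/2" "norm D"] eE e(2) by (simp add: norm_transpose)
  finally have nD: "norm D \<le> 4 * ?q" using nC' by linarith
  have "(norm C)\<^sup>2 = C \<bullet> C" by (rule power2_norm_eq_inner)
  have trD: "trace D = trace C - trace (D ** E)"
  proof -
    have "trace (transpose C) = trace C" by (simp add: trace_def transpose_def)
    then show ?thesis using CD by (simp add: trace_add)
  qed
  have "Si = matrix_inv S" "Ti = matrix_inv T"
    by (simp_all add: Si_def Ti_def S_def T_def inv_sqrt_mat_def)
  then have "2 * ?q \<le> trace C + trace D"
    using trace_add_trace_inv_ge[OF pd] by (simp add: C_def D_def)
  then have trC: "2 * trace C \<ge> 2 * ?q - \<bar>trace (D ** E)\<bar>" using trD by linarith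
  have "\<bar>trace (D ** E)\<bar> \<le> 4 * ?q * e"
    using trace_mult_le[of D E] mult_mono[OF nD eE] e0 by simp
  have "(norm (C - mat 1))\<^sup>2 = (norm C)\<^sup>2 - 2 * trace C + ?q"
  proof -
    have "(mat 1 :: real^'q^'q) \<bullet> mat 1 = ?q" "C \<bullet> mat 1 = trace C"
      using trace_matrix_mult_inner[of "mat 1 :: real^'q^'q" "mat 1"] trace_matrix_mult_inner[of C "mat 1"]
      by (simp_all add: trace_I)
    then show ?thesis by (simp add: power2_norm_eq_inner inner_simps inner_commute)
  qed
  \<comment> \<open>One q e comes from tr E and four from tr (D E), where norm D \<le> 4 q.\<close>
  also have "\<dots> \<le> 5 * ?q * e" 
    using nC tE trC \<open>\<bar>trace (D ** E)\<bar> \<le> 4 * ?q * e\<close> abs_le_D1[OF tE] by (simp add: algebra_simps)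
  finally have nCI: "norm (C - mat 1) \<le> sqrt (5 * ?q * e)" by (rule real_le_rsqrt)
  \<comment> \<open>The difference of the two roots at z is therefore -(C - I) applied to
    \<open>Ti *v z\<close>, which is why the error is relative to the perturbed root.\<close>
  have "C ** Ti = Si" by (simp add: C_def matrix_mul_assoc[symmetric] pT(3))
  then have "Ti *v z - Si *v z = - ((C - mat 1) *v (Ti *v z))"
    unfolding matrix_vector_mult_diff_rdistrib by (simp add: matrix_vector_mul_assoc)
  then have "norm (Ti *v z - Si *v z) \<le> norm (C - mat 1) * norm (Ti *v z)"
    using norm_matrix_vector_le[of "C - mat 1" "Ti *v z"] by simp
  also have "\<dots> \<le> sqrt (5 * ?q * e) * norm (Ti *v z)" by (intro mult_right_mono nCI) simp
  finally show ?thesis by (simp add: Si_def Ti_def)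
qed

text \<open>The crude dimension factor is harmless because the dimensions are fixed along the
  array.\<close>

lemma norm_le_spectral_norm: "norm A \<le> real (CARD('m) * CARD('n)) * spectral_norm A" for A :: "real ^ 'n ^ 'm"
proof -
  have ent: "\<bar>A $ i $ j\<bar> \<le> spectral_norm A" for i j
    unfolding spectral_norm_def by (rule matrix_component_le_onorm)
  have row: "norm (A $ i) \<le> real CARD('n) * spectral_norm A" for i
    using norm_le_l1_cart[of "A $ i"] sum_mono[of UNIV "\<lambda>j. \<bar>A $ i $ j\<bar>" "\<lambda>_. spectral_norm A"] ent by simp
  have "norm A \<le> (\<Sum>i\<in>UNIV. norm (A $ i))" unfolding norm_vec_def by (rule L2_set_le_sum) simp
  also have "\<dots> \<le> (\<Sum>i\<in>(UNIV :: 'm set). real CARD('n) * spectral_norm A)" by (intro sum_mono row)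
  finally show ?thesis by (simp add: mult_ac)
qed

section \<open>Weak convergence to the normal law\<close>

text \<open>The phase c puts sines among the generators, and the product-to-sum formula makes the
  class an algebra. Expectations of generators are real parts of rotated characteristic functions,
  so convergence of the latter passes to the whole class.\<close>

inductive trig_polynomial :: "('b::euclidean_space \<Rightarrow> real) \<Rightarrow> bool" where
  base: "trig_polynomial (\<lambda>x. a * cos (t \<bullet> x + c))"
| add: "trig_polynomial f \<Longrightarrow> trig_polynomial g \<Longrightarrow> trig_polynomial (\<lambda>x. f x + g x)"

lemma trig_polynomial_const: "trig_polynomial (\<lambda>_. a)"
  using trig_polynomial.base[of a 0 0] by simp

lemma trig_polynomial_sin: "trig_polynomial (\<lambda>x. a * sin (t \<bullet> x))"
  using trig_polynomial.base[of a t "- pi / 2"] by (simp add: cos_diff)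

lemma trig_polynomial_sum:
  "finite I \<Longrightarrow> (\<And>i. i \<in> I \<Longrightarrow> trig_polynomial (f i)) \<Longrightarrow> trig_polynomial (\<lambda>x. \<Sum>i\<in>I. f i x)"
  by (induction I rule: finite_induct) (auto intro: trig_polynomial_const trig_polynomial.add)

lemma trig_polynomial_mult_base:
  assumes "trig_polynomial g"
  shows "trig_polynomial (\<lambda>x. a * cos (t \<bullet> x + c) * g x)"
  using assms
proof (induction rule: trig_polynomial.induct)
  case (base b s d)
  have *: "a * cos (t \<bullet> x + c) * (b * cos (s \<bullet> x + d)) =
     (a * b / 2) * cos ((t - s) \<bullet> x + (c - d)) + (a * b / 2) * cos ((t + s) \<bullet> x + (c + d))" for x
  proof -
    have "cos (t \<bullet> x + c) * cos (s \<bullet> x + d) = (cos ((t - s) \<bullet> x + (c - d)) + cos ((t + s) \<bullet> x + (c + d))) / 2"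
      by (subst cos_times_cos) (simp add: inner_simps algebra_simps)
    then show ?thesis by (simp add: field_simps)
  qed
  show ?case unfolding * by (intro trig_polynomial.add trig_polynomial.base)
next
  case (add f g)
  then show ?case using trig_polynomial.add by (simp add: distrib_left)
qed

lemma trig_polynomial_mult:
  assumes "trig_polynomial f" "trig_polynomial g"
  shows "trig_polynomial (\<lambda>x. f x * g x)"
  using assms
proof (induction rule: trig_polynomial.induct)
  case (base a t c)
  then show ?case by (rule trig_polynomial_mult_base)
next
  case (add f1 f2)
  then show ?case using trig_polynomial.add by (simp add: distrib_right)
qed

text \<open>Stone-Weierstrass supplies polynomials on a cube. Composed with sines of the coordinates
  they stay bounded on the whole space and become functions whose expectations are
  controlled.\<close>

lemma trig_polynomial_poly_sin:
  assumes "real_polynomial_function (p :: 'b::euclidean_space \<Rightarrow> real)"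
  shows "trig_polynomial (\<lambda>x :: 'b. p (\<Sum>b\<in>Basis. sin (w * (x \<bullet> b)) *\<^sub>R b))"
  using assms
proof (induction rule: real_polynomial_function.induct)
  case (linear f)
  then interpret bounded_linear f .
  have "f (\<Sum>b\<in>Basis. sin (w * (x \<bullet> b)) *\<^sub>R b) = (\<Sum>b\<in>Basis. f b * sin ((w *\<^sub>R b) \<bullet> x))" for x
    by (simp add: sum scaleR mult.commute inner_commute)
  then show ?case by (simp add: trig_polynomial_sum trig_polynomial_sin del: inner_scaleR_left)
qed (auto intro: trig_polynomial_const trig_polynomial.add trig_polynomial_mult)

lemma trig_polynomial_continuous: "trig_polynomial f \<Longrightarrow> continuous_on UNIV f"
  by (induction rule: trig_polynomial.induct) (auto intro!: continuous_intros)

lemma trig_polynomial_bounded: "trig_polynomial f \<Longrightarrow> \<exists>B. \<forall>x. \<bar>f x\<bar> \<le> B"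
proof (induction rule: trig_polynomial.induct)
  case (base a t c)
  have "\<bar>a * cos (t \<bullet> x + c)\<bar> \<le> \<bar>a\<bar>" for x
    by (simp add: abs_mult mult_left_le)
  then show ?case by blast
next
  case (add f g)
  then obtain B C where "\<forall>x. \<bar>f x\<bar> \<le> B" "\<forall>x. \<bar>g x\<bar> \<le> C" by blast
  then show ?case by (intro exI[of _ "B + C"]) (meson abs_triangle_ineq add_mono order_trans)
qed

lemma trig_polynomial_integral_tendsto:
  fixes X :: "nat \<Rightarrow> 'a \<Rightarrow> 'b::euclidean_space"
  assumes f: "trig_polynomial f"
    and M: "\<And>G. prob_space (M G)" and X: "\<And>G. X G \<in> borel_measurable (M G)"
    and mu: "prob_space \<mu>" "sets \<mu> = sets borel"
    and char: "\<And>t. (\<lambda>G. CLINT \<omega>|M G. iexp (t \<bullet> X G \<omega>)) \<longlonglongrightarrow> (CLINT z|\<mu>. iexp (t \<bullet> z))"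
  shows "(\<lambda>G. LINT \<omega>|M G. f (X G \<omega>)) \<longlonglongrightarrow> (LINT z|\<mu>. f z)"
  using f
proof (induction rule: trig_polynomial.induct)
  case (base a t c)
  \<comment> \<open>Stated for an arbitrary probability space, since it is applied both under
    \<open>M G\<close> and under the limit law.\<close>
  have *: "(LINT \<omega>|P. a * cos (t \<bullet> Y \<omega> + c)) = Re (a * iexp c * (CLINT \<omega>|P. iexp (t \<bullet> Y \<omega>)))"
    if P: "prob_space P" and Y: "Y \<in> borel_measurable P" for P :: "'c measure" and Y
  proof -
    interpret prob_space P by (rule P)
    have i: "integrable P (\<lambda>\<omega>. iexp (t \<bullet> Y \<omega>))" using Y by (intro integrable_iexp) auto
    have "Re (a * iexp c * (CLINT \<omega>|P. iexp (t \<bullet> Y \<omega>))) = Re (CLINT \<omega>|P. a * iexp c * iexp (t \<bullet> Y \<omega>))" by simp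
    also have "\<dots> = (LINT \<omega>|P. Re (a * iexp c * iexp (t \<bullet> Y \<omega>)))"
      using i by (intro integral_Re[symmetric] integrable_mult_right) auto
    also have "\<dots> = (LINT \<omega>|P. a * cos (t \<bullet> Y \<omega> + c))"
    proof (rule Bochner_Integration.integral_cong[OF refl])
      fix \<omega>
      have eq: "a * iexp c * iexp (t \<bullet> Y \<omega>) = a * cis (t \<bullet> Y \<omega> + c)"
        by (simp add: cis_conv_exp exp_add[symmetric] algebra_simps)
      show "Re (a * iexp c * iexp (t \<bullet> Y \<omega>)) = a * cos (t \<bullet> Y \<omega> + c)" unfolding eq by simp
    qed
    finally show ?thesis by simp
  qed
  have "(\<lambda>G. Re (a * iexp c * (CLINT \<omega>|M G. iexp (t \<bullet> X G \<omega>)))) \<longlonglongrightarrow> Re (a * iexp c * (CLINT z|\<mu>. iexp (t \<bullet> z)))"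
    by (intro tendsto_intros char)
  then show ?case using *[OF M X] *[of \<mu> "\<lambda>z. z"] mu by (simp add: measurable_ident_sets)
next
  case (add f g)
  have i: "integrable P (\<lambda>\<omega>. h (Y \<omega>))" if h: "trig_polynomial h" and P: "prob_space P" and Y: "Y \<in> borel_measurable P"
    for P :: "'c measure" and Y and h :: "'b \<Rightarrow> real"
  proof -
    interpret prob_space P by (rule P)
    obtain B where "\<forall>x. \<bar>h x\<bar> \<le> B" using trig_polynomial_bounded[OF h] by blast
    then show ?thesis
      by (intro integrable_const_bound[of _ B] borel_measurable_continuous_on[OF trig_polynomial_continuous[OF h] Y]) auto
  qed
  show ?case
    using tendsto_add[OF add.IH] i[OF add.hyps(1) M X] i[OF add.hyps(2) M X]
      i[OF add.hyps(1) mu(1), of "\<lambda>z. z"] i[OF add.hyps(2) mu(1), of "\<lambda>z. z"] mu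
    by (simp add: measurable_ident_sets)
qed

text \<open>On the cube \<open>\<bar>x\<^sub>j\<bar> \<le> A\<close> one has \<open>f x = g (sin (x\<^sub>1/A), \<dots>)\<close> with \<open>g\<close> continuous on \<open>[-1,1]\<^sup>q\<close>.
  Approximating \<open>g\<close> by a polynomial yields a trigonometric polynomial that is close to \<open>f\<close> on
  the cube and still bounded off it.\<close>
lemma trig_approximation:
  fixes f :: "'b::euclidean_space \<Rightarrow> real"
  assumes f: "continuous_on UNIV f" and B: "\<And>x. \<bar>f x\<bar> \<le> B" and A: "A \<ge> 1" and e: "0 < e"
  obtains h where "trig_polynomial h" "\<And>x. \<bar>h x\<bar> \<le> B + e" "\<And>x. norm x \<le> A \<Longrightarrow> \<bar>f x - h x\<bar> \<le> e"
proof -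
  define g where "g s = f (\<Sum>b\<in>Basis. (A * arcsin (s \<bullet> b)) *\<^sub>R b)" for s
  define S where "S = cbox (- One) (One :: 'b)"
  have "continuous_on S g" unfolding g_def
    by (rule continuous_on_compose2[OF f]) (auto simp: S_def mem_box intro!: continuous_intros)
  then obtain p where p: "real_polynomial_function p" "\<And>s. s \<in> S \<Longrightarrow> \<bar>g s - p s\<bar> < e"
    using Stone_Weierstrass_real_polynomial_function[of S g e] e by (auto simp: S_def)
  define \<sigma> :: "'b \<Rightarrow> 'b" where "\<sigma> x = (\<Sum>b\<in>Basis. sin ((1/A) * (x \<bullet> b)) *\<^sub>R b)" for x
  have \<sigma>: "\<sigma> x \<in> S" for x by (simp add: S_def mem_box \<sigma>_def)
  show ?thesis
  proof (rule that)
    show "trig_polynomial (\<lambda>x. p (\<sigma> x))" unfolding \<sigma>_def by (rule trig_polynomial_poly_sin[OF p(1)])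
    have gB: "\<bar>g s\<bar> \<le> B" for s unfolding g_def by (rule B)
    show "\<bar>p (\<sigma> x)\<bar> \<le> B + e" for x using p(2)[OF \<sigma>[of x]] gB[of "\<sigma> x"] by linarith
    show "\<bar>f x - p (\<sigma> x)\<bar> \<le> e" if x: "norm x \<le> A" for x
    proof -
      have "A * arcsin (\<sigma> x \<bullet> b) = x \<bullet> b" if b: "b \<in> Basis" for b
      proof -
        have "\<bar>x \<bullet> b\<bar> \<le> A" using Basis_le_norm[OF b, of x] x by linarith
        then have "\<bar>(1/A) * (x \<bullet> b)\<bar> \<le> 1" using A by (simp add: abs_mult pos_divide_le_eq)
        \<comment> \<open>The scaled coordinates have modulus at most 1, within the range where
          \<open>arcsin\<close> undoes \<open>sin\<close>.\<close>
        moreover have "1 \<le> pi / 2" using pi_gt3 by linarith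
        ultimately have "arcsin (sin ((1/A) * (x \<bullet> b))) = (1/A) * (x \<bullet> b)" by (intro arcsin_sin) linarith+
        then show ?thesis using A b by (simp add: \<sigma>_def)
      qed
      then have "(\<Sum>b\<in>Basis. (A * arcsin (\<sigma> x \<bullet> b)) *\<^sub>R b) = (\<Sum>b\<in>Basis. (x \<bullet> b) *\<^sub>R b)" by (intro sum.cong) auto
      then have "g (\<sigma> x) = f x" by (simp add: g_def euclidean_representation)
      then show ?thesis using p(2)[OF \<sigma>[of x]] by simp
    qed
  qed
qed

text \<open>On the ball of radius A the integrands differ by at most e, off it by at most 2 B +
  e.\<close>

lemma (in prob_space) expectation_diff_le:
  fixes Y :: "'a \<Rightarrow> 'b::euclidean_space"
  assumes Y: "Y \<in> borel_measurable M" and f: "continuous_on UNIV f" and h: "continuous_on UNIV h"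
    and fB: "\<And>x. \<bar>f x\<bar> \<le> B" and hB: "\<And>x. \<bar>h x\<bar> \<le> (B::real) + e" and close: "\<And>x. norm x \<le> A \<Longrightarrow> \<bar>f x - h x\<bar> \<le> e"
    and e: "0 \<le> e"
  shows "\<bar>(LINT \<omega>|M. f (Y \<omega>)) - (LINT \<omega>|M. h (Y \<omega>))\<bar> \<le> e + (2 * B + e) * prob {\<omega> \<in> space M. A < norm (Y \<omega>)}"
proof -
  have [measurable]: "(\<lambda>\<omega>. f (Y \<omega>)) \<in> borel_measurable M" "(\<lambda>\<omega>. h (Y \<omega>)) \<in> borel_measurable M" "Y \<in> borel_measurable M"
    using borel_measurable_continuous_on[OF f Y] borel_measurable_continuous_on[OF h Y] Y by auto
  let ?T = "{\<omega> \<in> space M. A < norm (Y \<omega>)}"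
  have T[measurable]: "?T \<in> sets M" by measurable
  have i: "integrable M (\<lambda>\<omega>. f (Y \<omega>))" "integrable M (\<lambda>\<omega>. h (Y \<omega>))"
    by (rule integrable_const_bound[of _ B], simp add: fB, measurable)
       (rule integrable_const_bound[of _ "B + e"], simp add: hB, measurable)
  have "integrable M (indicator ?T :: 'a \<Rightarrow> real)"
    by (rule integrable_real_indicator[OF T]) (simp add: emeasure_eq_measure)
  then have ind: "integrable M (\<lambda>\<omega>. (2 * B + e) * indicator ?T \<omega>)" by (rule integrable_mult_right)
  then have it: "integrable M (\<lambda>\<omega>. e + (2 * B + e) * indicator ?T \<omega>)"
    by (intro Bochner_Integration.integrable_add) auto
  have "\<bar>(LINT \<omega>|M. f (Y \<omega>)) - (LINT \<omega>|M. h (Y \<omega>))\<bar> = \<bar>LINT \<omega>|M. f (Y \<omega>) - h (Y \<omega>)\<bar>"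
    using i by simp
  also have "\<dots> \<le> (LINT \<omega>|M. \<bar>f (Y \<omega>) - h (Y \<omega>)\<bar>)" by (rule integral_abs_bound)
  also have "\<dots> \<le> (LINT \<omega>|M. e + (2 * B + e) * indicator ?T \<omega>)"
  proof (rule integral_mono)
    fix \<omega> assume "\<omega> \<in> space M"
    then show "\<bar>f (Y \<omega>) - h (Y \<omega>)\<bar> \<le> e + (2 * B + e) * indicator ?T \<omega>"
      using close[of "Y \<omega>"] fB[of "Y \<omega>"] hB[of "Y \<omega>"] e by (auto simp: indicator_def)
  qed (use i it in auto)
  also have "\<dots> = e + (2 * B + e) * prob ?T"
    by (subst Bochner_Integration.integral_add[OF _ ind]) (simp_all add: prob_space)
  finally show ?thesis .
qed

text \<open>A continuity theorem in several dimensions with tightness as a hypothesis: outside a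
  large ball there is little mass, and inside it f is uniformly close to a trigonometric polynomial,
  whose expectations converge.\<close>

lemma tendsto_in_dist_if_char:
  fixes X :: "nat \<Rightarrow> 'a \<Rightarrow> 'b::euclidean_space"
  assumes M: "\<And>G. prob_space (M G)" and X: "\<And>G. X G \<in> borel_measurable (M G)"
    and mu: "prob_space \<mu>" "sets \<mu> = sets borel"
    and tight: "\<And>e. 0 < e \<Longrightarrow> \<exists>A. \<forall>\<^sub>F G in sequentially. measure (M G) {\<omega> \<in> space (M G). A < norm (X G \<omega>)} < e"
    and char: "\<And>t. (\<lambda>G. CLINT \<omega>|M G. iexp (t \<bullet> X G \<omega>)) \<longlonglongrightarrow> (CLINT z|\<mu>. iexp (t \<bullet> z))"
  shows "tendsto_in_dist M X \<mu>"
  unfolding tendsto_in_dist_def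
proof (intro conjI allI impI)
  show "\<forall>\<^sub>F G in sequentially. X G \<in> borel_measurable (M G)" using X by simp
  fix f :: "'b \<Rightarrow> real" assume f: "continuous_on UNIV f" and "bounded (range f)"
  then obtain B where B: "\<And>x. \<bar>f x\<bar> \<le> B" by (auto simp: bounded_iff)
  then have B0: "0 \<le> B" using abs_ge_zero order_trans by blast
  interpret mu: prob_space \<mu> by (rule mu(1))
  have muid: "(\<lambda>z. z) \<in> borel_measurable \<mu>" using mu(2) by (simp add: measurable_ident_sets)
  \<comment> \<open>A single law is tight by continuity from above along the complements of
    balls.\<close>
  have tight_mu: "\<exists>A. mu.prob {z \<in> space \<mu>. A < norm z} < e" if "0 < e" for e
  proof -
    have "(\<lambda>n. mu.prob {z \<in> space \<mu>. real n < norm z}) \<longlonglongrightarrow> mu.prob (\<Inter>n. {z \<in> space \<mu>. real n < norm z})"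
      using muid by (intro mu.finite_Lim_measure_decseq) (auto simp: decseq_def)
    moreover have "(\<Inter>n. {z \<in> space \<mu>. real n < norm z}) = {}"
      by auto (metis not_less real_arch_simple)
    ultimately have "(\<lambda>n. mu.prob {z \<in> space \<mu>. real n < norm z}) \<longlonglongrightarrow> 0" by simp
    then have "\<forall>\<^sub>F n in sequentially. mu.prob {z \<in> space \<mu>. real n < norm z} < e" using that by (rule order_tendstoD)
    then show ?thesis by (auto dest: eventually_happens)
  qed
  show "(\<lambda>G. LINT \<omega>|M G. f (X G \<omega>)) \<longlonglongrightarrow> (LINT z|\<mu>. f z)"
  proof (rule tendstoI)
    fix r :: real assume r: "0 < r"
    \<comment> \<open>Two approximation errors e (2 B + 2) and one convergence error e add up to e
      (4 B + 5); the constant 4 B + 6 leaves a strict inequality.\<close>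
    define e where "e = min 1 (r / (4 * B + 6))"
    have "e \<le> r / (4 * B + 6)" by (simp add: e_def)
    then have e3: "e * (4 * B + 6) \<le> r" using B0 by (subst pos_le_divide_eq[symmetric]) auto
    have e: "0 < e" "e \<le> 1" "e * (4 * B + 6) \<le> r" using r B0 e3 by (simp_all add: e_def)
    obtain A1 where A1: "\<forall>\<^sub>F G in sequentially. measure (M G) {\<omega> \<in> space (M G). A1 < norm (X G \<omega>)} < e"
      using tight[OF e(1)] ..
    obtain A2 where A2: "mu.prob {z \<in> space \<mu>. A2 < norm z} < e" using tight_mu[OF e(1)] ..
    define A where "A = max 1 (max A1 A2)"
    have A': "1 \<le> A" by (simp add: A_def)
    obtain h where h: "trig_polynomial h" "\<And>x. \<bar>h x\<bar> \<le> B + e" "\<And>x. norm x \<le> A \<Longrightarrow> \<bar>f x - h x\<bar> \<le> e"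
      by (rule trig_approximation[OF f B A' e(1)]) blast
    note hc = trig_polynomial_continuous[OF h(1)]
    have up: "e + (2 * B + e) * p \<le> e * (2 * B + 2)" if p: "p \<le> e" for p
    proof -
      have "(2 * B + e) * p \<le> (2 * B + e) * e" using p e B0 by (intro mult_left_mono) auto
      also have "\<dots> \<le> (2 * B + 1) * e" using e by (intro mult_right_mono) auto
      finally have "(2 * B + e) * p \<le> (2 * B + 1) * e" .
      then show ?thesis by (simp add: algebra_simps)
    qed
    have "(\<lambda>G. LINT \<omega>|M G. h (X G \<omega>)) \<longlonglongrightarrow> (LINT z|\<mu>. h z)"
      by (rule trig_polynomial_integral_tendsto[OF h(1) M X mu char])
    then have "\<forall>\<^sub>F G in sequentially. dist (LINT \<omega>|M G. h (X G \<omega>)) (LINT z|\<mu>. h z) < e"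
      using e(1) by (rule tendstoD)
    with A1 show "\<forall>\<^sub>F G in sequentially. dist (LINT \<omega>|M G. f (X G \<omega>)) (LINT z|\<mu>. f z) < r"
    proof eventually_elim
      case (elim G)
      interpret G: prob_space "M G" by (rule M)
      note X[of G, measurable]
      have "G.prob {\<omega> \<in> space (M G). A < norm (X G \<omega>)} \<le> G.prob {\<omega> \<in> space (M G). A1 < norm (X G \<omega>)}"
        by (rule G.finite_measure_mono) (auto simp: A_def)
      then have 1: "\<bar>(LINT \<omega>|M G. f (X G \<omega>)) - (LINT \<omega>|M G. h (X G \<omega>))\<bar> \<le> e * (2 * B + 2)"
        using order_trans[OF G.expectation_diff_le[OF X f hc B h(2) h(3)] up] elim(1) e(1) by force
      have "mu.prob {z \<in> space \<mu>. A < norm z} \<le> mu.prob {z \<in> space \<mu>. A2 < norm z}"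
        using muid by (intro mu.finite_measure_mono) (auto simp: A_def)
      then have 2: "\<bar>(LINT z|\<mu>. f z) - (LINT z|\<mu>. h z)\<bar> \<le> e * (2 * B + 2)"
        using order_trans[OF mu.expectation_diff_le[OF muid f hc B h(2) h(3)] up] A2 e(1) by force
      have "dist (LINT \<omega>|M G. f (X G \<omega>)) (LINT z|\<mu>. f z) < e * (2 * B + 2) + e * (2 * B + 2) + e"
        using 1 2 elim(2) unfolding dist_real_def by linarith
      also have "\<dots> < r" using e by (simp add: algebra_simps)
      finally show ?case .
    qed
  qed
qed

section \<open>The Gaussian vector and the chi-squared law\<close>

lemma norm_power2_eq_sum: "(norm z)\<^sup>2 = (\<Sum>b\<in>Basis. (z \<bullet> b)\<^sup>2)"
  unfolding power2_norm_eq_inner euclidean_inner[of z z] by (simp add: power2_eq_square)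

lemma std_normal_vec_density:
  fixes z :: "real ^ 'q"
  shows "exp (- (norm z)\<^sup>2 / 2) / sqrt (2 * pi) ^ CARD('q) = (\<Prod>b\<in>Basis. std_normal_density (z \<bullet> b))"
proof -
  have "exp (- (norm z)\<^sup>2 / 2) = (\<Prod>b\<in>Basis. exp (- (z \<bullet> b)\<^sup>2 / 2))"
    unfolding norm_power2_eq_sum by (simp add: exp_sum[symmetric] sum_negf sum_divide_distrib)
  then show ?thesis
    unfolding std_normal_density_def prod.distrib prod_constant by (simp add: power_divide)
qed

lemma prob_space_std_normal_vec: "prob_space (std_normal_vec :: (real ^ 'q) measure)"
proof
  interpret product_sigma_finite "\<lambda>_ :: real ^ 'q. lborel :: real measure" ..
  have "emeasure (std_normal_vec :: (real ^ 'q) measure) (space std_normal_vec) =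
     (\<integral>\<^sup>+ z. (\<Prod>b\<in>Basis. ennreal (std_normal_density (z \<bullet> b))) \<partial>(lborel :: (real ^ 'q) measure))"
    unfolding std_normal_vec_def std_normal_vec_density
    by (simp add: emeasure_density prod_ennreal normal_density_nonneg)
  also have "\<dots> = (\<integral>\<^sup>+ f. (\<Prod>b\<in>Basis. ennreal (std_normal_density (f b))) \<partial>(\<Pi>\<^sub>M b\<in>(Basis :: (real ^ 'q) set). lborel))"
    by (subst lborel_eq, subst nn_integral_distr) (auto intro!: nn_integral_cong prod.cong)
  also have "\<dots> = (\<Prod>b\<in>(Basis :: (real ^ 'q) set). \<integral>\<^sup>+ x. ennreal (std_normal_density x) \<partial>lborel)"
    by (rule product_nn_integral_prod) auto
  also have "(\<integral>\<^sup>+ x. ennreal (std_normal_density x) \<partial>lborel) = 1"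
  proof -
    interpret prob_space "std_normal_distribution" by (rule prob_space_normal_density) simp
    show ?thesis using emeasure_space_1 by (simp add: emeasure_density)
  qed
  finally show "emeasure (std_normal_vec :: (real ^ 'q) measure) (space std_normal_vec) = 1" by simp
qed

lemma sets_std_normal_vec: "sets std_normal_vec = sets borel"
  by (simp add: std_normal_vec_def)

text \<open>Lebesgue measure on the vectors is a product over the basis, so the Gaussian integral
  factorises. This yields the characteristic function of the vector and that of its squared
  norm.\<close>

lemma std_normal_vec_integral_prod:
  fixes F :: "real ^ 'q \<Rightarrow> real \<Rightarrow> complex"
  assumes F[measurable]: "\<And>b. F b \<in> borel_measurable borel" and bd: "\<And>b x. norm (F b x) \<le> 1"
  shows "(CLINT z|std_normal_vec. (\<Prod>b\<in>Basis. F b (z \<bullet> b))) = (\<Prod>b\<in>Basis. CLINT x|std_normal_distribution. F b x)"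
proof -
  interpret product_sigma_finite "\<lambda>_ :: real ^ 'q. lborel :: real measure" ..
  interpret N: prob_space "std_normal_distribution" by (rule prob_space_normal_density) simp
  have int: "integrable lborel (\<lambda>x. std_normal_density x *\<^sub>R F b x)" for b
  proof -
    have "integrable std_normal_distribution (F b)"
      by (rule N.integrable_const_bound[of _ 1]) (auto simp: bd)
    then show ?thesis by (subst (asm) integrable_density) auto
  qed
  have "(CLINT z|std_normal_vec. (\<Prod>b\<in>Basis. F b (z \<bullet> b))) =
     (LINT z|(lborel :: (real ^ 'q) measure). (\<Prod>b\<in>Basis. std_normal_density (z \<bullet> b)) *\<^sub>R (\<Prod>b\<in>Basis. F b (z \<bullet> b)))"
    unfolding std_normal_vec_def std_normal_vec_density
    by (subst integral_density) (auto intro!: prod_nonneg)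
  also have "\<dots> = (LINT z|(lborel :: (real ^ 'q) measure). (\<Prod>b\<in>Basis. std_normal_density (z \<bullet> b) *\<^sub>R F b (z \<bullet> b)))"
    by (simp add: scaleR_conv_of_real prod.distrib)
  also have "\<dots> = (LINT f|(\<Pi>\<^sub>M b\<in>(Basis :: (real ^ 'q) set). lborel). (\<Prod>b\<in>Basis. std_normal_density (f b) *\<^sub>R F b (f b)))"
    by (subst lborel_eq, subst integral_distr) (auto intro!: Bochner_Integration.integral_cong prod.cong)
  also have "\<dots> = (\<Prod>b\<in>Basis. LINT x|lborel. std_normal_density x *\<^sub>R F b x)"
    by (rule product_integral_prod) (auto intro: int)
  also have "\<dots> = (\<Prod>b\<in>Basis. CLINT x|std_normal_distribution. F b x)"
    by (intro prod.cong refl integral_density[symmetric]) auto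
  finally show ?thesis .
qed

lemma iexp_sum: "iexp (\<Sum>i\<in>I. f i) = (\<Prod>i\<in>I. iexp (f i))"
  by (cases "finite I") (simp_all add: exp_sum sum_distrib_left)

lemma char_std_normal_vec:
  "(CLINT z|(std_normal_vec :: (real ^ 'q) measure). iexp (t \<bullet> z)) = complex_of_real (exp (- (norm t)\<^sup>2 / 2))"
proof -
  have "(CLINT z|(std_normal_vec :: (real ^ 'q) measure). iexp (t \<bullet> z)) =
    (CLINT z|std_normal_vec. (\<Prod>b\<in>Basis. iexp ((t \<bullet> b) * (z \<bullet> b))))"
    by (intro Bochner_Integration.integral_cong refl, subst euclidean_inner) (rule iexp_sum)
  also have "\<dots> = (\<Prod>b\<in>Basis. char std_normal_distribution (t \<bullet> b))"
    unfolding char_def by (rule std_normal_vec_integral_prod) auto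
  also have "\<dots> = complex_of_real (exp (\<Sum>b\<in>Basis. - (t \<bullet> b)\<^sup>2 / 2))"
    by (simp add: char_std_normal_distribution exp_sum)
  also have "(\<Sum>b\<in>Basis. - (t \<bullet> b)\<^sup>2 / 2) = - (norm t)\<^sup>2 / 2"
    by (simp add: norm_power2_eq_sum sum_negf sum_divide_distrib)
  finally show ?thesis .
qed

text \<open>Both characteristic functions are the same power of the integral of exp(i s x^2) against
  the normal law on the line. This identifies \<open>chi_squared\<close> with the law of the squared
  norm without computing a density.\<close>

lemma real_distribution_chi_squared: "real_distribution (chi_squared q)"
  and char_chi_squared: "char (chi_squared CARD('q)) s = (CLINT z|(std_normal_vec :: (real ^ 'q) measure). iexp (s * (norm z)\<^sup>2))"
proof -
  interpret N: prob_space "std_normal_distribution" by (rule prob_space_normal_density) simp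
  interpret P: product_prob_space "\<lambda>_ :: nat. std_normal_distribution" ..
  have m[measurable]: "(\<lambda>z. \<Sum>i<q. (z i)\<^sup>2) \<in> borel_measurable (\<Pi>\<^sub>M i\<in>{..<q}. std_normal_distribution)" for q
    by (intro borel_measurable_sum borel_measurable_power) simp
  have "prob_space (Pi\<^sub>M {..<q} (\<lambda>_. std_normal_distribution))"
    by (rule prob_space_PiM) (rule N.prob_space_axioms)
  then interpret Q: prob_space "Pi\<^sub>M {..<q} (\<lambda>_. std_normal_distribution)" .
  show "real_distribution (chi_squared q)" unfolding chi_squared_def
    by (rule Q.real_distribution_distr[OF m])
  have "char (chi_squared CARD('q)) s = (CLINT z|Pi\<^sub>M {..<CARD('q)} (\<lambda>_. std_normal_distribution). \<Prod>i<CARD('q). iexp (s * (z i)\<^sup>2))"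
    unfolding char_def chi_squared_def iexp_sum[symmetric]
    by (subst integral_distr[OF m]) (auto simp: sum_distrib_left)
  also have "\<dots> = (\<Prod>i<CARD('q). CLINT x|std_normal_distribution. iexp (s * x\<^sup>2))"
    by (rule P.product_integral_prod) (auto intro!: N.integrable_iexp)
  also have "\<dots> = (\<Prod>b\<in>(Basis :: (real ^ 'q) set). CLINT x|std_normal_distribution. iexp (s * x\<^sup>2))"
    by simp
  also have "\<dots> = (CLINT z|(std_normal_vec :: (real ^ 'q) measure). (\<Prod>b\<in>Basis. iexp (s * (z \<bullet> b)\<^sup>2)))"
    by (rule std_normal_vec_integral_prod[symmetric]) auto
  also have "\<dots> = (CLINT z|(std_normal_vec :: (real ^ 'q) measure). iexp (s * (norm z)\<^sup>2))"
    by (simp only: iexp_sum[symmetric] sum_distrib_left[symmetric] norm_power2_eq_sum)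
  finally show "char (chi_squared CARD('q)) s = (CLINT z|(std_normal_vec :: (real ^ 'q) measure). iexp (s * (norm z)\<^sup>2))" .
qed

text \<open>The hypotheses on the array hold from G = 2 on, so convergence is proved for the
  sequence shifted by 2, all of whose terms are probability spaces.\<close>

lemma tendsto_in_dist_offset:
  assumes "tendsto_in_dist (\<lambda>G. M (G + k)) (\<lambda>G. X (G + k)) \<mu>"
  shows "tendsto_in_dist M X \<mu>"
  using assms unfolding tendsto_in_dist_def
  using eventually_sequentially_seg[of "\<lambda>G. X G \<in> borel_measurable (M G)" k]
  by (auto intro: LIMSEQ_offset[of _ k])

lemma weak_conv_m_offset:
  assumes "weak_conv_m (\<lambda>G. \<mu> (G + k)) \<nu>"
  shows "weak_conv_m \<mu> \<nu>"
  using assms unfolding weak_conv_m_def weak_conv_def by (auto intro: LIMSEQ_offset[of _ k])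

lemma norm_iexp_diff_le: "norm (iexp a - iexp b) \<le> \<bar>a - b\<bar>"
proof -
  have "iexp a - iexp b = iexp b * (iexp (a - b) - 1)"
    by (simp add: right_diff_distrib exp_add[symmetric])
  then have "norm (iexp a - iexp b) = norm (iexp (a - b) - 1)" by (simp add: norm_mult)
  also have "\<dots> \<le> \<bar>a - b\<bar>"
    using iexp_approx1[of "a - b" 0] by simp
  finally show ?thesis .
qed

lemma (in prob_space) markov_inequality_square:
  assumes Y: "Y \<in> borel_measurable M" and i: "integrable M (\<lambda>\<omega>. (norm (Y \<omega>))\<^sup>2)" and A: "0 < A"
  shows "prob {\<omega> \<in> space M. A < norm (Y \<omega>)} \<le> expectation (\<lambda>\<omega>. (norm (Y \<omega>))\<^sup>2) / A\<^sup>2"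
proof -
  note Y[measurable]
  have "prob {\<omega> \<in> space M. A < norm (Y \<omega>)} \<le> prob {\<omega> \<in> space M. (norm (Y \<omega>))\<^sup>2 \<ge> A\<^sup>2}"
    by (rule finite_measure_mono) (use A in \<open>auto intro!: power_mono\<close>)
  also have "\<dots> \<le> expectation (\<lambda>\<omega>. (norm (Y \<omega>))\<^sup>2) / A\<^sup>2"
    using integral_Markov_inequality_measure[OF i, of "space M" "A\<^sup>2"] A by simp
  finally show ?thesis .
qed

text \<open>Slutsky's argument on the level of characteristic functions: W carries the Gaussian
  limit, its bounded second moments give tightness, and X differs from it by a term that vanishes in
  probability.\<close>

lemma tendsto_in_dist_std_normal_vec:
  fixes X W :: "nat \<Rightarrow> 'a \<Rightarrow> real ^ 'q"
  assumes M: "\<And>G. prob_space (M G)" and X: "\<And>G. X G \<in> borel_measurable (M G)"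
    and W: "\<And>G. W G \<in> borel_measurable (M G)" "\<And>G. integrable (M G) (\<lambda>\<omega>. (norm (W G \<omega>))\<^sup>2)"
      "\<And>G. (LINT \<omega>|M G. (norm (W G \<omega>))\<^sup>2) \<le> C"
    and char: "\<And>t. (\<lambda>G. CLINT \<omega>|M G. iexp (t \<bullet> W G \<omega>)) \<longlonglongrightarrow> complex_of_real (exp (- (norm t)\<^sup>2 / 2))"
    and diff: "\<And>e. 0 < e \<Longrightarrow> (\<lambda>G. measure (M G) {\<omega> \<in> space (M G). e < norm (X G \<omega> - W G \<omega>)}) \<longlonglongrightarrow> 0"
  shows "tendsto_in_dist M X std_normal_vec"
proof (rule tendsto_in_dist_if_char[OF M X prob_space_std_normal_vec sets_std_normal_vec])
  have C0: "0 \<le> C" by (rule order_trans[OF _ W(3)[of 0]]) simp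
  fix e :: real assume e: "0 < e"
  \<comment> \<open>Chebyshev's inequality leaves W mass at most C / A^2 \<le> e / 2 beyond
    A.\<close>
  define A where "A = sqrt (2 * (C + 1) / e)"
  have A: "0 < A" "A\<^sup>2 = 2 * (C + 1) / e" using e C0 by (auto simp: A_def)
  have "\<forall>\<^sub>F G in sequentially. measure (M G) {\<omega> \<in> space (M G). 1 < norm (X G \<omega> - W G \<omega>)} < e / 2"
    using diff[of 1] e by (intro order_tendstoD) auto
  then have "\<forall>\<^sub>F G in sequentially. measure (M G) {\<omega> \<in> space (M G). A + 1 < norm (X G \<omega>)} < e"
  proof eventually_elim
    case (elim G)
    interpret prob_space "M G" by (rule M)
    note [measurable] = X[of G] W(1)[of G]
    have tri: "norm (X G \<omega>) \<le> norm (W G \<omega>) + norm (X G \<omega> - W G \<omega>)" for \<omega>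
      using norm_triangle_ineq[of "W G \<omega>" "X G \<omega> - W G \<omega>"] by simp
    have "A < norm (W G \<omega>) \<or> 1 < norm (X G \<omega> - W G \<omega>)" if "A + 1 < norm (X G \<omega>)" for \<omega>
      using tri[of \<omega>] that by linarith
    then have "prob {\<omega> \<in> space (M G). A + 1 < norm (X G \<omega>)} \<le>
      prob ({\<omega> \<in> space (M G). A < norm (W G \<omega>)} \<union> {\<omega> \<in> space (M G). 1 < norm (X G \<omega> - W G \<omega>)})"
      by (intro finite_measure_mono) auto
    also have "\<dots> \<le> prob {\<omega> \<in> space (M G). A < norm (W G \<omega>)} + prob {\<omega> \<in> space (M G). 1 < norm (X G \<omega> - W G \<omega>)}"
      by (rule measure_Un_le) auto
    also have "prob {\<omega> \<in> space (M G). A < norm (W G \<omega>)} \<le> C / A\<^sup>2"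
      by (rule order_trans[OF markov_inequality_square[OF W(1,2) A(1)] divide_right_mono[OF W(3)]]) simp
    also have "C / A\<^sup>2 \<le> e / 2" using C0 e by (simp add: A(2) field_simps)
    finally show ?case using elim by simp
  qed
  then show "\<exists>A. \<forall>\<^sub>F G in sequentially. measure (M G) {\<omega> \<in> space (M G). A < norm (X G \<omega>)} < e" ..
next
  fix t :: "real ^ 'q"
  have "(\<lambda>G. (CLINT \<omega>|M G. iexp (t \<bullet> X G \<omega>)) - (CLINT \<omega>|M G. iexp (t \<bullet> W G \<omega>))) \<longlonglongrightarrow> 0"
  proof (rule tendstoI)
    fix e :: real assume e: "0 < e"
    \<comment> \<open>Where X and W differ by at most d the exponentials differ by at most |t| d
      \<le> e / 2; elsewhere they differ by at most 2, on a set of mass below e / 4.\<close>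
    define d where "d = e / (2 * (norm t + 1))"
    have nt: "0 < norm t + 1" using norm_ge_zero[of t] by linarith
    have d: "0 < d" "norm t * d \<le> e / 2" using e nt by (auto simp: d_def field_simps)
    have "\<forall>\<^sub>F G in sequentially. measure (M G) {\<omega> \<in> space (M G). d < norm (X G \<omega> - W G \<omega>)} < e / 4"
      using diff[OF d(1)] e by (intro order_tendstoD) auto
    then show "\<forall>\<^sub>F G in sequentially. dist ((CLINT \<omega>|M G. iexp (t \<bullet> X G \<omega>)) - (CLINT \<omega>|M G. iexp (t \<bullet> W G \<omega>))) 0 < e"
    proof eventually_elim
      case (elim G)
      interpret prob_space "M G" by (rule M)
      note [measurable] = X[of G] W(1)[of G]
      let ?T = "{\<omega> \<in> space (M G). d < norm (X G \<omega> - W G \<omega>)}"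
      have T: "?T \<in> sets (M G)" by measurable
      have i: "integrable (M G) (\<lambda>\<omega>. iexp (t \<bullet> X G \<omega>))" "integrable (M G) (\<lambda>\<omega>. iexp (t \<bullet> W G \<omega>))"
        by (rule integrable_iexp; measurable)+
      have "integrable (M G) (indicator ?T :: 'a \<Rightarrow> real)"
        by (rule integrable_real_indicator[OF T]) (simp add: emeasure_eq_measure)
      then have ind: "integrable (M G) (\<lambda>\<omega>. 2 * indicator ?T \<omega> :: real)" by (rule integrable_mult_right)
      have "norm ((CLINT \<omega>|M G. iexp (t \<bullet> X G \<omega>)) - (CLINT \<omega>|M G. iexp (t \<bullet> W G \<omega>)))
          = norm (CLINT \<omega>|M G. iexp (t \<bullet> X G \<omega>) - iexp (t \<bullet> W G \<omega>))" using i by simp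
      also have "\<dots> \<le> (LINT \<omega>|M G. norm (iexp (t \<bullet> X G \<omega>) - iexp (t \<bullet> W G \<omega>)))"
        by (rule integral_norm_bound)
      also have "\<dots> \<le> (LINT \<omega>|M G. norm t * d + 2 * indicator ?T \<omega>)"
      proof (rule integral_mono)
        fix \<omega> assume w: "\<omega> \<in> space (M G)"
        show "norm (iexp (t \<bullet> X G \<omega>) - iexp (t \<bullet> W G \<omega>)) \<le> norm t * d + 2 * indicator ?T \<omega>"
        proof (cases "\<omega> \<in> ?T")
          case True
          then show ?thesis using norm_triangle_ineq4[of "iexp (t \<bullet> X G \<omega>)" "iexp (t \<bullet> W G \<omega>)"] d(1)
            by (simp add: add_increasing)
        next
          case False
          have "norm (iexp (t \<bullet> X G \<omega>) - iexp (t \<bullet> W G \<omega>)) \<le> \<bar>t \<bullet> (X G \<omega> - W G \<omega>)\<bar>"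
            using norm_iexp_diff_le[of "t \<bullet> X G \<omega>" "t \<bullet> W G \<omega>"] by (simp add: inner_diff_right)
          also have "\<dots> \<le> norm t * norm (X G \<omega> - W G \<omega>)" by (rule Cauchy_Schwarz_ineq2)
          also have "\<dots> \<le> norm t * d" using False w by (intro mult_left_mono) auto
          finally show ?thesis using False by simp
        qed
      qed (use i ind in \<open>auto intro!: integrable_norm\<close>)
      also have "\<dots> = norm t * d + 2 * prob ?T"
        by (subst Bochner_Integration.integral_add[OF _ ind]) (simp_all add: prob_space)
      also have "\<dots> < e" using elim d(2) by linarith
      finally show ?case by simp
    qed
  qed
  from tendsto_add[OF this char[of t]]
  show "(\<lambda>G. CLINT \<omega>|M G. iexp (t \<bullet> X G \<omega>)) \<longlonglongrightarrow> (CLINT z|std_normal_vec. iexp (t \<bullet> z))"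
    by (simp add: char_std_normal_vec)
qed

section \<open>A central limit theorem under local dependence\<close>

lemma card_Collect_sum_prod:
  assumes "finite I" "\<And>n. n \<in> I \<Longrightarrow> finite (J n)" "\<And>n. n \<in> I \<Longrightarrow> real (card (J n)) \<le> D"
  shows "real (card (Sigma I J)) \<le> real (card I) * D"
proof -
  have "real (card (Sigma I J)) = (\<Sum>n\<in>I. real (card (J n)))" using assms by simp
  also have "\<dots> \<le> (\<Sum>n\<in>I. D)" by (intro sum_mono assms)
  finally show ?thesis by simp
qed

text \<open>A dependency graph on the index set: families without an edge between their index sets
  are independent. Neighbourhoods contain their own centre, and D bounds their size.\<close>

locale dependent_family = prob_space M for M :: "'a measure" +
  fixes I :: "nat set" and adj :: "nat \<Rightarrow> nat \<Rightarrow> bool" and \<xi> :: "nat \<Rightarrow> 'a \<Rightarrow> 'b::topological_space"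
    and D :: real
  assumes finite_I: "finite I"
    and adj_refl: "n \<in> I \<Longrightarrow> adj n n"
    and adj_sym: "adj n m \<Longrightarrow> adj m n"
    and meas: "n \<in> I \<Longrightarrow> \<xi> n \<in> borel_measurable M"
    and indep: "S \<subseteq> I \<Longrightarrow> S' \<subseteq> I \<Longrightarrow> (\<And>n m. n \<in> S \<Longrightarrow> m \<in> S' \<Longrightarrow> \<not> adj n m) \<Longrightarrow>
      indep_var (PiM S (\<lambda>_. borel)) (\<lambda>\<omega>. \<lambda>n\<in>S. \<xi> n \<omega>) (PiM S' (\<lambda>_. borel)) (\<lambda>\<omega>. \<lambda>n\<in>S'. \<xi> n \<omega>)"
    and deg: "n \<in> I \<Longrightarrow> real (card {m \<in> I. adj n m}) \<le> D"
    and D_nonneg: "0 \<le> D"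
begin

definition nbr :: "nat set \<Rightarrow> nat set" where "nbr S = {m \<in> I. \<exists>n\<in>S. adj n m}"

text \<open>Encoded as a measurable factorisation through the restricted family, the form in which
  independence of families passes to single variables. The equation is required on
  \<open>space M\<close> only.\<close>

definition dep_on :: "nat set \<Rightarrow> ('a \<Rightarrow> 'c::topological_space) \<Rightarrow> bool" where
  "dep_on S Z \<longleftrightarrow> (\<exists>F \<in> borel_measurable (PiM S (\<lambda>_. borel :: 'b measure)). \<forall>\<omega>\<in>space M. Z \<omega> = F (\<lambda>n\<in>S. \<xi> n \<omega>))"

lemma finite_nbr: "finite (nbr S)" using finite_I by (simp add: nbr_def)

lemma nbr_subset: "nbr S \<subseteq> I" by (auto simp: nbr_def)

lemma card_nbr:
  assumes "finite S" "S \<subseteq> I"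
  shows "real (card (nbr S)) \<le> real (card S) * D"
proof -
  have "nbr S = (\<Union>n\<in>S. {m \<in> I. adj n m})" by (auto simp: nbr_def)
  then have "card (nbr S) \<le> (\<Sum>n\<in>S. card {m \<in> I. adj n m})" using card_UN_le[OF assms(1)] by simp
  then have "real (card (nbr S)) \<le> (\<Sum>n\<in>S. real (card {m \<in> I. adj n m}))" by (metis of_nat_le_iff of_nat_sum)
  also have "\<dots> \<le> (\<Sum>n\<in>S. D)" using assms deg by (intro sum_mono) auto
  finally show ?thesis by simp
qed

lemma dep_on_measurable:
  assumes Z: "dep_on S Z" and S: "S \<subseteq> I"
  shows "Z \<in> borel_measurable M"
proof -
  obtain F where F: "F \<in> borel_measurable (PiM S (\<lambda>_. borel))" "\<And>\<omega>. \<omega> \<in> space M \<Longrightarrow> Z \<omega> = F (\<lambda>n\<in>S. \<xi> n \<omega>)"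
    using Z by (auto simp: dep_on_def)
  have "(\<lambda>\<omega>. \<lambda>n\<in>S. \<xi> n \<omega>) \<in> M \<rightarrow>\<^sub>M PiM S (\<lambda>_. borel)"
    by (rule measurable_restrict) (use S meas in auto)
  from measurable_compose[OF this F(1)] have "(\<lambda>\<omega>. F (\<lambda>n\<in>S. \<xi> n \<omega>)) \<in> borel_measurable M" .
  then show ?thesis using F(2) by (subst measurable_cong) auto
qed

lemma dep_on_mono:
  assumes "dep_on S Z" "S \<subseteq> T" shows "dep_on T Z"
proof -
  obtain F where F: "F \<in> borel_measurable (PiM S (\<lambda>_. borel))" "\<And>\<omega>. \<omega> \<in> space M \<Longrightarrow> Z \<omega> = F (\<lambda>n\<in>S. \<xi> n \<omega>)"
    using assms(1) by (auto simp: dep_on_def)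
  have "(\<lambda>f. F (restrict f S)) \<in> borel_measurable (PiM T (\<lambda>_. borel))"
    by (rule measurable_compose[OF measurable_restrict_subset F(1)]) (rule assms(2))
  moreover have "restrict (\<lambda>n\<in>T. \<xi> n \<omega>) S = (\<lambda>n\<in>S. \<xi> n \<omega>)" for \<omega>
    using assms(2) by (simp add: Int_absorb1)
  ultimately show ?thesis using F(2) unfolding dep_on_def
    by (intro bexI[of _ "\<lambda>f. F (restrict f S)"]) auto
qed

lemma dep_on_single:
  assumes "h \<in> borel_measurable borel" shows "dep_on {n} (\<lambda>\<omega>. h (\<xi> n \<omega>))"
proof -
  have "(\<lambda>f. h (f n)) \<in> borel_measurable (PiM {n} (\<lambda>_. borel))"
    by (rule measurable_compose[of "\<lambda>f. f n" _ borel h borel]) (simp_all add: assms)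
  then show ?thesis unfolding dep_on_def by (intro bexI[of _ "\<lambda>f. h (f n)"]) auto
qed

lemma dep_on_map:
  assumes "dep_on S Z" "h \<in> borel_measurable borel" shows "dep_on S (\<lambda>\<omega>. h (Z \<omega>))"
proof -
  obtain F where F: "F \<in> borel_measurable (PiM S (\<lambda>_. borel))" "\<And>\<omega>. \<omega> \<in> space M \<Longrightarrow> Z \<omega> = F (\<lambda>n\<in>S. \<xi> n \<omega>)"
    using assms(1) by (auto simp: dep_on_def)
  then show ?thesis unfolding dep_on_def
    by (intro bexI[of _ "\<lambda>f. h (F f)"] measurable_compose[OF F(1) assms(2)]) auto
qed

lemma dep_on_const: "dep_on S (\<lambda>_. c)"
  unfolding dep_on_def by (intro bexI[of _ "\<lambda>_. c"]) auto

lemma dep_on_mult: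
  fixes Y Z :: "'a \<Rightarrow> 'c::{real_normed_algebra, second_countable_topology}"
  assumes "dep_on S Y" "dep_on S Z" shows "dep_on S (\<lambda>\<omega>. Y \<omega> * Z \<omega>)"
proof -
  obtain F G where [measurable]: "F \<in> borel_measurable (PiM S (\<lambda>_. borel))" "G \<in> borel_measurable (PiM S (\<lambda>_. borel))"
    and "\<And>\<omega>. \<omega> \<in> space M \<Longrightarrow> Y \<omega> = F (\<lambda>n\<in>S. \<xi> n \<omega>)" "\<And>\<omega>. \<omega> \<in> space M \<Longrightarrow> Z \<omega> = G (\<lambda>n\<in>S. \<xi> n \<omega>)"
    using assms by (auto simp: dep_on_def)
  then show ?thesis unfolding dep_on_def by (intro bexI[of _ "\<lambda>f. F f * G f"]) auto
qed

lemma dep_on_add: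
  fixes Y Z :: "'a \<Rightarrow> 'c::{real_normed_algebra, second_countable_topology}"
  assumes "dep_on S Y" "dep_on S Z" shows "dep_on S (\<lambda>\<omega>. Y \<omega> + Z \<omega>)"
proof -
  obtain F G where [measurable]: "F \<in> borel_measurable (PiM S (\<lambda>_. borel))" "G \<in> borel_measurable (PiM S (\<lambda>_. borel))"
    and "\<And>\<omega>. \<omega> \<in> space M \<Longrightarrow> Y \<omega> = F (\<lambda>n\<in>S. \<xi> n \<omega>)" "\<And>\<omega>. \<omega> \<in> space M \<Longrightarrow> Z \<omega> = G (\<lambda>n\<in>S. \<xi> n \<omega>)"
    using assms by (auto simp: dep_on_def)
  then show ?thesis unfolding dep_on_def by (intro bexI[of _ "\<lambda>f. F f + G f"]) auto
qed

lemma dep_on_diff_const: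
  fixes Y :: "'a \<Rightarrow> 'c::{real_normed_algebra, second_countable_topology}"
  assumes "dep_on S Y" shows "dep_on S (\<lambda>\<omega>. Y \<omega> - c)"
  by (rule dep_on_map[OF assms]) simp

lemma dep_on_sum:
  fixes Z :: "'i \<Rightarrow> 'a \<Rightarrow> 'c::{real_normed_algebra, second_countable_topology}"
  assumes "finite J" "\<And>i. i \<in> J \<Longrightarrow> dep_on S (Z i)" shows "dep_on S (\<lambda>\<omega>. \<Sum>i\<in>J. Z i \<omega>)"
  using assms
proof (induction J rule: finite_induct)
  case empty
  show ?case by (simp add: dep_on_const)
next
  case (insert j J)
  then show ?case using dep_on_add[of S "Z j" "\<lambda>\<omega>. \<Sum>i\<in>J. Z i \<omega>"] by simp
qed

text \<open>The value type covers both uses: covariances over the reals and exponentials over the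
  complex numbers.\<close>

lemma indep_product:
  fixes Y Z :: "'a \<Rightarrow> 'c::{real_normed_field, banach, second_countable_topology}"
  assumes Y: "dep_on S Y" "integrable M Y" and Z: "dep_on S' Z" "integrable M Z"
    and S: "S \<subseteq> I" "S' \<subseteq> I" "\<And>n m. n \<in> S \<Longrightarrow> m \<in> S' \<Longrightarrow> \<not> adj n m"
  shows "(LINT \<omega>|M. Y \<omega> * Z \<omega>) = (LINT \<omega>|M. Y \<omega>) * (LINT \<omega>|M. Z \<omega>)"
proof -
  obtain F where F: "F \<in> borel_measurable (PiM S (\<lambda>_. borel))" "\<And>\<omega>. \<omega> \<in> space M \<Longrightarrow> Y \<omega> = F (\<lambda>n\<in>S. \<xi> n \<omega>)"
    using Y(1) unfolding dep_on_def by blast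
  obtain G where G: "G \<in> borel_measurable (PiM S' (\<lambda>_. borel))" "\<And>\<omega>. \<omega> \<in> space M \<Longrightarrow> Z \<omega> = G (\<lambda>n\<in>S'. \<xi> n \<omega>)"
    using Z(1) unfolding dep_on_def by blast
  define Y' where "Y' = F \<circ> (\<lambda>\<omega>. \<lambda>n\<in>S. \<xi> n \<omega>)"
  define Z' where "Z' = G \<circ> (\<lambda>\<omega>. \<lambda>n\<in>S'. \<xi> n \<omega>)"
  have iv: "indep_var borel Y' borel Z'"
    unfolding Y'_def Z'_def by (rule indep_var_compose[OF indep[OF S] F(1) G(1)])
  have eq: "\<And>\<omega>. \<omega> \<in> space M \<Longrightarrow> Y \<omega> = Y' \<omega>" "\<And>\<omega>. \<omega> \<in> space M \<Longrightarrow> Z \<omega> = Z' \<omega>"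
    unfolding Y'_def Z'_def o_def by (simp_all only: F(2) G(2))
  have "integrable M Y'"
    by (rule iffD1[OF Bochner_Integration.integrable_cong[OF refl eq(1)] Y(2)])
  moreover have "integrable M Z'"
    by (rule iffD1[OF Bochner_Integration.integrable_cong[OF refl eq(2)] Z(2)])
  ultimately have "(LINT \<omega>|M. Y' \<omega> * Z' \<omega>) = (LINT \<omega>|M. Y' \<omega>) * (LINT \<omega>|M. Z' \<omega>)"
    by (rule indep_var_lebesgue_integral[OF iv])
  moreover have "(LINT \<omega>|M. Y \<omega> * Z \<omega>) = (LINT \<omega>|M. Y' \<omega> * Z' \<omega>)"
    by (rule Bochner_Integration.integral_cong[OF refl]) (simp only: eq)
  moreover have "(LINT \<omega>|M. Y \<omega>) = (LINT \<omega>|M. Y' \<omega>)"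
    by (rule Bochner_Integration.integral_cong[OF refl eq(1)])
  moreover have "(LINT \<omega>|M. Z \<omega>) = (LINT \<omega>|M. Z' \<omega>)"
    by (rule Bochner_Integration.integral_cong[OF refl eq(2)])
  ultimately show ?thesis by (simp only:)
qed

text \<open>Covariances vanish unless the two index sets touch. Each p has at most K partners, and a
  centred summand is bounded by 2 B, whence 4 K B^2 per summand.\<close>

lemma variance_sum_le:
  fixes Z :: "'i \<Rightarrow> 'a \<Rightarrow> real"
  assumes P: "finite P" and Z: "\<And>p. p \<in> P \<Longrightarrow> dep_on (s p) (Z p)" and s: "\<And>p. p \<in> P \<Longrightarrow> s p \<subseteq> I"
    and B: "\<And>p. p \<in> P \<Longrightarrow> AE \<omega> in M. \<bar>Z p \<omega>\<bar> \<le> B"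
    and K: "\<And>p. p \<in> P \<Longrightarrow> real (card {p' \<in> P. \<exists>n\<in>s p. \<exists>m\<in>s p'. adj n m}) \<le> K"
  shows "expectation (\<lambda>\<omega>. ((\<Sum>p\<in>P. Z p \<omega>) - expectation (\<lambda>\<omega>. \<Sum>p\<in>P. Z p \<omega>))\<^sup>2) \<le> 4 * real (card P) * K * B\<^sup>2"
proof (cases "P = {}")
  case True then show ?thesis by simp
next
  case False
  have meas: "Z p \<in> borel_measurable M" if "p \<in> P" for p
    using dep_on_measurable[OF Z s] that by blast
  have intZ: "integrable M (Z p)" if "p \<in> P" for p
    using B[OF that] meas[OF that] by (intro integrable_const_bound[of _ B]) auto
  define \<mu> where "\<mu> p = expectation (Z p)" for p
  define U where "U p \<omega> = Z p \<omega> - \<mu> p" for p \<omega>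
  have mu: "\<bar>\<mu> p\<bar> \<le> B" if "p \<in> P" for p
  proof -
    have "\<bar>\<mu> p\<bar> \<le> expectation (\<lambda>\<omega>. \<bar>Z p \<omega>\<bar>)" unfolding \<mu>_def by (rule integral_abs_bound)
    also have "\<dots> \<le> expectation (\<lambda>_. B)"
      using B[OF that] intZ[OF that] by (intro integral_mono_AE) auto
    finally show ?thesis by (simp add: prob_space)
  qed
  have U: "AE \<omega> in M. \<bar>U p \<omega>\<bar> \<le> 2 * B" if "p \<in> P" for p
    using B[OF that]
  proof eventually_elim
    case (elim \<omega>)
    then show ?case using mu[OF that] by (simp add: U_def)
  qed
  have mU: "U p \<in> borel_measurable M" if "p \<in> P" for p
    unfolding U_def using meas[OF that] by simp
  have intU: "integrable M (U p)" if "p \<in> P" for p unfolding U_def using intZ[OF that] by simp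
  have EU: "expectation (U p) = 0" if "p \<in> P" for p
    unfolding U_def using intZ[OF that] by (simp add: \<mu>_def prob_space)
  have UU: "AE \<omega> in M. \<bar>U p \<omega> * U p' \<omega>\<bar> \<le> 4 * B\<^sup>2" if "p \<in> P" "p' \<in> P" for p p'
    using U[OF that(1)] U[OF that(2)]
  proof eventually_elim
    case (elim \<omega>)
    then have "\<bar>U p \<omega>\<bar> * \<bar>U p' \<omega>\<bar> \<le> (2 * B) * (2 * B)" by (intro mult_mono) auto
    then show ?case by (simp add: abs_mult power2_eq_square)
  qed
  have intUU: "integrable M (\<lambda>\<omega>. U p \<omega> * U p' \<omega>)" if "p \<in> P" "p' \<in> P" for p p'
    using UU[OF that] mU[OF that(1)] mU[OF that(2)] by (intro integrable_const_bound[of _ "4 * B\<^sup>2"]) auto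
  have cov: "expectation (\<lambda>\<omega>. U p \<omega> * U p' \<omega>) \<le> (if \<exists>n\<in>s p. \<exists>m\<in>s p'. adj n m then 4 * B\<^sup>2 else 0)"
    if p: "p \<in> P" "p' \<in> P" for p p'
  proof (cases "\<exists>n\<in>s p. \<exists>m\<in>s p'. adj n m")
    case True
    have "AE \<omega> in M. U p \<omega> * U p' \<omega> \<le> 4 * B\<^sup>2" using UU[OF p] by eventually_elim simp
    then have "expectation (\<lambda>\<omega>. U p \<omega> * U p' \<omega>) \<le> expectation (\<lambda>_. 4 * B\<^sup>2)"
      using intUU[OF p] by (intro integral_mono_AE) auto
    then show ?thesis using True by (simp add: prob_space)
  next
    case False
    have "expectation (\<lambda>\<omega>. U p \<omega> * U p' \<omega>) = expectation (U p) * expectation (U p')"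
      using False p unfolding U_def
      by (intro indep_product[of "s p" _ "s p'"] dep_on_diff_const Z s intU[unfolded U_def]) auto
    then show ?thesis using False EU[OF p(1)] by auto
  qed
  have "(\<Sum>p\<in>P. Z p \<omega>) - expectation (\<lambda>\<omega>. \<Sum>p\<in>P. Z p \<omega>) = (\<Sum>p\<in>P. U p \<omega>)" for \<omega>
    using intZ by (simp add: U_def sum_subtractf \<mu>_def)
  then have "expectation (\<lambda>\<omega>. ((\<Sum>p\<in>P. Z p \<omega>) - expectation (\<lambda>\<omega>. \<Sum>p\<in>P. Z p \<omega>))\<^sup>2)
      = expectation (\<lambda>\<omega>. \<Sum>p\<in>P. \<Sum>p'\<in>P. U p \<omega> * U p' \<omega>)"
    by (simp add: power2_eq_square sum_product)
  also have "\<dots> = (\<Sum>p\<in>P. \<Sum>p'\<in>P. expectation (\<lambda>\<omega>. U p \<omega> * U p' \<omega>))"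
    using intUU by (simp add: Bochner_Integration.integral_sum Bochner_Integration.integrable_sum)
  also have "\<dots> \<le> (\<Sum>p\<in>P. \<Sum>p'\<in>P. if \<exists>n\<in>s p. \<exists>m\<in>s p'. adj n m then 4 * B\<^sup>2 else 0)"
    by (intro sum_mono cov)
  also have "\<dots> = (\<Sum>p\<in>P. real (card {p' \<in> P. \<exists>n\<in>s p. \<exists>m\<in>s p'. adj n m}) * (4 * B\<^sup>2))"
    using P by (simp add: sum.inter_filter[symmetric])
  also have "\<dots> \<le> (\<Sum>p\<in>P. K * (4 * B\<^sup>2))"
    using K by (intro sum_mono mult_right_mono) auto
  finally show ?thesis by (simp add: mult_ac)
qed

lemma variance_sum_single_le:
  fixes Z :: "nat \<Rightarrow> 'a \<Rightarrow> real"
  assumes Z: "\<And>n. n \<in> I \<Longrightarrow> dep_on {n} (Z n)" and B: "\<And>n. n \<in> I \<Longrightarrow> AE \<omega> in M. \<bar>Z n \<omega>\<bar> \<le> B"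
  shows "expectation (\<lambda>\<omega>. ((\<Sum>n\<in>I. Z n \<omega>) - expectation (\<lambda>\<omega>. \<Sum>n\<in>I. Z n \<omega>))\<^sup>2) \<le> 4 * real (card I) * D * B\<^sup>2"
  by (rule variance_sum_le[where s = "\<lambda>n. {n}"]) (use finite_I Z B deg in auto)

text \<open>There are at most |I| D adjacent pairs. A pair that touches {n, m} has one coordinate
  among at most 2 D neighbours and the other adjacent to it, in either order, which makes 4 D^2
  partners and the constant 4 times 4.\<close>

lemma variance_sum_pair_le:
  fixes Z :: "nat \<Rightarrow> nat \<Rightarrow> 'a \<Rightarrow> real"
  assumes Z: "\<And>n m. n \<in> I \<Longrightarrow> m \<in> I \<Longrightarrow> dep_on {n, m} (Z n m)"
    and B: "\<And>n m. n \<in> I \<Longrightarrow> m \<in> I \<Longrightarrow> AE \<omega> in M. \<bar>Z n m \<omega>\<bar> \<le> B"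
  defines "T \<equiv> \<lambda>\<omega>. \<Sum>n\<in>I. \<Sum>m\<in>{m \<in> I. adj n m}. Z n m \<omega>"
  shows "expectation (\<lambda>\<omega>. (T \<omega> - expectation T)\<^sup>2) \<le> 16 * real (card I) * D ^ 3 * B\<^sup>2"
proof -
  define P where "P = Sigma I (\<lambda>n. {m \<in> I. adj n m})"
  have T: "T \<omega> = (\<Sum>p\<in>P. case p of (n, m) \<Rightarrow> Z n m \<omega>)" for \<omega>
    unfolding T_def P_def using finite_I by (subst sum.Sigma) auto
  have cP: "real (card P) \<le> real (card I) * D"
    unfolding P_def using finite_I deg by (intro card_Collect_sum_prod) auto
  have "expectation (\<lambda>\<omega>. (T \<omega> - expectation T)\<^sup>2) \<le> 4 * real (card P) * (4 * D\<^sup>2) * B\<^sup>2"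
    unfolding T
  proof (rule variance_sum_le[where s = "\<lambda>(n, m). {n, m}"])
    show "finite P" using finite_I by (simp add: P_def)
    fix p assume p: "p \<in> P"
    then obtain n m where nm: "p = (n, m)" "n \<in> I" "m \<in> I" by (auto simp: P_def)
    define A where "A = nbr {n, m}"
    have cA: "real (card A) \<le> 2 * D"
      unfolding A_def using card_nbr[of "{n, m}"] nm D_nonneg
      by (cases "n = m") (auto intro: order_trans)
    \<comment> \<open>The swapped copy covers the pairs whose second coordinate lies in the
      neighbourhood.\<close>
    have "{p' \<in> P. \<exists>a\<in>(case p of (n, m) \<Rightarrow> {n, m}). \<exists>b\<in>(case p' of (n, m) \<Rightarrow> {n, m}). adj a b}
       \<subseteq> Sigma A (\<lambda>a. {b \<in> I. adj a b}) \<union> prod.swap ` Sigma A (\<lambda>a. {b \<in> I. adj a b})"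
      unfolding A_def nbr_def P_def nm(1) using adj_sym by (auto simp: image_iff)
    then have "card {p' \<in> P. \<exists>a\<in>(case p of (n, m) \<Rightarrow> {n, m}). \<exists>b\<in>(case p' of (n, m) \<Rightarrow> {n, m}). adj a b}
       \<le> card (Sigma A (\<lambda>a. {b \<in> I. adj a b}) \<union> prod.swap ` Sigma A (\<lambda>a. {b \<in> I. adj a b}))"
      using finite_I finite_nbr by (intro card_mono) (auto simp: A_def)
    also have "\<dots> \<le> card (Sigma A (\<lambda>a. {b \<in> I. adj a b})) + card (prod.swap ` Sigma A (\<lambda>a. {b \<in> I. adj a b}))"
      by (rule card_Un_le)
    also have "card (prod.swap ` Sigma A (\<lambda>a. {b \<in> I. adj a b})) = card (Sigma A (\<lambda>a. {b \<in> I. adj a b}))"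
      by (rule card_image) (simp add: inj_on_def)
    finally have "real (card {p' \<in> P. \<exists>a\<in>(case p of (n, m) \<Rightarrow> {n, m}). \<exists>b\<in>(case p' of (n, m) \<Rightarrow> {n, m}). adj a b})
      \<le> 2 * real (card (Sigma A (\<lambda>a. {b \<in> I. adj a b})))" by linarith
    also have "real (card (Sigma A (\<lambda>a. {b \<in> I. adj a b}))) \<le> real (card A) * D"
      using finite_I finite_nbr nbr_subset deg by (intro card_Collect_sum_prod) (auto simp: A_def)
    also have "\<dots> \<le> 2 * D * D" using cA D_nonneg by (rule mult_right_mono)
    finally show "real (card {p' \<in> P. \<exists>a\<in>(case p of (n, m) \<Rightarrow> {n, m}). \<exists>b\<in>(case p' of (n, m) \<Rightarrow> {n, m}). adj a b}) \<le> 4 * D\<^sup>2"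
      by (simp add: power2_eq_square)
  qed (use Z B in \<open>auto simp: P_def\<close>)
  also have "\<dots> \<le> 4 * (real (card I) * D) * (4 * D\<^sup>2) * B\<^sup>2"
    using cP by (intro mult_right_mono mult_left_mono) auto
  finally show ?thesis by (simp add: power3_eq_cube power2_eq_square mult_ac)
qed

end

section \<open>Expansion of the moment generating function over dependency neighbourhoods\<close>

lemma exp_remainder_le:
  fixes w :: complex
  shows "norm (1 - exp (- w)) \<le> norm w * exp (norm w)"
    and "norm (1 - exp (- w) - w) \<le> (norm w)\<^sup>2 * exp (norm w)"
    and "norm (1 - exp (- w) - (w - w\<^sup>2 / 2)) \<le> norm w ^ 3 * exp (norm w)"
proof -
  \<comment> \<open>The expansion is at -w because deleting a neighbourhood from the sum multiplies
    the exponential by exp(-w); the factorial in the Taylor bound is dropped.\<close>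
  have T: "norm (exp (- w) - (\<Sum>i\<le>n. (- w) ^ i / fact i)) \<le> norm w ^ Suc n * exp (norm w)" for n
  proof -
    have "norm (exp (- w) - (\<Sum>i\<le>n. (- w) ^ i / fact i)) \<le> exp \<bar>Re (- w)\<bar> * norm (- w) ^ Suc n / fact n"
      by (rule Taylor_exp)
    also have "\<dots> \<le> exp (norm w) * norm w ^ Suc n / 1"
      using abs_Re_le_cmod[of w] by (intro frac_le mult_mono) auto
    finally show ?thesis by (simp add: mult.commute)
  qed
  show "norm (1 - exp (- w)) \<le> norm w * exp (norm w)"
    using T[of 0] by (simp add: norm_minus_commute)
  have "1 - exp (- w) - w = - (exp (- w) - (\<Sum>i\<le>1. (- w) ^ i / fact i))" by simp
  then show "norm (1 - exp (- w) - w) \<le> (norm w)\<^sup>2 * exp (norm w)"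
    using T[of 1] by (simp only: norm_minus_cancel) (simp add: power2_eq_square)
  have "1 - exp (- w) - (w - w\<^sup>2 / 2) = - (exp (- w) - (\<Sum>i\<le>2. (- w) ^ i / fact i))"
    by (simp add: numeral_2_eq_2 power2_eq_square)
  then show "norm (1 - exp (- w) - (w - w\<^sup>2 / 2)) \<le> norm w ^ 3 * exp (norm w)"
    using T[of 2] by (simp only: norm_minus_cancel) (simp add: numeral_3_eq_3)
qed

text \<open>The condition D b \<le> 1 bounds the sum over the neighbourhood of at most three indices
  by 3, the source of every factor exp 3.\<close>

locale bounded_scores = dependent_family M I adj \<xi> D
  for M :: "'a measure" and I adj and \<xi> :: "nat \<Rightarrow> 'a \<Rightarrow> 'b::topological_space" and D +
  fixes X :: "nat \<Rightarrow> 'a \<Rightarrow> real" and b :: real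
  assumes dep: "n \<in> I \<Longrightarrow> dep_on {n} (X n)"
    and mean_zero: "n \<in> I \<Longrightarrow> expectation (X n) = 0"
    and bounded: "n \<in> I \<Longrightarrow> AE \<omega> in M. \<bar>X n \<omega>\<bar> \<le> b"
    and b_nonneg: "0 \<le> b" and Db: "D * b \<le> 1"
begin

definition W where "W \<omega> = (\<Sum>n\<in>I. X n \<omega>)"
definition Y where "Y S \<omega> = (\<Sum>n\<in>nbr S. X n \<omega>)"
definition E where "E z B = (CLINT \<omega>|M. complex_of_real (B \<omega>) * exp (z * complex_of_real (W \<omega>)))"
definition mgf where "mgf z = E z (\<lambda>_. 1)"
definition rmgf where "rmgf t = (LINT \<omega>|M. exp (t * W \<omega>))"
definition U where "U i j \<omega> = X i \<omega> * X j \<omega> - expectation (\<lambda>\<omega>. X i \<omega> * X j \<omega>)"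
definition \<sigma>2 where "\<sigma>2 = (\<Sum>i\<in>I. \<Sum>j\<in>nbr {i}. expectation (\<lambda>\<omega>. X i \<omega> * X j \<omega>))"
text \<open>The z^2 coefficient left by the two expansions: the first sum stems from the centred
  products \<open>U\<close>, the second from the quadratic Taylor term. For independent scores it is
  half the sum of the third moments, so that \<kappa> z^3 / 3 is the third cumulant term.\<close>

definition \<kappa> where "\<kappa> = (\<Sum>i\<in>I. \<Sum>j\<in>nbr {i}. \<Sum>k\<in>nbr {i, j}. expectation (\<lambda>\<omega>. U i j \<omega> * X k \<omega>))
    - (1/2) * (\<Sum>i\<in>I. \<Sum>j\<in>nbr {i}. \<Sum>k\<in>nbr {i}. expectation (\<lambda>\<omega>. X i \<omega> * X j \<omega> * X k \<omega>))"

lemma measX [measurable]: "n \<in> I \<Longrightarrow> X n \<in> borel_measurable M"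
  using dep dep_on_measurable by blast

lemma measW [measurable]: "W \<in> borel_measurable M"
  unfolding W_def by (intro borel_measurable_sum measX)

lemma measY [measurable]: "Y S \<in> borel_measurable M"
  unfolding Y_def using nbr_subset by (intro borel_measurable_sum measX) auto

lemma AEX: "AE \<omega> in M. \<forall>n\<in>I. \<bar>X n \<omega>\<bar> \<le> b"
  by (rule AE_finite_allI[OF finite_I bounded])

lemma abs_sum_le:
  assumes "\<forall>n\<in>I. \<bar>X n \<omega>\<bar> \<le> b" "A \<subseteq> I"
  shows "\<bar>\<Sum>n\<in>A. X n \<omega>\<bar> \<le> real (card A) * b"
proof -
  have "\<bar>\<Sum>n\<in>A. X n \<omega>\<bar> \<le> (\<Sum>n\<in>A. \<bar>X n \<omega>\<bar>)" by (rule sum_abs)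
  also have "\<dots> \<le> (\<Sum>n\<in>A. b)" using assms by (intro sum_mono) auto
  finally show ?thesis by simp
qed

lemma AE_W: "AE \<omega> in M. \<bar>W \<omega>\<bar> \<le> real (card I) * b"
  using AEX by eventually_elim (auto simp: W_def intro: abs_sum_le)

text \<open>At most three indices i, j, k occur together in the expansions; the bound 3 is used
  uniformly for smaller sets as well.\<close>

lemma AE_Y:
  assumes S: "finite S" "S \<subseteq> I" "card S \<le> 3"
  shows "AE \<omega> in M. \<bar>Y S \<omega>\<bar> \<le> 3 * (D * b)"
  using AEX
proof eventually_elim
  case (elim \<omega>)
  have "\<bar>Y S \<omega>\<bar> \<le> real (card (nbr S)) * b" unfolding Y_def by (rule abs_sum_le[OF elim nbr_subset])
  also have "\<dots> \<le> (real (card S) * D) * b" using card_nbr[OF S(1,2)] b_nonneg by (rule mult_right_mono)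
  also have "\<dots> \<le> (3 * D) * b" using S(3) D_nonneg b_nonneg by (intro mult_right_mono) auto
  finally show ?case by simp
qed

lemma norm_exp_W: "norm (exp (z * complex_of_real w)) = exp (Re z * w)"
  by (simp add: norm_exp_eq_Re)

lemma integrable_exp:
  assumes f: "f \<in> borel_measurable M" "AE \<omega> in M. norm (f \<omega>) \<le> \<beta>"
  shows "integrable M (\<lambda>\<omega>. f \<omega> * exp (z * complex_of_real (W \<omega>)))"
proof (rule integrable_const_bound[of _ "\<beta> * exp (\<bar>Re z\<bar> * (real (card I) * b))"])
  show "AE \<omega> in M. norm (f \<omega> * exp (z * complex_of_real (W \<omega>))) \<le> \<beta> * exp (\<bar>Re z\<bar> * (real (card I) * b))"
    using f(2) AE_W
  proof eventually_elim
    case (elim \<omega>)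
    have "Re z * W \<omega> \<le> \<bar>Re z\<bar> * \<bar>W \<omega>\<bar>" by (metis abs_ge_self abs_mult)
    also have "\<dots> \<le> \<bar>Re z\<bar> * (real (card I) * b)" by (rule mult_left_mono[OF elim(2)]) simp
    finally have "exp (Re z * W \<omega>) \<le> exp (\<bar>Re z\<bar> * (real (card I) * b))" by simp
    with elim(1) show ?case unfolding norm_mult norm_exp_W by (intro mult_mono) (auto intro: order_trans[OF norm_ge_zero])
  qed
qed (use f in measurable)

lemma integrable_expB:
  assumes B: "B \<in> borel_measurable M" "AE \<omega> in M. \<bar>B \<omega>\<bar> \<le> \<beta>"
  shows "integrable M (\<lambda>\<omega>. complex_of_real (B \<omega>) * exp (z * complex_of_real (W \<omega>)))"
  by (rule integrable_exp[of _ \<beta>]) (use B in auto)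

lemma integrable_rexp: "integrable M (\<lambda>\<omega>. exp (t * W \<omega>))"
proof -
  have "integrable M (\<lambda>\<omega>. norm (complex_of_real 1 * exp (of_real t * complex_of_real (W \<omega>))))"
    by (rule integrable_norm[OF integrable_expB[of "\<lambda>_. 1" 1]]) auto
  then show ?thesis by (simp add: norm_exp_W)
qed

text \<open>Errors are measured against \<open>rmgf\<close> rather than a constant: on the imaginary
  axis it equals 1, and on the real axis it lets a differential inequality close.\<close>

lemma norm_integral_exp_le:
  assumes f: "f \<in> borel_measurable M" "AE \<omega> in M. norm (f \<omega>) \<le> \<beta>"
  shows "norm (CLINT \<omega>|M. f \<omega> * exp (z * complex_of_real (W \<omega>))) \<le> \<beta> * rmgf (Re z)"
proof -
  have "norm (CLINT \<omega>|M. f \<omega> * exp (z * complex_of_real (W \<omega>))) \<le> (LINT \<omega>|M. norm (f \<omega> * exp (z * complex_of_real (W \<omega>))))"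
    by (rule integral_norm_bound)
  also have "\<dots> \<le> (LINT \<omega>|M. \<beta> * exp (Re z * W \<omega>))"
  proof (rule integral_mono_AE)
    show "AE \<omega> in M. norm (f \<omega> * exp (z * complex_of_real (W \<omega>))) \<le> \<beta> * exp (Re z * W \<omega>)"
      using f(2) by eventually_elim (simp add: norm_mult norm_exp_W)
  qed (use integrable_norm[OF integrable_exp[OF f]] integrable_rexp in auto)
  finally show ?thesis by (simp add: rmgf_def)
qed

lemma E_sum:
  assumes "finite J" "\<And>j. j \<in> J \<Longrightarrow> B j \<in> borel_measurable M" "\<And>j. j \<in> J \<Longrightarrow> AE \<omega> in M. \<bar>B j \<omega>\<bar> \<le> \<beta>"
  shows "E z (\<lambda>\<omega>. \<Sum>j\<in>J. B j \<omega>) = (\<Sum>j\<in>J. E z (B j))"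
  unfolding E_def of_real_sum sum_distrib_right
  by (rule Bochner_Integration.integral_sum) (rule integrable_expB[OF assms(2,3)])

text \<open>Dropping the neighbourhood of \<open>S\<close> from \<open>W\<close> makes the exponential independent of \<open>Z\<close>.\<close>
lemma E_centered:
  assumes S: "finite S" "S \<subseteq> I" "card S \<le> 3"
    and Z: "dep_on S Z" "AE \<omega> in M. \<bar>Z \<omega>\<bar> \<le> \<beta>" "expectation Z = 0"
    and g: "g \<in> borel_measurable borel" "\<And>w. norm (1 - exp (- w) - g w) \<le> norm w ^ k * exp (norm w)"
    and z: "norm z \<le> 1"
  shows "norm (E z Z - (CLINT \<omega>|M. complex_of_real (Z \<omega>) * g (z * complex_of_real (Y S \<omega>)) * exp (z * complex_of_real (W \<omega>))))
    \<le> \<beta> * (3 * (D * b)) ^ k * exp 3 * rmgf (Re z)"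
proof -
  have mZ[measurable]: "Z \<in> borel_measurable M" by (rule dep_on_measurable[OF Z(1) S(2)])
  note g(1)[measurable]
  define y where "y \<omega> = z * complex_of_real (Y S \<omega>)" for \<omega>
  define R where "R \<omega> = (\<Sum>n\<in>I - nbr S. X n \<omega>)" for \<omega>
  define e where "e \<omega> = exp (z * complex_of_real (W \<omega>))" for \<omega>
  have [measurable]: "y \<in> borel_measurable M" "e \<in> borel_measurable M" unfolding y_def e_def by measurable
  have c: "0 \<le> 3 * (D * b)" "3 * (D * b) \<le> 3" using D_nonneg b_nonneg Db by auto
  have WR: "W \<omega> = R \<omega> + Y S \<omega>" for \<omega>
    unfolding W_def R_def Y_def using sum.subset_diff[OF nbr_subset finite_I] by auto
  have exp_R: "exp (z * complex_of_real (R \<omega>)) = exp (- y \<omega>) * e \<omega>" for \<omega>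
    by (simp add: y_def e_def WR exp_add[symmetric] distrib_left)
  have AEy: "AE \<omega> in M. norm (y \<omega>) \<le> 3 * (D * b)"
    using AE_Y[OF S]
  proof eventually_elim
    case (elim \<omega>)
    have "norm (y \<omega>) = norm z * \<bar>Y S \<omega>\<bar>" by (simp add: y_def norm_mult)
    also have "\<dots> \<le> 1 * (3 * (D * b))" using elim z by (intro mult_mono) auto
    finally show ?case by simp
  qed
  have \<beta>: "0 \<le> \<beta>"
  proof -
    have "AE \<omega> in M. 0 \<le> \<beta>" using Z(2) by eventually_elim (use abs_ge_zero order_trans in blast)
    then show ?thesis by simp
  qed
  have AEexp: "AE \<omega> in M. norm (exp (- y \<omega>)) \<le> exp 3"
    using AEy
  proof eventually_elim
    case (elim \<omega>)
    then show ?case using norm_exp[of "- y \<omega>"] c by (simp add: order_trans[of _ "exp (norm (y \<omega>))"])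
  qed
  have "(CLINT \<omega>|M. complex_of_real (Z \<omega>) * exp (z * complex_of_real (R \<omega>)))
     = (CLINT \<omega>|M. complex_of_real (Z \<omega>)) * (CLINT \<omega>|M. exp (z * complex_of_real (R \<omega>)))"
  proof (rule indep_product)
    show "dep_on S (\<lambda>\<omega>. complex_of_real (Z \<omega>))" by (rule dep_on_map[OF Z(1)]) simp
    have "dep_on (I - nbr S) R" unfolding R_def
      using finite_I dep by (intro dep_on_sum) (auto intro: dep_on_mono)
    then show "dep_on (I - nbr S) (\<lambda>\<omega>. exp (z * complex_of_real (R \<omega>)))"
      by (rule dep_on_map) measurable
    show "integrable M (\<lambda>\<omega>. complex_of_real (Z \<omega>))"
      by (rule integrable_const_bound[of _ \<beta>]) (use Z(2) in auto)
    show "integrable M (\<lambda>\<omega>. exp (z * complex_of_real (R \<omega>)))"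
      unfolding exp_R e_def by (rule integrable_exp[OF _ AEexp]) measurable
    show "\<And>n m. n \<in> S \<Longrightarrow> m \<in> I - nbr S \<Longrightarrow> \<not> adj n m" by (auto simp: nbr_def)
  qed (use S in auto)
  \<comment> \<open>Z is centred and independent of the reduced exponential. Hence E[Z exp(z W)]
    equals E[Z (1 - exp(-y)) exp(z W)], and g approximates the bracket.\<close>
  then have zero: "(CLINT \<omega>|M. complex_of_real (Z \<omega>) * exp (- y \<omega>) * e \<omega>) = 0"
    using Z(3) by (simp add: exp_R mult.assoc)
  have i1: "integrable M (\<lambda>\<omega>. complex_of_real (Z \<omega>) * e \<omega>)"
    unfolding e_def by (rule integrable_expB[OF mZ Z(2)])
  have i2: "integrable M (\<lambda>\<omega>. complex_of_real (Z \<omega>) * exp (- y \<omega>) * e \<omega>)"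
    unfolding e_def
  proof (rule integrable_exp[of _ "\<beta> * exp 3"])
    show "AE \<omega> in M. norm (complex_of_real (Z \<omega>) * exp (- y \<omega>)) \<le> \<beta> * exp 3"
      using Z(2) AEexp by eventually_elim (auto simp: norm_mult intro!: mult_mono \<beta>)
  qed measurable
  have rem: "AE \<omega> in M. norm (complex_of_real (Z \<omega>) * (1 - exp (- y \<omega>) - g (y \<omega>))) \<le> \<beta> * (3 * (D * b)) ^ k * exp 3"
    using Z(2) AEy
  proof eventually_elim
    case (elim \<omega>)
    have "norm (1 - exp (- y \<omega>) - g (y \<omega>)) \<le> norm (y \<omega>) ^ k * exp (norm (y \<omega>))" by (rule g(2))
    also have "\<dots> \<le> (3 * (D * b)) ^ k * exp 3"
      using elim(2) c by (intro mult_mono power_mono) auto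
    finally have "\<bar>Z \<omega>\<bar> * norm (1 - exp (- y \<omega>) - g (y \<omega>)) \<le> \<beta> * ((3 * (D * b)) ^ k * exp 3)"
      using elim(1) \<beta> by (intro mult_mono) auto
    then show ?case by (simp add: norm_mult mult.assoc)
  qed
  have i3: "integrable M (\<lambda>\<omega>. complex_of_real (Z \<omega>) * (1 - exp (- y \<omega>) - g (y \<omega>)) * e \<omega>)"
    unfolding e_def by (rule integrable_exp[OF _ rem]) measurable
  have "(\<lambda>\<omega>. complex_of_real (Z \<omega>) * g (y \<omega>) * e \<omega>) = (\<lambda>\<omega>. complex_of_real (Z \<omega>) * e \<omega>
      - complex_of_real (Z \<omega>) * exp (- y \<omega>) * e \<omega> - complex_of_real (Z \<omega>) * (1 - exp (- y \<omega>) - g (y \<omega>)) * e \<omega>)"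
    by (simp add: fun_eq_iff algebra_simps)
  then have "(CLINT \<omega>|M. complex_of_real (Z \<omega>) * g (y \<omega>) * e \<omega>) = (CLINT \<omega>|M. complex_of_real (Z \<omega>) * e \<omega>)
      - (CLINT \<omega>|M. complex_of_real (Z \<omega>) * (1 - exp (- y \<omega>) - g (y \<omega>)) * e \<omega>)"
    using i1 i2 i3 zero by simp
  then have "E z Z - (CLINT \<omega>|M. complex_of_real (Z \<omega>) * g (y \<omega>) * e \<omega>)
      = (CLINT \<omega>|M. complex_of_real (Z \<omega>) * (1 - exp (- y \<omega>) - g (y \<omega>)) * e \<omega>)"
    by (simp add: E_def e_def)
  also have "norm \<dots> \<le> \<beta> * (3 * (D * b)) ^ k * exp 3 * rmgf (Re z)"
    unfolding e_def by (rule norm_integral_exp_le[OF _ rem]) measurable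
  finally show ?thesis by (simp add: y_def e_def)
qed

end

context bounded_scores
begin

lemma rmgf_nonneg: "0 \<le> rmgf t"
  unfolding rmgf_def by (rule integral_nonneg_AE) simp

lemma E_diff_const:
  assumes B: "B \<in> borel_measurable M" "AE \<omega> in M. \<bar>B \<omega>\<bar> \<le> \<beta>"
  shows "E z (\<lambda>\<omega>. B \<omega> - c) = E z B - complex_of_real c * mgf z"
proof -
  have "integrable M (\<lambda>\<omega>. complex_of_real 1 * exp (z * complex_of_real (W \<omega>)))"
    by (rule integrable_expB[of _ 1]) auto
  then show ?thesis using integrable_expB[OF B, of z]
    unfolding E_def mgf_def by (simp add: left_diff_distrib)
qed

lemma abs_expectation_le:
  fixes B :: "'a \<Rightarrow> real"
  assumes B: "B \<in> borel_measurable M" "AE \<omega> in M. \<bar>B \<omega>\<bar> \<le> \<beta>"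
  shows "\<bar>expectation B\<bar> \<le> \<beta>"
proof -
  have i: "integrable M B" by (rule integrable_const_bound[of _ \<beta>]) (use B in auto)
  have "\<bar>expectation B\<bar> \<le> expectation (\<lambda>\<omega>. \<bar>B \<omega>\<bar>)" by (rule integral_abs_bound)
  also have "\<dots> \<le> expectation (\<lambda>_. \<beta>)"
    by (rule integral_mono_AE) (use B i in auto)
  finally show ?thesis by (simp add: prob_space)
qed

lemma AE_centered:
  fixes B :: "'a \<Rightarrow> real"
  assumes B: "B \<in> borel_measurable M" "AE \<omega> in M. \<bar>B \<omega>\<bar> \<le> \<beta>"
  shows "AE \<omega> in M. \<bar>B \<omega> - expectation B\<bar> \<le> 2 * \<beta>"
  using B(2)
proof eventually_elim
  case (elim \<omega>)
  then show ?case using abs_expectation_le[OF B] by linarith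
qed

text \<open>\<open>E_centered\<close> for B minus its mean with g = 0; the first-order remainder
  costs a factor 3 D b, and centring doubles \<beta>.\<close>

lemma E_factorises:
  assumes S: "finite S" "S \<subseteq> I" "card S \<le> 3"
    and B: "dep_on S B" "AE \<omega> in M. \<bar>B \<omega>\<bar> \<le> \<beta>" and z: "norm z \<le> 1"
  shows "norm (E z B - complex_of_real (expectation B) * mgf z) \<le> 6 * \<beta> * (D * b) * exp 3 * rmgf (Re z)"
proof -
  have mB: "B \<in> borel_measurable M" by (rule dep_on_measurable[OF B(1) S(2)])
  have i: "integrable M B" by (rule integrable_const_bound[of _ \<beta>]) (use B mB in auto)
  have "norm (E z (\<lambda>\<omega>. B \<omega> - expectation B) - (CLINT \<omega>|M. complex_of_real (B \<omega> - expectation B) * 0 * exp (z * complex_of_real (W \<omega>))))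
    \<le> (2 * \<beta>) * (3 * (D * b)) ^ 1 * exp 3 * rmgf (Re z)"
  proof (rule E_centered[OF S, where g = "\<lambda>_. 0"])
    show "dep_on S (\<lambda>\<omega>. B \<omega> - expectation B)" by (rule dep_on_diff_const[OF B(1)])
    show "expectation (\<lambda>\<omega>. B \<omega> - expectation B) = 0" using i by (simp add: prob_space)
    show "norm (1 - exp (- w) - 0) \<le> norm w ^ 1 * exp (norm w)" for w :: complex
      using exp_remainder_le(1)[of w] by simp
  qed (use z AE_centered[OF mB B(2)] in auto)
  then show ?thesis by (simp add: E_diff_const[OF mB B(2)] mult_ac)
qed

lemma AE_prod2:
  assumes "i \<in> I" "j \<in> I" shows "AE \<omega> in M. \<bar>X i \<omega> * X j \<omega>\<bar> \<le> b\<^sup>2"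
  using bounded[OF assms(1)] bounded[OF assms(2)]
proof eventually_elim
  case (elim \<omega>)
  then show ?case unfolding abs_mult power2_eq_square using b_nonneg by (intro mult_mono) auto
qed

lemma AE_prod3:
  assumes "i \<in> I" "j \<in> I" "k \<in> I" shows "AE \<omega> in M. \<bar>X i \<omega> * X j \<omega> * X k \<omega>\<bar> \<le> b ^ 3"
  using AE_prod2[OF assms(1,2)] bounded[OF assms(3)]
proof eventually_elim
  case (elim \<omega>)
  then have "\<bar>X i \<omega> * X j \<omega>\<bar> * \<bar>X k \<omega>\<bar> \<le> b\<^sup>2 * b" using b_nonneg by (intro mult_mono) auto
  then show ?case by (simp add: abs_mult power3_eq_cube power2_eq_square)
qed

lemma dep_prod2: "i \<in> I \<Longrightarrow> j \<in> I \<Longrightarrow> i \<in> S \<Longrightarrow> j \<in> S \<Longrightarrow> dep_on S (\<lambda>\<omega>. X i \<omega> * X j \<omega>)"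
  by (intro dep_on_mult dep_on_mono[OF dep]) auto

lemma U_props:
  assumes ij: "i \<in> I" "j \<in> I"
  shows "dep_on {i, j} (U i j)" "U i j \<in> borel_measurable M" "AE \<omega> in M. \<bar>U i j \<omega>\<bar> \<le> 2 * b\<^sup>2" "expectation (U i j) = 0"
proof -
  have m: "(\<lambda>\<omega>. X i \<omega> * X j \<omega>) \<in> borel_measurable M" using measX ij by measurable
  have i: "integrable M (\<lambda>\<omega>. X i \<omega> * X j \<omega>)"
    by (rule integrable_const_bound[of _ "b\<^sup>2"]) (use AE_prod2[OF ij] m in auto)
  show d: "dep_on {i, j} (U i j)" unfolding U_def by (rule dep_on_diff_const[OF dep_prod2]) (use ij in auto)
  show "U i j \<in> borel_measurable M" by (rule dep_on_measurable[OF d]) (use ij in auto)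
  show "AE \<omega> in M. \<bar>U i j \<omega>\<bar> \<le> 2 * b\<^sup>2" unfolding U_def by (rule AE_centered[OF m AE_prod2[OF ij]])
  show "expectation (U i j) = 0" unfolding U_def using i by (simp add: prob_space)
qed

lemma card_triple: "card {i, j, k :: nat} \<le> 3"
  by (simp add: card_insert_if)

text \<open>The centred product is expanded to first order at cost 2 times 9, and the resulting
  triples are factorised at cost 2 D neighbours times 12 D; together 42.\<close>

lemma E_pair:
  assumes ij: "i \<in> I" "j \<in> I" and z: "norm z \<le> 1"
  shows "norm (E z (\<lambda>\<omega>. X i \<omega> * X j \<omega>) - complex_of_real (expectation (\<lambda>\<omega>. X i \<omega> * X j \<omega>)) * mgf z
      - z * complex_of_real (\<Sum>k\<in>nbr {i, j}. expectation (\<lambda>\<omega>. U i j \<omega> * X k \<omega>)) * mgf z)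
     \<le> 42 * D\<^sup>2 * b ^ 4 * exp 3 * rmgf (Re z)"
proof -
  let ?S = "{i, j}" and ?m0 = "exp 3 * rmgf (Re z)"
  note Up = U_props[OF ij]
  have m0: "0 \<le> ?m0" using rmgf_nonneg by simp
  have S: "finite ?S" "?S \<subseteq> I" "card ?S \<le> 3" using ij card_triple[of i j j] by auto
  have UX: "AE \<omega> in M. \<bar>U i j \<omega> * X k \<omega>\<bar> \<le> 2 * b ^ 3" if k: "k \<in> I" for k
    using Up(3) bounded[OF k]
  proof eventually_elim
    case (elim \<omega>)
    then have "\<bar>U i j \<omega>\<bar> * \<bar>X k \<omega>\<bar> \<le> (2 * b\<^sup>2) * b" using b_nonneg by (intro mult_mono) auto
    then show ?case by (simp add: abs_mult power3_eq_cube power2_eq_square)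
  qed
  have mUX: "(\<lambda>\<omega>. U i j \<omega> * X k \<omega>) \<in> borel_measurable M" if "k \<in> I" for k
    using Up(2) measX[OF that] by measurable
  have step1: "norm (E z (U i j) - (CLINT \<omega>|M. complex_of_real (U i j \<omega>) * (z * complex_of_real (Y ?S \<omega>)) * exp (z * complex_of_real (W \<omega>))))
      \<le> (2 * b\<^sup>2) * (3 * (D * b)) ^ 2 * exp 3 * rmgf (Re z)"
    by (rule E_centered[OF S Up(1) Up(3) Up(4), where g = "\<lambda>w. w"]) (use z exp_remainder_le(2) in auto)
  have "(CLINT \<omega>|M. complex_of_real (U i j \<omega>) * (z * complex_of_real (Y ?S \<omega>)) * exp (z * complex_of_real (W \<omega>)))
      = z * E z (\<lambda>\<omega>. \<Sum>k\<in>nbr ?S. U i j \<omega> * X k \<omega>)"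
    unfolding E_def Y_def integral_mult_right_zero[symmetric]
    by (rule Bochner_Integration.integral_cong[OF refl]) (simp add: sum_distrib_left mult_ac)
  also have "E z (\<lambda>\<omega>. \<Sum>k\<in>nbr ?S. U i j \<omega> * X k \<omega>) = (\<Sum>k\<in>nbr ?S. E z (\<lambda>\<omega>. U i j \<omega> * X k \<omega>))"
    by (rule E_sum[OF finite_nbr]) (use nbr_subset UX mUX in auto)
  finally have eq1: "(CLINT \<omega>|M. complex_of_real (U i j \<omega>) * (z * complex_of_real (Y ?S \<omega>)) * exp (z * complex_of_real (W \<omega>)))
      = z * (\<Sum>k\<in>nbr ?S. E z (\<lambda>\<omega>. U i j \<omega> * X k \<omega>))" .
  have "(2 * b\<^sup>2) * (3 * (D * b)) ^ 2 * exp 3 * rmgf (Re z) = 18 * D\<^sup>2 * b ^ 4 * ?m0"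
    by (simp add: power_mult_distrib power2_eq_square power4_eq_xxxx)
  with step1 have step1': "norm (E z (U i j) - z * (\<Sum>k\<in>nbr ?S. E z (\<lambda>\<omega>. U i j \<omega> * X k \<omega>))) \<le> 18 * D\<^sup>2 * b ^ 4 * ?m0"
    unfolding eq1 by argo
  have "norm (E z (\<lambda>\<omega>. U i j \<omega> * X k \<omega>) - complex_of_real (expectation (\<lambda>\<omega>. U i j \<omega> * X k \<omega>)) * mgf z)
     \<le> 12 * D * b ^ 4 * ?m0" if "k \<in> nbr ?S" for k
  proof -
    have k: "k \<in> I" using that nbr_subset by auto
    have "dep_on {i, j, k} (\<lambda>\<omega>. U i j \<omega> * X k \<omega>)"
      by (intro dep_on_mult dep_on_mono[OF Up(1)] dep_on_mono[OF dep[OF k]]) auto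
    then have "norm (E z (\<lambda>\<omega>. U i j \<omega> * X k \<omega>) - complex_of_real (expectation (\<lambda>\<omega>. U i j \<omega> * X k \<omega>)) * mgf z)
      \<le> 6 * (2 * b ^ 3) * (D * b) * exp 3 * rmgf (Re z)"
      by (intro E_factorises[OF _ _ card_triple _ UX z]) (use ij k in auto)
    then show ?thesis by (simp add: power3_eq_cube power4_eq_xxxx mult_ac)
  qed
  then have "(\<Sum>k\<in>nbr ?S. norm (E z (\<lambda>\<omega>. U i j \<omega> * X k \<omega>) - complex_of_real (expectation (\<lambda>\<omega>. U i j \<omega> * X k \<omega>)) * mgf z))
      \<le> (\<Sum>k\<in>nbr ?S. 12 * D * b ^ 4 * ?m0)" by (rule sum_mono)
  also have "\<dots> = real (card (nbr ?S)) * (12 * D * b ^ 4 * ?m0)" by simp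
  also have "\<dots> \<le> (2 * D) * (12 * D * b ^ 4 * ?m0)"
  proof (rule mult_right_mono)
    have "real (card (nbr ?S)) \<le> real (card ?S) * D" using card_nbr S by blast
    also have "\<dots> \<le> 2 * D" using D_nonneg by (intro mult_right_mono) (auto simp: card_insert_if)
    finally show "real (card (nbr ?S)) \<le> 2 * D" .
  qed (use D_nonneg b_nonneg m0 in auto)
  also have "\<dots> = 24 * D\<^sup>2 * b ^ 4 * ?m0" by (simp add: power2_eq_square)
  finally have sum_le: "(\<Sum>k\<in>nbr ?S. norm (E z (\<lambda>\<omega>. U i j \<omega> * X k \<omega>) - complex_of_real (expectation (\<lambda>\<omega>. U i j \<omega> * X k \<omega>)) * mgf z))
      \<le> 24 * D\<^sup>2 * b ^ 4 * ?m0" .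
  have nz: "norm (z * x) \<le> norm x" for x using z by (simp add: norm_mult mult_left_le_one_le)
  have step2: "norm (z * ((\<Sum>k\<in>nbr ?S. E z (\<lambda>\<omega>. U i j \<omega> * X k \<omega>)) - (\<Sum>k\<in>nbr ?S. complex_of_real (expectation (\<lambda>\<omega>. U i j \<omega> * X k \<omega>)) * mgf z)))
     \<le> 24 * D\<^sup>2 * b ^ 4 * ?m0"
    unfolding sum_subtractf[symmetric] by (rule order_trans[OF nz order_trans[OF norm_sum sum_le]])
  have EU: "E z (U i j) = E z (\<lambda>\<omega>. X i \<omega> * X j \<omega>) - complex_of_real (expectation (\<lambda>\<omega>. X i \<omega> * X j \<omega>)) * mgf z"
    unfolding U_def by (rule E_diff_const[OF _ AE_prod2[OF ij]]) (use measX ij in measurable)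
  have sum_mgf: "(\<Sum>k\<in>nbr ?S. complex_of_real (expectation (\<lambda>\<omega>. U i j \<omega> * X k \<omega>)) * mgf z)
      = complex_of_real (\<Sum>k\<in>nbr ?S. expectation (\<lambda>\<omega>. U i j \<omega> * X k \<omega>)) * mgf z"
    by (simp add: sum_distrib_right)
  have "p - z * t * m = (p - z * s) + z * (s - t * m)" for p t m s :: complex
    by (simp add: algebra_simps)
  then have "E z (\<lambda>\<omega>. X i \<omega> * X j \<omega>) - complex_of_real (expectation (\<lambda>\<omega>. X i \<omega> * X j \<omega>)) * mgf z
      - z * complex_of_real (\<Sum>k\<in>nbr ?S. expectation (\<lambda>\<omega>. U i j \<omega> * X k \<omega>)) * mgf z
     = (E z (U i j) - z * (\<Sum>k\<in>nbr ?S. E z (\<lambda>\<omega>. U i j \<omega> * X k \<omega>)))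
      + z * ((\<Sum>k\<in>nbr ?S. E z (\<lambda>\<omega>. U i j \<omega> * X k \<omega>)) - (\<Sum>k\<in>nbr ?S. complex_of_real (expectation (\<lambda>\<omega>. U i j \<omega> * X k \<omega>)) * mgf z))"
    unfolding sum_mgf EU .
  also have "norm \<dots> \<le> 18 * D\<^sup>2 * b ^ 4 * ?m0 + 24 * D\<^sup>2 * b ^ 4 * ?m0"
    by (rule order_trans[OF norm_triangle_ineq add_mono[OF step1' step2]])
  finally show ?thesis by (simp add: algebra_simps)
qed

text \<open>Expanding a centred score to second order produces pairs, treated by
  \<open>E_pair\<close>, and triples, treated by \<open>E_factorises\<close>. The errors 27, 42 and
  6 / 2 add up to 72.\<close>

lemma E_single:
  assumes i: "i \<in> I" and z: "norm z \<le> 1"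
  shows "norm (E z (X i) - (z * complex_of_real (\<Sum>j\<in>nbr {i}. expectation (\<lambda>\<omega>. X i \<omega> * X j \<omega>))
     + z\<^sup>2 * complex_of_real ((\<Sum>j\<in>nbr {i}. \<Sum>k\<in>nbr {i, j}. expectation (\<lambda>\<omega>. U i j \<omega> * X k \<omega>))
         - (1/2) * (\<Sum>j\<in>nbr {i}. \<Sum>k\<in>nbr {i}. expectation (\<lambda>\<omega>. X i \<omega> * X j \<omega> * X k \<omega>)))) * mgf z)
     \<le> 72 * D ^ 3 * b ^ 4 * exp 3 * rmgf (Re z)"
proof -
  let ?S = "{i}" and ?m0 = "exp 3 * rmgf (Re z)"
  have m0: "0 \<le> ?m0" using rmgf_nonneg by simp
  have S: "finite ?S" "?S \<subseteq> I" "card ?S \<le> 3" using i by auto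
  have cS: "real (card (nbr ?S)) \<le> D" using card_nbr[of ?S] i by simp
  have nI: "\<And>j. j \<in> nbr ?S \<Longrightarrow> j \<in> I" using nbr_subset by auto
  have m2: "(\<lambda>\<omega>. X i \<omega> * X j \<omega>) \<in> borel_measurable M" if "j \<in> I" for j
    using measX[OF i] measX[OF that] by measurable
  have m3: "(\<lambda>\<omega>. X i \<omega> * X j \<omega> * X k \<omega>) \<in> borel_measurable M" if "j \<in> I" "k \<in> I" for j k
    using m2[OF that(1)] measX[OF that(2)] by measurable
  define A where "A = (\<Sum>j\<in>nbr ?S. E z (\<lambda>\<omega>. X i \<omega> * X j \<omega>))"
  define B where "B = (\<Sum>j\<in>nbr ?S. \<Sum>k\<in>nbr ?S. E z (\<lambda>\<omega>. X i \<omega> * X j \<omega> * X k \<omega>))"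
  define \<mu> where "\<mu> j = expectation (\<lambda>\<omega>. X i \<omega> * X j \<omega>)" for j
  define \<tau> where "\<tau> j = (\<Sum>k\<in>nbr {i, j}. expectation (\<lambda>\<omega>. U i j \<omega> * X k \<omega>))" for j
  define \<rho> where "\<rho> j k = expectation (\<lambda>\<omega>. X i \<omega> * X j \<omega> * X k \<omega>)" for j k
  define p where "p \<omega> = complex_of_real (X i \<omega>) * (z * complex_of_real (Y ?S \<omega>) - (z * complex_of_real (Y ?S \<omega>))\<^sup>2 / 2) * exp (z * complex_of_real (W \<omega>))" for \<omega>
  have step0: "norm (E z (X i) - (CLINT \<omega>|M. p \<omega>)) \<le> b * (3 * (D * b)) ^ 3 * exp 3 * rmgf (Re z)"
    unfolding p_def
    by (rule E_centered[OF S dep[OF i] bounded[OF i] mean_zero[OF i], where g = "\<lambda>w. w - w\<^sup>2 / 2"])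
       (use z exp_remainder_le(3) in auto)
  have EA: "E z (\<lambda>\<omega>. X i \<omega> * Y ?S \<omega>) = A"
    unfolding A_def Y_def sum_distrib_left
    by (rule E_sum[OF finite_nbr m2 AE_prod2]) (use nI i in auto)
  have EB: "E z (\<lambda>\<omega>. X i \<omega> * Y ?S \<omega> * Y ?S \<omega>) = B"
  proof -
    have "X i \<omega> * Y ?S \<omega> * Y ?S \<omega> = (\<Sum>(j, k)\<in>nbr ?S \<times> nbr ?S. X i \<omega> * X j \<omega> * X k \<omega>)" for \<omega>
    proof -
      have "X i \<omega> * Y ?S \<omega> * Y ?S \<omega> = X i \<omega> * (\<Sum>j\<in>nbr ?S. \<Sum>k\<in>nbr ?S. X j \<omega> * X k \<omega>)"
        by (simp only: Y_def sum_product mult.assoc)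
      also have "\<dots> = (\<Sum>j\<in>nbr ?S. \<Sum>k\<in>nbr ?S. X i \<omega> * X j \<omega> * X k \<omega>)"
        by (simp only: sum_distrib_left mult.assoc)
      finally show ?thesis by (simp only: sum.cartesian_product)
    qed
    then have "E z (\<lambda>\<omega>. X i \<omega> * Y ?S \<omega> * Y ?S \<omega>) = E z (\<lambda>\<omega>. \<Sum>p\<in>nbr ?S \<times> nbr ?S. X i \<omega> * X (fst p) \<omega> * X (snd p) \<omega>)"
      by (simp add: case_prod_beta)
    also have "\<dots> = (\<Sum>p\<in>nbr ?S \<times> nbr ?S. E z (\<lambda>\<omega>. X i \<omega> * X (fst p) \<omega> * X (snd p) \<omega>))"
      by (rule E_sum[OF _ m3 AE_prod3]) (use finite_nbr nI i in auto)
    also have "\<dots> = B" unfolding B_def by (simp add: sum.cartesian_product case_prod_beta)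
    finally show ?thesis .
  qed
  have bY: "AE \<omega> in M. \<bar>X i \<omega> * Y ?S \<omega>\<bar> \<le> b * (3 * (D * b))"
    using bounded[OF i] AE_Y[OF S]
  proof eventually_elim
    case (elim \<omega>)
    then show ?case unfolding abs_mult using b_nonneg by (intro mult_mono) auto
  qed
  have bYY: "AE \<omega> in M. \<bar>X i \<omega> * Y ?S \<omega> * Y ?S \<omega>\<bar> \<le> b * (3 * (D * b)) * (3 * (D * b))"
    using bY AE_Y[OF S]
  proof eventually_elim
    case (elim \<omega>)
    then show ?case unfolding abs_mult[of "X i \<omega> * Y ?S \<omega>"] using b_nonneg D_nonneg by (intro mult_mono) auto
  qed
  have mi: "X i \<in> borel_measurable M" by (rule measX[OF i])
  have iY: "integrable M (\<lambda>\<omega>. complex_of_real (X i \<omega> * Y ?S \<omega>) * exp (z * complex_of_real (W \<omega>)))"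
    by (rule integrable_expB[OF _ bY]) (use mi in measurable)
  have iYY: "integrable M (\<lambda>\<omega>. complex_of_real (X i \<omega> * Y ?S \<omega> * Y ?S \<omega>) * exp (z * complex_of_real (W \<omega>)))"
    by (rule integrable_expB[OF _ bYY]) (use mi in measurable)
  have "(CLINT \<omega>|M. p \<omega>) = (CLINT \<omega>|M. z * (complex_of_real (X i \<omega> * Y ?S \<omega>) * exp (z * complex_of_real (W \<omega>)))
     - (z\<^sup>2 / 2) * (complex_of_real (X i \<omega> * Y ?S \<omega> * Y ?S \<omega>) * exp (z * complex_of_real (W \<omega>))))"
    by (rule Bochner_Integration.integral_cong[OF refl]) (simp add: p_def power2_eq_square algebra_simps)
  also have "\<dots> = z * E z (\<lambda>\<omega>. X i \<omega> * Y ?S \<omega>) - (z\<^sup>2 / 2) * E z (\<lambda>\<omega>. X i \<omega> * Y ?S \<omega> * Y ?S \<omega>)"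
    unfolding E_def by (subst Bochner_Integration.integral_diff) (use iY iYY in auto)
  finally have p: "(CLINT \<omega>|M. p \<omega>) = z * A - (z\<^sup>2 / 2) * B" by (simp only: EA EB)
  have stepA: "norm (A - (\<Sum>j\<in>nbr ?S. complex_of_real (\<mu> j) * mgf z + z * complex_of_real (\<tau> j) * mgf z)) \<le> D * (42 * D\<^sup>2 * b ^ 4 * ?m0)"
  proof -
    have "norm (A - (\<Sum>j\<in>nbr ?S. complex_of_real (\<mu> j) * mgf z + z * complex_of_real (\<tau> j) * mgf z))
       \<le> (\<Sum>j\<in>nbr ?S. norm (E z (\<lambda>\<omega>. X i \<omega> * X j \<omega>) - (complex_of_real (\<mu> j) * mgf z + z * complex_of_real (\<tau> j) * mgf z)))"
      unfolding A_def sum_subtractf[symmetric] by (rule norm_sum)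
    also have "\<dots> \<le> (\<Sum>j\<in>nbr ?S. 42 * D\<^sup>2 * b ^ 4 * ?m0)"
    proof (rule sum_mono)
      fix j assume j: "j \<in> nbr ?S"
      show "norm (E z (\<lambda>\<omega>. X i \<omega> * X j \<omega>) - (complex_of_real (\<mu> j) * mgf z + z * complex_of_real (\<tau> j) * mgf z)) \<le> 42 * D\<^sup>2 * b ^ 4 * ?m0"
        using E_pair[OF i nI[OF j] z] by (simp add: \<mu>_def \<tau>_def mult_ac diff_diff_eq)
    qed
    also have "\<dots> = real (card (nbr ?S)) * (42 * D\<^sup>2 * b ^ 4 * ?m0)" by simp
    also have "\<dots> \<le> D * (42 * D\<^sup>2 * b ^ 4 * ?m0)"
      using cS by (rule mult_right_mono) (use D_nonneg b_nonneg m0 in auto)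
    finally show ?thesis .
  qed
  have stepB: "norm (B - (\<Sum>j\<in>nbr ?S. \<Sum>k\<in>nbr ?S. complex_of_real (\<rho> j k) * mgf z)) \<le> D * (D * (6 * D * b ^ 4 * ?m0))"
  proof -
    have "norm (B - (\<Sum>j\<in>nbr ?S. \<Sum>k\<in>nbr ?S. complex_of_real (\<rho> j k) * mgf z))
       \<le> (\<Sum>j\<in>nbr ?S. \<Sum>k\<in>nbr ?S. norm (E z (\<lambda>\<omega>. X i \<omega> * X j \<omega> * X k \<omega>) - complex_of_real (\<rho> j k) * mgf z))"
      unfolding B_def sum_subtractf[symmetric] by (intro order_trans[OF norm_sum] sum_mono norm_sum)
    also have "\<dots> \<le> (\<Sum>j\<in>nbr ?S. \<Sum>k\<in>nbr ?S. 6 * D * b ^ 4 * ?m0)"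
    proof (intro sum_mono)
      fix j k assume j: "j \<in> nbr ?S" and k: "k \<in> nbr ?S"
      have "dep_on {i, j, k} (\<lambda>\<omega>. X i \<omega> * X j \<omega> * X k \<omega>)"
        by (intro dep_on_mult dep_on_mono[OF dep]) (use i nI[OF j] nI[OF k] in auto)
      then have "norm (E z (\<lambda>\<omega>. X i \<omega> * X j \<omega> * X k \<omega>) - complex_of_real (\<rho> j k) * mgf z) \<le> 6 * b ^ 3 * (D * b) * exp 3 * rmgf (Re z)"
        unfolding \<rho>_def by (intro E_factorises[OF _ _ card_triple _ AE_prod3 z]) (use i nI[OF j] nI[OF k] in auto)
      then show "norm (E z (\<lambda>\<omega>. X i \<omega> * X j \<omega> * X k \<omega>) - complex_of_real (\<rho> j k) * mgf z) \<le> 6 * D * b ^ 4 * ?m0"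
        by (simp add: power3_eq_cube power4_eq_xxxx mult_ac)
    qed
    also have "\<dots> = real (card (nbr ?S)) * (real (card (nbr ?S)) * (6 * D * b ^ 4 * ?m0))" by simp
    also have "\<dots> \<le> D * (D * (6 * D * b ^ 4 * ?m0))"
      using cS by (intro mult_mono) (use D_nonneg b_nonneg rmgf_nonneg in auto)
    finally show ?thesis .
  qed
  have nz: "norm (z * x) \<le> norm x" for x using z by (simp add: norm_mult mult_left_le_one_le)
  have nz2: "norm ((z\<^sup>2 / 2) * x) \<le> norm x / 2" for x
    using nz[of "z * x"] nz[of x] by (simp add: power2_eq_square norm_mult norm_divide mult.assoc)
  let ?a = "\<Sum>j\<in>nbr ?S. complex_of_real (\<mu> j) * mgf z + z * complex_of_real (\<tau> j) * mgf z"
  let ?b = "\<Sum>j\<in>nbr ?S. \<Sum>k\<in>nbr ?S. complex_of_real (\<rho> j k) * mgf z"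
  have a_eq: "?a = complex_of_real (\<Sum>j\<in>nbr ?S. \<mu> j) * mgf z + z * complex_of_real (\<Sum>j\<in>nbr ?S. \<tau> j) * mgf z"
    by (simp only: of_real_sum sum.distrib sum_distrib_left sum_distrib_right mult.assoc)
  have b_eq: "?b = complex_of_real (\<Sum>j\<in>nbr ?S. \<Sum>k\<in>nbr ?S. \<rho> j k) * mgf z"
    by (simp only: of_real_sum sum_distrib_right)
  have ab: "(z * complex_of_real (\<Sum>j\<in>nbr ?S. \<mu> j) + z\<^sup>2 * complex_of_real ((\<Sum>j\<in>nbr ?S. \<tau> j)
      - (1/2) * (\<Sum>j\<in>nbr ?S. \<Sum>k\<in>nbr ?S. \<rho> j k))) * mgf z = z * ?a - (z\<^sup>2 / 2) * ?b"
    unfolding a_eq b_eq of_real_diff of_real_mult by (simp add: power2_eq_square algebra_simps del: of_real_sum)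
  have split: "E z (X i) - (z * ?a - (z\<^sup>2 / 2) * ?b) = (E z (X i) - (CLINT \<omega>|M. p \<omega>)) + z * (A - ?a) - (z\<^sup>2 / 2) * (B - ?b)"
    unfolding p by (simp add: algebra_simps)
  have "norm ((E z (X i) - (CLINT \<omega>|M. p \<omega>)) + z * (A - ?a) - (z\<^sup>2 / 2) * (B - ?b))
      \<le> norm (E z (X i) - (CLINT \<omega>|M. p \<omega>)) + norm (z * (A - ?a)) + norm ((z\<^sup>2 / 2) * (B - ?b))"
    by (rule order_trans[OF norm_triangle_ineq4 add_right_mono[OF norm_triangle_ineq]])
  moreover have "norm (z * (A - ?a)) \<le> D * (42 * D\<^sup>2 * b ^ 4 * ?m0)" by (rule order_trans[OF nz stepA])
  moreover have "norm ((z\<^sup>2 / 2) * (B - ?b)) \<le> D * (D * (6 * D * b ^ 4 * ?m0)) / 2"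
    by (rule order_trans[OF nz2 divide_right_mono[OF stepB]]) simp
  moreover have "b * (3 * (D * b)) ^ 3 * exp 3 * rmgf (Re z) + D * (42 * D\<^sup>2 * b ^ 4 * ?m0) + D * (D * (6 * D * b ^ 4 * ?m0)) / 2
      = 72 * D ^ 3 * b ^ 4 * exp 3 * rmgf (Re z)"
    by (simp add: power3_eq_cube power2_eq_square power4_eq_xxxx)
  ultimately have "norm (E z (X i) - (z * ?a - (z\<^sup>2 / 2) * ?b)) \<le> 72 * D ^ 3 * b ^ 4 * exp 3 * rmgf (Re z)"
    unfolding split using step0 by linarith
  then show ?thesis unfolding ab[symmetric] by (simp only: \<mu>_def[abs_def] \<tau>_def[abs_def] \<rho>_def[abs_def])
qed

text \<open>Total error of the expansion. With D twice the maximal degree and b of order lam^(-1/2)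
  it is a multiple of the accumulation ratio.\<close>

definition \<eta> where "\<eta> = 72 * exp 3 * real (card I) * D ^ 3 * b ^ 4"

lemma E_W:
  assumes z: "norm z \<le> 1"
  shows "norm (E z W - (z * complex_of_real \<sigma>2 + z\<^sup>2 * complex_of_real \<kappa>) * mgf z) \<le> \<eta> * rmgf (Re z)"
proof -
  let ?t = "\<lambda>i. (z * complex_of_real (\<Sum>j\<in>nbr {i}. expectation (\<lambda>\<omega>. X i \<omega> * X j \<omega>))
     + z\<^sup>2 * complex_of_real ((\<Sum>j\<in>nbr {i}. \<Sum>k\<in>nbr {i, j}. expectation (\<lambda>\<omega>. U i j \<omega> * X k \<omega>))
         - (1/2) * (\<Sum>j\<in>nbr {i}. \<Sum>k\<in>nbr {i}. expectation (\<lambda>\<omega>. X i \<omega> * X j \<omega> * X k \<omega>)))) * mgf z"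
  have EW: "E z W = (\<Sum>i\<in>I. E z (X i))"
    unfolding W_def by (rule E_sum[OF finite_I measX bounded])
  have t: "(z * complex_of_real \<sigma>2 + z\<^sup>2 * complex_of_real \<kappa>) * mgf z = (\<Sum>i\<in>I. ?t i)"
    unfolding \<sigma>2_def \<kappa>_def of_real_sum of_real_diff of_real_mult sum_distrib_right[symmetric] sum.distrib
      sum_distrib_left[symmetric] sum_subtractf ..
  have "norm (E z W - (z * complex_of_real \<sigma>2 + z\<^sup>2 * complex_of_real \<kappa>) * mgf z) \<le> (\<Sum>i\<in>I. norm (E z (X i) - ?t i))"
    unfolding EW t sum_subtractf[symmetric] by (rule norm_sum)
  also have "\<dots> \<le> (\<Sum>i\<in>I. 72 * D ^ 3 * b ^ 4 * exp 3 * rmgf (Re z))"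
    by (intro sum_mono E_single z)
  finally show ?thesis by (simp add: \<eta>_def mult_ac)
qed

end

section \<open>From the differential equation to the characteristic function\<close>

context bounded_scores
begin

text \<open>W is almost surely bounded, so the second-order remainder of exp(h W) is dominated by a
  multiple of |h|^2; the size of that multiple does not matter.\<close>

lemma mgf_has_derivative: "(mgf has_field_derivative E z W) (at z within S)"
proof -
  define c where "c = real (card I) * b"
  have c0: "0 \<le> c" unfolding c_def using b_nonneg by simp
  define K where "K = c\<^sup>2 * exp c * rmgf (Re z)"
  have main: "norm ((mgf (z + h) - mgf z) - h * E z W) \<le> (norm h)\<^sup>2 * K" if h: "norm h \<le> 1" for h
  proof -
    let ?e = "\<lambda>\<omega>. exp (z * complex_of_real (W \<omega>))"
    let ?f = "\<lambda>\<omega>. exp (h * complex_of_real (W \<omega>)) - 1 - h * complex_of_real (W \<omega>)"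
    have bd: "AE \<omega> in M. norm (?f \<omega>) \<le> (norm h)\<^sup>2 * (c\<^sup>2 * exp c)"
      using AE_W
    proof eventually_elim
      case (elim \<omega>)
      let ?w = "h * complex_of_real (W \<omega>)"
      have nw: "norm ?w \<le> norm h * c" using elim by (simp add: norm_mult c_def mult_left_mono)
      also have "\<dots> \<le> 1 * c" using h c0 by (intro mult_right_mono)
      finally have nw': "norm ?w \<le> c" by simp
      have eq: "?f \<omega> = - (1 - exp (- (- ?w)) - (- ?w))" by simp
      have "norm (?f \<omega>) \<le> (norm ?w)\<^sup>2 * exp (norm ?w)"
        unfolding eq norm_minus_cancel[of "1 - exp (- (- ?w)) - (- ?w)"] using exp_remainder_le(2)[of "- ?w"] by (simp only: norm_minus_cancel)
      also have "\<dots> \<le> (norm h * c)\<^sup>2 * exp c" using nw nw' by (intro mult_mono power_mono) auto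
      finally show ?case by (simp add: power_mult_distrib mult_ac)
    qed
    have i1: "integrable M (\<lambda>\<omega>. ?f \<omega> * ?e \<omega>)"
      by (rule integrable_exp[OF _ bd]) measurable
    have i2: "integrable M (\<lambda>\<omega>. complex_of_real 1 * exp (w * complex_of_real (W \<omega>)))" for w
      by (rule integrable_expB[of _ 1]) auto
    have i3: "integrable M (\<lambda>\<omega>. complex_of_real (W \<omega>) * ?e \<omega>)"
      by (rule integrable_expB[OF measW AE_W])
    have "(\<lambda>\<omega>. ?f \<omega> * ?e \<omega>) = (\<lambda>\<omega>. complex_of_real 1 * exp ((z + h) * complex_of_real (W \<omega>)) - complex_of_real 1 * ?e \<omega>
         - h * (complex_of_real (W \<omega>) * ?e \<omega>))"
      by (simp add: fun_eq_iff distrib_right exp_add algebra_simps)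
    then have "(CLINT \<omega>|M. ?f \<omega> * ?e \<omega>) = (mgf (z + h) - mgf z) - h * E z W"
      unfolding mgf_def E_def using i2[of "z + h"] i2[of z] i3 by simp
    then have "norm ((mgf (z + h) - mgf z) - h * E z W) = norm (CLINT \<omega>|M. ?f \<omega> * ?e \<omega>)" by simp
    also have "\<dots> \<le> (norm h)\<^sup>2 * (c\<^sup>2 * exp c) * rmgf (Re z)"
      by (rule norm_integral_exp_le[OF _ bd]) measurable
    finally show ?thesis by (simp add: K_def mult_ac)
  qed
  have "((\<lambda>h. (mgf (z + h) - mgf z) / h - E z W) \<longlongrightarrow> 0) (at 0)"
  proof (rule Lim_null_comparison)
    show "\<forall>\<^sub>F h in at 0. norm ((mgf (z + h) - mgf z) / h - E z W) \<le> norm h * K"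
      unfolding eventually_at
    proof (intro exI[of _ 1] conjI ballI impI)
      fix h :: complex assume h: "h \<noteq> 0 \<and> dist h 0 < 1"
      have "(mgf (z + h) - mgf z) / h - E z W = ((mgf (z + h) - mgf z) - h * E z W) / h"
        using h by (simp add: field_simps)
      then have "norm ((mgf (z + h) - mgf z) / h - E z W) \<le> (norm h)\<^sup>2 * K / norm h"
        using main[of h] h by (simp add: norm_divide divide_right_mono)
      then show "norm ((mgf (z + h) - mgf z) / h - E z W) \<le> norm h * K"
        using h by (simp add: power2_eq_square)
    qed simp
    show "((\<lambda>h. norm h * K) \<longlongrightarrow> 0) (at 0)" by (auto intro!: tendsto_eq_intros)
  qed
  then have "(mgf has_field_derivative E z W) (at z)"
    unfolding DERIV_def by (simp add: Lim_null[symmetric] LIM_zero_cancel)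
  then show ?thesis by (rule has_field_derivative_at_within)
qed

text \<open>A primitive of \<sigma>2 z + \<kappa> z^2, so that exp(-q) is the integrating factor of
  the approximate equation for \<open>mgf\<close>.\<close>

definition q where "q z = complex_of_real \<sigma>2 * z\<^sup>2 / 2 + complex_of_real \<kappa> * z ^ 3 / 3"

definition F where "F z = exp (- q z) * mgf z"

lemma F_has_derivative:
  "(F has_field_derivative exp (- q z) * (E z W - (z * complex_of_real \<sigma>2 + z\<^sup>2 * complex_of_real \<kappa>) * mgf z)) (at z within S)"
proof -
  have "(q has_field_derivative (z * complex_of_real \<sigma>2 + z\<^sup>2 * complex_of_real \<kappa>)) (at z within S)"
    unfolding q_def by (auto intro!: derivative_eq_intros simp: field_simps)
  then show ?thesis unfolding F_def
    by (auto intro!: derivative_eq_intros mgf_has_derivative simp: algebra_simps)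
qed

lemma F_0: "F 0 = 1"
  by (simp add: F_def q_def mgf_def E_def prob_space)

text \<open>Pairs outside a neighbourhood are uncorrelated, so the restricted double sum is already
  the full variance.\<close>

lemma \<sigma>2_eq: "expectation (\<lambda>\<omega>. (W \<omega>)\<^sup>2) = \<sigma>2"
proof -
  have i2: "integrable M (\<lambda>\<omega>. X i \<omega> * X j \<omega>)" if "i \<in> I" "j \<in> I" for i j
    by (rule integrable_const_bound[of _ "b\<^sup>2"]) (use AE_prod2[OF that] measX that in auto)
  have i1: "integrable M (X i)" if "i \<in> I" for i
    by (rule integrable_const_bound[of _ b]) (use bounded[OF that] measX that in auto)
  have "expectation (\<lambda>\<omega>. (W \<omega>)\<^sup>2) = expectation (\<lambda>\<omega>. \<Sum>i\<in>I. \<Sum>j\<in>I. X i \<omega> * X j \<omega>)"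
    by (simp add: W_def power2_eq_square sum_product)
  also have "\<dots> = (\<Sum>i\<in>I. \<Sum>j\<in>I. expectation (\<lambda>\<omega>. X i \<omega> * X j \<omega>))"
    using i2 by (simp add: Bochner_Integration.integral_sum Bochner_Integration.integrable_sum)
  also have "\<dots> = \<sigma>2" unfolding \<sigma>2_def
  proof (rule sum.cong[OF refl])
    fix i assume i: "i \<in> I"
    show "(\<Sum>j\<in>I. expectation (\<lambda>\<omega>. X i \<omega> * X j \<omega>)) = (\<Sum>j\<in>nbr {i}. expectation (\<lambda>\<omega>. X i \<omega> * X j \<omega>))"
    proof (rule sum.mono_neutral_right[OF finite_I nbr_subset])
      show "\<forall>j\<in>I - nbr {i}. expectation (\<lambda>\<omega>. X i \<omega> * X j \<omega>) = 0"
      proof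
        fix j assume j: "j \<in> I - nbr {i}"
        have "expectation (\<lambda>\<omega>. X i \<omega> * X j \<omega>) = expectation (X i) * expectation (X j)"
          using i j by (intro indep_product[OF dep i1 dep i1]) (auto simp: nbr_def)
        then show "expectation (\<lambda>\<omega>. X i \<omega> * X j \<omega>) = 0" using mean_zero[OF i] by simp
      qed
    qed
  qed
  finally show ?thesis .
qed

lemma \<sigma>2_nonneg: "0 \<le> \<sigma>2"
  unfolding \<sigma>2_eq[symmetric] by (rule integral_nonneg_AE) simp

lemma mgf_of_real: "mgf (complex_of_real t) = complex_of_real (rmgf t)"
proof -
  have "mgf (complex_of_real t) = (CLINT \<omega>|M. complex_of_real (exp (t * W \<omega>)))"
    unfolding mgf_def E_def by (rule Bochner_Integration.integral_cong) (simp_all add: exp_of_real[symmetric])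
  then show ?thesis by (simp add: rmgf_def)
qed

text \<open>Jensen's inequality \<open>1 \<le> E[e\<^sup>W]\<close> turns the differential inequality for the moment generating
  function into a lower bound on \<open>\<kappa>\<close>.\<close>
lemma \<kappa>_lower: "0 \<le> \<sigma>2 / 2 + \<kappa> / 3 + \<eta>"
proof -
  define G where "G t = Re (F (complex_of_real t))" for t
  define G' where "G' t = Re (exp (- q (complex_of_real t)) * (E (complex_of_real t) W
     - (complex_of_real t * complex_of_real \<sigma>2 + (complex_of_real t)\<^sup>2 * complex_of_real \<kappa>) * mgf (complex_of_real t)))" for t
  have q_re: "q (complex_of_real t) = complex_of_real (\<sigma>2 * t\<^sup>2 / 2 + \<kappa> * t ^ 3 / 3)" for t
    by (simp add: q_def)
  have G_eq: "G t = exp (- (\<sigma>2 * t\<^sup>2 / 2 + \<kappa> * t ^ 3 / 3)) * rmgf t" for t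
    unfolding G_def F_def q_re mgf_of_real of_real_minus[symmetric] exp_of_real by simp
  have dG: "(G has_real_derivative G' t) (at t)" for t
  proof -
    have "((\<lambda>t. F (complex_of_real t)) has_vector_derivative exp (- q (complex_of_real t)) * (E (complex_of_real t) W
     - (complex_of_real t * complex_of_real \<sigma>2 + (complex_of_real t)\<^sup>2 * complex_of_real \<kappa>) * mgf (complex_of_real t))) (at t)"
      by (rule has_vector_derivative_real_field[OF F_has_derivative])
    from bounded_linear.has_vector_derivative[OF bounded_linear_Re this]
    show ?thesis unfolding has_real_derivative_iff_has_vector_derivative G_def G'_def .
  qed
  \<comment> \<open>The error in \<open>E_W\<close> is proportional to \<open>rmgf t\<close>, which
    the factor exp(-q) turns back into G.\<close>
  have G'_le: "G' t \<le> \<eta> * G t" if t: "0 \<le> t" "t \<le> 1" for t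
  proof -
    have "G' t \<le> norm (exp (- q (complex_of_real t)) * (E (complex_of_real t) W
     - (complex_of_real t * complex_of_real \<sigma>2 + (complex_of_real t)\<^sup>2 * complex_of_real \<kappa>) * mgf (complex_of_real t)))"
      unfolding G'_def by (rule complex_Re_le_cmod)
    also have "\<dots> \<le> exp (- (\<sigma>2 * t\<^sup>2 / 2 + \<kappa> * t ^ 3 / 3)) * (\<eta> * rmgf t)"
      unfolding norm_mult using E_W[of "complex_of_real t"] t
      by (intro mult_mono) (auto simp: q_re norm_exp_eq_Re)
    finally show ?thesis by (simp add: G_eq mult_ac)
  qed
  \<comment> \<open>Gronwall's argument: the product is nonincreasing, which bounds
    \<open>rmgf 1\<close> by exp(\<sigma>2/2 + \<kappa>/3 + \<eta>).\<close>
  have "G 1 * exp (- \<eta> * 1) \<le> G 0 * exp (- \<eta> * 0)"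
  proof (rule DERIV_nonpos_imp_nonincreasing[of 0 1 "\<lambda>t. G t * exp (- \<eta> * t)"])
    fix t :: real assume t: "0 \<le> t" "t \<le> 1"
    have "((\<lambda>t. G t * exp (- \<eta> * t)) has_real_derivative (G' t - \<eta> * G t) * exp (- \<eta> * t)) (at t)"
      by (auto intro!: derivative_eq_intros dG simp: algebra_simps)
    moreover have "(G' t - \<eta> * G t) * exp (- \<eta> * t) \<le> 0"
      using G'_le[OF t] by (simp add: mult_le_0_iff)
    ultimately show "\<exists>y. ((\<lambda>t. G t * exp (- \<eta> * t)) has_real_derivative y) (at t) \<and> y \<le> 0" by blast
  qed simp
  moreover have "G 0 = 1" using F_0 by (simp add: G_def)
  moreover have "G 1 * exp (- \<eta> * 1) = rmgf 1 * exp (- (\<sigma>2 / 2 + \<kappa> / 3 + \<eta>))"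
    unfolding G_eq by (simp add: mult_exp_exp mult_ac)
  ultimately have "rmgf 1 * exp (- (\<sigma>2 / 2 + \<kappa> / 3 + \<eta>)) \<le> 1" by simp
  moreover have "1 \<le> rmgf 1"
  proof -
    have i: "integrable M W" by (rule integrable_const_bound[OF _ measW]) (use AE_W in auto)
    have EW: "expectation W = 0"
    proof -
      have "integrable M (X n)" if "n \<in> I" for n
        by (rule integrable_const_bound[of _ b]) (use bounded[OF that] measX that in auto)
      then have "expectation W = (\<Sum>n\<in>I. expectation (X n))" unfolding W_def by simp
      then show ?thesis using mean_zero by simp
    qed
    have "expectation (\<lambda>\<omega>. 1 + W \<omega>) \<le> expectation (\<lambda>\<omega>. exp (1 * W \<omega>))"
      by (rule integral_mono) (use i integrable_rexp[of 1] in \<open>auto simp: exp_ge_add_one_self\<close>)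
    then show ?thesis using i EW by (simp add: rmgf_def prob_space)
  qed
  then have "1 * exp (- (\<sigma>2 / 2 + \<kappa> / 3 + \<eta>)) \<le> rmgf 1 * exp (- (\<sigma>2 / 2 + \<kappa> / 3 + \<eta>))"
    by (rule mult_right_mono) simp
  ultimately have "exp (- (\<sigma>2 / 2 + \<kappa> / 3 + \<eta>)) \<le> 1" by linarith
  then show ?thesis by simp
qed

text \<open>Along the segment from 0 to \<i> the cubic term of q is imaginary, so |exp(-q)| \<le>
  exp(\<sigma>2/2), and \<open>rmgf 0\<close> is 1. Multiplying back by exp(q \<i>) cancels that
  factor.\<close>

lemma char_approx: "norm (mgf \<i> - exp (- complex_of_real (\<sigma>2 / 2) - \<i> * complex_of_real (\<kappa> / 3))) \<le> \<eta>"
proof -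
  have rmgf0: "rmgf 0 = 1" by (simp add: rmgf_def prob_space)
  have "norm (F \<i> - F 0) \<le> exp (\<sigma>2 / 2) * \<eta> * norm (\<i> - 0)"
  proof (rule field_differentiable_bound[of "closed_segment 0 \<i>"])
    fix z assume "z \<in> closed_segment 0 \<i>"
    then obtain t where t: "0 \<le> t" "t \<le> 1" "z = t *\<^sub>R \<i>" by (auto simp: closed_segment_def)
    have rez: "Re z = 0" "norm z \<le> 1" using t by auto
    have "\<i> ^ 3 = - \<i>" by (simp add: power3_eq_cube)
    then have "z\<^sup>2 = - complex_of_real (t\<^sup>2)" "z ^ 3 = - (\<i> * complex_of_real (t ^ 3))"
      by (simp_all add: t(3) scaleR_conv_of_real power_mult_distrib)
    then have "Re (- q z) = \<sigma>2 * t\<^sup>2 / 2" by (simp add: q_def)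
    also have "\<dots> \<le> \<sigma>2 / 2" using t \<sigma>2_nonneg by (simp add: mult_left_le power_le_one)
    finally have "norm (exp (- q z)) \<le> exp (\<sigma>2 / 2)" by (simp add: norm_exp_eq_Re)
    then show "norm (exp (- q z) * (E z W - (z * complex_of_real \<sigma>2 + z\<^sup>2 * complex_of_real \<kappa>) * mgf z)) \<le> exp (\<sigma>2 / 2) * \<eta>"
      unfolding norm_mult using E_W[OF rez(2)] rez rmgf0 by (intro mult_mono) auto
  qed (use F_has_derivative in \<open>auto\<close>)
  then have FF: "norm (F \<i> - 1) \<le> exp (\<sigma>2 / 2) * \<eta>" by (simp add: F_0)
  have qi: "q \<i> = - complex_of_real (\<sigma>2 / 2) - \<i> * complex_of_real (\<kappa> / 3)"
    by (simp add: q_def power3_eq_cube)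
  have "mgf \<i> - exp (q \<i>) = exp (q \<i>) * (F \<i> - 1)"
    by (simp add: F_def algebra_simps exp_minus)
  then have "norm (mgf \<i> - exp (q \<i>)) \<le> exp (- \<sigma>2 / 2) * (exp (\<sigma>2 / 2) * \<eta>)"
    using FF by (simp add: norm_mult norm_exp_eq_Re qi)
  also have "\<dots> = \<eta>" by (simp add: mult.assoc[symmetric] exp_add[symmetric])
  finally show ?thesis by (simp add: qi)
qed

lemma scaled:
  assumes l: "\<bar>l\<bar> * (D * b) \<le> 1"
  shows "bounded_scores M I adj \<xi> D (\<lambda>n \<omega>. l * X n \<omega>) (\<bar>l\<bar> * b)"
proof
  fix n assume n: "n \<in> I"
  show "dep_on {n} (\<lambda>\<omega>. l * X n \<omega>)" by (rule dep_on_map[OF dep[OF n]]) simp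
  show "expectation (\<lambda>\<omega>. l * X n \<omega>) = 0" using mean_zero[OF n] by simp
  show "AE \<omega> in M. \<bar>l * X n \<omega>\<bar> \<le> \<bar>l\<bar> * b"
    using bounded[OF n] by eventually_elim (simp add: abs_mult mult_left_mono)
qed (use b_nonneg l in \<open>auto simp: mult_ac\<close>)

text \<open>\<sigma>2, \<kappa> and \<eta> are homogeneous of degrees 2, 3 and 4 in the scores; the
  odd degree of \<kappa> makes the sign of l informative.\<close>

lemma \<kappa>_lower_scaled:
  assumes l: "\<bar>l\<bar> * (D * b) \<le> 1"
  shows "0 \<le> l\<^sup>2 * \<sigma>2 / 2 + l ^ 3 * \<kappa> / 3 + l ^ 4 * \<eta>"
proof -
  interpret S: bounded_scores M I adj \<xi> D "\<lambda>n \<omega>. l * X n \<omega>" "\<bar>l\<bar> * b" by (rule scaled[OF l])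
  have 0: "expectation (\<lambda>\<omega>. l * X i \<omega> * (l * X j \<omega>)) = l\<^sup>2 * expectation (\<lambda>\<omega>. X i \<omega> * X j \<omega>)" for i j
  proof -
    have "expectation (\<lambda>\<omega>. l * X i \<omega> * (l * X j \<omega>)) = expectation (\<lambda>\<omega>. l\<^sup>2 * (X i \<omega> * X j \<omega>))"
      by (rule Bochner_Integration.integral_cong) (simp_all add: power2_eq_square)
    then show ?thesis by simp
  qed
  have 1: "S.\<sigma>2 = l\<^sup>2 * \<sigma>2"
    unfolding S.\<sigma>2_def \<sigma>2_def 0 by (simp only: sum_distrib_left)
  have SU: "S.U i j \<omega> = l\<^sup>2 * U i j \<omega>" for i j \<omega>
    unfolding S.U_def U_def 0 by (simp add: power2_eq_square algebra_simps)
  have 2: "expectation (\<lambda>\<omega>. S.U i j \<omega> * (l * X k \<omega>)) = l ^ 3 * expectation (\<lambda>\<omega>. U i j \<omega> * X k \<omega>)" for i j k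
  proof -
    have "expectation (\<lambda>\<omega>. S.U i j \<omega> * (l * X k \<omega>)) = expectation (\<lambda>\<omega>. l ^ 3 * (U i j \<omega> * X k \<omega>))"
      by (rule Bochner_Integration.integral_cong) (simp_all add: SU power2_eq_square power3_eq_cube)
    then show ?thesis by simp
  qed
  have 3: "expectation (\<lambda>\<omega>. l * X i \<omega> * (l * X j \<omega>) * (l * X k \<omega>)) = l ^ 3 * expectation (\<lambda>\<omega>. X i \<omega> * X j \<omega> * X k \<omega>)" for i j k
  proof -
    have "expectation (\<lambda>\<omega>. l * X i \<omega> * (l * X j \<omega>) * (l * X k \<omega>)) = expectation (\<lambda>\<omega>. l ^ 3 * (X i \<omega> * X j \<omega> * X k \<omega>))"
      by (rule Bochner_Integration.integral_cong) (simp_all add: power3_eq_cube)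
    then show ?thesis by simp
  qed
  have 4: "S.\<kappa> = l ^ 3 * \<kappa>"
    unfolding S.\<kappa>_def \<kappa>_def 2 3 right_diff_distrib by (simp add: sum_distrib_left mult.left_commute)
  have 5: "S.\<eta> = l ^ 4 * \<eta>"
    unfolding S.\<eta>_def \<eta>_def by (simp add: power_mult_distrib)
  show ?thesis using S.\<kappa>_lower unfolding 1 4 5 .
qed

text \<open>\<open>\<kappa>_lower_scaled\<close> at l and at -l, divided by l^3.\<close>

lemma \<kappa>_bound:
  assumes l: "0 < l" "l * (D * b) \<le> 1"
  shows "\<bar>\<kappa>\<bar> / 3 \<le> \<sigma>2 / (2 * l) + l * \<eta>"
proof -
  have "l ^ 3 * (\<bar>\<kappa>\<bar> / 3) \<le> l ^ 3 * (\<sigma>2 / (2 * l) + l * \<eta>)"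
  proof -
    have "l ^ 3 * (\<sigma>2 / (2 * l) + l * \<eta>) = l\<^sup>2 * \<sigma>2 / 2 + l ^ 4 * \<eta>"
      using l by (simp add: field_simps power2_eq_square power3_eq_cube power4_eq_xxxx)
    moreover have "0 \<le> l\<^sup>2 * \<sigma>2 / 2 + l ^ 3 * \<kappa> / 3 + l ^ 4 * \<eta>" using \<kappa>_lower_scaled[of l] l by simp
    moreover have "0 \<le> l\<^sup>2 * \<sigma>2 / 2 - l ^ 3 * \<kappa> / 3 + l ^ 4 * \<eta>" using \<kappa>_lower_scaled[of "- l"] l by simp
    ultimately show ?thesis by (cases "0 \<le> \<kappa>") auto
  qed
  then show ?thesis using l by simp
qed

text \<open>The parameter l is free up to l D b \<le> 1: a large l suppresses the variance term,
  while the smallness of \<eta> has to absorb the factor 1 + l.\<close>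

theorem char_bound:
  assumes l: "0 < l" "l * (D * b) \<le> 1"
  shows "norm ((CLINT \<omega>|M. iexp (W \<omega>)) - complex_of_real (exp (- \<sigma>2 / 2))) \<le> \<eta> * (1 + l) + \<sigma>2 / (2 * l)"
proof -
  have m: "mgf \<i> = (CLINT \<omega>|M. iexp (W \<omega>))" by (simp add: mgf_def E_def)
  have arg: "- complex_of_real (\<sigma>2 / 2) - \<i> * complex_of_real (\<kappa> / 3) = complex_of_real (- \<sigma>2 / 2) + \<i> * complex_of_real (- \<kappa> / 3)"
    by simp
  have "exp (- complex_of_real (\<sigma>2 / 2) - \<i> * complex_of_real (\<kappa> / 3)) - complex_of_real (exp (- \<sigma>2 / 2))
     = complex_of_real (exp (- \<sigma>2 / 2)) * (iexp (- \<kappa> / 3) - iexp 0)"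
    unfolding arg exp_add exp_of_real by (simp add: right_diff_distrib)
  then have "norm (exp (- complex_of_real (\<sigma>2 / 2) - \<i> * complex_of_real (\<kappa> / 3)) - complex_of_real (exp (- \<sigma>2 / 2)))
     = exp (- \<sigma>2 / 2) * norm (iexp (- \<kappa> / 3) - iexp 0)" by (simp add: norm_mult)
  also have "\<dots> \<le> 1 * \<bar>- \<kappa> / 3 - 0\<bar>" using \<sigma>2_nonneg by (intro mult_mono norm_iexp_diff_le) auto
  also have "\<dots> \<le> \<sigma>2 / (2 * l) + l * \<eta>" using \<kappa>_bound[OF l] by simp
  finally have "norm (mgf \<i> - complex_of_real (exp (- \<sigma>2 / 2))) \<le> \<eta> + (\<sigma>2 / (2 * l) + l * \<eta>)"
    using norm_triangle_ineq[of "mgf \<i> - exp (- complex_of_real (\<sigma>2 / 2) - \<i> * complex_of_real (\<kappa> / 3))"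
      "exp (- complex_of_real (\<sigma>2 / 2) - \<i> * complex_of_real (\<kappa> / 3)) - complex_of_real (exp (- \<sigma>2 / 2))"] char_approx
    by simp
  then show ?thesis by (simp add: m algebra_simps)
qed

end

section \<open>The jackknife for dyadic data\<close>

locale dyadic_config =
  fixes G N :: nat and psi :: "nat \<Rightarrow> nat set"
  assumes G2: "2 \<le> G"
    and dyads: "n \<in> {1..N} \<Longrightarrow> psi n \<subseteq> {1..G} \<and> card (psi n) = 2"
    and min_degree: "1 \<le> min_degree G N psi"
begin

abbreviation I where "I \<equiv> {1..N}"
abbreviation inc where "inc g \<equiv> incident N psi g"

definition D0 :: real where "D0 = real (max_degree G N psi)"

definition adj where "adj n m \<longleftrightarrow> psi n \<inter> psi m \<noteq> {}"

lemma inc_subset: "inc g \<subseteq> I" by (auto simp: incident_def)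

lemma finite_psi: "n \<in> I \<Longrightarrow> finite (psi n)"
  using dyads[of n] finite_subset by auto

lemma card_inc_le: "g \<in> {1..G} \<Longrightarrow> real (card (inc g)) \<le> D0"
  unfolding D0_def max_degree_def by (intro of_nat_mono Max_ge) auto

lemma card_inc_ge: "g \<in> {1..G} \<Longrightarrow> 1 \<le> card (inc g)"
proof -
  assume g: "g \<in> {1..G}"
  have "min_degree G N psi \<le> card (inc g)" unfolding min_degree_def using g by (intro Min_le) auto
  then show ?thesis using min_degree by simp
qed

lemma D0_ge: "1 \<le> D0"
  using card_inc_ge[of 1] card_inc_le[of 1] G2 by force

lemma D0_le: "D0 \<le> real N"
proof -
  have "card (inc g) \<le> N" for g using card_mono[OF _ inc_subset, of g] by simp
  then show ?thesis unfolding D0_def max_degree_def using G2 by (auto intro!: Max.boundedI)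
qed

lemma N_ge: "1 \<le> N"
  using D0_ge D0_le by simp

text \<open>The factor 2 is the number of units in a dyad.\<close>

lemma sum_incident:
  fixes f :: "nat \<Rightarrow> 'v::real_vector"
  shows "(\<Sum>g\<in>{1..G}. \<Sum>n\<in>inc g. f n) = 2 *\<^sub>R (\<Sum>n\<in>I. f n)"
proof -
  have "(\<Sum>g\<in>{1..G}. \<Sum>n\<in>inc g. f n) = (\<Sum>g\<in>{1..G}. \<Sum>n\<in>I. if g \<in> psi n then f n else 0)"
    unfolding incident_def by (intro sum.cong refl sum.inter_filter) simp
  also have "\<dots> = (\<Sum>n\<in>I. \<Sum>g\<in>{1..G}. if g \<in> psi n then f n else 0)" by (rule sum.swap)
  also have "\<dots> = (\<Sum>n\<in>I. 2 *\<^sub>R f n)"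
  proof (rule sum.cong[OF refl])
    fix n assume n: "n \<in> I"
    have "(\<Sum>g\<in>{1..G}. if g \<in> psi n then f n else 0) = (\<Sum>g\<in>{g \<in> {1..G}. g \<in> psi n}. f n)"
      by (rule sum.inter_filter[symmetric]) simp
    also have "{g \<in> {1..G}. g \<in> psi n} = psi n" using dyads[OF n] by auto
    also have "(\<Sum>g\<in>psi n. f n) = 2 *\<^sub>R f n"
      using dyads[OF n] by (simp add: sum_constant_scaleR)
    finally show "(\<Sum>g\<in>{1..G}. if g \<in> psi n then f n else 0) = 2 *\<^sub>R f n" .
  qed
  finally show ?thesis by (simp add: scaleR_sum_right)
qed

lemma sum_card_inc: "(\<Sum>g\<in>{1..G}. real (card (inc g))) = 2 * real N"
  using sum_incident[of "\<lambda>_. 1 :: real"] by simp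

lemma sum_card_inc_sq: "(\<Sum>g\<in>{1..G}. (real (card (inc g)))\<^sup>2) \<le> 2 * real N * D0"
proof -
  have "(\<Sum>g\<in>{1..G}. (real (card (inc g)))\<^sup>2) \<le> (\<Sum>g\<in>{1..G}. real (card (inc g)) * D0)"
    using card_inc_le by (intro sum_mono) (auto simp: power2_eq_square intro!: mult_left_mono)
  also have "\<dots> = 2 * real N * D0" using sum_card_inc by (simp add: sum_distrib_right[symmetric])
  finally show ?thesis .
qed

lemma adj_refl: "n \<in> I \<Longrightarrow> adj n n"
  using dyads[of n] by (auto simp: adj_def)

lemma adj_sym: "adj n m \<Longrightarrow> adj m n"
  by (auto simp: adj_def)

lemma degree_le:
  assumes n: "n \<in> I" shows "real (card {m \<in> I. adj n m}) \<le> 2 * D0"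
proof -
  have "{m \<in> I. adj n m} = (\<Union>g\<in>psi n. inc g)" by (auto simp: adj_def incident_def)
  then have "card {m \<in> I. adj n m} \<le> (\<Sum>g\<in>psi n. card (inc g))"
    using card_UN_le[OF finite_psi[OF n]] by simp
  then have "real (card {m \<in> I. adj n m}) \<le> (\<Sum>g\<in>psi n. real (card (inc g)))" by (metis of_nat_le_iff of_nat_sum)
  also have "\<dots> \<le> (\<Sum>g\<in>psi n. D0)" using dyads[OF n] by (intro sum_mono card_inc_le) auto
  finally show ?thesis using dyads[OF n] by simp
qed

text \<open>Two dyads share 0, 1 or 2 units, and 2 only if they coincide. The second indicator is
  the excess that the multiplicity condition has to absorb.\<close>

lemma card_Int_dyads:
  assumes "n \<in> I" "m \<in> I"
  shows "real (card (psi n \<inter> psi m)) = (if adj n m then 1 else 0) + (if psi m = psi n then 1 else 0)"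
proof (cases "psi m = psi n")
  case True
  then show ?thesis using dyads[OF assms(1)] adj_refl[OF assms(1)] by (simp add: adj_def)
next
  case False
  have c2: "card (psi n) = 2" "card (psi m) = 2" using dyads assms by blast+
  have "\<not> psi n \<subseteq> psi m"
    using card_subset_eq[OF finite_psi[OF assms(2)], of "psi n"] c2 False by auto
  then have "psi n \<inter> psi m \<subset> psi n" by blast
  then have "card (psi n \<inter> psi m) < 2" using psubset_card_mono[OF finite_psi[OF assms(1)]] c2(1) by metis
  moreover have "adj n m \<longleftrightarrow> card (psi n \<inter> psi m) \<noteq> 0"
    using finite_psi[OF assms(1)] by (simp add: adj_def)
  ultimately show ?thesis using False by (auto simp: less_2_cases_iff)
qed

text \<open>Interchanging the sums leaves the number of common units as the weight of a pair, so
  pairs without a common unit drop out.\<close>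

lemma sum_incident_product:
  fixes f h :: "nat \<Rightarrow> real"
  shows "(\<Sum>g\<in>{1..G}. (\<Sum>n\<in>inc g. f n) * (\<Sum>m\<in>inc g. h m)) =
    (\<Sum>n\<in>I. \<Sum>m\<in>{m \<in> I. adj n m}. real (card (psi n \<inter> psi m)) * (f n * h m))"
proof -
  have "(\<Sum>g\<in>{1..G}. (\<Sum>n\<in>inc g. f n) * (\<Sum>m\<in>inc g. h m)) =
     (\<Sum>g\<in>{1..G}. \<Sum>n\<in>I. \<Sum>m\<in>I. if g \<in> psi n \<inter> psi m then f n * h m else 0)"
  proof (rule sum.cong[OF refl])
    fix g
    have s: "(\<Sum>n\<in>inc g. k n) = (\<Sum>n\<in>I. if g \<in> psi n then k n else 0)" for k :: "nat \<Rightarrow> real"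
      unfolding incident_def by (rule sum.inter_filter) simp
    show "(\<Sum>n\<in>inc g. f n) * (\<Sum>m\<in>inc g. h m) = (\<Sum>n\<in>I. \<Sum>m\<in>I. if g \<in> psi n \<inter> psi m then f n * h m else 0)"
      unfolding s sum_product by (intro sum.cong refl) auto
  qed
  also have "\<dots> = (\<Sum>n\<in>I. \<Sum>g\<in>{1..G}. \<Sum>m\<in>I. if g \<in> psi n \<inter> psi m then f n * h m else 0)"
    by (rule sum.swap)
  also have "\<dots> = (\<Sum>n\<in>I. \<Sum>m\<in>I. \<Sum>g\<in>{1..G}. if g \<in> psi n \<inter> psi m then f n * h m else 0)"
    by (intro sum.cong refl sum.swap)
  also have "\<dots> = (\<Sum>n\<in>I. \<Sum>m\<in>I. real (card (psi n \<inter> psi m)) * (f n * h m))"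
  proof (intro sum.cong refl)
    fix n m assume n: "n \<in> I" and "m \<in> I"
    have "(\<Sum>g\<in>{1..G}. if g \<in> psi n \<inter> psi m then f n * h m else 0) = (\<Sum>g\<in>{g \<in> {1..G}. g \<in> psi n \<inter> psi m}. f n * h m)"
      by (rule sum.inter_filter[symmetric]) simp
    also have "{g \<in> {1..G}. g \<in> psi n \<inter> psi m} = psi n \<inter> psi m" using dyads[OF n] by auto
    finally show "(\<Sum>g\<in>{1..G}. if g \<in> psi n \<inter> psi m then f n * h m else 0) = real (card (psi n \<inter> psi m)) * (f n * h m)" by simp
  qed
  also have "\<dots> = (\<Sum>n\<in>I. \<Sum>m\<in>{m \<in> I. adj n m}. real (card (psi n \<inter> psi m)) * (f n * h m))"
    by (intro sum.cong refl sum.mono_neutral_right) (auto simp: adj_def)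
  finally show ?thesis .
qed

text \<open>Grouped by dyad, each of the L_d observations on d contributes L_d.\<close>

lemma multiplicity_sum_eq: "real (multiplicity_sum G N psi) = (\<Sum>n\<in>I. real (card {m \<in> I. psi m = psi n}))"
proof -
  let ?P = "{d. d \<subseteq> {1..G} \<and> card d = 2}"
  have fin: "finite ?P" by (rule finite_subset[of _ "Pow {1..G}"]) auto
  have "(\<Sum>n\<in>I. real (card {m \<in> I. psi m = psi n})) = (\<Sum>d\<in>?P. \<Sum>n\<in>{n \<in> I. psi n = d}. real (card {m \<in> I. psi m = psi n}))"
  proof (rule sum.group[symmetric])
    show "psi ` I \<subseteq> ?P" using dyads by blast
  qed (use fin in simp_all)
  also have "\<dots> = (\<Sum>d\<in>?P. (real (card {n \<in> I. psi n = d}))\<^sup>2)"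
    by (intro sum.cong refl) (simp add: power2_eq_square)
  finally show ?thesis by (simp add: multiplicity_sum_def)
qed

end

section \<open>The jackknife on one realisation\<close>

lemma quadratic_perturbation:
  fixes s r :: "'i \<Rightarrow> real"
  assumes J: "finite J" and t: "0 < t"
  shows "\<bar>(\<Sum>i\<in>J. (s i + r i)\<^sup>2) - (\<Sum>i\<in>J. (s i)\<^sup>2)\<bar> \<le> t * (\<Sum>i\<in>J. (s i)\<^sup>2) + (1 / t + 1) * (\<Sum>i\<in>J. (r i)\<^sup>2)"
proof -
  have "\<bar>(\<Sum>i\<in>J. (s i + r i)\<^sup>2) - (\<Sum>i\<in>J. (s i)\<^sup>2)\<bar> = \<bar>\<Sum>i\<in>J. 2 * s i * r i + (r i)\<^sup>2\<bar>"
    unfolding sum_subtractf[symmetric] by (simp add: power2_sum algebra_simps)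
  also have "\<dots> \<le> (\<Sum>i\<in>J. \<bar>2 * s i * r i + (r i)\<^sup>2\<bar>)" by (rule sum_abs)
  also have "\<dots> \<le> (\<Sum>i\<in>J. t * (s i)\<^sup>2 + (1 / t + 1) * (r i)\<^sup>2)"
  proof (rule sum_mono)
    fix i
    \<comment> \<open>Young's inequality with weight t, read off from the squares of t s + r and t s
      - r divided by t.\<close>
    have p: "0 \<le> (t * s i + r i)\<^sup>2 / t" "0 \<le> (t * s i - r i)\<^sup>2 / t" using t by simp_all
    have "(t * s i + r i)\<^sup>2 / t = t * (s i)\<^sup>2 + 2 * s i * r i + (r i)\<^sup>2 / t"
      "(t * s i - r i)\<^sup>2 / t = t * (s i)\<^sup>2 - 2 * s i * r i + (r i)\<^sup>2 / t"
      using t by (simp_all add: field_simps power2_eq_square)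
    with p have "\<bar>2 * s i * r i\<bar> \<le> t * (s i)\<^sup>2 + (r i)\<^sup>2 / t" by linarith
    then show "\<bar>2 * s i * r i + (r i)\<^sup>2\<bar> \<le> t * (s i)\<^sup>2 + (1 / t + 1) * (r i)\<^sup>2"
      using abs_triangle_ineq[of "2 * s i * r i" "(r i)\<^sup>2"] by (simp add: distrib_right)
  qed
  finally show ?thesis by (simp add: sum.distrib sum_distrib_left)
qed

lemma sum_sq_add_le: "(\<Sum>i\<in>J. (a i + b i :: real)\<^sup>2) \<le> 2 * (\<Sum>i\<in>J. (a i)\<^sup>2) + 2 * (\<Sum>i\<in>J. (b i)\<^sup>2)"
proof -
  have "(a i + b i)\<^sup>2 \<le> 2 * (a i)\<^sup>2 + 2 * (b i)\<^sup>2" for i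
    using zero_le_power2[of "a i - b i"] by (simp add: power2_sum power2_diff)
  then have "(\<Sum>i\<in>J. (a i + b i)\<^sup>2) \<le> (\<Sum>i\<in>J. 2 * (a i)\<^sup>2 + 2 * (b i)\<^sup>2)" by (intro sum_mono)
  then show ?thesis by (simp add: sum.distrib sum_distrib_left)
qed

lemma sum_sq_centered_le:
  fixes c :: "'i \<Rightarrow> real"
  assumes J: "finite J"
  shows "(\<Sum>i\<in>J. (c i - (\<Sum>j\<in>J. c j) / real (card J))\<^sup>2) \<le> (\<Sum>i\<in>J. (c i)\<^sup>2)"
proof (cases "J = {}")
  case False
  then have k: "0 < real (card J)" using J by (simp add: card_gt_0_iff)
  define m where "m = (\<Sum>j\<in>J. c j) / real (card J)"
  have m: "(\<Sum>j\<in>J. c j) = real (card J) * m" using k by (simp add: m_def)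
  have "(\<Sum>i\<in>J. (c i - m)\<^sup>2) = (\<Sum>i\<in>J. (c i)\<^sup>2) - 2 * m * (\<Sum>i\<in>J. c i) + real (card J) * m\<^sup>2"
  proof -
    have "(c i - m)\<^sup>2 = (c i)\<^sup>2 - 2 * m * c i + m\<^sup>2" for i by (simp add: power2_diff)
    then show ?thesis by (simp only: sum.distrib sum_subtractf sum_distrib_left[symmetric] sum_constant)
  qed
  also have "\<dots> = (\<Sum>i\<in>J. (c i)\<^sup>2) - real (card J) * m\<^sup>2" unfolding m by (simp add: power2_eq_square algebra_simps)
  finally show ?thesis using k by (simp add: m_def)
qed simp

lemma gram_apply: "gram J xs *v v = (\<Sum>n\<in>J. (xs n \<bullet> v) *\<^sub>R xs n)"
  by (cases "finite J", induction J rule: finite_induct)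
     (simp_all add: gram_def matrix_vector_mult_add_rdistrib outer_apply)

lemma abs_form_le: "\<bar>v \<bullet> (E *v v)\<bar> \<le> norm E * (v \<bullet> v)" for E :: "real ^ 'n ^ 'n"
proof -
  have "\<bar>v \<bullet> (E *v v)\<bar> \<le> norm v * norm (E *v v)" by (rule Cauchy_Schwarz_ineq2)
  also have "\<dots> \<le> norm v * (norm E * norm v)" by (intro mult_left_mono norm_matrix_vector_le) simp
  finally show ?thesis by (simp add: power2_norm_eq_inner[symmetric] power2_eq_square mult_ac)
qed

text \<open>One realisation with deterministic bounds. \<open>gram_close\<close> and
  \<open>degree_small\<close> each spend a quarter of cQ, which leaves every A_(g) / N coercive with
  constant cQ / 2.\<close>

locale jackknife_data = dyadic_config +
  fixes xs :: "nat \<Rightarrow> real ^ 'k" and us ys :: "nat \<Rightarrow> real" and \<beta> :: "real ^ 'k" and C :: real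
    and Q :: "real ^ 'k ^ 'k" and cQ :: real
  assumes model: "n \<in> {1..N} \<Longrightarrow> ys n = \<beta> \<bullet> xs n + us n"
    and bx: "n \<in> {1..N} \<Longrightarrow> norm (xs n) \<le> C" and bu: "n \<in> {1..N} \<Longrightarrow> \<bar>us n\<bar> \<le> C" and C1: "1 \<le> C"
    and cQ: "0 < cQ" and Qsym: "transpose Q = Q" and Qlow: "\<And>v. cQ * (v \<bullet> v) \<le> v \<bullet> (Q *v v)"
    and gram_close: "norm ((1 / real N) *\<^sub>R gram {1..N} xs - Q) \<le> cQ / 4"
    and degree_small: "D0 * C\<^sup>2 \<le> cQ / 4 * real N"
begin

abbreviation "A \<equiv> gram {1..N} xs"
abbreviation "Ag g \<equiv> gram (inc g) xs"
abbreviation "Ad g \<equiv> gram_del N psi xs g"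
definition S where "S = (\<Sum>n\<in>I. us n *\<^sub>R xs n)"
definition Sg where "Sg g = (\<Sum>n\<in>inc g. us n *\<^sub>R xs n)"
definition \<eta>1 where "\<eta>1 = norm ((1 / real N) *\<^sub>R A - Q)"
definition bt where "bt = ols N xs ys - \<beta>"
definition e where "e g = Sg g - Ag g *v bt"
definition d where "d g = ols N xs ys - ols_del N psi xs ys g"
text \<open>The common error budget: the Gram error, the size of the score sum and the largest
  degree are all at most of order D0 in expectation.\<close>

definition \<Psi> where "\<Psi> = real N * \<eta>1\<^sup>2 + (norm S)\<^sup>2 / real N + D0"

lemma N_pos: "0 < real N" using N_ge by simp

lemma norm_gram_apply_le:
  assumes "J \<subseteq> I" shows "norm (gram J xs *v v) \<le> real (card J) * C\<^sup>2 * norm v"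
proof -
  have "norm (gram J xs *v v) \<le> (\<Sum>n\<in>J. norm ((xs n \<bullet> v) *\<^sub>R xs n))" unfolding gram_apply by (rule norm_sum)
  also have "\<dots> \<le> (\<Sum>n\<in>J. C\<^sup>2 * norm v)"
  proof (rule sum_mono)
    fix n assume "n \<in> J"
    then have b: "norm (xs n) \<le> C" using bx assms by blast
    have "norm ((xs n \<bullet> v) *\<^sub>R xs n) \<le> (norm (xs n) * norm v) * norm (xs n)"
      unfolding norm_scaleR by (intro mult_right_mono Cauchy_Schwarz_ineq2) simp
    also have "\<dots> \<le> (C * norm v) * C" using b C1 by (intro mult_mono) auto
    finally show "norm ((xs n \<bullet> v) *\<^sub>R xs n) \<le> C\<^sup>2 * norm v" by (simp add: power2_eq_square mult_ac)
  qed
  finally show ?thesis by (simp add: mult_ac)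
qed

lemma norm_Ag_le: "g \<in> {1..G} \<Longrightarrow> norm (Ag g *v v) \<le> D0 * C\<^sup>2 * norm v"
  using norm_gram_apply_le[OF inc_subset, of g v] card_inc_le[of g]
  by (meson mult_right_mono norm_ge_zero order_trans zero_le_power2)

lemma norm_score_le:
  assumes "J \<subseteq> I" shows "norm (\<Sum>n\<in>J. us n *\<^sub>R xs n) \<le> real (card J) * C\<^sup>2"
proof -
  have "norm (\<Sum>n\<in>J. us n *\<^sub>R xs n) \<le> (\<Sum>n\<in>J. norm (us n *\<^sub>R xs n))" by (rule norm_sum)
  also have "\<dots> \<le> (\<Sum>n\<in>J. C * C)"
    unfolding norm_scaleR using assms bx bu C1 by (intro sum_mono mult_mono) auto
  finally show ?thesis by (simp add: power2_eq_square)
qed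

lemma A_lower: "real N * (3 / 4 * cQ) * (v \<bullet> v) \<le> v \<bullet> (A *v v)"
proof -
  have eq: "v \<bullet> (((1 / real N) *\<^sub>R A - Q) *v v) = (v \<bullet> (A *v v)) / real N - v \<bullet> (Q *v v)"
    by (simp add: matrix_vector_mult_diff_rdistrib scaleR_matrix_vector_assoc[symmetric] inner_diff_right)
  have "\<bar>v \<bullet> (((1 / real N) *\<^sub>R A - Q) *v v)\<bar> \<le> cQ / 4 * (v \<bullet> v)"
    by (rule order_trans[OF abs_form_le mult_right_mono[OF gram_close inner_ge_zero]])
  then have "cQ * (v \<bullet> v) - cQ / 4 * (v \<bullet> v) \<le> (v \<bullet> (A *v v)) / real N"
    using Qlow[of v] unfolding eq by linarith
  then have "real N * (cQ * (v \<bullet> v) - cQ / 4 * (v \<bullet> v)) \<le> real N * ((v \<bullet> (A *v v)) / real N)"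
    by (rule mult_left_mono) simp
  then show ?thesis using N_pos by (simp add: algebra_simps)
qed

lemma Ad_lower:
  assumes g: "g \<in> {1..G}" shows "real N * (cQ / 2) * (v \<bullet> v) \<le> v \<bullet> (Ad g *v v)"
proof -
  have "v \<bullet> (Ag g *v v) \<le> norm v * norm (Ag g *v v)" by (rule norm_cauchy_schwarz)
  also have "\<dots> \<le> norm v * (D0 * C\<^sup>2 * norm v)" by (intro mult_left_mono norm_Ag_le g) simp
  also have "\<dots> = (D0 * C\<^sup>2) * (v \<bullet> v)" by (simp add: power2_norm_eq_inner[symmetric] power2_eq_square mult_ac)
  also have "\<dots> \<le> (cQ / 4 * real N) * (v \<bullet> v)" by (intro mult_right_mono degree_small) simp
  finally show ?thesis using A_lower[of v]
    by (simp add: gram_del_def matrix_vector_mult_diff_rdistrib inner_diff_right algebra_simps)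
qed

lemma invertible_A: "invertible A" "norm (matrix_inv A *v v) \<le> norm v * (2 / (cQ * real N))"
proof -
  \<comment> \<open>The constant 3/4 is weakened to 1/2 so that the inverses of \<open>A\<close> and
    \<open>Ad g\<close> obey the same bound.\<close>
  have low: "real N * (cQ / 2) * (v \<bullet> v) \<le> v \<bullet> (A *v v)" for v
  proof -
    have "real N * (cQ / 2) * (v \<bullet> v) \<le> real N * (3 / 4 * cQ) * (v \<bullet> v)"
      using cQ by (intro mult_right_mono mult_left_mono) auto
    then show ?thesis using A_lower[of v] by linarith
  qed
  have pos: "0 < real N * (cQ / 2)" using cQ N_pos by simp
  show "invertible A" by (rule invertible_of_lower_bound(1)[OF pos low])
  show "norm (matrix_inv A *v v) \<le> norm v * (2 / (cQ * real N))"
    using invertible_of_lower_bound(2)[OF pos low, of v] by (simp add: field_simps)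
qed

lemma invertible_Ad:
  assumes g: "g \<in> {1..G}"
  shows "invertible (Ad g)" "norm (matrix_inv (Ad g) *v v) \<le> norm v * (2 / (cQ * real N))"
proof -
  have pos: "0 < real N * (cQ / 2)" using cQ N_pos by simp
  show "invertible (Ad g)" by (rule invertible_of_lower_bound(1)[OF pos Ad_lower[OF g]])
  show "norm (matrix_inv (Ad g) *v v) \<le> norm v * (2 / (cQ * real N))"
    using invertible_of_lower_bound(2)[OF pos Ad_lower[OF g], of v] by (simp add: field_simps)
qed

lemma jackknife_defined: "jackknife_defined G N psi xs"
  unfolding jackknife_defined_def using invertible_Ad by blast

lemma sum_ys:
  assumes "J \<subseteq> I"
  shows "(\<Sum>n\<in>J. ys n *\<^sub>R xs n) = gram J xs *v \<beta> + (\<Sum>n\<in>J. us n *\<^sub>R xs n)"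
proof -
  have "(\<Sum>n\<in>J. ys n *\<^sub>R xs n) = (\<Sum>n\<in>J. (xs n \<bullet> \<beta>) *\<^sub>R xs n + us n *\<^sub>R xs n)"
    using assms model by (intro sum.cong refl) (auto simp: scaleR_add_left inner_commute)
  then show ?thesis by (simp add: sum.distrib gram_apply)
qed

lemma bt_eq: "bt = matrix_inv A *v S" "A *v bt = S"
proof -
  show "bt = matrix_inv A *v S"
    unfolding bt_def ols_def S_def using invertible_A(1)
    by (simp add: sum_ys matrix_vector_right_distrib matrix_inv_apply_cancel)
  then show "A *v bt = S" using invertible_A(1) by (simp add: matrix_inv_apply_cancel)
qed

lemma norm_bt_le: "norm bt \<le> 2 / cQ * (norm S / real N)"
  using invertible_A(2)[of S] by (simp add: bt_eq(1) mult_ac)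

text \<open>A crude constant is enough for bounding the residual scores e_g, whose size comes from
  the degree of g.\<close>

lemma norm_bt_le': "norm bt \<le> 2 * C\<^sup>2 / cQ"
proof -
  have "norm S \<le> real N * C\<^sup>2" using norm_score_le[of I] by (simp add: S_def)
  then have "norm S / real N \<le> C\<^sup>2" using N_pos by (simp add: pos_divide_le_eq mult.commute)
  then have "2 / cQ * (norm S / real N) \<le> 2 / cQ * C\<^sup>2" using cQ by (intro mult_left_mono) auto
  with norm_bt_le show ?thesis by simp
qed

text \<open>The normal equations are A bt = S for the full sample and A_(g) (b_(g) - \<beta>) = S -
  S_g after deletion; subtracting them leaves only terms incident to g.\<close>

lemma Ad_d:
  assumes g: "g \<in> {1..G}" shows "Ad g *v d g = e g" "d g = matrix_inv (Ad g) *v e g"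
proof -
  have split: "(\<Sum>n\<in>I - inc g. f n) = (\<Sum>n\<in>I. f n) - (\<Sum>n\<in>inc g. f n)" for f :: "nat \<Rightarrow> real ^ 'k"
    by (rule sum_diff[OF _ inc_subset]) simp
  have "Ad g *v (\<beta> + matrix_inv (Ad g) *v (S - Sg g)) = (\<Sum>n\<in>I - inc g. ys n *\<^sub>R xs n)"
    using invertible_Ad(1)[OF g]
    unfolding split sum_ys[OF inc_subset] sum_ys[OF order_refl] S_def Sg_def
    by (simp add: matrix_vector_right_distrib matrix_inv_apply_cancel)
       (simp add: gram_del_def matrix_vector_mult_diff_rdistrib)
  then have od: "ols_del N psi xs ys g = \<beta> + matrix_inv (Ad g) *v (S - Sg g)"
    unfolding ols_del_def by (metis invertible_Ad(1)[OF g] matrix_inv_apply_cancel(1))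
  have "Ad g *v d g = Ad g *v bt - (S - Sg g)"
    unfolding d_def od bt_def[symmetric] using invertible_Ad(1)[OF g]
    by (simp add: bt_def matrix_vector_mult_diff_distrib matrix_vector_right_distrib matrix_inv_apply_cancel)
  also have "\<dots> = e g" by (simp only: gram_del_def matrix_vector_mult_diff_rdistrib bt_eq(2) e_def) simp
  finally show "Ad g *v d g = e g" .
  then show "d g = matrix_inv (Ad g) *v e g" using invertible_Ad(1)[OF g] by (metis matrix_inv_apply_cancel(1))
qed

text \<open>With each observation counted twice the sum is 2 (S - A bt), which vanishes by the
  normal equations.\<close>

lemma sum_e: "(\<Sum>g\<in>{1..G}. e g) = 0"
proof -
  have "(\<Sum>g\<in>{1..G}. e g) = (\<Sum>g\<in>{1..G}. \<Sum>n\<in>inc g. us n *\<^sub>R xs n - (xs n \<bullet> bt) *\<^sub>R xs n)"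
    unfolding e_def Sg_def gram_apply by (simp add: sum_subtractf)
  also have "\<dots> = 2 *\<^sub>R (S - A *v bt)" unfolding sum_incident S_def gram_apply by (simp add: sum_subtractf)
  finally show ?thesis unfolding bt_eq(2) by simp
qed

lemma norm_e_le:
  assumes g: "g \<in> {1..G}" shows "norm (e g) \<le> real (card (inc g)) * (C\<^sup>2 * (1 + 2 * C\<^sup>2 / cQ))"
proof -
  have "norm (e g) \<le> norm (Sg g) + norm (Ag g *v bt)" unfolding e_def by (rule norm_triangle_ineq4)
  also have "\<dots> \<le> real (card (inc g)) * C\<^sup>2 + real (card (inc g)) * C\<^sup>2 * norm bt"
    using norm_score_le[OF inc_subset, of g] norm_gram_apply_le[OF inc_subset, of g bt] by (simp add: Sg_def)
  also have "\<dots> \<le> real (card (inc g)) * C\<^sup>2 + real (card (inc g)) * C\<^sup>2 * (2 * C\<^sup>2 / cQ)"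
    by (intro add_left_mono mult_left_mono norm_bt_le') auto
  finally show ?thesis by (simp add: algebra_simps)
qed

lemma \<eta>1_nonneg: "0 \<le> \<eta>1" by (simp add: \<eta>1_def)

lemma \<Psi>_ge: "D0 \<le> \<Psi>" "(norm S)\<^sup>2 / real N \<le> \<Psi>" "real N * \<eta>1\<^sup>2 + D0 \<le> \<Psi>" "0 \<le> \<Psi>"
  using D0_ge by (auto simp: \<Psi>_def intro!: add_nonneg_nonneg)

text \<open>With \<open>v = N Q w\<close> the functional \<open>v\<close> of \<open>A\<^sub>(\<^sub>g\<^sub>)\<^sup>-\<^sup>1 e\<^sub>g\<close> is \<open>w\<close> of \<open>e\<^sub>g\<close> up to the error of
  estimating \<open>Q\<close>.\<close>
lemma direction_error:
  assumes M: "Z *v z = y"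
  shows "(real N *\<^sub>R (Q *v w)) \<bullet> z - w \<bullet> y = w \<bullet> (real N *\<^sub>R ((Q - (1 / real N) *\<^sub>R Z) *v z))"
proof -
  have "(Q *v w) \<bullet> z = w \<bullet> (Q *v z)" by (rule inner_matrix_vector_sym[OF Qsym, symmetric])
  then show ?thesis using N_pos M
    by (simp add: matrix_vector_mult_diff_rdistrib scaleR_matrix_vector_assoc[symmetric] inner_diff_right right_diff_distrib)
qed

text \<open>The error is at most |w| N \<eta>1 |bt|, and 2 \<eta>1 |S| \<le> N \<eta>1^2 + |S|^2 / N
  brings it within the budget \<Psi>.\<close>

lemma functional_bt: "\<bar>(real N *\<^sub>R (Q *v w)) \<bullet> bt - w \<bullet> S\<bar> \<le> norm w * (\<Psi> / cQ)"
proof -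
  have "\<bar>(real N *\<^sub>R (Q *v w)) \<bullet> bt - w \<bullet> S\<bar> \<le> norm w * norm (real N *\<^sub>R ((Q - (1 / real N) *\<^sub>R A) *v bt))"
    unfolding direction_error[OF bt_eq(2)] by (rule Cauchy_Schwarz_ineq2)
  also have "norm (real N *\<^sub>R ((Q - (1 / real N) *\<^sub>R A) *v bt)) \<le> real N * (\<eta>1 * norm bt)"
    unfolding norm_scaleR \<eta>1_def using norm_matrix_vector_le[of "Q - (1 / real N) *\<^sub>R A" bt]
    by (simp add: norm_minus_commute mult_left_mono)
  also have "\<dots> \<le> real N * (\<eta>1 * (2 / cQ * (norm S / real N)))"
    by (intro mult_left_mono norm_bt_le \<eta>1_nonneg) simp
  also have "\<dots> = 2 * (\<eta>1 * norm S) / cQ" using N_pos by simp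
  also have "\<dots> \<le> \<Psi> / cQ"
  proof -
    have "0 \<le> (sqrt (real N) * \<eta>1 - norm S / sqrt (real N))\<^sup>2" by simp
    also have "\<dots> = real N * \<eta>1\<^sup>2 + (norm S)\<^sup>2 / real N - 2 * (\<eta>1 * norm S)"
      using N_pos by (simp add: power2_diff power_mult_distrib power_divide)
    also have "\<dots> \<le> \<Psi> - 2 * (\<eta>1 * norm S)" using D0_ge by (simp add: \<Psi>_def)
    finally show ?thesis using cQ by (simp add: divide_right_mono)
  qed
  finally show ?thesis by (simp add: mult_left_mono)
qed

text \<open>\<alpha> is the effect of residuals in place of errors, \<gamma> that of A_(g) in place
  of N Q, and r is what both leave after centring.\<close>

definition \<alpha> where "\<alpha> w g = w \<bullet> (Ag g *v bt)"
definition \<gamma> where "\<gamma> w g = w \<bullet> (real N *\<^sub>R ((Q - (1 / real N) *\<^sub>R Ad g) *v d g))"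
definition r where "r w g = (\<gamma> w g - (\<Sum>h\<in>{1..G}. \<gamma> w h) / real (card {1..G})) - \<alpha> w g"

definition K1 where "K1 = C\<^sup>2 * (1 + 2 * C\<^sup>2 / cQ)"
text \<open>Twice the constants 8 and 16 K1^2 of \<open>sum_\<alpha>_le\<close> and
  \<open>sum_\<gamma>_le\<close>; K1 is the constant of \<open>norm_e_le\<close>.\<close>

definition K where "K = 16 * C ^ 4 / cQ\<^sup>2 + 32 * C ^ 4 * K1\<^sup>2 / cQ\<^sup>2"

lemma functional_d: "g \<in> {1..G} \<Longrightarrow> (real N *\<^sub>R (Q *v w)) \<bullet> d g = w \<bullet> Sg g - \<alpha> w g + \<gamma> w g"
  using direction_error[OF Ad_d(1), of g w] by (simp add: \<alpha>_def \<gamma>_def e_def inner_diff_right)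

text \<open>Because the e_g sum to zero, subtracting the jackknife mean changes only the \<gamma>
  terms; the leading part w . S_g stays as it is.\<close>

lemma centered_functional:
  assumes g: "g \<in> {1..G}"
  shows "(real N *\<^sub>R (Q *v w)) \<bullet> (jackknife_mean G N psi xs ys - ols_del N psi xs ys g) = w \<bullet> Sg g + r w g"
proof -
  let ?v = "real N *\<^sub>R (Q *v w)"
  have "(\<Sum>h\<in>{1..G}. ?v \<bullet> d h) = (\<Sum>h\<in>{1..G}. w \<bullet> e h + \<gamma> w h)"
    using functional_d by (intro sum.cong refl) (simp add: e_def \<alpha>_def inner_diff_right)
  also have "\<dots> = (\<Sum>h\<in>{1..G}. \<gamma> w h)" using sum_e by (simp add: sum.distrib inner_sum_right[symmetric])
  finally have s: "(\<Sum>h\<in>{1..G}. ?v \<bullet> d h) = (\<Sum>h\<in>{1..G}. \<gamma> w h)" .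
  have "jackknife_mean G N psi xs ys = (1 / real G) *\<^sub>R (\<Sum>h\<in>{1..G}. ols N xs ys - d h)"
    by (simp add: jackknife_mean_def d_def)
  also have "\<dots> = ols N xs ys - (1 / real G) *\<^sub>R (\<Sum>h\<in>{1..G}. d h)"
    using G2 by (simp add: sum_subtractf sum_constant_scaleR scaleR_diff_right del: sum_constant)
  finally have "jackknife_mean G N psi xs ys - ols_del N psi xs ys g = d g - (1 / real G) *\<^sub>R (\<Sum>h\<in>{1..G}. d h)"
    by (simp add: d_def)
  then have "?v \<bullet> (jackknife_mean G N psi xs ys - ols_del N psi xs ys g) = ?v \<bullet> d g - (\<Sum>h\<in>{1..G}. ?v \<bullet> d h) / real G"
    by (simp only: inner_diff_right inner_scaleR_right inner_sum_right) simp
  then show ?thesis unfolding s functional_d[OF g] r_def by simp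
qed

text \<open>The degrees enter squared, with sum at most 2 N D0, and the estimation error enters
  through |bt|^2 \<le> 4 |S|^2 / (cQ N)^2.\<close>

lemma sum_\<alpha>_le: "(\<Sum>g\<in>{1..G}. (\<alpha> w g)\<^sup>2) \<le> 8 * C ^ 4 / cQ\<^sup>2 * (w \<bullet> w) * (D0 * \<Psi>)"
proof -
  have "(\<Sum>g\<in>{1..G}. (\<alpha> w g)\<^sup>2) \<le> (\<Sum>g\<in>{1..G}. (norm w * (C\<^sup>2 * norm bt))\<^sup>2 * (real (card (inc g)))\<^sup>2)"
  proof (rule sum_mono)
    fix g
    have "\<bar>\<alpha> w g\<bar> \<le> norm w * norm (Ag g *v bt)" unfolding \<alpha>_def by (rule Cauchy_Schwarz_ineq2)
    also have "\<dots> \<le> norm w * (real (card (inc g)) * C\<^sup>2 * norm bt)"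
      by (intro mult_left_mono norm_gram_apply_le inc_subset) simp
    finally have "\<bar>\<alpha> w g\<bar>\<^sup>2 \<le> (norm w * (real (card (inc g)) * C\<^sup>2 * norm bt))\<^sup>2" by (rule power_mono) simp
    then show "(\<alpha> w g)\<^sup>2 \<le> (norm w * (C\<^sup>2 * norm bt))\<^sup>2 * (real (card (inc g)))\<^sup>2"
      by (simp add: power_mult_distrib mult_ac)
  qed
  also have "\<dots> = (norm w * (C\<^sup>2 * norm bt))\<^sup>2 * (\<Sum>g\<in>{1..G}. (real (card (inc g)))\<^sup>2)" by (simp add: sum_distrib_left)
  also have "\<dots> \<le> (norm w * (C\<^sup>2 * norm bt))\<^sup>2 * (2 * real N * D0)"
    by (intro mult_left_mono sum_card_inc_sq) simp
  also have "\<dots> = ((w \<bullet> w) * C ^ 4 * 2 * real N * D0) * (norm bt)\<^sup>2"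
    by (simp add: power_mult_distrib power2_norm_eq_inner mult_ac)
  also have "\<dots> \<le> ((w \<bullet> w) * C ^ 4 * 2 * real N * D0) * (2 / cQ * (norm S / real N))\<^sup>2"
    using D0_ge by (intro mult_left_mono power_mono norm_bt_le) auto
  also have "\<dots> = 8 * C ^ 4 / cQ\<^sup>2 * (w \<bullet> w) * (D0 * ((norm S)\<^sup>2 / real N))"
    using N_pos by (simp add: power_mult_distrib power_divide) (simp add: field_simps power2_eq_square)
  also have "\<dots> \<le> 8 * C ^ 4 / cQ\<^sup>2 * (w \<bullet> w) * (D0 * \<Psi>)"
    using D0_ge \<Psi>_ge(2) by (intro mult_left_mono) auto
  finally show ?thesis .
qed

text \<open>N |d_g| is at most of the order of the degree of g, and A_(g) / N approximates Q up to
  h, whose square is of order \<Psi> / N.\<close>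

lemma sum_\<gamma>_le: "(\<Sum>g\<in>{1..G}. (\<gamma> w g)\<^sup>2) \<le> 16 * C ^ 4 * K1\<^sup>2 / cQ\<^sup>2 * (w \<bullet> w) * (D0 * \<Psi>)"
proof -
  define h where "h = \<eta>1 + D0 * C\<^sup>2 / real N"
  have h0: "0 \<le> h" using \<eta>1_nonneg D0_ge by (simp add: h_def)
  have "C\<^sup>2 \<ge> 1" using C1 by simp
  then have C4: "1 \<le> C ^ 4" using power_mono[of 1 C 4] C1 by simp
  have "h\<^sup>2 \<le> 2 * \<eta>1\<^sup>2 + 2 * (D0 * C\<^sup>2 / real N)\<^sup>2"
    using zero_le_power2[of "\<eta>1 - D0 * C\<^sup>2 / real N"] unfolding h_def by (simp add: power2_sum power2_diff)
  also have "(D0 * C\<^sup>2 / real N)\<^sup>2 = C ^ 4 * (D0 * (D0 / real N)) / real N"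
    by (simp add: power_mult_distrib power_divide power2_eq_square power4_eq_xxxx)
  \<comment> \<open>One factor D0 / N \<le> 1 is given away.\<close>
  also have "\<dots> \<le> C ^ 4 * (D0 * 1) / real N"
    using D0_ge D0_le N_pos C4 by (intro divide_right_mono mult_left_mono) auto
  also have "2 * \<eta>1\<^sup>2 = 2 * (1 * (real N * \<eta>1\<^sup>2)) / real N" using N_pos by simp
  also have "\<dots> \<le> 2 * (C ^ 4 * (real N * \<eta>1\<^sup>2)) / real N"
    using C4 by (intro divide_right_mono mult_left_mono mult_right_mono) auto
  finally have "h\<^sup>2 \<le> 2 * C ^ 4 * (real N * \<eta>1\<^sup>2 + D0) / real N"
    by (simp add: add_divide_distrib distrib_left)
  also have "\<dots> \<le> 2 * C ^ 4 * \<Psi> / real N"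
    using \<Psi>_ge(3) C4 by (intro divide_right_mono mult_left_mono) auto
  finally have h2: "h\<^sup>2 \<le> 2 * C ^ 4 * \<Psi> / real N" .
  have "(\<Sum>g\<in>{1..G}. (\<gamma> w g)\<^sup>2) \<le> (\<Sum>g\<in>{1..G}. (norm w * (h * (2 / cQ) * K1))\<^sup>2 * (real (card (inc g)))\<^sup>2)"
  proof (rule sum_mono)
    fix g assume g: "g \<in> {1..G}"
    have "(Q - (1 / real N) *\<^sub>R Ad g) *v z = (1 / real N) *\<^sub>R (Ag g *v z) - ((1 / real N) *\<^sub>R A - Q) *v z" for z
      by (simp add: gram_del_def matrix_vector_mult_diff_rdistrib scaleR_matrix_vector_assoc[symmetric] scaleR_diff_right)
    then have nQ: "norm ((Q - (1 / real N) *\<^sub>R Ad g) *v z) \<le> h * norm z" for z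
    proof -
      have "norm ((Q - (1 / real N) *\<^sub>R Ad g) *v z) \<le> norm ((1 / real N) *\<^sub>R (Ag g *v z)) + norm (((1 / real N) *\<^sub>R A - Q) *v z)"
        unfolding \<open>\<And>z. (Q - (1 / real N) *\<^sub>R Ad g) *v z = _ z\<close> by (rule norm_triangle_ineq4)
      also have "\<dots> \<le> (1 / real N) * (D0 * C\<^sup>2 * norm z) + \<eta>1 * norm z"
        unfolding \<eta>1_def norm_scaleR using norm_Ag_le[OF g, of z] N_pos
        by (intro add_mono norm_matrix_vector_le) (simp add: divide_right_mono)
      finally show ?thesis by (simp add: h_def algebra_simps)
    qed
    have K1: "0 \<le> K1" using cQ by (simp add: K1_def)
    have nd: "real N * norm (d g) \<le> (2 / cQ) * (real (card (inc g)) * K1)"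
    proof -
      have "real N * norm (d g) \<le> real N * (norm (e g) * (2 / (cQ * real N)))"
        unfolding Ad_d(2)[OF g] by (intro mult_left_mono invertible_Ad(2) g) simp
      also have "\<dots> = (2 / cQ) * norm (e g)" using N_pos by simp
      also have "\<dots> \<le> (2 / cQ) * (real (card (inc g)) * K1)"
        unfolding K1_def using cQ by (intro mult_left_mono norm_e_le g) auto
      finally show ?thesis .
    qed
    have "\<bar>\<gamma> w g\<bar> \<le> norm w * norm (real N *\<^sub>R ((Q - (1 / real N) *\<^sub>R Ad g) *v d g))"
      unfolding \<gamma>_def by (rule Cauchy_Schwarz_ineq2)
    also have "\<dots> \<le> norm w * (h * (real N * norm (d g)))"
    proof (rule mult_left_mono)
      have "real N * norm ((Q - (1 / real N) *\<^sub>R Ad g) *v d g) \<le> real N * (h * norm (d g))"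
        by (intro mult_left_mono nQ) simp
      then show "norm (real N *\<^sub>R ((Q - (1 / real N) *\<^sub>R Ad g) *v d g)) \<le> h * (real N * norm (d g))"
        by (simp add: mult_ac)
    qed simp
    also have "\<dots> \<le> norm w * (h * ((2 / cQ) * (real (card (inc g)) * K1)))"
      by (intro mult_left_mono nd h0) simp
    finally have "\<bar>\<gamma> w g\<bar>\<^sup>2 \<le> (norm w * (h * ((2 / cQ) * (real (card (inc g)) * K1))))\<^sup>2" by (rule power_mono) simp
    then show "(\<gamma> w g)\<^sup>2 \<le> (norm w * (h * (2 / cQ) * K1))\<^sup>2 * (real (card (inc g)))\<^sup>2"
      by (simp add: power_mult_distrib power_divide mult_ac)
  qed
  also have "\<dots> = (norm w * (h * (2 / cQ) * K1))\<^sup>2 * (\<Sum>g\<in>{1..G}. (real (card (inc g)))\<^sup>2)" by (simp add: sum_distrib_left)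
  also have "\<dots> \<le> (norm w * (h * (2 / cQ) * K1))\<^sup>2 * (2 * real N * D0)"
    by (intro mult_left_mono sum_card_inc_sq) simp
  also have "\<dots> = ((w \<bullet> w) * (4 / cQ\<^sup>2) * K1\<^sup>2 * (2 * real N * D0)) * h\<^sup>2"
    by (simp add: power_mult_distrib power_divide power2_norm_eq_inner mult_ac)
  also have "\<dots> \<le> ((w \<bullet> w) * (4 / cQ\<^sup>2) * K1\<^sup>2 * (2 * real N * D0)) * (2 * C ^ 4 * \<Psi> / real N)"
    using D0_ge by (intro mult_left_mono h2) auto
  also have "\<dots> = 16 * C ^ 4 * K1\<^sup>2 / cQ\<^sup>2 * (w \<bullet> w) * (D0 * \<Psi>)"
    using N_pos by (simp add: field_simps)
  finally show ?thesis .
qed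

lemma sum_r_le: "(\<Sum>g\<in>{1..G}. (r w g)\<^sup>2) \<le> K * (w \<bullet> w) * \<Psi>\<^sup>2"
proof -
  let ?c = "\<lambda>g. \<gamma> w g - (\<Sum>h\<in>{1..G}. \<gamma> w h) / real (card {1..G})"
  have "(\<Sum>g\<in>{1..G}. (r w g)\<^sup>2) \<le> 2 * (\<Sum>g\<in>{1..G}. (?c g)\<^sup>2) + 2 * (\<Sum>g\<in>{1..G}. (\<alpha> w g)\<^sup>2)"
    using sum_sq_add_le[of ?c "\<lambda>g. - \<alpha> w g" "{1..G}"] by (simp add: r_def)
  also have "\<dots> \<le> 2 * (\<Sum>g\<in>{1..G}. (\<gamma> w g)\<^sup>2) + 2 * (\<Sum>g\<in>{1..G}. (\<alpha> w g)\<^sup>2)"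
    using sum_sq_centered_le[of "{1..G}" "\<gamma> w"] by simp
  also have "\<dots> \<le> 2 * (16 * C ^ 4 * K1\<^sup>2 / cQ\<^sup>2 * (w \<bullet> w) * (D0 * \<Psi>)) + 2 * (8 * C ^ 4 / cQ\<^sup>2 * (w \<bullet> w) * (D0 * \<Psi>))"
    using sum_\<gamma>_le[of w] sum_\<alpha>_le[of w] by linarith
  also have "\<dots> = K * (w \<bullet> w) * (D0 * \<Psi>)" by (simp add: K_def algebra_simps)
  \<comment> \<open>D0 is one of the terms of \<Psi>, so the product is at most the square.\<close>
  also have "\<dots> \<le> K * (w \<bullet> w) * (\<Psi> * \<Psi>)"
    using \<Psi>_ge C1 by (intro mult_left_mono mult_right_mono) (auto simp: K_def)
  finally show ?thesis by (simp add: power2_eq_square)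
qed

lemma jackknife_form:
  "v \<bullet> (jackknife_variance G N psi xs ys *v v) =
    (real G - 1) / real G * (\<Sum>g\<in>{1..G}. (v \<bullet> (jackknife_mean G N psi xs ys - ols_del N psi xs ys g))\<^sup>2)"
proof -
  let ?m = "jackknife_mean G N psi xs ys" and ?o = "ols_del N psi xs ys"
  have "(\<Sum>g\<in>J. outer (?o g - ?m) (?o g - ?m)) *v v = (\<Sum>g\<in>J. ((?o g - ?m) \<bullet> v) *\<^sub>R (?o g - ?m))" if "finite J" for J
    using that by (induction J rule: finite_induct) (simp_all add: matrix_vector_mult_add_rdistrib outer_apply)
  then have "v \<bullet> (jackknife_variance G N psi xs ys *v v) = (real G - 1) / real G * (\<Sum>g\<in>{1..G}. (v \<bullet> (?o g - ?m))\<^sup>2)"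
    using jackknife_defined
    by (simp add: jackknife_variance_def scaleR_matrix_vector_assoc[symmetric] inner_sum_right power2_eq_square inner_commute)
  moreover have "(v \<bullet> (?o g - ?m))\<^sup>2 = (v \<bullet> (?m - ?o g))\<^sup>2" for g
    by (simp add: inner_diff_right power2_commute)
  ultimately show ?thesis by simp
qed

text \<open>B stands for the population form w . Om w. The parameter t weighs the cross term between
  leading part and remainder, and 1 / G is the price of the factor (G - 1) / G.\<close>

theorem jackknife_deviation:
  assumes w: "v = real N *\<^sub>R (Q *v w)" and B: "l * (w \<bullet> w) \<le> B" and l: "0 < l"
    and main: "\<bar>(\<Sum>g\<in>{1..G}. (w \<bullet> Sg g)\<^sup>2) - B\<bar> \<le> x * B" and x: "0 \<le> x" and t: "0 < t"
  shows "\<bar>v \<bullet> (jackknife_variance G N psi xs ys *v v) - B\<bar> \<le>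
    (t * (1 + x) + (1 / t + 1) * (K * (\<Psi>\<^sup>2 / l)) + x + 1 / real G) * B"
proof -
  define T where "T = (\<Sum>g\<in>{1..G}. (w \<bullet> Sg g + r w g)\<^sup>2)"
  define s where "s = (\<Sum>g\<in>{1..G}. (w \<bullet> Sg g)\<^sup>2)"
  have Gp: "0 < real G" using G2 by simp
  have "0 \<le> l * (w \<bullet> w)" using l by simp
  then have B0: "0 \<le> B" using B by linarith
  have K0: "0 \<le> K" using C1 by (simp add: K_def)
  have V: "v \<bullet> (jackknife_variance G N psi xs ys *v v) = (real G - 1) / real G * T"
    unfolding jackknife_form T_def w using centered_functional by simp
  have "w \<bullet> w \<le> B / l" using B l by (simp add: pos_le_divide_eq mult.commute)
  then have "K * (w \<bullet> w) * \<Psi>\<^sup>2 \<le> K * (B / l) * \<Psi>\<^sup>2" using K0 by (intro mult_left_mono mult_right_mono) auto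
  then have rr: "(\<Sum>g\<in>{1..G}. (r w g)\<^sup>2) \<le> K * (\<Psi>\<^sup>2 / l) * B" using sum_r_le[of w] by (simp add: mult_ac)
  have ss: "s \<le> (1 + x) * B" using main by (simp add: s_def algebra_simps)
  have "\<bar>T - s\<bar> \<le> t * s + (1 / t + 1) * (\<Sum>g\<in>{1..G}. (r w g)\<^sup>2)"
    unfolding T_def s_def by (rule quadratic_perturbation[OF _ t]) simp
  also have "\<dots> \<le> t * ((1 + x) * B) + (1 / t + 1) * (K * (\<Psi>\<^sup>2 / l) * B)"
    using t by (intro add_mono mult_left_mono ss rr) auto
  finally have Ts: "\<bar>T - s\<bar> \<le> t * ((1 + x) * B) + (1 / t + 1) * (K * (\<Psi>\<^sup>2 / l) * B)" .
  have sB: "\<bar>s - B\<bar> \<le> x * B" using main by (simp only: s_def)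
  have TB: "\<bar>T - B\<bar> \<le> t * ((1 + x) * B) + (1 / t + 1) * (K * (\<Psi>\<^sup>2 / l) * B) + x * B"
    using Ts sB by linarith
  have "(real G - 1) / real G * T - B = (1 - 1 / real G) * (T - B) - B / real G"
    using Gp by (simp add: field_simps)
  moreover have "\<bar>(1 - 1 / real G) * (T - B)\<bar> \<le> \<bar>T - B\<bar>"
    unfolding abs_mult using Gp G2 by (intro mult_left_le_one_le) auto
  ultimately have "\<bar>(real G - 1) / real G * T - B\<bar> \<le> \<bar>T - B\<bar> + B / real G"
    using B0 Gp abs_triangle_ineq4[of "(1 - 1 / real G) * (T - B)" "B / real G"] by simp
  with TB have "\<bar>(real G - 1) / real G * T - B\<bar> \<le> t * ((1 + x) * B) + (1 / t + 1) * (K * (\<Psi>\<^sup>2 / l) * B) + x * B + B / real G"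
    by linarith
  then show ?thesis unfolding V by (simp add: algebra_simps)
qed

end

section \<open>Moments of the error terms\<close>

lemma norm_power2_vec: "(norm v)\<^sup>2 = (\<Sum>i\<in>UNIV. (norm (v $ i))\<^sup>2)"
  by (simp add: norm_vec_def L2_set_def sum_nonneg)

lemma norm_power2_matrix: "(norm A)\<^sup>2 = (\<Sum>i\<in>UNIV. \<Sum>j\<in>UNIV. (A $ i $ j)\<^sup>2)" for A :: "real ^ 'n ^ 'm"
  by (simp add: norm_power2_vec)

text \<open>Evaluating a matrix at two fixed vectors is bounded linear and hence commutes with the
  Bochner integral.\<close>

lemma integral_matrix_form:
  fixes f :: "'a \<Rightarrow> real ^ 'n ^ 'm"
  assumes "integrable M f"
  shows "a \<bullet> ((LINT \<omega>|M. f \<omega>) *v c) = (LINT \<omega>|M. a \<bullet> (f \<omega> *v c))"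
proof -
  have "linear (\<lambda>A :: real ^ 'n ^ 'm. a \<bullet> (A *v c))"
    by (intro linearI) (simp_all add: matrix_vector_mult_add_rdistrib inner_add_right scaleR_matrix_vector_assoc[symmetric])
  then have "bounded_linear (\<lambda>A :: real ^ 'n ^ 'm. a \<bullet> (A *v c))" by (simp add: linear_conv_bounded_linear)
  from integral_bounded_linear[OF this assms] show ?thesis by simp
qed

lemma matrix_entry_form: "A $ i $ j = axis i 1 \<bullet> (A *v axis j 1)" for A :: "real ^ 'n ^ 'm"
  by (simp add: matrix_vector_mult_basis column_def inner_axis')

lemma (in prob_space) mean_square_decomposition:
  fixes T :: "'a \<Rightarrow> real"
  assumes m: "T \<in> borel_measurable M" and B: "AE \<omega> in M. \<bar>T \<omega>\<bar> \<le> B"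
  shows "expectation (\<lambda>\<omega>. (T \<omega> - m)\<^sup>2) = expectation (\<lambda>\<omega>. (T \<omega> - expectation T)\<^sup>2) + (expectation T - m)\<^sup>2"
proof -
  have i: "integrable M T" by (rule integrable_const_bound[of _ B]) (use m B in auto)
  have i2: "integrable M (\<lambda>\<omega>. (T \<omega> - expectation T)\<^sup>2)"
  proof (rule integrable_const_bound[of _ "(B + \<bar>expectation T\<bar>)\<^sup>2"])
    show "AE \<omega> in M. norm ((T \<omega> - expectation T)\<^sup>2) \<le> (B + \<bar>expectation T\<bar>)\<^sup>2"
      using B
    proof eventually_elim
      case (elim \<omega>)
      then have "\<bar>T \<omega> - expectation T\<bar> \<le> B + \<bar>expectation T\<bar>" by linarith
      then show ?case using power_mono[of "\<bar>T \<omega> - expectation T\<bar>" "B + \<bar>expectation T\<bar>" 2] by simp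
    qed
  qed (use m in measurable)
  define \<mu> where "\<mu> = expectation T"
  have eq: "(T \<omega> - m)\<^sup>2 = (T \<omega> - \<mu>)\<^sup>2 + (2 * (\<mu> - m) * (T \<omega> - \<mu>) + (\<mu> - m)\<^sup>2)" for \<omega>
    by (simp add: power2_eq_square algebra_simps)
  have "expectation (\<lambda>\<omega>. (T \<omega> - m)\<^sup>2) = expectation (\<lambda>\<omega>. (T \<omega> - \<mu>)\<^sup>2) + expectation (\<lambda>\<omega>. 2 * (\<mu> - m) * (T \<omega> - \<mu>) + (\<mu> - m)\<^sup>2)"
    unfolding eq using i i2 by (intro Bochner_Integration.integral_add) (auto simp: \<mu>_def)
  also have "expectation (\<lambda>\<omega>. 2 * (\<mu> - m) * (T \<omega> - \<mu>) + (\<mu> - m)\<^sup>2) = (\<mu> - m)\<^sup>2"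
    using i by (simp add: prob_space \<mu>_def)
  finally show ?thesis by (simp add: \<mu>_def)
qed

lemma integral_sum_sum:
  fixes f :: "'i \<Rightarrow> 'j \<Rightarrow> 'a \<Rightarrow> real"
  assumes "\<And>n m. n \<in> A \<Longrightarrow> m \<in> B n \<Longrightarrow> integrable M (f n m)"
  shows "(LINT \<omega>|M. (\<Sum>n\<in>A. \<Sum>m\<in>B n. f n m \<omega>)) = (\<Sum>n\<in>A. \<Sum>m\<in>B n. LINT \<omega>|M. f n m \<omega>)"
proof -
  have "(LINT \<omega>|M. (\<Sum>n\<in>A. \<Sum>m\<in>B n. f n m \<omega>)) = (\<Sum>n\<in>A. LINT \<omega>|M. (\<Sum>m\<in>B n. f n m \<omega>))"
    by (rule Bochner_Integration.integral_sum) (rule Bochner_Integration.integrable_sum, rule assms)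
  also have "\<dots> = (\<Sum>n\<in>A. \<Sum>m\<in>B n. LINT \<omega>|M. f n m \<omega>)"
    by (intro sum.cong refl Bochner_Integration.integral_sum assms)
  finally show ?thesis .
qed

locale dyadic_model = prob_space M + dyadic_config G N psi
  for M :: "'a measure" and G N :: nat and psi :: "nat \<Rightarrow> nat set" +
  fixes x :: "nat \<Rightarrow> 'a \<Rightarrow> real ^ 'k" and u :: "nat \<Rightarrow> 'a \<Rightarrow> real" and C cQ :: real
  assumes rv_x: "n \<in> {1..N} \<Longrightarrow> x n \<in> borel_measurable M"
    and rv_u: "n \<in> {1..N} \<Longrightarrow> u n \<in> borel_measurable M"
    and dependence: "dyadic_dependence M N psi x u"
    and bounded_x: "n \<in> {1..N} \<Longrightarrow> AE \<omega> in M. norm (x n \<omega>) \<le> C"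
    and bounded_u: "n \<in> {1..N} \<Longrightarrow> AE \<omega> in M. \<bar>u n \<omega>\<bar> \<le> C"
    and C1: "1 \<le> C"
    and exogeneity: "n \<in> {1..N} \<Longrightarrow> (LINT \<omega>|M. u n \<omega> *\<^sub>R x n \<omega>) = 0"
    and cQ: "0 < cQ" and identification: "cQ \<le> lambda_min (design_matrix M N x)"
    and Omega_pos: "pos_def (score_variance M N x u)"
begin

definition \<xi> where "\<xi> n \<omega> = (x n \<omega>, u n \<omega>)"
abbreviation Om where "Om \<equiv> score_variance M N x u"
abbreviation Qm where "Qm \<equiv> design_matrix M N x"
definition lam where "lam = lambda_min Om"
definition score where "score n \<omega> = u n \<omega> *\<^sub>R x n \<omega>"
definition St where "St \<omega> = (\<Sum>n\<in>I. score n \<omega>)"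

sublocale F: dependent_family M "{1..N}" adj \<xi> "2 * D0"
proof
  show "finite {1..N}" by simp
  show "\<And>n. n \<in> I \<Longrightarrow> adj n n" by (rule adj_refl)
  show "\<And>n m. adj n m \<Longrightarrow> adj m n" by (rule adj_sym)
  show "\<And>n. n \<in> I \<Longrightarrow> \<xi> n \<in> borel_measurable M"
    unfolding \<xi>_def[abs_def] borel_prod[symmetric] using rv_x rv_u by measurable
  show "\<And>n. n \<in> I \<Longrightarrow> real (card {m \<in> I. adj n m}) \<le> 2 * D0" by (rule degree_le)
  show "0 \<le> 2 * D0" using D0_ge by simp
  fix S S' assume S: "S \<subseteq> I" "S' \<subseteq> I" and na: "\<And>n m. n \<in> S \<Longrightarrow> m \<in> S' \<Longrightarrow> \<not> adj n m"
  \<comment> \<open>\<open>dyadic_dependence\<close> speaks of disjoint index sets; a common index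
    would be adjacent to itself.\<close>
  have "S \<inter> S' = {}" using na adj_refl S(1) by blast
  moreover have "\<forall>n\<in>S. \<forall>m\<in>S'. psi n \<inter> psi m = {}" using na by (auto simp: adj_def)
  ultimately show "indep_var (Pi\<^sub>M S (\<lambda>_. borel)) (\<lambda>\<omega>. \<lambda>n\<in>S. \<xi> n \<omega>) (Pi\<^sub>M S' (\<lambda>_. borel)) (\<lambda>\<omega>. \<lambda>n\<in>S'. \<xi> n \<omega>)"
    using dependence S unfolding dyadic_dependence_def \<xi>_def by blast
qed

lemma dep_fun:
  assumes "h \<in> borel_measurable (borel \<Otimes>\<^sub>M borel)" shows "F.dep_on {n} (\<lambda>\<omega>. h (x n \<omega>, u n \<omega>))"
  using F.dep_on_single[of h n] assms unfolding borel_prod \<xi>_def by simp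

lemma lam_pos: "0 < lam" unfolding lam_def by (rule lambda_min_pos[OF Omega_pos])

lemma Om_sym: "transpose Om = Om" using Omega_pos by (simp add: pos_def_def)

lemma lam_le: "lam * (a \<bullet> a) \<le> a \<bullet> (Om *v a)"
  unfolding lam_def by (rule lambda_min_properties(2)[OF Om_sym])

lemma N_pos: "0 < real N" using N_ge by simp

lemma AE_data: "AE \<omega> in M. \<forall>n\<in>I. norm (x n \<omega>) \<le> C \<and> \<bar>u n \<omega>\<bar> \<le> C"
  by (rule AE_finite_allI) (use bounded_x bounded_u in auto)

lemma norm_score_le: "norm (x n \<omega>) \<le> C \<Longrightarrow> \<bar>u n \<omega>\<bar> \<le> C \<Longrightarrow> norm (score n \<omega>) \<le> C\<^sup>2"
  unfolding score_def norm_scaleR power2_eq_square using C1 by (intro mult_mono) auto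

lemma AE_inner_score: "n \<in> I \<Longrightarrow> AE \<omega> in M. \<bar>a \<bullet> score n \<omega>\<bar> \<le> norm a * C\<^sup>2"
  using AE_data
proof eventually_elim
  case (elim \<omega>)
  then have "norm a * norm (score n \<omega>) \<le> norm a * C\<^sup>2" by (intro mult_left_mono norm_score_le) auto
  then show ?case using Cauchy_Schwarz_ineq2[of a "score n \<omega>"] by linarith
qed

lemma meas_score [measurable]: "n \<in> I \<Longrightarrow> score n \<in> borel_measurable M"
  unfolding score_def[abs_def] using rv_x rv_u by measurable

lemma meas_St [measurable]: "St \<in> borel_measurable M"
  unfolding St_def[abs_def] by (intro borel_measurable_sum meas_score)

lemma dep_inner_score: "F.dep_on {n} (\<lambda>\<omega>. a \<bullet> score n \<omega>)"
  unfolding score_def using dep_fun[of "\<lambda>p. a \<bullet> (snd p *\<^sub>R fst p)" n] by simp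

lemma integrable_inner_score: "n \<in> I \<Longrightarrow> integrable M (\<lambda>\<omega>. a \<bullet> score n \<omega>)"
  by (rule integrable_const_bound[OF AE_inner_score[unfolded real_norm_def[symmetric]]]) auto

lemma integrable_score: "n \<in> I \<Longrightarrow> integrable M (score n)"
proof -
  assume n: "n \<in> I"
  have "AE \<omega> in M. norm (score n \<omega>) \<le> C\<^sup>2"
    using AE_data by eventually_elim (use n norm_score_le in auto)
  then show ?thesis by (rule integrable_const_bound) (use n in simp)
qed

lemma mean_inner_score:
  assumes n: "n \<in> I" shows "expectation (\<lambda>\<omega>. a \<bullet> score n \<omega>) = 0"
proof -
  have "(LINT \<omega>|M. score n \<omega>) = 0" using exogeneity[OF n] by (simp only: score_def)
  then show ?thesis using integral_inner_right[of a M "score n"] integrable_score[OF n] by simp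
qed

lemma mean_inner_St: "expectation (\<lambda>\<omega>. a \<bullet> St \<omega>) = 0"
  unfolding St_def inner_sum_right using integrable_inner_score mean_inner_score
  by (simp add: Bochner_Integration.integral_sum)

lemma norm_St_le: "\<forall>n\<in>I. norm (x n \<omega>) \<le> C \<and> \<bar>u n \<omega>\<bar> \<le> C \<Longrightarrow> norm (St \<omega>) \<le> real N * C\<^sup>2"
  unfolding St_def using sum_norm_bound[of I "\<lambda>n. score n \<omega>" "C\<^sup>2"] norm_score_le by simp

text \<open>The scores have mean zero, so the covariance matrix is the mean of the outer product of
  \<open>St\<close> with itself.\<close>

lemma Om_form: "a \<bullet> (Om *v c) = expectation (\<lambda>\<omega>. (a \<bullet> St \<omega>) * (c \<bullet> St \<omega>))"
proof -
  have "(LINT \<omega>|M. St \<omega>) = (\<Sum>n\<in>I. LINT \<omega>|M. score n \<omega>)"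
    unfolding St_def by (rule Bochner_Integration.integral_sum) (rule integrable_score)
  also have "\<dots> = 0" using exogeneity by (simp add: score_def[abs_def])
  finally have E0: "(LINT \<omega>|M. St \<omega>) = 0" .
  have Om: "Om = (LINT \<omega>|M. outer (St \<omega>) (St \<omega>))"
    unfolding score_variance_def covariance_matrix_def score_def[symmetric] St_def[symmetric] E0 by simp
  have "AE \<omega> in M. norm (outer (St \<omega>) (St \<omega>)) \<le> (real N * C\<^sup>2) * (real N * C\<^sup>2)"
    using AE_data
  proof eventually_elim
    case (elim \<omega>)
    from norm_St_le[OF this] show ?case unfolding norm_outer by (intro mult_mono) auto
  qed
  then have "integrable M (\<lambda>\<omega>. outer (St \<omega>) (St \<omega>))" by (rule integrable_const_bound) simp
  then show ?thesis unfolding Om by (subst integral_matrix_form) (auto simp: outer_apply inner_commute mult_ac)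
qed

lemma variance_linear_le: "expectation (\<lambda>\<omega>. (a \<bullet> St \<omega>)\<^sup>2) \<le> 8 * real N * D0 * (norm a * C\<^sup>2)\<^sup>2"
proof -
  have eq: "(\<Sum>n\<in>I. a \<bullet> score n \<omega>) = a \<bullet> St \<omega>" for \<omega> by (simp only: St_def inner_sum_right)
  have "expectation (\<lambda>\<omega>. (a \<bullet> St \<omega> - 0)\<^sup>2) \<le> 4 * real (card I) * (2 * D0) * (norm a * C\<^sup>2)\<^sup>2"
    using F.variance_sum_single_le[of "\<lambda>n \<omega>. a \<bullet> score n \<omega>" "norm a * C\<^sup>2", OF dep_inner_score AE_inner_score]
    unfolding eq mean_inner_St .
  then show ?thesis by simp
qed

text \<open>One basis vector already bounds the smallest eigenvalue. The estimate serves to derive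
  D0 / N \<rightarrow> 0 from the accumulation condition.\<close>

lemma lam_upper: "lam \<le> 8 * real N * D0 * C ^ 4"
proof -
  let ?a = "axis undefined 1 :: real ^ 'k"
  have "lam * (?a \<bullet> ?a) \<le> expectation (\<lambda>\<omega>. (?a \<bullet> St \<omega>)\<^sup>2)"
    using lam_le[of ?a] by (simp add: Om_form power2_eq_square)
  also have "\<dots> \<le> 8 * real N * D0 * (norm ?a * C\<^sup>2)\<^sup>2" by (rule variance_linear_le)
  finally show ?thesis by (simp add: inner_axis_axis)
qed

lemma AE_outer_entry: "n \<in> I \<Longrightarrow> AE \<omega> in M. \<bar>x n \<omega> $ i * x n \<omega> $ j\<bar> \<le> C\<^sup>2"
  using AE_data
proof eventually_elim
  case (elim \<omega>)
  then show ?case unfolding abs_mult power2_eq_square using C1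
    by (intro mult_mono order_trans[OF component_le_norm_cart]) auto
qed

definition \<eta>1 where "\<eta>1 \<omega> = norm ((1 / real N) *\<^sub>R gram {1..N} (\<lambda>n. x n \<omega>) - Qm)"

lemma gram_entry: "gram J xs $ i $ j = (\<Sum>n\<in>J. xs n $ i * xs n $ j)"
  by (simp add: gram_def outer_def)

lemma meas_outer_entry: "n \<in> I \<Longrightarrow> (\<lambda>\<omega>. x n \<omega> $ i * x n \<omega> $ j) \<in> borel_measurable M"
  using rv_x by measurable

lemma integrable_outer_entry: "n \<in> I \<Longrightarrow> integrable M (\<lambda>\<omega>. x n \<omega> $ i * x n \<omega> $ j)"
  by (rule integrable_const_bound[OF AE_outer_entry[unfolded real_norm_def[symmetric]]]) (auto intro: meas_outer_entry)

lemma Qm_entry: "Qm $ i $ j = (1 / real N) * expectation (\<lambda>\<omega>. \<Sum>n\<in>I. x n \<omega> $ i * x n \<omega> $ j)"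
proof -
  have "(LINT \<omega>|M. outer (x n \<omega>) (x n \<omega>)) $ i $ j = expectation (\<lambda>\<omega>. x n \<omega> $ i * x n \<omega> $ j)" if n: "n \<in> I" for n
  proof -
    have "AE \<omega> in M. norm (outer (x n \<omega>) (x n \<omega>)) \<le> C * C"
      using AE_data
    proof eventually_elim
      case (elim \<omega>)
      then show ?case unfolding norm_outer using n C1 by (intro mult_mono) auto
    qed
    then have "integrable M (\<lambda>\<omega>. outer (x n \<omega>) (x n \<omega>))"
      by (rule integrable_const_bound) (use rv_x[OF n] in measurable)
    then show ?thesis unfolding matrix_entry_form
      by (subst integral_matrix_form) (auto simp: outer_apply inner_axis inner_axis' mult.commute)
  qed
  then show ?thesis unfolding design_matrix_def using integrable_outer_entry
    by (simp add: Bochner_Integration.integral_sum)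
qed

lemma Qm_sym: "transpose Qm = Qm"
  by (simp add: transpose_def vec_eq_iff Qm_entry mult.commute)

lemma Qm_low: "cQ * (v \<bullet> v) \<le> v \<bullet> (Qm *v v)"
  using lambda_min_properties(2)[OF Qm_sym, of v] mult_right_mono[OF identification inner_ge_zero[of v]] by linarith

lemma meas_gram: "J \<subseteq> I \<Longrightarrow> (\<lambda>\<omega>. gram J (\<lambda>n. x n \<omega>)) \<in> borel_measurable M"
  unfolding gram_def using rv_x by (intro borel_measurable_sum borel_measurable_outer) auto

lemma meas_\<eta>1 [measurable]: "\<eta>1 \<in> borel_measurable M"
  unfolding \<eta>1_def[abs_def] using meas_gram[OF order_refl] by measurable

lemma integrable_sq_centered:
  fixes T :: "'a \<Rightarrow> real"
  assumes "T \<in> borel_measurable M" "AE \<omega> in M. \<bar>T \<omega>\<bar> \<le> B"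
  shows "integrable M (\<lambda>\<omega>. (T \<omega> - m)\<^sup>2)"
proof (rule integrable_const_bound[of _ "(B + \<bar>m\<bar>)\<^sup>2"])
  show "AE \<omega> in M. norm ((T \<omega> - m)\<^sup>2) \<le> (B + \<bar>m\<bar>)\<^sup>2"
    using assms(2)
  proof eventually_elim
    case (elim \<omega>)
    then have "\<bar>T \<omega> - m\<bar> \<le> B + \<bar>m\<bar>" by linarith
    then show ?case using power_mono[of "\<bar>T \<omega> - m\<bar>" "B + \<bar>m\<bar>" 2] by simp
  qed
qed (use assms in measurable)

text \<open>Each entry of the Gram error is a centred sum over a dependency graph of degree 2 D0,
  divided by N, so its variance is of order D0 / N.\<close>

lemma \<eta>1_moment: "integrable M (\<lambda>\<omega>. (\<eta>1 \<omega>)\<^sup>2)"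
  "real N * expectation (\<lambda>\<omega>. (\<eta>1 \<omega>)\<^sup>2) \<le> 8 * (real CARD('k))\<^sup>2 * C ^ 4 * D0"
proof -
  define T where "T i j \<omega> = (\<Sum>n\<in>I. x n \<omega> $ i * x n \<omega> $ j)" for i j \<omega>
  have mT: "T i j \<in> borel_measurable M" for i j
    unfolding T_def[abs_def] by (intro borel_measurable_sum meas_outer_entry)
  have bT: "AE \<omega> in M. \<bar>T i j \<omega>\<bar> \<le> real N * C\<^sup>2" for i j
  proof -
    have "AE \<omega> in M. \<forall>n\<in>I. \<bar>x n \<omega> $ i * x n \<omega> $ j\<bar> \<le> C\<^sup>2"
      by (rule AE_finite_allI) (use AE_outer_entry in auto)
    then show ?thesis
    proof eventually_elim
      case (elim \<omega>)
      then show ?case unfolding T_def using sum_norm_bound[of I "\<lambda>n. x n \<omega> $ i * x n \<omega> $ j" "C\<^sup>2"] by simp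
    qed
  qed
  have eq: "(\<eta>1 \<omega>)\<^sup>2 = (\<Sum>i\<in>UNIV. \<Sum>j\<in>UNIV. (1 / real N)\<^sup>2 * (T i j \<omega> - expectation (T i j))\<^sup>2)" for \<omega>
    unfolding \<eta>1_def norm_power2_matrix power_mult_distrib[symmetric]
    by (intro sum.cong refl arg_cong[where f = "\<lambda>x. x\<^sup>2"]) (simp add: gram_entry Qm_entry T_def[abs_def] right_diff_distrib)
  have i: "integrable M (\<lambda>\<omega>. (1 / real N)\<^sup>2 * (T i j \<omega> - expectation (T i j))\<^sup>2)" for i j
    by (intro integrable_mult_right integrable_sq_centered[OF mT bT])
  show "integrable M (\<lambda>\<omega>. (\<eta>1 \<omega>)\<^sup>2)" unfolding eq
    by (intro Bochner_Integration.integrable_sum i)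
  have V: "expectation (\<lambda>\<omega>. (T i j \<omega> - expectation (T i j))\<^sup>2) \<le> 8 * real N * D0 * C ^ 4" for i j
  proof -
    have "F.dep_on {n} (\<lambda>\<omega>. x n \<omega> $ i * x n \<omega> $ j)" for n
      using dep_fun[of "\<lambda>p. fst p $ i * fst p $ j" n] by simp
    from F.variance_sum_single_le[OF this AE_outer_entry]
    show ?thesis by (simp add: T_def[abs_def] mult_ac)
  qed
  have "expectation (\<lambda>\<omega>. (\<eta>1 \<omega>)\<^sup>2) = (\<Sum>i\<in>UNIV. \<Sum>j\<in>UNIV. (1 / real N)\<^sup>2 * expectation (\<lambda>\<omega>. (T i j \<omega> - expectation (T i j))\<^sup>2))"
    unfolding eq using i by (simp add: Bochner_Integration.integral_sum Bochner_Integration.integrable_sum del: integrable_mult_right_iff)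
  also have "\<dots> \<le> (\<Sum>i\<in>(UNIV :: 'k set). \<Sum>j\<in>(UNIV :: 'k set). (1 / real N)\<^sup>2 * (8 * real N * D0 * C ^ 4))"
    by (intro sum_mono mult_left_mono V) simp
  also have "\<dots> = (real CARD('k))\<^sup>2 * ((1 / real N)\<^sup>2 * (8 * real N * D0 * C ^ 4))" by (simp add: power2_eq_square)
  also have "\<dots> = 8 * (real CARD('k))\<^sup>2 * C ^ 4 * D0 / real N" using N_pos by (simp add: power2_eq_square)
  finally show "real N * expectation (\<lambda>\<omega>. (\<eta>1 \<omega>)\<^sup>2) \<le> 8 * (real CARD('k))\<^sup>2 * C ^ 4 * D0"
    using N_pos by (simp add: pos_le_divide_eq mult.commute)
qed

lemma AE_inner_St: "AE \<omega> in M. \<bar>a \<bullet> St \<omega>\<bar> \<le> norm a * (real N * C\<^sup>2)"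
  using AE_data
proof eventually_elim
  case (elim \<omega>)
  have "norm a * norm (St \<omega>) \<le> norm a * (real N * C\<^sup>2)" by (intro mult_left_mono norm_St_le elim) simp
  then show ?case using Cauchy_Schwarz_ineq2[of a "St \<omega>"] by linarith
qed

lemma St_moment: "integrable M (\<lambda>\<omega>. (norm (St \<omega>))\<^sup>2)"
  "expectation (\<lambda>\<omega>. (norm (St \<omega>))\<^sup>2) / real N \<le> 8 * real CARD('k) * C ^ 4 * D0"
proof -
  have eq: "(norm (St \<omega>))\<^sup>2 = (\<Sum>i\<in>UNIV. (axis i 1 \<bullet> St \<omega>)\<^sup>2)" for \<omega>
    by (simp add: norm_power2_vec inner_axis')
  have i: "integrable M (\<lambda>\<omega>. (a \<bullet> St \<omega>)\<^sup>2)" for a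
    using integrable_sq_centered[OF _ AE_inner_St[of a], of 0] by simp
  show "integrable M (\<lambda>\<omega>. (norm (St \<omega>))\<^sup>2)" unfolding eq by (intro Bochner_Integration.integrable_sum i)
  have "expectation (\<lambda>\<omega>. (norm (St \<omega>))\<^sup>2) = (\<Sum>i\<in>UNIV. expectation (\<lambda>\<omega>. (axis i 1 \<bullet> St \<omega>)\<^sup>2))"
    unfolding eq by (rule Bochner_Integration.integral_sum) (rule i)
  also have "\<dots> \<le> (\<Sum>i\<in>(UNIV :: 'k set). 8 * real N * D0 * (norm (axis i 1 :: real ^ 'k) * C\<^sup>2)\<^sup>2)"
    by (intro sum_mono variance_linear_le)
  also have "\<dots> = 8 * real CARD('k) * C ^ 4 * D0 * real N" by simp
  finally show "expectation (\<lambda>\<omega>. (norm (St \<omega>))\<^sup>2) / real N \<le> 8 * real CARD('k) * C ^ 4 * D0"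
    using N_pos by (simp add: pos_divide_le_eq)
qed

definition \<Psi> where "\<Psi> \<omega> = real N * (\<eta>1 \<omega>)\<^sup>2 + (norm (St \<omega>))\<^sup>2 / real N + D0"
definition K\<Psi> where "K\<Psi> = 8 * (real CARD('k))\<^sup>2 * C ^ 4 + 8 * real CARD('k) * C ^ 4 + 1"

lemma \<Psi>_moment: "\<Psi> \<in> borel_measurable M" "integrable M \<Psi>" "expectation \<Psi> \<le> K\<Psi> * D0"
proof -
  show "\<Psi> \<in> borel_measurable M" unfolding \<Psi>_def[abs_def] by measurable
  show "integrable M \<Psi>" unfolding \<Psi>_def[abs_def] using \<eta>1_moment(1) St_moment(1) by simp
  have "expectation \<Psi> = real N * expectation (\<lambda>\<omega>. (\<eta>1 \<omega>)\<^sup>2) + expectation (\<lambda>\<omega>. (norm (St \<omega>))\<^sup>2) / real N + D0"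
    unfolding \<Psi>_def[abs_def] using \<eta>1_moment(1) St_moment(1) by (simp add: prob_space)
  then show "expectation \<Psi> \<le> K\<Psi> * D0"
    using \<eta>1_moment(2) St_moment(2) by (simp add: K\<Psi>_def algebra_simps)
qed

text \<open>The sum of S_g S_g' evaluated at a pair of directions; two arguments are kept so that
  single matrix entries can be read off.\<close>

definition \<Xi> where "\<Xi> a c \<omega> = (\<Sum>g\<in>{1..G}. (a \<bullet> (\<Sum>n\<in>inc g. score n \<omega>)) * (c \<bullet> (\<Sum>n\<in>inc g. score n \<omega>)))"

text \<open>Bias and variance are treated apart. The variance is that of a sum over adjacent pairs,
  with 512 = 16 times 2^3 times 2^2; the bias is the excess weight of pairs with a common dyad, each
  bounded by C^4 / lam.\<close>

lemma \<Xi>_moment: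
  assumes a: "lam * (a \<bullet> a) \<le> 1" and c: "lam * (c \<bullet> c) \<le> 1"
  shows "\<Xi> a c \<in> borel_measurable M" "integrable M (\<lambda>\<omega>. (\<Xi> a c \<omega> - a \<bullet> (Om *v c))\<^sup>2)"
    "expectation (\<lambda>\<omega>. (\<Xi> a c \<omega> - a \<bullet> (Om *v c))\<^sup>2) \<le> 512 * C ^ 8 * (real N * D0 ^ 3 / lam\<^sup>2)
      + C ^ 8 * (real (multiplicity_sum G N psi) / lam)\<^sup>2"
proof -
  define f where "f n \<omega> = a \<bullet> score n \<omega>" for n \<omega>
  define h where "h n \<omega> = c \<bullet> score n \<omega>" for n \<omega>
  define Z where "Z n m \<omega> = real (card (psi n \<inter> psi m)) * (f n \<omega> * h m \<omega>)" for n m \<omega>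
  define B where "B = 2 * (C ^ 4 / lam)"
  have \<Xi>_eq: "\<Xi> a c \<omega> = (\<Sum>n\<in>I. \<Sum>m\<in>{m \<in> I. adj n m}. Z n m \<omega>)" for \<omega>
    unfolding \<Xi>_def inner_sum_right Z_def f_def h_def by (rule sum_incident_product)
  have ac: "norm a * norm c \<le> 1 / lam"
  proof -
    have "(norm a)\<^sup>2 \<le> 1 / lam" "(norm c)\<^sup>2 \<le> 1 / lam"
      using a c lam_pos by (simp_all add: power2_norm_eq_inner pos_le_divide_eq mult.commute)
    moreover have "2 * (norm a * norm c) \<le> (norm a)\<^sup>2 + (norm c)\<^sup>2"
      using zero_le_power2[of "norm a - norm c"] by (simp add: power2_diff)
    ultimately show ?thesis by linarith
  qed
  have fh: "AE \<omega> in M. \<bar>f n \<omega> * h m \<omega>\<bar> \<le> C ^ 4 / lam" if "n \<in> I" "m \<in> I" for n m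
    using AE_inner_score[OF that(1), of a] AE_inner_score[OF that(2), of c]
  proof eventually_elim
    case (elim \<omega>)
    then have "\<bar>f n \<omega>\<bar> * \<bar>h m \<omega>\<bar> \<le> (norm a * C\<^sup>2) * (norm c * C\<^sup>2)"
      unfolding f_def h_def by (intro mult_mono) auto
    also have "\<dots> = (norm a * norm c) * C ^ 4" by (simp add: power2_eq_square power4_eq_xxxx)
    also have "\<dots> \<le> 1 / lam * C ^ 4" by (intro mult_right_mono ac) simp
    finally show ?case by (simp add: abs_mult)
  qed
  have c2: "real (card (psi n \<inter> psi m)) \<le> 2" if "n \<in> I" "m \<in> I" for n m
    using card_Int_dyads[OF that] by simp
  have Zb: "AE \<omega> in M. \<bar>Z n m \<omega>\<bar> \<le> B" if nm: "n \<in> I" "m \<in> I" for n m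
    using fh[OF nm]
  proof eventually_elim
    case (elim \<omega>)
    have "real (card (psi n \<inter> psi m)) * \<bar>f n \<omega> * h m \<omega>\<bar> \<le> 2 * (C ^ 4 / lam)"
      by (intro mult_mono elim c2[OF nm]) auto
    then show ?case by (simp add: Z_def B_def abs_mult)
  qed
  have dep: "F.dep_on {n, m} (Z n m)" for n m
    unfolding Z_def[abs_def] f_def h_def
    by (intro F.dep_on_mult F.dep_on_const F.dep_on_mono[OF dep_inner_score]) auto
  have var: "expectation (\<lambda>\<omega>. (\<Xi> a c \<omega> - expectation (\<Xi> a c))\<^sup>2) \<le> 16 * real N * (2 * D0) ^ 3 * B\<^sup>2"
    using F.variance_sum_pair_le[of Z B, OF dep Zb] by (simp add: \<Xi>_eq[abs_def])
  have mZ: "Z n m \<in> borel_measurable M" if "n \<in> I" "m \<in> I" for n m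
    by (rule F.dep_on_measurable[OF dep]) (use that in auto)
  show m\<Xi>: "\<Xi> a c \<in> borel_measurable M"
    unfolding \<Xi>_eq[abs_def] using mZ by (intro borel_measurable_sum) auto
  have iZ: "integrable M (Z n m)" if "n \<in> I" "m \<in> I" for n m
    by (rule integrable_const_bound[of _ B]) (use Zb[OF that] mZ[OF that] in auto)
  have ifh: "integrable M (\<lambda>\<omega>. f n \<omega> * h m \<omega>)" if "n \<in> I" "m \<in> I" for n m
    by (rule integrable_const_bound[of _ "C ^ 4 / lam"]) (use fh[OF that] that in \<open>auto simp: f_def h_def\<close>)
  have "\<exists>B'. AE \<omega> in M. \<bar>\<Xi> a c \<omega>\<bar> \<le> B'"
  proof
    have "AE \<omega> in M. \<forall>n\<in>I. \<forall>m\<in>I. \<bar>Z n m \<omega>\<bar> \<le> B"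
      by (intro AE_finite_allI) (use Zb in auto)
    then show "AE \<omega> in M. \<bar>\<Xi> a c \<omega>\<bar> \<le> (\<Sum>n\<in>I. \<Sum>m\<in>{m \<in> I. adj n m}. B)"
    proof eventually_elim
      case (elim \<omega>)
      then show ?case unfolding \<Xi>_eq
        by (intro order_trans[OF sum_abs] sum_mono) auto
    qed
  qed
  then obtain B' where B': "AE \<omega> in M. \<bar>\<Xi> a c \<omega>\<bar> \<le> B'" ..
  show "integrable M (\<lambda>\<omega>. (\<Xi> a c \<omega> - a \<bullet> (Om *v c))\<^sup>2)" by (rule integrable_sq_centered[OF m\<Xi> B'])
  have zero: "expectation (\<lambda>\<omega>. f n \<omega> * h m \<omega>) = 0" if nm: "n \<in> I" "m \<in> I" "\<not> adj n m" for n m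
  proof -
    have "expectation (\<lambda>\<omega>. f n \<omega> * h m \<omega>) = expectation (f n) * expectation (h m)"
      unfolding f_def[abs_def] h_def[abs_def]
      by (intro F.indep_product[OF dep_inner_score _ dep_inner_score] integrable_inner_score) (use nm in auto)
    then show ?thesis using mean_inner_score[OF nm(1)] by (simp add: f_def[abs_def])
  qed
  have Om_eq: "a \<bullet> (Om *v c) = (\<Sum>n\<in>I. \<Sum>m\<in>{m \<in> I. adj n m}. expectation (\<lambda>\<omega>. f n \<omega> * h m \<omega>))"
  proof -
    have "a \<bullet> (Om *v c) = expectation (\<lambda>\<omega>. \<Sum>n\<in>I. \<Sum>m\<in>I. f n \<omega> * h m \<omega>)"
      unfolding Om_form St_def inner_sum_right sum_product f_def h_def ..
    also have "\<dots> = (\<Sum>n\<in>I. \<Sum>m\<in>I. expectation (\<lambda>\<omega>. f n \<omega> * h m \<omega>))"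
      by (rule integral_sum_sum) (rule ifh)
    also have "\<dots> = (\<Sum>n\<in>I. \<Sum>m\<in>{m \<in> I. adj n m}. expectation (\<lambda>\<omega>. f n \<omega> * h m \<omega>))"
      by (intro sum.cong refl sum.mono_neutral_right) (use zero in auto)
    finally show ?thesis .
  qed
  have EZ: "expectation (Z n m) = real (card (psi n \<inter> psi m)) * expectation (\<lambda>\<omega>. f n \<omega> * h m \<omega>)" for n m
    unfolding Z_def[abs_def] by (rule integral_mult_right_zero)
  have "expectation (\<Xi> a c) = (\<Sum>n\<in>I. \<Sum>m\<in>{m \<in> I. adj n m}. expectation (Z n m))"
    unfolding \<Xi>_eq[abs_def] by (rule integral_sum_sum) (rule iZ, auto)
  then have E\<Xi>: "expectation (\<Xi> a c) = (\<Sum>n\<in>I. \<Sum>m\<in>{m \<in> I. adj n m}. real (card (psi n \<inter> psi m)) * expectation (\<lambda>\<omega>. f n \<omega> * h m \<omega>))"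
    by (simp only: EZ)
  \<comment> \<open>On adjacent pairs the weight minus 1 is the indicator of a common dyad.\<close>
  have dE: "expectation (\<Xi> a c) - a \<bullet> (Om *v c) = (\<Sum>n\<in>I. \<Sum>m\<in>{m \<in> I. adj n m}. (if psi m = psi n then 1 else 0) * expectation (\<lambda>\<omega>. f n \<omega> * h m \<omega>))"
    unfolding E\<Xi> Om_eq sum_subtractf[symmetric]
  proof (intro sum.cong refl)
    fix n m assume n: "n \<in> I" and m: "m \<in> {m \<in> I. adj n m}"
    have c: "real (card (psi n \<inter> psi m)) = 1 + (if psi m = psi n then 1 else 0)"
      using card_Int_dyads[OF n, of m] m by simp
    show "real (card (psi n \<inter> psi m)) * expectation (\<lambda>\<omega>. f n \<omega> * h m \<omega>) - expectation (\<lambda>\<omega>. f n \<omega> * h m \<omega>)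
      = (if psi m = psi n then 1 else 0) * expectation (\<lambda>\<omega>. f n \<omega> * h m \<omega>)"
      unfolding c by (simp only: distrib_right mult_1 add_diff_cancel_left')
  qed
  have "\<bar>expectation (\<Xi> a c) - a \<bullet> (Om *v c)\<bar> \<le> (\<Sum>n\<in>I. \<Sum>m\<in>{m \<in> I. adj n m}. if psi m = psi n then C ^ 4 / lam else 0)"
    unfolding dE
  proof (intro order_trans[OF sum_abs] sum_mono)
    fix n m assume nm: "n \<in> I" "m \<in> {m \<in> I. adj n m}"
    have "\<bar>expectation (\<lambda>\<omega>. f n \<omega> * h m \<omega>)\<bar> \<le> expectation (\<lambda>\<omega>. \<bar>f n \<omega> * h m \<omega>\<bar>)" by (rule integral_abs_bound)
    also have "\<dots> \<le> expectation (\<lambda>_. C ^ 4 / lam)"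
      using nm by (intro integral_mono_AE fh integrable_abs ifh) auto
    finally show "\<bar>(if psi m = psi n then 1 else 0) * expectation (\<lambda>\<omega>. f n \<omega> * h m \<omega>)\<bar> \<le> (if psi m = psi n then C ^ 4 / lam else 0)"
      by (simp add: prob_space)
  qed
  also have "\<dots> = (\<Sum>n\<in>I. real (card {m \<in> I. psi m = psi n}) * (C ^ 4 / lam))"
  proof (rule sum.cong[OF refl])
    fix n assume n: "n \<in> I"
    have "(\<Sum>m\<in>{m \<in> I. adj n m}. if psi m = psi n then C ^ 4 / lam else 0) = (\<Sum>m\<in>{m \<in> {m \<in> I. adj n m}. psi m = psi n}. C ^ 4 / lam)"
      by (rule sum.inter_filter[symmetric]) simp
    also have "{m \<in> {m \<in> I. adj n m}. psi m = psi n} = {m \<in> I. psi m = psi n}"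
    proof -
      have "adj n m" if "psi m = psi n" for m using adj_refl[OF n] unfolding adj_def that .
      then show ?thesis by blast
    qed
    finally show "(\<Sum>m\<in>{m \<in> I. adj n m}. if psi m = psi n then C ^ 4 / lam else 0) = real (card {m \<in> I. psi m = psi n}) * (C ^ 4 / lam)"
      by simp
  qed
  also have "\<dots> = C ^ 4 * (real (multiplicity_sum G N psi) / lam)"
    unfolding multiplicity_sum_eq sum_distrib_right[symmetric] by (simp add: mult.commute)
  finally have bias: "\<bar>expectation (\<Xi> a c) - a \<bullet> (Om *v c)\<bar> \<le> C ^ 4 * (real (multiplicity_sum G N psi) / lam)" .
  have "(expectation (\<Xi> a c) - a \<bullet> (Om *v c))\<^sup>2 \<le> (C ^ 4 * (real (multiplicity_sum G N psi) / lam))\<^sup>2"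
    using power_mono[OF bias, of 2] by simp
  then have "expectation (\<lambda>\<omega>. (\<Xi> a c \<omega> - a \<bullet> (Om *v c))\<^sup>2) \<le> 16 * real N * (2 * D0) ^ 3 * B\<^sup>2 + (C ^ 4 * (real (multiplicity_sum G N psi) / lam))\<^sup>2"
    unfolding mean_square_decomposition[OF m\<Xi> B', of "a \<bullet> (Om *v c)"] using var by linarith
  also have "\<dots> = 512 * C ^ 8 * (real N * D0 ^ 3 / lam\<^sup>2) + C ^ 8 * (real (multiplicity_sum G N psi) / lam)\<^sup>2"
    by (simp add: B_def power_mult_distrib power_divide)
  finally show "expectation (\<lambda>\<omega>. (\<Xi> a c \<omega> - a \<bullet> (Om *v c))\<^sup>2) \<le> 512 * C ^ 8 * (real N * D0 ^ 3 / lam\<^sup>2)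
      + C ^ 8 * (real (multiplicity_sum G N psi) / lam)\<^sup>2" .
qed

end

lemma norm_le_if_inner_le:
  fixes z :: "'b::real_inner"
  assumes "\<And>t. \<bar>t \<bullet> z\<bar> \<le> c * norm t" "0 \<le> c"
  shows "norm z \<le> c"
proof (cases "z = 0")
  case True
  then show ?thesis using assms(2) by simp
next
  case False
  have "norm z * norm z \<le> c * norm z" using assms(1)[of z] by (simp add: power2_norm_eq_inner[symmetric] power2_eq_square)
  then show ?thesis using False by simp
qed

lemma transpose_jackknife_variance: "transpose (jackknife_variance G N psi xs ys) = jackknife_variance G N psi xs ys"
  for xs :: "nat \<Rightarrow> real ^ 'k"
proof -
  have "transpose (\<Sum>g\<in>J. outer (f g) (f g)) = (\<Sum>g\<in>J. outer (f g) (f g))" for J and f :: "nat \<Rightarrow> real ^ 'k"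
    by (induction J rule: infinite_finite_induct) (simp_all add: transpose_add transpose_outer, simp_all add: transpose_def vec_eq_iff)
  moreover have "transpose (0 :: real ^ 'k ^ 'k) = 0" by (simp add: transpose_def vec_eq_iff)
  ultimately show ?thesis by (simp add: jackknife_variance_def transpose_scaleR)
qed

lemma jackknife_variance_nonneg: "0 \<le> v \<bullet> (jackknife_variance G N psi xs ys *v v)"
  for xs :: "nat \<Rightarrow> real ^ 'k"
proof -
  have "0 \<le> v \<bullet> ((\<Sum>g\<in>J. outer (f g) (f g)) *v v)" for J and f :: "nat \<Rightarrow> real ^ 'k"
    by (induction J rule: infinite_finite_induct)
       (simp_all add: matrix_vector_mult_add_rdistrib outer_apply inner_add_right inner_commute)
  then show ?thesis
    by (cases "G = 0") (auto simp: jackknife_variance_def scaleR_matrix_vector_assoc[symmetric] intro!: mult_nonneg_nonneg)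
qed

section \<open>Bounds for a fixed number of units\<close>

context dyadic_model
begin

text \<open>\<open>char_bound\<close> with degree bound 2 D0 and score bound |a| C^2; the constant
  is 72 times 2^3.\<close>

theorem clt_bound:
  assumes l: "0 < l" "l * (2 * D0 * (norm a * C\<^sup>2)) \<le> 1" and small: "2 * D0 * (norm a * C\<^sup>2) \<le> 1"
  shows "norm ((CLINT \<omega>|M. iexp (a \<bullet> St \<omega>)) - complex_of_real (exp (- (a \<bullet> (Om *v a)) / 2)))
    \<le> 576 * exp 3 * C ^ 8 * (real N * D0 ^ 3 * norm a ^ 4) * (1 + l) + (a \<bullet> (Om *v a)) / (2 * l)"
proof -
  interpret B: bounded_scores M "{1..N}" adj \<xi> "2 * D0" "\<lambda>n \<omega>. a \<bullet> score n \<omega>" "norm a * C\<^sup>2"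
  proof
    show "\<And>n. n \<in> I \<Longrightarrow> F.dep_on {n} (\<lambda>\<omega>. a \<bullet> score n \<omega>)" by (rule dep_inner_score)
    show "\<And>n. n \<in> I \<Longrightarrow> expectation (\<lambda>\<omega>. a \<bullet> score n \<omega>) = 0" by (rule mean_inner_score)
    show "\<And>n. n \<in> I \<Longrightarrow> AE \<omega> in M. \<bar>a \<bullet> score n \<omega>\<bar> \<le> norm a * C\<^sup>2" by (rule AE_inner_score)
    show "0 \<le> norm a * C\<^sup>2" by simp
    show "2 * D0 * (norm a * C\<^sup>2) \<le> 1" by (rule small)
  qed
  have W: "B.W \<omega> = a \<bullet> St \<omega>" for \<omega> unfolding B.W_def St_def inner_sum_right ..
  have s: "B.\<sigma>2 = a \<bullet> (Om *v a)"
    unfolding B.\<sigma>2_eq[symmetric] W Om_form by (simp add: power2_eq_square)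
  have eta: "B.\<eta> = 576 * exp 3 * C ^ 8 * (real N * D0 ^ 3 * norm a ^ 4)"
    unfolding B.\<eta>_def by (simp add: power_mult_distrib)
  show ?thesis using B.char_bound[OF l] unfolding W s eta .
qed

text \<open>The matrix sum of S_g S_g' whitened by Om^(-1/2). Its distance to the identity controls
  all directions at once, relative to Om.\<close>

definition Xm where "Xm \<omega> = inv_sqrt_mat Om ** (\<Sum>g\<in>{1..G}. outer (\<Sum>n\<in>inc g. score n \<omega>) (\<Sum>n\<in>inc g. score n \<omega>)) ** inv_sqrt_mat Om"

lemma sum_outer_apply: "(\<Sum>g\<in>J. outer (f g) (f g)) *v v = (\<Sum>g\<in>J. (f g \<bullet> v) *\<^sub>R f g)"
  by (induction J rule: infinite_finite_induct) (simp_all add: matrix_vector_mult_add_rdistrib outer_apply)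

lemma Xm_form: "a \<bullet> (Xm \<omega> *v c) = \<Xi> (inv_sqrt_mat Om *v a) (inv_sqrt_mat Om *v c) \<omega>"
proof -
  have "a \<bullet> (Xm \<omega> *v c) = (inv_sqrt_mat Om *v a) \<bullet> ((\<Sum>g\<in>{1..G}. outer (\<Sum>n\<in>inc g. score n \<omega>) (\<Sum>n\<in>inc g. score n \<omega>)) *v (inv_sqrt_mat Om *v c))"
    unfolding Xm_def matrix_vector_mul_assoc[symmetric]
    by (rule inner_matrix_vector_sym[OF inv_sqrt_mat_properties(2)[OF Omega_pos]])
  then show ?thesis by (simp add: sum_outer_apply \<Xi>_def inner_sum_right inner_commute mult.commute)
qed

lemma inv_sqrt_Om_form: "(inv_sqrt_mat Om *v a) \<bullet> (Om *v (inv_sqrt_mat Om *v c)) = a \<bullet> c"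
proof -
  have "(inv_sqrt_mat Om *v a) \<bullet> (Om *v (inv_sqrt_mat Om *v c)) = a \<bullet> (inv_sqrt_mat Om *v (Om *v (inv_sqrt_mat Om *v c)))"
    by (rule inner_matrix_vector_sym[OF inv_sqrt_mat_properties(2)[OF Omega_pos], symmetric])
  then show ?thesis
    using inv_sqrt_mat_properties(5)[OF Omega_pos] by (simp add: matrix_vector_mul_assoc matrix_mul_assoc)
qed

definition \<delta> where "\<delta> = 512 * C ^ 8 * (real N * D0 ^ 3 / lam\<^sup>2) + C ^ 8 * (real (multiplicity_sum G N psi) / lam)\<^sup>2"

text \<open>The entries are \<Xi> at whitened basis vectors; these satisfy lam |a|^2 \<le> 1 because
  their Om-form is 1.\<close>

lemma Xm_moment:
  "(\<lambda>\<omega>. norm (Xm \<omega> - mat 1)) \<in> borel_measurable M"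
  "integrable M (\<lambda>\<omega>. (norm (Xm \<omega> - mat 1))\<^sup>2)"
  "expectation (\<lambda>\<omega>. (norm (Xm \<omega> - mat 1))\<^sup>2) \<le> (real CARD('k))\<^sup>2 * \<delta>"
proof -
  let ?a = "\<lambda>i. inv_sqrt_mat Om *v axis i 1"
  have la: "lam * (?a i \<bullet> ?a i) \<le> 1" for i
    using lam_le[of "?a i"] by (simp add: inv_sqrt_Om_form inner_axis_axis)
  note m = \<Xi>_moment[OF la la]
  have ent: "(Xm \<omega> - mat 1) $ i $ j = \<Xi> (?a i) (?a j) \<omega> - ?a i \<bullet> (Om *v ?a j)" for \<omega> i j
  proof -
    have "mat 1 $ i $ j = axis i 1 \<bullet> (axis j 1 :: real ^ 'k)" by (simp add: mat_def inner_axis_axis)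
    then show ?thesis by (simp add: matrix_entry_form[of "Xm \<omega>"] Xm_form inv_sqrt_Om_form)
  qed
  have eq: "(norm (Xm \<omega> - mat 1))\<^sup>2 = (\<Sum>i\<in>UNIV. \<Sum>j\<in>UNIV. (\<Xi> (?a i) (?a j) \<omega> - ?a i \<bullet> (Om *v ?a j))\<^sup>2)" for \<omega>
    unfolding norm_power2_matrix ent ..
  have "(\<lambda>\<omega>. Xm \<omega> - mat 1) \<in> borel_measurable M"
    by (intro borel_measurable_vecI) (simp only: ent, use m(1) in measurable)
  then show "(\<lambda>\<omega>. norm (Xm \<omega> - mat 1)) \<in> borel_measurable M" by simp
  show "integrable M (\<lambda>\<omega>. (norm (Xm \<omega> - mat 1))\<^sup>2)" unfolding eq
    by (intro Bochner_Integration.integrable_sum m(2))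
  have "expectation (\<lambda>\<omega>. (norm (Xm \<omega> - mat 1))\<^sup>2) = (\<Sum>i\<in>UNIV. \<Sum>j\<in>UNIV. expectation (\<lambda>\<omega>. (\<Xi> (?a i) (?a j) \<omega> - ?a i \<bullet> (Om *v ?a j))\<^sup>2))"
    unfolding eq by (rule integral_sum_sum) (rule m(2))
  also have "\<dots> \<le> (\<Sum>i\<in>(UNIV :: 'k set). \<Sum>j\<in>(UNIV :: 'k set). \<delta>)"
    unfolding \<delta>_def by (intro sum_mono m(3))
  finally show "expectation (\<lambda>\<omega>. (norm (Xm \<omega> - mat 1))\<^sup>2) \<le> (real CARD('k))\<^sup>2 * \<delta>"
    by (simp add: power2_eq_square)
qed

text \<open>Off this set the hypotheses of \<open>jackknife_data\<close> and
  \<open>jackknife_deviation\<close> hold at precision \<theta>, once the data are bounded and the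
  degrees small.\<close>

definition Bad where "Bad \<theta> = {\<omega> \<in> space M. cQ / 4 < norm (\<eta>1 \<omega>)} \<union> {\<omega> \<in> space M. \<theta> * sqrt lam \<le> \<Psi> \<omega>}
   \<union> {\<omega> \<in> space M. \<theta> < norm (Xm \<omega> - mat 1)}"

lemma Bad_sets: "Bad \<theta> \<in> sets M"
  unfolding Bad_def using \<Psi>_moment(1) Xm_moment(1) by measurable

text \<open>Chebyshev's inequality for the first and third event, Markov's for \<Psi>; 128 is 8
  times 4^2.\<close>

lemma prob_Bad_le:
  assumes \<theta>: "0 < \<theta>"
  shows "prob (Bad \<theta>) \<le> 128 * (real CARD('k))\<^sup>2 * C ^ 4 / cQ\<^sup>2 * (D0 / real N) + K\<Psi> / \<theta> * (D0 / sqrt lam) + (real CARD('k))\<^sup>2 / \<theta>\<^sup>2 * \<delta>"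
proof -
  have m1: "{\<omega> \<in> space M. cQ / 4 < norm (\<eta>1 \<omega>)} \<in> sets M" "{\<omega> \<in> space M. \<theta> * sqrt lam \<le> \<Psi> \<omega>} \<in> sets M"
    "{\<omega> \<in> space M. \<theta> < norm (Xm \<omega> - mat 1)} \<in> sets M"
    using \<Psi>_moment(1) Xm_moment(1) by measurable
  have "prob (Bad \<theta>) \<le> prob {\<omega> \<in> space M. cQ / 4 < norm (\<eta>1 \<omega>)} + prob {\<omega> \<in> space M. \<theta> * sqrt lam \<le> \<Psi> \<omega>}
    + prob {\<omega> \<in> space M. \<theta> < norm (Xm \<omega> - mat 1)}"
    unfolding Bad_def by (rule order_trans[OF measure_Un_le add_right_mono[OF measure_Un_le]]) (use m1 in auto)
  also have "prob {\<omega> \<in> space M. cQ / 4 < norm (\<eta>1 \<omega>)} \<le> expectation (\<lambda>\<omega>. (norm (\<eta>1 \<omega>))\<^sup>2) / (cQ / 4)\<^sup>2"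
    by (rule markov_inequality_square) (use \<eta>1_moment(1) cQ in auto)
  also have "\<dots> \<le> (8 * (real CARD('k))\<^sup>2 * C ^ 4 * D0 / real N) / (cQ / 4)\<^sup>2"
    using \<eta>1_moment(2) N_pos by (intro divide_right_mono) (auto simp: pos_le_divide_eq mult.commute)
  also have "\<dots> = 128 * (real CARD('k))\<^sup>2 * C ^ 4 / cQ\<^sup>2 * (D0 / real N)" by (simp add: power_divide mult_ac)
  also have "prob {\<omega> \<in> space M. \<theta> * sqrt lam \<le> \<Psi> \<omega>} \<le> expectation \<Psi> / (\<theta> * sqrt lam)"
  proof -
    have "0 \<le> \<Psi> \<omega>" for \<omega> using D0_ge by (simp add: \<Psi>_def)
    then show ?thesis
      using integral_Markov_inequality_measure[OF \<Psi>_moment(2), of "space M" "\<theta> * sqrt lam"] \<theta> lam_pos by simp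
  qed
  also have "\<dots> \<le> (K\<Psi> * D0) / (\<theta> * sqrt lam)"
    using \<Psi>_moment(3) \<theta> lam_pos by (intro divide_right_mono) auto
  also have "\<dots> = K\<Psi> / \<theta> * (D0 / sqrt lam)" by simp
  also have "prob {\<omega> \<in> space M. \<theta> < norm (Xm \<omega> - mat 1)} \<le> expectation (\<lambda>\<omega>. (norm (norm (Xm \<omega> - mat 1)))\<^sup>2) / \<theta>\<^sup>2"
    using markov_inequality_square[of "\<lambda>\<omega>. norm (Xm \<omega> - mat 1)", OF Xm_moment(1) _ \<theta>] Xm_moment(2) by simp
  also have "\<dots> \<le> ((real CARD('k))\<^sup>2 * \<delta>) / \<theta>\<^sup>2"
    using Xm_moment(3) by (intro divide_right_mono) auto
  finally show ?thesis by simp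
qed

abbreviation Vm where "Vm \<equiv> sandwich_variance M N x u"
text \<open>The direction w with v = N Q w, which turns the V-form at v into the Om-form at
  w.\<close>

definition wdir where "wdir v = (1 / real N) *\<^sub>R (matrix_inv Qm *v v)"

lemma invertible_Qm: "invertible Qm" by (rule invertible_of_lower_bound(1)[OF cQ Qm_low])

lemma wdir_eq: "v = real N *\<^sub>R (Qm *v wdir v)"
  using N_pos by (simp add: wdir_def matrix_vector_mult_scaleR matrix_inv_apply_cancel(2)[OF invertible_Qm])

lemma Vm_form: "v \<bullet> (Vm *v v') = wdir v \<bullet> (Om *v wdir v')"
proof -
  have sym: "transpose (matrix_inv Qm) = matrix_inv Qm" by (simp add: transpose_matrix_inv[OF invertible_Qm] Qm_sym)
  have "v \<bullet> (Vm *v v') = (1 / (real N)\<^sup>2) * (v \<bullet> (matrix_inv Qm *v (Om *v (matrix_inv Qm *v v'))))"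
    by (simp add: sandwich_variance_def scaleR_matrix_vector_assoc[symmetric] matrix_vector_mul_assoc[symmetric])
  also have "v \<bullet> (matrix_inv Qm *v (Om *v (matrix_inv Qm *v v'))) = (matrix_inv Qm *v v) \<bullet> (Om *v (matrix_inv Qm *v v'))"
    by (rule inner_matrix_vector_sym[OF sym])
  finally show ?thesis by (simp add: wdir_def matrix_vector_mult_scaleR power2_eq_square)
qed

lemma Vm_pos_def: "pos_def Vm"
proof -
  have sym: "transpose (matrix_inv Qm) = matrix_inv Qm" by (simp add: transpose_matrix_inv[OF invertible_Qm] Qm_sym)
  have "transpose Vm = Vm"
    by (simp add: sandwich_variance_def transpose_scaleR matrix_transpose_mul sym Om_sym matrix_mul_assoc)
  moreover have "0 < v \<bullet> (Vm *v v)" if "v \<noteq> 0" for v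
  proof -
    have "wdir v \<noteq> 0"
    proof
      assume w: "wdir v = 0"
      have "v = real N *\<^sub>R (Qm *v 0)" using wdir_eq[of v] unfolding w .
      with that show False by simp
    qed
    then show ?thesis unfolding Vm_form using Omega_pos by (simp add: pos_def_def)
  qed
  ultimately show ?thesis by (simp add: pos_def_def)
qed

lemma norm_wdir_le: "norm (wdir v) \<le> sqrt (v \<bullet> (Vm *v v)) / sqrt lam"
proof -
  have "(norm (wdir v))\<^sup>2 \<le> (v \<bullet> (Vm *v v)) / lam"
    unfolding Vm_form power2_norm_eq_inner using lam_le[of "wdir v"] lam_pos by (simp add: pos_le_divide_eq mult.commute)
  then have "norm (wdir v) \<le> sqrt ((v \<bullet> (Vm *v v)) / lam)" by (rule real_le_rsqrt)
  then show ?thesis by (simp add: real_sqrt_divide)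
qed

text \<open>The constant \<open>K\<close> of \<open>jackknife_data\<close> with its parameters made
  explicit.\<close>

definition KJ where "KJ = 16 * C ^ 4 / cQ\<^sup>2 + 32 * C ^ 4 * (C\<^sup>2 * (1 + 2 * C\<^sup>2 / cQ))\<^sup>2 / cQ\<^sup>2"

text \<open>The deterministic results are instantiated at each \<omega>. The exceptional null set
  comes from the bounds on the data alone and therefore serves all directions v
  simultaneously.\<close>

lemma good_event:
  fixes y :: "nat \<Rightarrow> 'a \<Rightarrow> real"
  assumes model: "\<forall>n\<in>{1..N}. \<forall>\<omega>\<in>space M. y n \<omega> = \<beta> \<bullet> x n \<omega> + u n \<omega>"
    and small: "D0 * C\<^sup>2 \<le> cQ / 4 * real N" and \<theta>: "0 < \<theta>" "\<theta> \<le> 1"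
  shows "AE \<omega> in M. \<omega> \<notin> Bad \<theta> \<longrightarrow>
    jackknife_defined G N psi (\<lambda>n. x n \<omega>) \<and>
    (\<forall>v. \<bar>v \<bullet> (jackknife_variance G N psi (\<lambda>n. x n \<omega>) (\<lambda>n. y n \<omega>) *v v) - v \<bullet> (Vm *v v)\<bar>
        \<le> ((3 + 2 * KJ) * \<theta> + 1 / real G) * (v \<bullet> (Vm *v v))) \<and>
    (\<forall>v. \<bar>v \<bullet> (ols N (\<lambda>n. x n \<omega>) (\<lambda>n. y n \<omega>) - \<beta>) - wdir v \<bullet> St \<omega>\<bar> \<le> sqrt (v \<bullet> (Vm *v v)) * (\<theta> / cQ))"
  using AE_data AE_space
proof eventually_elim
  case (elim \<omega>)
  show ?case
  proof
    assume nb: "\<omega> \<notin> Bad \<theta>"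
    have g: "\<eta>1 \<omega> \<le> cQ / 4" "\<Psi> \<omega> < \<theta> * sqrt lam" "norm (Xm \<omega> - mat 1) \<le> \<theta>"
      using nb elim(2) by (auto simp: Bad_def \<eta>1_def not_less not_le)
    interpret J: jackknife_data G N psi "\<lambda>n. x n \<omega>" "\<lambda>n. u n \<omega>" "\<lambda>n. y n \<omega>" \<beta> C Qm cQ
    proof
      show "\<And>n. n \<in> I \<Longrightarrow> y n \<omega> = \<beta> \<bullet> x n \<omega> + u n \<omega>" using model elim(2) by blast
      show "\<And>n. n \<in> I \<Longrightarrow> norm (x n \<omega>) \<le> C" "\<And>n. n \<in> I \<Longrightarrow> \<bar>u n \<omega>\<bar> \<le> C" using elim(1) by blast+
      show "norm ((1 / real N) *\<^sub>R gram I (\<lambda>n. x n \<omega>) - Qm) \<le> cQ / 4" using g(1) by (simp only: \<eta>1_def)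
    qed (fact C1 cQ Qm_sym Qm_low small)+
    have JS: "J.S = St \<omega>" by (simp add: J.S_def St_def score_def)
    have JSg: "J.Sg g = (\<Sum>n\<in>inc g. score n \<omega>)" for g by (simp add: J.Sg_def score_def)
    have J\<Psi>: "J.\<Psi> = \<Psi> \<omega>" by (simp only: J.\<Psi>_def \<Psi>_def J.\<eta>1_def \<eta>1_def JS)
    have JK: "J.K = KJ" by (simp only: J.K_def KJ_def J.K1_def)
    have \<Psi>0: "0 \<le> \<Psi> \<omega>" using D0_ge by (simp add: \<Psi>_def)
    have KJ0: "0 \<le> KJ" using C1 by (simp add: KJ_def)
    have \<Psi>2: "(\<Psi> \<omega>)\<^sup>2 / lam \<le> \<theta>\<^sup>2"
    proof -
      have "(\<Psi> \<omega>)\<^sup>2 \<le> (\<theta> * sqrt lam)\<^sup>2" using g(2) \<Psi>0 by (intro power_mono) auto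
      then show ?thesis using lam_pos by (simp add: power_mult_distrib pos_divide_le_eq)
    qed
    \<comment> \<open>In the coordinates t = Om^(1/2) w this is the bound on \<open>Xm\<close> minus
      the identity.\<close>
    have main: "\<bar>(\<Sum>g\<in>{1..G}. (w \<bullet> J.Sg g)\<^sup>2) - w \<bullet> (Om *v w)\<bar> \<le> \<theta> * (w \<bullet> (Om *v w))" for w
    proof -
      define t where "t = sqrt_mat Om *v w"
      have w: "w = inv_sqrt_mat Om *v t"
        using inv_sqrt_mat_properties(4)[OF Omega_pos] by (simp add: t_def matrix_vector_mul_assoc)
      have "(\<Sum>g\<in>{1..G}. (w \<bullet> J.Sg g)\<^sup>2) = t \<bullet> (Xm \<omega> *v t)"
        unfolding Xm_form w[symmetric] \<Xi>_def JSg by (simp add: power2_eq_square)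
      moreover have "w \<bullet> (Om *v w) = t \<bullet> t" unfolding w by (rule inv_sqrt_Om_form)
      moreover have "t \<bullet> ((Xm \<omega> - mat 1) *v t) = t \<bullet> (Xm \<omega> *v t) - t \<bullet> t"
        by (simp add: matrix_vector_mult_diff_rdistrib inner_diff_right)
      ultimately show ?thesis
        using order_trans[OF abs_form_le[of t "Xm \<omega> - mat 1"] mult_right_mono[OF g(3) inner_ge_zero[of t]]] by simp
    qed
    have dev: "\<bar>v \<bullet> (jackknife_variance G N psi (\<lambda>n. x n \<omega>) (\<lambda>n. y n \<omega>) *v v) - v \<bullet> (Vm *v v)\<bar>
        \<le> ((3 + 2 * KJ) * \<theta> + 1 / real G) * (v \<bullet> (Vm *v v))" for v
    proof -
      have V0: "0 \<le> v \<bullet> (Vm *v v)" using pos_def_imp_semidef[OF Vm_pos_def] by (simp add: pos_semidef_def)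
      have "\<bar>v \<bullet> (jackknife_variance G N psi (\<lambda>n. x n \<omega>) (\<lambda>n. y n \<omega>) *v v) - v \<bullet> (Vm *v v)\<bar>
        \<le> (\<theta> * (1 + \<theta>) + (1 / \<theta> + 1) * (KJ * ((\<Psi> \<omega>)\<^sup>2 / lam)) + \<theta> + 1 / real G) * (v \<bullet> (Vm *v v))"
        using J.jackknife_deviation[OF wdir_eq[of v] lam_le lam_pos main, of \<theta>] \<theta>
        unfolding JK J\<Psi> Vm_form[of v v] by simp
      \<comment> \<open>With t = \<theta> in \<open>jackknife_deviation\<close> the remainder is
        (1/\<theta> + 1) KJ \<theta>^2 \<le> 2 KJ \<theta>, and the other terms give 3 \<theta> and
        1 / G.\<close>
      also have "\<dots> \<le> ((3 + 2 * KJ) * \<theta> + 1 / real G) * (v \<bullet> (Vm *v v))"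
      proof (rule mult_right_mono[OF _ V0])
        have "(1 / \<theta> + 1) * (KJ * ((\<Psi> \<omega>)\<^sup>2 / lam)) \<le> (1 / \<theta> + 1) * (KJ * \<theta>\<^sup>2)"
          using \<theta> KJ0 by (intro mult_left_mono \<Psi>2) auto
        also have "\<dots> = KJ * \<theta> + KJ * (\<theta> * \<theta>)" using \<theta> by (simp add: field_simps power2_eq_square)
        also have "\<dots> \<le> KJ * \<theta> + KJ * (\<theta> * 1)" using \<theta> KJ0 by (intro add_left_mono mult_left_mono) auto
        also have "\<dots> = 2 * KJ * \<theta>" by simp
        finally have "(1 / \<theta> + 1) * (KJ * ((\<Psi> \<omega>)\<^sup>2 / lam)) \<le> 2 * KJ * \<theta>" .
        moreover have "\<theta> * (1 + \<theta>) \<le> \<theta> * 2" using \<theta> by (intro mult_left_mono) auto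
        ultimately show "\<theta> * (1 + \<theta>) + (1 / \<theta> + 1) * (KJ * ((\<Psi> \<omega>)\<^sup>2 / lam)) + \<theta> + 1 / real G \<le> (3 + 2 * KJ) * \<theta> + 1 / real G"
          by (simp add: algebra_simps)
      qed
      finally show ?thesis .
    qed
    have lin: "\<bar>v \<bullet> (ols N (\<lambda>n. x n \<omega>) (\<lambda>n. y n \<omega>) - \<beta>) - wdir v \<bullet> St \<omega>\<bar> \<le> sqrt (v \<bullet> (Vm *v v)) * (\<theta> / cQ)" for v
    proof -
      have "\<bar>v \<bullet> J.bt - wdir v \<bullet> J.S\<bar> \<le> norm (wdir v) * (\<Psi> \<omega> / cQ)"
        using J.functional_bt[of "wdir v"] unfolding wdir_eq[symmetric] J\<Psi> .
      also have "\<dots> \<le> (sqrt (v \<bullet> (Vm *v v)) / sqrt lam) * (\<theta> * sqrt lam / cQ)"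
        using g(2) \<Psi>0 cQ by (intro mult_mono norm_wdir_le divide_right_mono) (auto intro: order_trans[OF norm_ge_zero norm_wdir_le])
      also have "\<dots> = sqrt (v \<bullet> (Vm *v v)) * (\<theta> / cQ)" using lam_pos by simp
      finally show ?thesis unfolding JS J.bt_def .
    qed
    show "jackknife_defined G N psi (\<lambda>n. x n \<omega>) \<and>
    (\<forall>v. \<bar>v \<bullet> (jackknife_variance G N psi (\<lambda>n. x n \<omega>) (\<lambda>n. y n \<omega>) *v v) - v \<bullet> (Vm *v v)\<bar>
        \<le> ((3 + 2 * KJ) * \<theta> + 1 / real G) * (v \<bullet> (Vm *v v))) \<and>
    (\<forall>v. \<bar>v \<bullet> (ols N (\<lambda>n. x n \<omega>) (\<lambda>n. y n \<omega>) - \<beta>) - wdir v \<bullet> St \<omega>\<bar> \<le> sqrt (v \<bullet> (Vm *v v)) * (\<theta> / cQ))"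
      using J.jackknife_defined dev lin by blast
  qed
qed

text \<open>The linear leading term of the normalised estimator; its covariance is the identity for
  R of full rank.\<close>

definition Wv :: "real ^ 'q ^ 'k \<Rightarrow> 'a \<Rightarrow> real ^ 'q" where
  "Wv R \<omega> = transpose ((1 / real N) *\<^sub>R (matrix_inv Qm ** (R ** inv_sqrt_mat (sandwich R Vm)))) *v St \<omega>"

lemma Wv_inner: "t \<bullet> Wv R \<omega> = wdir ((R ** inv_sqrt_mat (sandwich R Vm)) *v t) \<bullet> St \<omega>"
proof -
  let ?L = "(1 / real N) *\<^sub>R (matrix_inv Qm ** (R ** inv_sqrt_mat (sandwich R Vm)))"
  have "t \<bullet> Wv R \<omega> = (?L *v t) \<bullet> St \<omega>"
    using inner_matrix_vector_transpose[of t "transpose ?L" "St \<omega>"] by (simp only: Wv_def transpose_transpose)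
  then show ?thesis by (simp add: wdir_def scaleR_matrix_vector_assoc[symmetric] matrix_vector_mul_assoc)
qed

lemma Wv_direction:
  fixes R :: "real ^ 'q ^ 'k" and t :: "real ^ 'q"
  assumes R: "rank R = CARD('q)"
  defines "a \<equiv> wdir ((R ** inv_sqrt_mat (sandwich R Vm)) *v t)"
  shows "a \<bullet> (Om *v a) = t \<bullet> t" "norm a \<le> norm t / sqrt lam"
proof -
  show "a \<bullet> (Om *v a) = t \<bullet> t"
    unfolding a_def Vm_form[symmetric] by (rule normalised_direction[OF Vm_pos_def R])
  show "norm a \<le> norm t / sqrt lam"
    using norm_wdir_le[of "(R ** inv_sqrt_mat (sandwich R Vm)) *v t"]
    unfolding normalised_direction[OF Vm_pos_def R] a_def by (simp add: norm_eq_sqrt_inner)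
qed

lemma Wv_measurable [measurable]: "Wv R \<in> borel_measurable M"
  unfolding Wv_def[abs_def] by measurable

text \<open>The second moment is the trace of the identity covariance; it provides tightness
  independently of R.\<close>

lemma Wv_moment:
  fixes R :: "real ^ 'q ^ 'k"
  assumes R: "rank R = CARD('q)"
  shows "integrable M (\<lambda>\<omega>. (norm (Wv R \<omega>))\<^sup>2)" "expectation (\<lambda>\<omega>. (norm (Wv R \<omega>))\<^sup>2) = real CARD('q)"
proof -
  define a where "a i = wdir ((R ** inv_sqrt_mat (sandwich R Vm)) *v (axis i 1 :: real ^ 'q))" for i
  have eq: "(norm (Wv R \<omega>))\<^sup>2 = (\<Sum>i\<in>UNIV. (a i \<bullet> St \<omega>)\<^sup>2)" for \<omega>
  proof -
    have "Wv R \<omega> $ i = a i \<bullet> St \<omega>" for i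
      using Wv_inner[of "axis i 1" R \<omega>] by (simp add: a_def inner_axis')
    then show ?thesis by (simp add: norm_power2_vec)
  qed
  have i: "integrable M (\<lambda>\<omega>. (b \<bullet> St \<omega>)\<^sup>2)" for b
    using integrable_sq_centered[OF _ AE_inner_St[of b], of 0] by simp
  show "integrable M (\<lambda>\<omega>. (norm (Wv R \<omega>))\<^sup>2)" unfolding eq by (intro Bochner_Integration.integrable_sum i)
  have "expectation (\<lambda>\<omega>. (norm (Wv R \<omega>))\<^sup>2) = (\<Sum>i\<in>UNIV. expectation (\<lambda>\<omega>. (a i \<bullet> St \<omega>)\<^sup>2))"
    unfolding eq by (rule Bochner_Integration.integral_sum) (rule i)
  also have "\<dots> = (\<Sum>i\<in>(UNIV :: 'q set). 1)"
  proof (rule sum.cong[OF refl])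
    fix i :: 'q
    show "expectation (\<lambda>\<omega>. (a i \<bullet> St \<omega>)\<^sup>2) = 1"
      using Om_form[of "a i" "a i"] Wv_direction(1)[OF R, of "axis i 1"]
      by (simp add: a_def power2_eq_square inner_axis_axis)
  qed
  finally show "expectation (\<lambda>\<omega>. (norm (Wv R \<omega>))\<^sup>2) = real CARD('q)" by simp
qed

text \<open>Normalised directions have length at most |t| / sqrt lam, which turns N D0^3 |a|^4 into
  the accumulation ratio. Since l \<ge> 1, one condition on l covers both smallness conditions of
  \<open>clt_bound\<close>.\<close>

lemma Wv_char:
  fixes R :: "real ^ 'q ^ 'k"
  assumes R: "rank R = CARD('q)" and l: "1 \<le> l" "l * (2 * norm t * C\<^sup>2 * (D0 / sqrt lam)) \<le> 1"
  shows "norm ((CLINT \<omega>|M. iexp (t \<bullet> Wv R \<omega>)) - complex_of_real (exp (- (norm t)\<^sup>2 / 2)))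
    \<le> 576 * exp 3 * C ^ 8 * norm t ^ 4 * (1 + l) * (real N * D0 ^ 3 / lam\<^sup>2) + (norm t)\<^sup>2 / (2 * l)"
proof -
  define a where "a = wdir ((R ** inv_sqrt_mat (sandwich R Vm)) *v t)"
  note a = Wv_direction[OF R, of t, folded a_def]
  have na: "2 * D0 * (norm a * C\<^sup>2) \<le> 2 * norm t * C\<^sup>2 * (D0 / sqrt lam)"
  proof -
    have "2 * D0 * (norm a * C\<^sup>2) \<le> 2 * D0 * (norm t / sqrt lam * C\<^sup>2)"
      using a(2) D0_ge by (intro mult_left_mono mult_right_mono) auto
    then show ?thesis by (simp add: mult_ac)
  qed
  have n0: "0 \<le> 2 * D0 * (norm a * C\<^sup>2)" using D0_ge by simp
  have l1: "l * (2 * D0 * (norm a * C\<^sup>2)) \<le> 1"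
    using mult_left_mono[OF na, of l] l by linarith
  have "1 * (2 * D0 * (norm a * C\<^sup>2)) \<le> l * (2 * D0 * (norm a * C\<^sup>2))" using l n0 by (intro mult_right_mono) auto
  then have l2: "2 * D0 * (norm a * C\<^sup>2) \<le> 1" using l1 by linarith
  have n4: "norm a ^ 4 \<le> norm t ^ 4 / lam\<^sup>2"
  proof -
    have "norm a ^ 4 \<le> (norm t / sqrt lam) ^ 4" by (rule power_mono[OF a(2)]) simp
    also have "sqrt lam ^ 4 = ((sqrt lam)\<^sup>2)\<^sup>2" by (simp only: power_mult[symmetric]) simp
    then have "(norm t / sqrt lam) ^ 4 = norm t ^ 4 / lam\<^sup>2" using lam_pos by (simp add: power_divide)
    finally show ?thesis .
  qed
  have tt: "t \<bullet> t = (norm t)\<^sup>2" by (simp add: power2_norm_eq_inner)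
  have "norm ((CLINT \<omega>|M. iexp (t \<bullet> Wv R \<omega>)) - complex_of_real (exp (- (norm t)\<^sup>2 / 2)))
    \<le> 576 * exp 3 * C ^ 8 * (real N * D0 ^ 3 * norm a ^ 4) * (1 + l) + (norm t)\<^sup>2 / (2 * l)"
    using clt_bound[of l a] l l1 l2 unfolding Wv_inner a_def[symmetric] a(1) tt by simp
  also have "\<dots> \<le> 576 * exp 3 * C ^ 8 * (real N * D0 ^ 3 * (norm t ^ 4 / lam\<^sup>2)) * (1 + l) + (norm t)\<^sup>2 / (2 * l)"
    using l D0_ge C1 by (intro add_right_mono mult_right_mono mult_left_mono n4) auto
  finally show ?thesis by (simp add: mult_ac)
qed

end

section \<open>Triangular arrays\<close>

locale dyadic_array =
  fixes M :: "nat \<Rightarrow> 'a measure" and N :: "nat \<Rightarrow> nat" and psi :: "nat \<Rightarrow> nat \<Rightarrow> nat set"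
    and x :: "nat \<Rightarrow> nat \<Rightarrow> 'a \<Rightarrow> real ^ 'k" and u y :: "nat \<Rightarrow> nat \<Rightarrow> 'a \<Rightarrow> real"
    and \<beta> :: "nat \<Rightarrow> real ^ 'k" and R :: "nat \<Rightarrow> real ^ 'q ^ 'k" and C cQ :: real
  assumes model: "2 \<le> G \<Longrightarrow> dyadic_model (M G) G (N G) (psi G) (x G) (u G) C cQ"
    and outcome: "2 \<le> G \<Longrightarrow> n \<in> {1..N G} \<Longrightarrow> \<omega> \<in> space (M G) \<Longrightarrow> y G n \<omega> = \<beta> G \<bullet> x G n \<omega> + u G n \<omega>"
    and accumulation:
      "(\<lambda>G. real (N G) * real (max_degree G (N G) (psi G)) ^ 3
             / (lambda_min (score_variance (M G) (N G) (x G) (u G)))\<^sup>2) \<longlonglongrightarrow> 0"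
    and multiplicity:
      "(\<lambda>G. real (multiplicity_sum G (N G) (psi G))
             / lambda_min (score_variance (M G) (N G) (x G) (u G))) \<longlonglongrightarrow> 0"
    and full_rank: "2 \<le> G \<Longrightarrow> rank (R G) = CARD('q)"
begin

definition D where "D G = real (max_degree G (N G) (psi G))"
definition lam where "lam G = lambda_min (score_variance (M G) (N G) (x G) (u G))"
definition J where "J G = real (multiplicity_sum G (N G) (psi G))"
definition V where "V G = sandwich_variance (M G) (N G) (x G) (u G)"
definition VJ where "VJ G \<omega> = jackknife_variance G (N G) (psi G) (\<lambda>n. x G n \<omega>) (\<lambda>n. y G n \<omega>)"
definition b where "b G \<omega> = ols (N G) (\<lambda>n. x G n \<omega>) (\<lambda>n. y G n \<omega>)"
definition jd where "jd G \<omega> \<longleftrightarrow> jackknife_defined G (N G) (psi G) (\<lambda>n. x G n \<omega>)"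
definition W where "W G \<omega> = transpose ((1 / real (N G)) *\<^sub>R (matrix_inv (design_matrix (M G) (N G) (x G))
   ** (R G ** inv_sqrt_mat (sandwich (R G) (V G))))) *v (\<Sum>n\<in>{1..N G}. u G n \<omega> *\<^sub>R x G n \<omega>)"
definition KK where "KK = 3 + 2 * (16 * C ^ 4 / cQ\<^sup>2 + 32 * C ^ 4 * (C\<^sup>2 * (1 + 2 * C\<^sup>2 / cQ))\<^sup>2 / cQ\<^sup>2)"

text \<open>The conclusion of \<open>good_event\<close> in a single precision e: for all directions
  in the variance part, for the given R in the linear part.\<close>

definition good where
  "good G e \<omega> \<longleftrightarrow> jd G \<omega> \<and> (\<forall>v. \<bar>v \<bullet> (VJ G \<omega> *v v) - v \<bullet> (V G *v v)\<bar> \<le> e * (v \<bullet> (V G *v v)))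
    \<and> norm (inv_sqrt_mat (sandwich (R G) (V G)) *v (transpose (R G) *v (b G \<omega> - \<beta> G)) - W G \<omega>) \<le> e"

lemma acc: "(\<lambda>G. real (N G) * D G ^ 3 / (lam G)\<^sup>2) \<longlonglongrightarrow> 0"
  using accumulation by (simp add: D_def lam_def)

lemma mult: "(\<lambda>G. J G / lam G) \<longlonglongrightarrow> 0"
  using multiplicity by (simp add: J_def lam_def)

lemma basics:
  assumes "2 \<le> G"
  shows "1 \<le> D G" "D G \<le> real (N G)" "0 < lam G" "lam G \<le> 8 * real (N G) * D G * C ^ 4" "0 < real (N G)" "1 \<le> C" "0 < cQ"
proof -
  interpret m: dyadic_model "M G" G "N G" "psi G" "x G" "u G" C cQ by (rule model[OF assms])
  show "1 \<le> D G" "D G \<le> real (N G)" "0 < lam G" "lam G \<le> 8 * real (N G) * D G * C ^ 4" "0 < real (N G)" "1 \<le> C" "0 < cQ"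
    using m.D0_ge m.D0_le m.lam_pos m.lam_upper m.N_pos m.C1 m.cQ by (simp_all add: D_def lam_def m.D0_def m.lam_def)
qed

lemma C1: "1 \<le> C" and cQ: "0 < cQ" using basics[of 2] by simp_all

lemma ev2: "\<forall>\<^sub>F G in sequentially. (2 :: nat) \<le> G" by (rule eventually_ge_at_top)

text \<open>The upper bound lam \<le> 8 N D C^4 gives N D^3 / lam^2 \<ge> D / (64 C^8 N).\<close>

lemma D_N: "(\<lambda>G. D G / real (N G)) \<longlonglongrightarrow> 0"
proof (rule Lim_null_comparison)
  show "\<forall>\<^sub>F G in sequentially. norm (D G / real (N G)) \<le> 64 * C ^ 8 * (real (N G) * D G ^ 3 / (lam G)\<^sup>2)"
    using ev2
  proof eventually_elim
    case (elim G)
    note bs = basics[OF elim]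
    have "(lam G)\<^sup>2 \<le> (8 * real (N G) * D G * C ^ 4)\<^sup>2" using bs by (intro power_mono) auto
    then have l2: "(lam G)\<^sup>2 \<le> 64 * C ^ 8 * ((real (N G))\<^sup>2 * (D G)\<^sup>2)" by (simp add: power_mult_distrib mult_ac)
    have "D G / real (N G) * (lam G)\<^sup>2 \<le> D G / real (N G) * (64 * C ^ 8 * ((real (N G))\<^sup>2 * (D G)\<^sup>2))"
      using l2 bs by (intro mult_left_mono) auto
    also have "\<dots> = 64 * C ^ 8 * (real (N G) * D G ^ 3)" using bs by (simp add: power2_eq_square power3_eq_cube)
    finally have "D G / real (N G) \<le> 64 * C ^ 8 * (real (N G) * D G ^ 3) / (lam G)\<^sup>2"
      using bs by (simp add: pos_le_divide_eq)
    then show ?case using bs by simp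
  qed
  show "(\<lambda>G. 64 * C ^ 8 * (real (N G) * D G ^ 3 / (lam G)\<^sup>2)) \<longlonglongrightarrow> 0"
    using tendsto_mult_right_zero[OF acc] .
qed

text \<open>D^4 \<le> N D^3, so the fourth power of the ratio lies below the accumulation
  ratio.\<close>

lemma D_sqrt_lam: "(\<lambda>G. D G / sqrt (lam G)) \<longlonglongrightarrow> 0"
proof (rule Lim_null_comparison)
  show "\<forall>\<^sub>F G in sequentially. norm (D G / sqrt (lam G)) \<le> sqrt (sqrt (real (N G) * D G ^ 3 / (lam G)\<^sup>2))"
    using ev2
  proof eventually_elim
    case (elim G)
    note bs = basics[OF elim]
    have "((D G)\<^sup>2 / lam G)\<^sup>2 = D G * D G ^ 3 / (lam G)\<^sup>2" by (simp add: power_divide power2_eq_square power3_eq_cube)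
    also have "\<dots> \<le> real (N G) * D G ^ 3 / (lam G)\<^sup>2" using bs by (intro divide_right_mono mult_right_mono) auto
    finally have "(D G)\<^sup>2 / lam G \<le> sqrt (real (N G) * D G ^ 3 / (lam G)\<^sup>2)" by (rule real_le_rsqrt)
    then have "(D G / sqrt (lam G))\<^sup>2 \<le> sqrt (real (N G) * D G ^ 3 / (lam G)\<^sup>2)" using bs by (simp add: power_divide)
    then show ?case using bs by (simp add: real_le_rsqrt)
  qed
  show "(\<lambda>G. sqrt (sqrt (real (N G) * D G ^ 3 / (lam G)\<^sup>2))) \<longlonglongrightarrow> 0"
    using tendsto_real_sqrt[OF tendsto_real_sqrt[OF acc]] by simp
qed

text \<open>The event \<open>good\<close> quantifies over all directions, and its measurability is
  not established; its complement is covered, up to a null set, by a measurable set of small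
  probability.\<close>

lemma good_eventually:
  assumes e: "0 < e" and p: "0 < p"
  shows "\<forall>\<^sub>F G in sequentially. \<exists>B\<in>sets (M G). measure (M G) B < p \<and> (AE \<omega> in M G. \<omega> \<notin> B \<longrightarrow> good G e \<omega>)"
proof -
  have KK: "3 \<le> KK" using C1 by (simp add: KK_def)
  \<comment> \<open>Half of e is reserved for 1 / G, and the bound e cQ keeps the linearisation
    error \<theta> / cQ below e.\<close>
  define \<theta> where "\<theta> = min 1 (min (e / (2 * KK)) (e * cQ))"
  have \<theta>: "0 < \<theta>" "\<theta> \<le> 1" "\<theta> \<le> e / (2 * KK)" "\<theta> \<le> e * cQ"
    using e KK cQ by (auto simp: \<theta>_def)
  have \<theta>1: "KK * \<theta> \<le> e / 2" "\<theta> / cQ \<le> e"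
    using \<theta>(3,4) KK cQ by (simp_all add: field_simps)
  let ?k = "(real CARD('k))\<^sup>2"
  define bad where "bad G = 128 * ?k * C ^ 4 / cQ\<^sup>2 * (D G / real (N G))
     + (8 * ?k * C ^ 4 + 8 * real CARD('k) * C ^ 4 + 1) / \<theta> * (D G / sqrt (lam G))
     + ?k / \<theta>\<^sup>2 * (512 * C ^ 8 * (real (N G) * D G ^ 3 / (lam G)\<^sup>2) + C ^ 8 * (J G / lam G)\<^sup>2)" for G
  have "bad \<longlonglongrightarrow> 128 * ?k * C ^ 4 / cQ\<^sup>2 * 0 + (8 * ?k * C ^ 4 + 8 * real CARD('k) * C ^ 4 + 1) / \<theta> * 0
     + ?k / \<theta>\<^sup>2 * (512 * C ^ 8 * 0 + C ^ 8 * 0\<^sup>2)"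
    unfolding bad_def[abs_def]
    by (intro tendsto_add tendsto_mult tendsto_power tendsto_const D_N D_sqrt_lam acc mult)
  then have "bad \<longlonglongrightarrow> 0" by simp
  then have e1: "\<forall>\<^sub>F G in sequentially. bad G < p" using p by (rule order_tendstoD)
  have e2: "\<forall>\<^sub>F G in sequentially. D G / real (N G) < cQ / 4 / C\<^sup>2"
    using D_N by (rule order_tendstoD) (use cQ C1 in auto)
  have e3: "\<forall>\<^sub>F G in sequentially. 1 / real G < e / 2"
    using lim_1_over_n by (rule order_tendstoD) (use e in simp)
  from e1 e2 e3 ev2 show ?thesis
  proof eventually_elim
    case (elim G)
    interpret m: dyadic_model "M G" G "N G" "psi G" "x G" "u G" C cQ by (rule model[OF elim(4)])
    note bs = basics[OF elim(4)]
    have eqs: "m.D0 = D G" "m.lam = lam G" by (simp_all add: D_def lam_def m.D0_def m.lam_def)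
    have small: "m.D0 * C\<^sup>2 \<le> cQ / 4 * real (N G)"
      using elim(2) bs C1 by (simp add: eqs field_simps)
    have VV: "sandwich_variance (M G) (N G) (x G) (u G) = V G" by (simp add: V_def)
    have "measure (M G) (m.Bad \<theta>) \<le> bad G"
      using m.prob_Bad_le[OF \<theta>(1)] unfolding bad_def eqs m.K\<Psi>_def m.\<delta>_def J_def .
    then have B: "measure (M G) (m.Bad \<theta>) < p" using elim(1) by simp
    have V0: "0 \<le> v \<bullet> (V G *v v)" for v
      using pos_def_imp_semidef[OF m.Vm_pos_def] by (simp add: pos_semidef_def V_def)
    have WW: "m.Wv (R G) \<omega> = W G \<omega>" for \<omega>
      by (simp add: m.Wv_def W_def m.St_def m.score_def V_def)
    have out: "\<forall>n\<in>{1..N G}. \<forall>\<omega>\<in>space (M G). y G n \<omega> = \<beta> G \<bullet> x G n \<omega> + u G n \<omega>"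
      using outcome[OF elim(4)] by blast
    have "AE \<omega> in M G. \<omega> \<notin> m.Bad \<theta> \<longrightarrow> good G e \<omega>"
      using m.good_event[OF out small \<theta>(1,2)]
    proof eventually_elim
      case (elim \<omega>)
      show ?case
      proof
        assume nb: "\<omega> \<notin> m.Bad \<theta>"
        let ?S = "inv_sqrt_mat (sandwich (R G) (V G))"
        have d: "\<bar>v \<bullet> (VJ G \<omega> *v v) - v \<bullet> (V G *v v)\<bar> \<le> (KK * \<theta> + 1 / real G) * (v \<bullet> (V G *v v))" for v
          using elim nb unfolding VJ_def V_def KK_def m.KJ_def by blast
        have dev: "\<bar>v \<bullet> (VJ G \<omega> *v v) - v \<bullet> (V G *v v)\<bar> \<le> e * (v \<bullet> (V G *v v))" for v
          by (rule order_trans[OF d mult_right_mono[OF _ V0]])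
             (use \<theta>1(1) \<open>1 / real G < e / 2\<close> in linarith)
        have lin: "\<bar>v \<bullet> (b G \<omega> - \<beta> G) - m.wdir v \<bullet> m.St \<omega>\<bar> \<le> sqrt (v \<bullet> (V G *v v)) * (\<theta> / cQ)" for v
          using elim nb unfolding b_def V_def by blast
        have "norm (?S *v (transpose (R G) *v (b G \<omega> - \<beta> G)) - W G \<omega>) \<le> \<theta> / cQ"
        proof (rule norm_le_if_inner_le)
          fix t :: "real ^ 'q"
          note pd = pos_def_sandwich[OF m.Vm_pos_def full_rank[OF \<open>2 \<le> G\<close>], folded V_def]
          have "t \<bullet> (?S *v (transpose (R G) *v (b G \<omega> - \<beta> G))) = (?S *v t) \<bullet> (transpose (R G) *v (b G \<omega> - \<beta> G))"
            by (rule inner_matrix_vector_sym[OF inv_sqrt_mat_properties(2)[OF pd]])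
          also have "\<dots> = (R G *v (?S *v t)) \<bullet> (b G \<omega> - \<beta> G)"
            using inner_matrix_vector_transpose[of "?S *v t" "transpose (R G)" "b G \<omega> - \<beta> G"] by (simp only: transpose_transpose)
          also have "\<dots> = ((R G ** ?S) *v t) \<bullet> (b G \<omega> - \<beta> G)" by (simp add: matrix_vector_mul_assoc)
          finally have 1: "t \<bullet> (?S *v (transpose (R G) *v (b G \<omega> - \<beta> G)) - W G \<omega>)
             = ((R G ** ?S) *v t) \<bullet> (b G \<omega> - \<beta> G) - m.wdir ((R G ** ?S) *v t) \<bullet> m.St \<omega>"
            using m.Wv_inner[of t "R G" \<omega>] unfolding WW VV by (simp add: inner_diff_right)
          have "((R G ** ?S) *v t) \<bullet> (V G *v ((R G ** ?S) *v t)) = t \<bullet> t"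
            unfolding V_def by (rule normalised_direction[OF m.Vm_pos_def full_rank[OF \<open>2 \<le> G\<close>]])
          then show "\<bar>t \<bullet> (?S *v (transpose (R G) *v (b G \<omega> - \<beta> G)) - W G \<omega>)\<bar> \<le> \<theta> / cQ * norm t"
            unfolding 1 using lin[of "(R G ** ?S) *v t"] by (simp add: norm_eq_sqrt_inner mult.commute)
        qed (use \<theta> cQ in simp)
        then show "good G e \<omega>" unfolding good_def using dev elim nb \<theta>1(2) by (auto simp: jd_def)
      qed
    qed
    with B m.Bad_sets show ?case by blast
  qed
qed

text \<open>Turns deterministic consequences of \<open>good\<close> into vanishing probabilities, by
  comparison with the measurable covering set of \<open>good_eventually\<close>.\<close>

lemma vanish:
  assumes e: "0 < e" and imp: "\<And>G \<omega>. 2 \<le> G \<Longrightarrow> \<omega> \<in> space (M G) \<Longrightarrow> good G e \<omega> \<Longrightarrow> \<not> P G \<omega>"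
  shows "(\<lambda>G. measure (M G) {\<omega> \<in> space (M G). P G \<omega>}) \<longlonglongrightarrow> 0"
proof (rule tendstoI)
  fix p :: real assume p: "0 < p"
  from good_eventually[OF e p] ev2
  show "\<forall>\<^sub>F G in sequentially. dist (measure (M G) {\<omega> \<in> space (M G). P G \<omega>}) 0 < p"
  proof eventually_elim
    case (elim G)
    then obtain B where B: "B \<in> sets (M G)" "measure (M G) B < p" "AE \<omega> in M G. \<omega> \<notin> B \<longrightarrow> good G e \<omega>" by blast
    interpret m: dyadic_model "M G" G "N G" "psi G" "x G" "u G" C cQ by (rule model[OF elim(2)])
    have "measure (M G) {\<omega> \<in> space (M G). P G \<omega>} \<le> measure (M G) B"
    proof (rule m.finite_measure_mono_AE[OF _ B(1)])
      show "AE \<omega> in M G. \<omega> \<in> {\<omega> \<in> space (M G). P G \<omega>} \<longrightarrow> \<omega> \<in> B"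
        using B(3) by eventually_elim (use imp[OF elim(2)] in blast)
    qed
    then show ?case using B(2) by simp
  qed
qed

lemma V_pos_def: "2 \<le> G \<Longrightarrow> pos_def (V G)"
  using dyadic_model.Vm_pos_def[OF model] by (simp add: V_def)

lemma VJ_sym: "transpose (VJ G \<omega>) = VJ G \<omega>"
  by (simp add: VJ_def transpose_jackknife_variance)

lemma good_rel_deviation:
  fixes T :: "real ^ 'q ^ 'k"
  assumes "2 \<le> G" "rank T = CARD('q)" "good G e \<omega>" "0 \<le> e"
  shows "rel_deviation T (V G) (VJ G \<omega>) \<le> e"
  using assms by (intro rel_deviation_le V_pos_def VJ_sym) (auto simp: good_def)

text \<open>For e < 1 the relative bound leaves at least (1 - e) v . V v, which is positive.\<close>

lemma good_pos_def:
  assumes G: "2 \<le> G" and g: "good G e \<omega>" and e: "e < 1"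
  shows "pos_def (sandwich (R G) (VJ G \<omega>))"
proof (rule pos_def_sandwich[OF _ full_rank[OF G]])
  show "pos_def (VJ G \<omega>)" unfolding pos_def_def
  proof (intro conjI allI impI VJ_sym)
    fix v :: "real ^ 'k" assume "v \<noteq> 0"
    then have "0 < v \<bullet> (V G *v v)" using V_pos_def[OF G] by (simp add: pos_def_def)
    moreover have "v \<bullet> (V G *v v) - e * (v \<bullet> (V G *v v)) \<le> v \<bullet> (VJ G \<omega> *v v)"
    proof -
      have "\<bar>v \<bullet> (VJ G \<omega> *v v) - v \<bullet> (V G *v v)\<bar> \<le> e * (v \<bullet> (V G *v v))" using g unfolding good_def by blast
      then show ?thesis by linarith
    qed
    moreover have "v \<bullet> (V G *v v) - e * (v \<bullet> (V G *v v)) = (1 - e) * (v \<bullet> (V G *v v))" by (simp add: algebra_simps)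
    ultimately show "0 < v \<bullet> (VJ G \<omega> *v v)" using e by (smt (verit) mult_pos_pos)
  qed
qed

lemma VJ_sandwich_semidef: "pos_semidef (sandwich T (VJ G \<omega>))"
  unfolding pos_semidef_def sandwich_form
  by (simp add: transpose_sandwich VJ_sym) (simp add: VJ_def jackknife_variance_nonneg)

lemma meas_y:
  assumes G: "2 \<le> G" and n: "n \<in> {1..N G}" shows "y G n \<in> borel_measurable (M G)"
proof -
  interpret m: dyadic_model "M G" G "N G" "psi G" "x G" "u G" C cQ by (rule model[OF G])
  have "(\<lambda>\<omega>. \<beta> G \<bullet> x G n \<omega> + u G n \<omega>) \<in> borel_measurable (M G)"
    using m.rv_x[OF n] m.rv_u[OF n] by measurable
  then show ?thesis using outcome[OF G n] by (subst measurable_cong)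
qed

lemma meas:
  assumes G: "2 \<le> G"
  shows "b G \<in> borel_measurable (M G)" "VJ G \<in> borel_measurable (M G)" "Measurable.pred (M G) (jd G)" "W G \<in> borel_measurable (M G)"
proof -
  interpret m: dyadic_model "M G" G "N G" "psi G" "x G" "u G" C cQ by (rule model[OF G])
  have xy: "(\<lambda>\<omega>. \<Sum>n\<in>A. y G n \<omega> *\<^sub>R x G n \<omega>) \<in> borel_measurable (M G)" if "A \<subseteq> {1..N G}" for A
    using m.rv_x meas_y[OF G] that by (intro borel_measurable_sum borel_measurable_scaleR) auto
  note g1[measurable] = m.meas_gram[OF order_refl] xy[OF order_refl]
  show "b G \<in> borel_measurable (M G)"
    unfolding b_def[abs_def] ols_def by measurable
  have gd[measurable]: "(\<lambda>\<omega>. gram_del (N G) (psi G) (\<lambda>n. x G n \<omega>) g) \<in> borel_measurable (M G)" for g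
    unfolding gram_del_def by (intro borel_measurable_diff m.meas_gram m.inc_subset order_refl)
  have "(\<lambda>\<omega>. ols_del (N G) (psi G) (\<lambda>n. x G n \<omega>) (\<lambda>n. y G n \<omega>) g) \<in> borel_measurable (M G)" for g
    unfolding ols_del_def
    by (intro borel_measurable_matrix_vector_mult borel_measurable_matrix_inv gd xy) auto
  note od[measurable] = this
  show jd[measurable]: "Measurable.pred (M G) (jd G)"
    unfolding jd_def[abs_def] jackknife_defined_def by measurable
  have jm[measurable]: "(\<lambda>\<omega>. jackknife_mean G (N G) (psi G) (\<lambda>n. x G n \<omega>) (\<lambda>n. y G n \<omega>)) \<in> borel_measurable (M G)"
    unfolding jackknife_mean_def by measurable
  show "VJ G \<in> borel_measurable (M G)"
    unfolding VJ_def[abs_def] jackknife_variance_def jd_def[symmetric] by measurable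
  have "m.Wv (R G) = W G"
    by (simp add: fun_eq_iff m.Wv_def W_def m.St_def m.score_def V_def)
  then show "W G \<in> borel_measurable (M G)" using m.Wv_measurable[of "R G"] by simp
qed

theorem rel_deviation_tendsto: "tendsto_in_prob_zero M (\<lambda>G \<omega>. ennreal (rel_deviation (R G) (V G) (VJ G \<omega>)))"
  unfolding tendsto_in_prob_zero_def
proof (intro conjI allI impI)
  show "\<forall>\<^sub>F G in sequentially. (\<lambda>\<omega>. ennreal (rel_deviation (R G) (V G) (VJ G \<omega>))) \<in> borel_measurable (M G)"
    using ev2 by eventually_elim (use meas(2) in measurable)
  fix e :: real assume e: "0 < e"
  show "(\<lambda>G. measure (M G) {\<omega> \<in> space (M G). ennreal (rel_deviation (R G) (V G) (VJ G \<omega>)) > ennreal e}) \<longlonglongrightarrow> 0"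
    by (rule vanish[OF e]) (use good_rel_deviation[OF _ full_rank] e in \<open>auto simp: not_less intro!: ennreal_leI\<close>)
qed

theorem sup_rel_deviation_tendsto:
  "tendsto_in_prob_zero M (\<lambda>G \<omega>. SUP T \<in> {T :: real ^ 'q ^ 'k. rank T = CARD('q)}. ennreal (rel_deviation T (V G) (VJ G \<omega>)))"
  unfolding tendsto_in_prob_zero_def
proof (intro conjI allI impI)
  show "\<forall>\<^sub>F G in sequentially. (\<lambda>\<omega>. SUP T \<in> {T :: real ^ 'q ^ 'k. rank T = CARD('q)}. ennreal (rel_deviation T (V G) (VJ G \<omega>))) \<in> borel_measurable (M G)"
    using ev2 by eventually_elim (rule borel_measurable_SUP_rel_deviation[OF meas(2)])
  fix e :: real assume e: "0 < e"
  show "(\<lambda>G. measure (M G) {\<omega> \<in> space (M G). (SUP T \<in> {T :: real ^ 'q ^ 'k. rank T = CARD('q)}. ennreal (rel_deviation T (V G) (VJ G \<omega>))) > ennreal e}) \<longlonglongrightarrow> 0"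
  proof (rule vanish[OF e])
    fix G \<omega> assume g: "2 \<le> G" "good G e \<omega>"
    have "(SUP T \<in> {T :: real ^ 'q ^ 'k. rank T = CARD('q)}. ennreal (rel_deviation T (V G) (VJ G \<omega>))) \<le> ennreal e"
      using good_rel_deviation[OF g(1) _ g(2)] e by (intro SUP_least ennreal_leI) auto
    then show "\<not> (SUP T \<in> {T :: real ^ 'q ^ 'k. rank T = CARD('q)}. ennreal (rel_deviation T (V G) (VJ G \<omega>))) > ennreal e"
      by (simp only: not_less)
  qed
qed

text \<open>Measurability of P is essential: \<open>measure\<close> assigns 0 to nonmeasurable sets,
  so a vanishing complement alone would prove nothing.\<close>

lemma measure_tendsto_1:
  assumes P: "\<And>G. 2 \<le> G \<Longrightarrow> Measurable.pred (M G) (P G)"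
    and v: "(\<lambda>G. measure (M G) {\<omega> \<in> space (M G). \<not> P G \<omega>}) \<longlonglongrightarrow> 0"
  shows "(\<lambda>G. measure (M G) {\<omega> \<in> space (M G). P G \<omega>}) \<longlonglongrightarrow> 1"
proof (rule Lim_transform_eventually)
  show "(\<lambda>G. 1 - measure (M G) {\<omega> \<in> space (M G). \<not> P G \<omega>}) \<longlonglongrightarrow> 1"
    using tendsto_diff[OF tendsto_const v, of 1] by simp
  show "\<forall>\<^sub>F G in sequentially. 1 - measure (M G) {\<omega> \<in> space (M G). \<not> P G \<omega>} = measure (M G) {\<omega> \<in> space (M G). P G \<omega>}"
    using ev2
  proof eventually_elim
    case (elim G)
    interpret m: dyadic_model "M G" G "N G" "psi G" "x G" "u G" C cQ by (rule model[OF elim])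
    have "{\<omega> \<in> space (M G). P G \<omega>} \<in> sets (M G)" using P[OF elim] by measurable
    then show ?case using m.prob_neg[of "P G"] by simp
  qed
qed

theorem jackknife_defined_tendsto: "(\<lambda>G. measure (M G) {\<omega> \<in> space (M G). jd G \<omega>}) \<longlonglongrightarrow> 1"
  by (rule measure_tendsto_1[OF meas(3) vanish[of 1]]) (auto simp: good_def)

theorem pos_def_tendsto: "(\<lambda>G. measure (M G) {\<omega> \<in> space (M G). pos_def (sandwich (R G) (VJ G \<omega>))}) \<longlonglongrightarrow> 1"
proof (rule measure_tendsto_1[OF _ vanish[of "1/2"]])
  fix G :: nat assume "2 \<le> G"
  note meas(2)[OF this, measurable]
  show "Measurable.pred (M G) (\<lambda>\<omega>. pos_def (sandwich (R G) (VJ G \<omega>)))"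
    unfolding sandwich_def by measurable
qed (use good_pos_def in auto)

end

section \<open>The studentised estimator and the Wald statistic\<close>

context dyadic_array
begin

definition Tst where
  "Tst F G \<omega> = (if pos_def (sandwich (R G) (VJ G \<omega>))
     then inv_sqrt_mat (sandwich (R G) (VJ G \<omega>)) *v (transpose (R G) *v (b G \<omega> - \<beta> G)) else F G \<omega>)"

lemma meas_Tst:
  fixes F :: "nat \<Rightarrow> 'a \<Rightarrow> real ^ 'q"
  assumes G: "2 \<le> G" and F: "F G \<in> borel_measurable (M G)"
  shows "Tst F G \<in> borel_measurable (M G)"
proof -
  note [measurable] = meas(1,2)[OF G] F
  have S[measurable]: "(\<lambda>\<omega>. sandwich (R G) (VJ G \<omega>)) \<in> borel_measurable (M G)"
    unfolding sandwich_def by measurable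
  note borel_measurable_inv_sqrt_mat[OF S, measurable]
  \<comment> \<open>The inner conditional replaces \<open>inv_sqrt_mat\<close> by a version that is
    measurable on the whole space.\<close>
  have "Tst F G = (\<lambda>\<omega>. if pos_def (sandwich (R G) (VJ G \<omega>))
     then (if pos_def (sandwich (R G) (VJ G \<omega>)) then inv_sqrt_mat (sandwich (R G) (VJ G \<omega>)) else 0) *v (transpose (R G) *v (b G \<omega> - \<beta> G)) else F G \<omega>)"
    by (simp add: Tst_def fun_eq_iff)
  also have "\<dots> \<in> borel_measurable (M G)" by measurable
  finally show ?thesis .
qed

text \<open>Passing from the spectral to the Frobenius norm costs q^2, so
  \<open>inv_sqrt_perturbation\<close> yields sqrt(5 q^3 e) relative to the statistic itself. As
  this factor is at most 1/2 the statistic can be absorbed: its norm is at most 2 (|W| + e).\<close>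

lemma Tst_close:
  fixes F :: "nat \<Rightarrow> 'a \<Rightarrow> real ^ 'q"
  assumes G: "2 \<le> G" and g: "good G e \<omega>" and e: "0 < e" "e < 1" "(real CARD('q))\<^sup>2 * e \<le> 1 / 2"
    and k: "sqrt (5 * real CARD('q) ^ 3 * e) \<le> 1 / 2"
  shows "norm (Tst F G \<omega> - W G \<omega>) \<le> 2 * sqrt (5 * real CARD('q) ^ 3 * e) * (norm (W G \<omega>) + e) + e"
proof -
  let ?P = "sandwich (R G) (V G)" and ?P1 = "sandwich (R G) (VJ G \<omega>)" and ?q = "real CARD('q)"
  define z where "z = transpose (R G) *v (b G \<omega> - \<beta> G)"
  define \<kappa> where "\<kappa> = sqrt (5 * ?q ^ 3 * e)"
  have \<kappa>: "0 \<le> \<kappa>" "\<kappa> \<le> 1 / 2" using e k by (simp_all add: \<kappa>_def)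
  note pd = pos_def_sandwich[OF V_pos_def[OF G] full_rank[OF G]] and pd1 = good_pos_def[OF G g e(2)]
  have T: "Tst F G \<omega> = inv_sqrt_mat ?P1 *v z" using pd1 by (simp add: Tst_def z_def)
  have "norm (inv_sqrt_mat ?P ** ?P1 ** inv_sqrt_mat ?P - mat 1) \<le> ?q\<^sup>2 * rel_deviation (R G) (V G) (VJ G \<omega>)"
    unfolding rel_deviation_def using norm_le_spectral_norm[of "inv_sqrt_mat ?P ** ?P1 ** inv_sqrt_mat ?P - mat 1"]
    by (simp add: power2_eq_square)
  also have "\<dots> \<le> ?q\<^sup>2 * e"
    using good_rel_deviation[OF G full_rank[OF G] g] e by (intro mult_left_mono) auto
  finally have E: "norm (inv_sqrt_mat ?P ** ?P1 ** inv_sqrt_mat ?P - mat 1) \<le> ?q\<^sup>2 * e" .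
  have eq: "5 * ?q * (?q\<^sup>2 * e) = 5 * ?q ^ 3 * e" by (simp add: power2_eq_square power3_eq_cube)
  have 1: "norm (Tst F G \<omega> - inv_sqrt_mat ?P *v z) \<le> \<kappa> * norm (Tst F G \<omega>)"
    using inv_sqrt_perturbation[OF pd pd1 E e(3), of z] unfolding T eq \<kappa>_def .
  have 2: "norm (inv_sqrt_mat ?P *v z - W G \<omega>) \<le> e" using g unfolding good_def z_def by blast
  define a where "a = norm (Tst F G \<omega>)"
  have "a \<le> norm (Tst F G \<omega> - inv_sqrt_mat ?P *v z) + norm (inv_sqrt_mat ?P *v z - W G \<omega>) + norm (W G \<omega>)"
    unfolding a_def using norm_triangle_ineq[of "Tst F G \<omega> - inv_sqrt_mat ?P *v z" "inv_sqrt_mat ?P *v z"]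
      norm_triangle_ineq[of "inv_sqrt_mat ?P *v z - W G \<omega>" "W G \<omega>"] by simp
  also have "\<dots> \<le> 1 / 2 * a + e + norm (W G \<omega>)"
    using 1 2 mult_right_mono[OF \<kappa>(2), of a] by (simp add: a_def)
  finally have a: "a \<le> 2 * (norm (W G \<omega>) + e)" by simp
  have "norm (Tst F G \<omega> - W G \<omega>) \<le> norm (Tst F G \<omega> - inv_sqrt_mat ?P *v z) + norm (inv_sqrt_mat ?P *v z - W G \<omega>)"
    using norm_triangle_ineq[of "Tst F G \<omega> - inv_sqrt_mat ?P *v z" "inv_sqrt_mat ?P *v z - W G \<omega>"] by simp
  also have "\<dots> \<le> \<kappa> * (2 * (norm (W G \<omega>) + e)) + e"
    using 1 2 mult_left_mono[OF a \<kappa>(1)] by (simp add: a_def)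
  also have "\<kappa> * (2 * (norm (W G \<omega>) + e)) = 2 * \<kappa> * (norm (W G \<omega>) + e)" by simp
  finally show ?thesis unfolding \<kappa>_def .
qed

lemma W_moment:
  assumes G: "2 \<le> G"
  shows "integrable (M G) (\<lambda>\<omega>. (norm (W G \<omega>))\<^sup>2)" "(LINT \<omega>|M G. (norm (W G \<omega>))\<^sup>2) \<le> real CARD('q)"
proof -
  interpret m: dyadic_model "M G" G "N G" "psi G" "x G" "u G" C cQ by (rule model[OF G])
  have "m.Wv (R G) = W G"
    by (simp add: fun_eq_iff m.Wv_def W_def m.St_def m.score_def V_def)
  then show "integrable (M G) (\<lambda>\<omega>. (norm (W G \<omega>))\<^sup>2)" "(LINT \<omega>|M G. (norm (W G \<omega>))\<^sup>2) \<le> real CARD('q)"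
    using m.Wv_moment[OF full_rank[OF G]] by simp_all
qed

text \<open>l is fixed beforehand, so large that |t|^2 / (2 l) \<le> e / 2; the limits of D / sqrt
  lam and of the accumulation ratio then make it admissible and the other term small.\<close>

lemma W_char: "(\<lambda>G. CLINT \<omega>|M G. iexp (t \<bullet> W G \<omega>)) \<longlonglongrightarrow> complex_of_real (exp (- (norm t)\<^sup>2 / 2))"
proof (rule tendstoI)
  fix e :: real assume e: "0 < e"
  define l where "l = max 1 ((norm t)\<^sup>2 / e)"
  have l: "1 \<le> l" "(norm t)\<^sup>2 / (2 * l) \<le> e / 2"
  proof -
    have "(norm t)\<^sup>2 / e \<le> l" by (simp add: l_def)
    then have "(norm t)\<^sup>2 \<le> l * e" using e by (simp add: pos_divide_le_eq)
    then show "(norm t)\<^sup>2 / (2 * l) \<le> e / 2" by (simp add: l_def pos_divide_le_eq mult_ac)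
  qed (simp add: l_def)
  have "(\<lambda>G. l * (2 * norm t * C\<^sup>2 * (D G / sqrt (lam G)))) \<longlonglongrightarrow> l * (2 * norm t * C\<^sup>2 * 0)"
    by (intro tendsto_mult tendsto_const D_sqrt_lam)
  then have e1: "\<forall>\<^sub>F G in sequentially. l * (2 * norm t * C\<^sup>2 * (D G / sqrt (lam G))) < 1"
    by (rule order_tendstoD) simp
  have "(\<lambda>G. 576 * exp 3 * C ^ 8 * norm t ^ 4 * (1 + l) * (real (N G) * D G ^ 3 / (lam G)\<^sup>2)) \<longlonglongrightarrow> 576 * exp 3 * C ^ 8 * norm t ^ 4 * (1 + l) * 0"
    by (intro tendsto_mult tendsto_const acc)
  then have e2: "\<forall>\<^sub>F G in sequentially. 576 * exp 3 * C ^ 8 * norm t ^ 4 * (1 + l) * (real (N G) * D G ^ 3 / (lam G)\<^sup>2) < e / 2"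
    by (rule order_tendstoD) (use e in simp)
  from e1 e2 ev2 show "\<forall>\<^sub>F G in sequentially. dist (CLINT \<omega>|M G. iexp (t \<bullet> W G \<omega>)) (complex_of_real (exp (- (norm t)\<^sup>2 / 2))) < e"
  proof eventually_elim
    case (elim G)
    interpret m: dyadic_model "M G" G "N G" "psi G" "x G" "u G" C cQ by (rule model[OF elim(3)])
    have eqs: "m.D0 = D G" "m.lam = lam G" by (simp_all add: D_def lam_def m.D0_def m.lam_def)
    have WW: "m.Wv (R G) = W G"
      by (simp add: fun_eq_iff m.Wv_def W_def m.St_def m.score_def V_def)
    have "norm ((CLINT \<omega>|M G. iexp (t \<bullet> W G \<omega>)) - complex_of_real (exp (- (norm t)\<^sup>2 / 2)))
      \<le> 576 * exp 3 * C ^ 8 * norm t ^ 4 * (1 + l) * (real (N G) * D G ^ 3 / (lam G)\<^sup>2) + (norm t)\<^sup>2 / (2 * l)"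
      using m.Wv_char[OF full_rank[OF elim(3)] l(1), of t] elim(1) unfolding eqs WW by simp
    then show ?case using elim(2) l(2) unfolding dist_norm by linarith
  qed
qed

text \<open>The bound of \<open>Tst_close\<close> grows with |W|, so W is confined to a ball of
  radius A by its second moment, and the precision e is chosen after A.\<close>

lemma Tst_diff:
  fixes F :: "nat \<Rightarrow> 'a \<Rightarrow> real ^ 'q"
  assumes \<epsilon>: "0 < \<epsilon>"
  shows "(\<lambda>G. measure (M G) {\<omega> \<in> space (M G). \<epsilon> < norm (Tst F G \<omega> - W G \<omega>)}) \<longlonglongrightarrow> 0"
proof (rule tendstoI)
  fix p :: real assume p: "0 < p"
  let ?q = "real CARD('q)"
  define A where "A = sqrt (2 * (?q + 1) / p)"
  have A: "0 < A" "?q / A\<^sup>2 < p / 2" using p by (auto simp: A_def field_simps)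
  \<comment> \<open>Limits as e decreases to 0 produce one e that meets all smallness
    requirements.\<close>
  have "((\<lambda>e. 2 * sqrt (5 * ?q ^ 3 * e) * (A + e) + e) \<longlongrightarrow> 2 * sqrt (5 * ?q ^ 3 * 0) * (A + 0) + 0) (at_right 0)"
    by (intro tendsto_intros)
  then have 1: "\<forall>\<^sub>F e in at_right 0. 2 * sqrt (5 * ?q ^ 3 * e) * (A + e) + e < \<epsilon>"
    by (rule order_tendstoD) (use \<epsilon> in simp)
  have "((\<lambda>e. sqrt (5 * ?q ^ 3 * e)) \<longlongrightarrow> sqrt (5 * ?q ^ 3 * 0)) (at_right 0)" by (intro tendsto_intros)
  then have 2: "\<forall>\<^sub>F e in at_right 0. sqrt (5 * ?q ^ 3 * e) < 1 / 2" by (rule order_tendstoD) simp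
  have "((\<lambda>e. ?q\<^sup>2 * e) \<longlongrightarrow> ?q\<^sup>2 * 0) (at_right 0)" by (intro tendsto_intros)
  then have 3: "\<forall>\<^sub>F e in at_right 0. ?q\<^sup>2 * e < 1 / 2" by (rule order_tendstoD) simp
  have 4: "\<forall>\<^sub>F e in at_right 0. 0 < e \<and> e < (1 :: real)"
    using eventually_at_right_real[of 0 1] by (auto elim: eventually_mono)
  have "\<forall>\<^sub>F e in at_right 0. 2 * sqrt (5 * ?q ^ 3 * e) * (A + e) + e < \<epsilon> \<and> sqrt (5 * ?q ^ 3 * e) < 1 / 2 \<and> ?q\<^sup>2 * e < 1 / 2 \<and> 0 < e \<and> e < 1"
    using 1 2 3 4 by eventually_elim auto
  then obtain e where e: "2 * sqrt (5 * ?q ^ 3 * e) * (A + e) + e < \<epsilon>" "sqrt (5 * ?q ^ 3 * e) < 1 / 2" "?q\<^sup>2 * e < 1 / 2" "0 < e" "e < 1"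
    using eventually_happens'[OF trivial_limit_at_right_real] by blast
  have "0 < p / 2" using p by simp
  from good_eventually[OF e(4) this] ev2
  show "\<forall>\<^sub>F G in sequentially. dist (measure (M G) {\<omega> \<in> space (M G). \<epsilon> < norm (Tst F G \<omega> - W G \<omega>)}) 0 < p"
  proof eventually_elim
    case (elim G)
    then obtain B where B: "B \<in> sets (M G)" "measure (M G) B < p / 2" "AE \<omega> in M G. \<omega> \<notin> B \<longrightarrow> good G e \<omega>" by blast
    interpret m: dyadic_model "M G" G "N G" "psi G" "x G" "u G" C cQ by (rule model[OF elim(2)])
    note mW = meas(4)[OF elim(2)]
    note mW[measurable]
    let ?W = "{\<omega> \<in> space (M G). A < norm (W G \<omega>)}"
    have W: "?W \<in> sets (M G)" by measurable
    have "measure (M G) {\<omega> \<in> space (M G). \<epsilon> < norm (Tst F G \<omega> - W G \<omega>)} \<le> measure (M G) (B \<union> ?W)"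
    proof (rule m.finite_measure_mono_AE)
      show "AE \<omega> in M G. \<omega> \<in> {\<omega> \<in> space (M G). \<epsilon> < norm (Tst F G \<omega> - W G \<omega>)} \<longrightarrow> \<omega> \<in> B \<union> ?W"
        using B(3) AE_space
      proof eventually_elim
        case (elim \<omega>)
        have "\<not> \<epsilon> < norm (Tst F G \<omega> - W G \<omega>)" if nb: "\<omega> \<notin> B" and w: "norm (W G \<omega>) \<le> A"
        proof -
          have "norm (Tst F G \<omega> - W G \<omega>) \<le> 2 * sqrt (5 * ?q ^ 3 * e) * (norm (W G \<omega>) + e) + e"
            using elim nb e \<open>2 \<le> G\<close> by (intro Tst_close) auto
          also have "\<dots> \<le> 2 * sqrt (5 * ?q ^ 3 * e) * (A + e) + e"
            using w e(4) by (intro add_right_mono mult_left_mono) auto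
          finally show ?thesis using e(1) by linarith
        qed
        then show ?case using elim(2) by (cases "\<omega> \<in> B"; cases "norm (W G \<omega>) \<le> A") (simp_all add: not_le)
      qed
    qed (use B(1) W in simp)
    also have "\<dots> \<le> measure (M G) B + measure (M G) ?W" by (rule measure_Un_le[OF B(1) W])
    also have "measure (M G) ?W \<le> (LINT \<omega>|M G. (norm (W G \<omega>))\<^sup>2) / A\<^sup>2"
      by (rule m.markov_inequality_square[OF mW W_moment(1)[OF elim(2)] A(1)])
    also have "\<dots> \<le> ?q / A\<^sup>2" by (rule divide_right_mono[OF W_moment(2)[OF elim(2)]]) simp
    finally have "measure (M G) {\<omega> \<in> space (M G). \<epsilon> < norm (Tst F G \<omega> - W G \<omega>)} \<le> measure (M G) B + ?q / A\<^sup>2" by simp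
    then show ?case using B(2) A(2) measure_nonneg[of "M G" "{\<omega> \<in> space (M G). \<epsilon> < norm (Tst F G \<omega> - W G \<omega>)}"]
      unfolding dist_real_def by linarith
  qed
qed

theorem Tst_tendsto_in_dist:
  fixes F :: "nat \<Rightarrow> 'a \<Rightarrow> real ^ 'q"
  assumes F: "\<And>G. 2 \<le> G \<Longrightarrow> F G \<in> borel_measurable (M G)"
  shows "tendsto_in_dist M (Tst F) std_normal_vec"
proof (rule tendsto_in_dist_offset[where k = 2])
  show "tendsto_in_dist (\<lambda>G. M (G + 2)) (\<lambda>G. Tst F (G + 2)) std_normal_vec"
  proof (rule tendsto_in_dist_std_normal_vec[where W = "\<lambda>G. W (G + 2)" and C = "real CARD('q)"])
    fix G
    show "prob_space (M (G + 2))" using model[of "G + 2"] by (simp add: dyadic_model_def)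
    show "Tst F (G + 2) \<in> borel_measurable (M (G + 2))" by (rule meas_Tst) (simp_all add: F)
    show "W (G + 2) \<in> borel_measurable (M (G + 2))" by (rule meas(4)) simp
    show "integrable (M (G + 2)) (\<lambda>\<omega>. (norm (W (G + 2) \<omega>))\<^sup>2)" by (rule W_moment(1)) simp
    show "(LINT \<omega>|M (G + 2). (norm (W (G + 2) \<omega>))\<^sup>2) \<le> real CARD('q)" by (rule W_moment(2)) simp
  next
    fix t
    show "(\<lambda>G. CLINT \<omega>|M (G + 2). iexp (t \<bullet> W (G + 2) \<omega>)) \<longlonglongrightarrow> complex_of_real (exp (- (norm t)\<^sup>2 / 2))"
      by (rule LIMSEQ_ignore_initial_segment[OF W_char])
  next
    fix e :: real assume "0 < e"
    show "(\<lambda>G. measure (M (G + 2)) {\<omega> \<in> space (M (G + 2)). e < norm (Tst F (G + 2) \<omega> - W (G + 2) \<omega>)}) \<longlonglongrightarrow> 0"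
      by (rule LIMSEQ_ignore_initial_segment[OF Tst_diff[OF \<open>0 < e\<close>]])
  qed
qed

lemma meas_wald: "2 \<le> G \<Longrightarrow> (\<lambda>\<omega>. wald_statistic (R G) r (b G \<omega>) (VJ G \<omega>)) \<in> borel_measurable (M G)"
proof -
  assume G: "2 \<le> G"
  note [measurable] = meas(1,2)[OF G]
  show ?thesis unfolding wald_statistic_def sandwich_def by measurable
qed

lemma wald_eq:
  assumes r: "transpose (R G) *v \<beta> G = r" and pd: "pos_def (sandwich (R G) (VJ G \<omega>))"
  shows "wald_statistic (R G) r (b G \<omega>) (VJ G \<omega>) = (norm (Tst F G \<omega>))\<^sup>2"
proof -
  let ?S = "sandwich (R G) (VJ G \<omega>)"
  define z where "z = transpose (R G) *v (b G \<omega> - \<beta> G)"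
  have z: "transpose (R G) *v b G \<omega> - r = z" unfolding z_def r[symmetric] by (rule matrix_vector_mult_diff_distrib[symmetric])
  have "wald_statistic (R G) r (b G \<omega>) (VJ G \<omega>) = z \<bullet> (matrix_inv ?S *v z)"
    using pos_def_lower_bound[OF pd] unfolding wald_statistic_def z by simp
  also have "\<dots> = z \<bullet> (inv_sqrt_mat ?S *v (inv_sqrt_mat ?S *v z))"
    by (simp only: inv_sqrt_mat_properties(6)[OF pd, symmetric] matrix_vector_mul_assoc)
  also have "\<dots> = (inv_sqrt_mat ?S *v z) \<bullet> (inv_sqrt_mat ?S *v z)"
    by (rule inner_matrix_vector_sym[OF inv_sqrt_mat_properties(2)[OF pd]])
  finally show ?thesis using pd by (simp add: Tst_def z_def power2_norm_eq_inner)
qed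

text \<open>Where the estimated variance is positive definite the statistic is the squared norm of
  the studentised vector. Its characteristic function is thus the expectation of a bounded
  continuous function of that vector, up to the probability of the complement.\<close>

lemma wald_char:
  assumes r: "\<And>G. 2 \<le> G \<Longrightarrow> transpose (R G) *v \<beta> G = r G"
  shows "(\<lambda>G. CLINT \<omega>|M G. iexp (s * wald_statistic (R G) (r G) (b G \<omega>) (VJ G \<omega>))) \<longlonglongrightarrow> char (chi_squared CARD('q)) s"
proof -
  define T where "T = Tst (\<lambda>_ _. 0 :: real ^ 'q)"
  have mT: "T G \<in> borel_measurable (M G)" if "2 \<le> G" for G
    unfolding T_def by (rule meas_Tst[OF that]) simp
  have lim: "(\<lambda>G. LINT \<omega>|M G. f (T G \<omega>)) \<longlonglongrightarrow> (LINT z|std_normal_vec. f z)"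
    if "continuous_on UNIV f" "bounded (range f)" for f :: "real ^ 'q \<Rightarrow> real"
    using Tst_tendsto_in_dist[of "\<lambda>_ _. 0"] that unfolding tendsto_in_dist_def T_def by simp
  \<comment> \<open>\<open>tendsto_in_dist\<close> tests real functions, hence the split of g into
    real and imaginary part.\<close>
  define g where "g z = iexp (s * (norm z)\<^sup>2)" for z :: "real ^ 'q"
  have g_c: "continuous_on UNIV (\<lambda>z. Re (g z))" "continuous_on UNIV (\<lambda>z. Im (g z))"
    unfolding g_def by (intro continuous_intros)+
  have "norm (g z) = 1" for z by (simp add: g_def)
  then have g_b: "bounded (range (\<lambda>z. Re (g z)))" "bounded (range (\<lambda>z. Im (g z)))"
    unfolding bounded_iff by (metis (mono_tags, lifting) abs_Re_le_cmod abs_Im_le_cmod imageE real_norm_def)+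
  have g_int: "(CLINT \<omega>|P. g (Y \<omega>)) = Complex (LINT \<omega>|P. Re (g (Y \<omega>))) (LINT \<omega>|P. Im (g (Y \<omega>)))"
    if P: "prob_space P" and Y: "Y \<in> borel_measurable P" for P :: "'c measure" and Y
  proof -
    interpret prob_space P by (rule P)
    have "integrable P (\<lambda>\<omega>. g (Y \<omega>))" unfolding g_def using Y by (intro integrable_iexp) auto
    then show ?thesis by (simp add: complex_eq_iff)
  qed
  have prob: "prob_space (M G)" if "2 \<le> G" for G using model[OF that] by (simp add: dyadic_model_def)
  have "(\<lambda>G. Complex (LINT \<omega>|M G. Re (g (T G \<omega>))) (LINT \<omega>|M G. Im (g (T G \<omega>))))
     \<longlonglongrightarrow> Complex (LINT z|std_normal_vec. Re (g z)) (LINT z|std_normal_vec. Im (g z))"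
    by (intro tendsto_Complex lim g_c g_b)
  moreover have "(CLINT z|std_normal_vec. g z) = Complex (LINT z|std_normal_vec. Re (g z)) (LINT z|std_normal_vec. Im (g z))"
    by (rule g_int[OF prob_space_std_normal_vec, of "\<lambda>z. z"]) (simp add: measurable_ident_sets sets_std_normal_vec)
  ultimately have 1: "(\<lambda>G. Complex (LINT \<omega>|M G. Re (g (T G \<omega>))) (LINT \<omega>|M G. Im (g (T G \<omega>)))) \<longlonglongrightarrow> char (chi_squared CARD('q)) s"
    by (simp add: char_chi_squared g_def)
  have 2: "(\<lambda>G. (CLINT \<omega>|M G. iexp (s * wald_statistic (R G) (r G) (b G \<omega>) (VJ G \<omega>)))
      - Complex (LINT \<omega>|M G. Re (g (T G \<omega>))) (LINT \<omega>|M G. Im (g (T G \<omega>)))) \<longlonglongrightarrow> 0"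
  proof (rule Lim_null_comparison)
    have "(\<lambda>G. measure (M G) {\<omega> \<in> space (M G). \<not> pos_def (sandwich (R G) (VJ G \<omega>))}) \<longlonglongrightarrow> 0"
      by (rule vanish[of "1/2"]) (use good_pos_def in auto)
    from tendsto_mult_right_zero[OF this, of 2]
    show "(\<lambda>G. 2 * measure (M G) {\<omega> \<in> space (M G). \<not> pos_def (sandwich (R G) (VJ G \<omega>))}) \<longlonglongrightarrow> 0" .
    show "\<forall>\<^sub>F G in sequentially. norm ((CLINT \<omega>|M G. iexp (s * wald_statistic (R G) (r G) (b G \<omega>) (VJ G \<omega>)))
      - Complex (LINT \<omega>|M G. Re (g (T G \<omega>))) (LINT \<omega>|M G. Im (g (T G \<omega>))))
      \<le> 2 * measure (M G) {\<omega> \<in> space (M G). \<not> pos_def (sandwich (R G) (VJ G \<omega>))}"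
      using ev2
    proof eventually_elim
      case (elim G)
      interpret prob_space "M G" by (rule prob[OF elim])
      note [measurable] = meas(2)[OF elim] meas_wald[OF elim, of "r G"] mT[OF elim]
      let ?w = "\<lambda>\<omega>. wald_statistic (R G) (r G) (b G \<omega>) (VJ G \<omega>)"
      let ?B = "{\<omega> \<in> space (M G). \<not> pos_def (sandwich (R G) (VJ G \<omega>))}"
      have B: "?B \<in> sets (M G)" unfolding sandwich_def by measurable
      have ind: "integrable (M G) (indicator ?B :: 'a \<Rightarrow> real)"
        by (rule integrable_real_indicator[OF B]) (simp add: emeasure_eq_measure)
      have i: "integrable (M G) (\<lambda>\<omega>. iexp (s * ?w \<omega>))" "integrable (M G) (\<lambda>\<omega>. g (T G \<omega>))"
        unfolding g_def by (rule integrable_iexp; measurable)+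
      have "norm ((CLINT \<omega>|M G. iexp (s * ?w \<omega>)) - (CLINT \<omega>|M G. g (T G \<omega>))) = norm (CLINT \<omega>|M G. iexp (s * ?w \<omega>) - g (T G \<omega>))"
        using i by simp
      also have "\<dots> \<le> (LINT \<omega>|M G. norm (iexp (s * ?w \<omega>) - g (T G \<omega>)))" by (rule integral_norm_bound)
      \<comment> \<open>Both exponentials have modulus 1 and agree off \<open>?B\<close>.\<close>
      also have "\<dots> \<le> (LINT \<omega>|M G. 2 * indicator ?B \<omega>)"
      proof (rule integral_mono)
        fix \<omega> assume w: "\<omega> \<in> space (M G)"
        show "norm (iexp (s * ?w \<omega>) - g (T G \<omega>)) \<le> 2 * indicator ?B \<omega>"
        proof (cases "\<omega> \<in> ?B")
          case True
          then show ?thesis using norm_triangle_ineq4[of "iexp (s * ?w \<omega>)" "g (T G \<omega>)"] by (simp add: g_def)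
        next
          case False
          then have "pos_def (sandwich (R G) (VJ G \<omega>))" using w by simp
          from wald_eq[OF r[OF elim] this] have "?w \<omega> = (norm (T G \<omega>))\<^sup>2" by (simp only: T_def)
          then show ?thesis by (simp add: g_def)
        qed
      qed (use i ind in \<open>auto intro!: integrable_norm integrable_mult_right\<close>)
      also have "(LINT \<omega>|M G. 2 * indicator ?B \<omega>) = 2 * measure (M G) (?B \<inter> space (M G))" by simp
      also have "?B \<inter> space (M G) = ?B" by blast
      finally show ?case unfolding g_int[OF prob_space_axioms mT[OF elim]] .
    qed
  qed
  from tendsto_add[OF 2 1] show ?thesis by simp
qed

text \<open>Levy's continuity theorem on the real line; the shift by 2 makes every law in the
  sequence a probability distribution.\<close>

theorem wald_weak_conv:
  fixes r :: "nat \<Rightarrow> real ^ 'q"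
  assumes r: "\<And>G. 2 \<le> G \<Longrightarrow> transpose (R G) *v \<beta> G = r G"
  shows "weak_conv_m (\<lambda>G. distr (M G) borel (\<lambda>\<omega>. wald_statistic (R G) (r G) (b G \<omega>) (VJ G \<omega>))) (chi_squared CARD('q))"
proof (rule weak_conv_m_offset[where k = 2], rule levy_continuity)
  fix G :: nat
  let ?G = "G + 2"
  have G2: "2 \<le> ?G" by simp
  interpret prob_space "M ?G" using model[OF G2] by (simp add: dyadic_model_def)
  show "real_distribution (distr (M ?G) borel (\<lambda>\<omega>. wald_statistic (R ?G) (r ?G) (b ?G \<omega>) (VJ ?G \<omega>)))"
    by (rule real_distribution_distr[OF meas_wald[OF G2]])
next
  show "real_distribution (chi_squared CARD('q))" by (rule real_distribution_chi_squared)
next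
  fix s
  have "char (distr (M (G + 2)) borel (\<lambda>\<omega>. wald_statistic (R (G + 2)) (r (G + 2)) (b (G + 2) \<omega>) (VJ (G + 2) \<omega>))) s
     = (CLINT \<omega>|M (G + 2). iexp (s * wald_statistic (R (G + 2)) (r (G + 2)) (b (G + 2) \<omega>) (VJ (G + 2) \<omega>)))" for G :: nat
    unfolding char_def using meas_wald[of "G + 2" "r (G + 2)"] by (subst integral_distr) auto
  then show "(\<lambda>G. char (distr (M (G + 2)) borel (\<lambda>\<omega>. wald_statistic (R (G + 2)) (r (G + 2)) (b (G + 2) \<omega>) (VJ (G + 2) \<omega>))) s) \<longlonglongrightarrow> char (chi_squared CARD('q)) s"
    using LIMSEQ_ignore_initial_segment[OF wald_char[OF r, of s], of 2] by simp
qed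

end

theorem theorem2:
  fixes M :: "nat \<Rightarrow> 'a measure"
    and N :: "nat \<Rightarrow> nat"
    and psi :: "nat \<Rightarrow> nat \<Rightarrow> nat set"
    and x :: "nat \<Rightarrow> nat \<Rightarrow> 'a \<Rightarrow> real ^ 'k"
    and u y :: "nat \<Rightarrow> nat \<Rightarrow> 'a \<Rightarrow> real"
    and \<beta> :: "nat \<Rightarrow> real ^ 'k"
    and R :: "nat \<Rightarrow> real ^ 'q ^ 'k"
    and r :: "nat \<Rightarrow> real ^ 'q"
    and C\<^sub>x C\<^sub>u c\<^sub>Q :: real
    and V :: "nat \<Rightarrow> real ^ 'k ^ 'k"
    and V\<^sub>J :: "nat \<Rightarrow> 'a \<Rightarrow> real ^ 'k ^ 'k"
    and b :: "nat \<Rightarrow> 'a \<Rightarrow> real ^ 'k"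
  assumes prob: "\<forall>G\<ge>2. prob_space (M G)"
    and dyads: "\<forall>G\<ge>2. \<forall>n\<in>{1..N G}. psi G n \<subseteq> {1..G} \<and> card (psi G n) = 2"
    and rv_x: "\<forall>G\<ge>2. \<forall>n\<in>{1..N G}. x G n \<in> borel_measurable (M G)"
    and rv_u: "\<forall>G\<ge>2. \<forall>n\<in>{1..N G}. u G n \<in> borel_measurable (M G)"
    and model: "\<forall>G\<ge>2. \<forall>n\<in>{1..N G}. \<forall>\<omega>\<in>space (M G). y G n \<omega> = \<beta> G \<bullet> x G n \<omega> + u G n \<omega>"
    and dependence: "\<forall>G\<ge>2. dyadic_dependence (M G) (N G) (psi G) (x G) (u G)"
    and bounded_x: "\<forall>G\<ge>2. \<forall>n\<in>{1..N G}. AE \<omega> in M G. norm (x G n \<omega>) \<le> C\<^sub>x"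
    and bounded_u: "\<forall>G\<ge>2. \<forall>n\<in>{1..N G}. AE \<omega> in M G. \<bar>u G n \<omega>\<bar> \<le> C\<^sub>u"
    and exogeneity: "\<forall>G\<ge>2. \<forall>n\<in>{1..N G}. (LINT \<omega>|M G. u G n \<omega> *\<^sub>R x G n \<omega>) = 0"
    and identification: "0 < c\<^sub>Q" "\<forall>G\<ge>2. c\<^sub>Q \<le> lambda_min (design_matrix (M G) (N G) (x G))"
    and Omega_pos: "\<forall>G\<ge>2. pos_def (score_variance (M G) (N G) (x G) (u G))"
    and accumulation:
      "(\<lambda>G. real (N G) * real (max_degree G (N G) (psi G)) ^ 3
             / (lambda_min (score_variance (M G) (N G) (x G) (u G)))\<^sup>2) \<longlonglongrightarrow> 0"
    and configuration: "\<forall>G\<ge>2. 1 \<le> min_degree G (N G) (psi G)"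
    and multiplicity:
      "(\<lambda>G. real (multiplicity_sum G (N G) (psi G))
             / lambda_min (score_variance (M G) (N G) (x G) (u G))) \<longlonglongrightarrow> 0"
    and dims: "CARD('q) \<le> CARD('k)"
    and full_rank: "\<forall>G\<ge>2. rank (R G) = CARD('q)"
    and V_eq: "V = (\<lambda>G. sandwich_variance (M G) (N G) (x G) (u G))"
    and VJ_eq: "V\<^sub>J = (\<lambda>G \<omega>. jackknife_variance G (N G) (psi G) (\<lambda>n. x G n \<omega>) (\<lambda>n. y G n \<omega>))"
    and b_eq: "b = (\<lambda>G \<omega>. ols (N G) (\<lambda>n. x G n \<omega>) (\<lambda>n. y G n \<omega>))"
  shows
    \<comment> \<open>(a)\<close>
    "tendsto_in_prob_zero M (\<lambda>G \<omega>. ennreal (rel_deviation (R G) (V G) (V\<^sub>J G \<omega>))) \<and>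
     tendsto_in_prob_zero M
       (\<lambda>G \<omega>. SUP T \<in> {T :: real ^ 'q ^ 'k. rank T = CARD('q)}.
                  ennreal (rel_deviation T (V G) (V\<^sub>J G \<omega>))) \<and>
     \<comment> \<open>(b)\<close>
     (\<forall>G\<ge>2. \<forall>\<omega>\<in>space (M G). jackknife_defined G (N G) (psi G) (\<lambda>n. x G n \<omega>) \<longrightarrow>
        pos_semidef (sandwich (R G) (V\<^sub>J G \<omega>))) \<and>
     (\<lambda>G. measure (M G) {\<omega> \<in> space (M G). jackknife_defined G (N G) (psi G) (\<lambda>n. x G n \<omega>)})
        \<longlonglongrightarrow> 1 \<and>
     (\<lambda>G. measure (M G) {\<omega> \<in> space (M G). pos_def (sandwich (R G) (V\<^sub>J G \<omega>))}) \<longlonglongrightarrow> 1 \<and>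
     \<comment> \<open>(c): \<open>F\<close> is the arbitrary value of the statistic off the event\<close>
     (\<forall>F :: nat \<Rightarrow> 'a \<Rightarrow> real ^ 'q. (\<forall>G\<ge>2. F G \<in> borel_measurable (M G)) \<longrightarrow>
        tendsto_in_dist M
          (\<lambda>G \<omega>. if pos_def (sandwich (R G) (V\<^sub>J G \<omega>))
                  then inv_sqrt_mat (sandwich (R G) (V\<^sub>J G \<omega>)) *v (transpose (R G) *v (b G \<omega> - \<beta> G))
                  else F G \<omega>)
          std_normal_vec) \<and>
     \<comment> \<open>(d)\<close>
     ((\<forall>G\<ge>2. transpose (R G) *v \<beta> G = r G) \<longrightarrow>
        (\<forall>\<^sub>F G in sequentially.
           (\<lambda>\<omega>. wald_statistic (R G) (r G) (b G \<omega>) (V\<^sub>J G \<omega>)) \<in> borel_measurable (M G)) \<and>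
        weak_conv_m
          (\<lambda>G. distr (M G) borel (\<lambda>\<omega>. wald_statistic (R G) (r G) (b G \<omega>) (V\<^sub>J G \<omega>)))
          (chi_squared CARD('q)))"
proof -
  \<comment> \<open>A common bound, at least 1 so that lower powers of C may be replaced by higher
    ones.\<close>
  define C where "C = max 1 (max C\<^sub>x C\<^sub>u)"
  have C: "C\<^sub>x \<le> C" "C\<^sub>u \<le> C" "1 \<le> C" unfolding C_def by auto
  have dm: "dyadic_model (M G) G (N G) (psi G) (x G) (u G) C c\<^sub>Q" if G: "2 \<le> G" for G
  proof (intro dyadic_model.intro dyadic_config.intro dyadic_model_axioms.intro)
    fix n assume n: "n \<in> {1..N G}"
    show "AE \<omega> in M G. norm (x G n \<omega>) \<le> C"
      using bounded_x[rule_format, OF G n] by (rule eventually_mono) (use C in linarith)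
    show "AE \<omega> in M G. \<bar>u G n \<omega>\<bar> \<le> C"
      using bounded_u[rule_format, OF G n] by (rule eventually_mono) (use C in linarith)
    show "psi G n \<subseteq> {1..G} \<and> card (psi G n) = 2" "x G n \<in> borel_measurable (M G)"
      "u G n \<in> borel_measurable (M G)" "(LINT \<omega>|M G. u G n \<omega> *\<^sub>R x G n \<omega>) = 0"
      using G n dyads rv_x rv_u exogeneity by simp_all
  next
    show "1 \<le> min_degree G (N G) (psi G)" using configuration G by blast
  qed (simp_all add: G C(3) prob dependence identification Omega_pos)
  interpret A: dyadic_array M N psi x u y \<beta> R C c\<^sub>Q
    by (rule dyadic_array.intro[OF dm model[rule_format] accumulation multiplicity full_rank[rule_format]])
  have eq: "V = A.V" "V\<^sub>J = A.VJ" "b = A.b"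
    by (simp_all add: fun_eq_iff V_eq VJ_eq b_eq A.V_def A.VJ_def A.b_def)
  show ?thesis unfolding eq
  proof (intro conjI impI allI ballI)
    show "tendsto_in_prob_zero M (\<lambda>G \<omega>. ennreal (rel_deviation (R G) (A.V G) (A.VJ G \<omega>)))"
      by (rule A.rel_deviation_tendsto)
    show "tendsto_in_prob_zero M (\<lambda>G \<omega>. SUP T \<in> {T :: real ^ 'q ^ 'k. rank T = CARD('q)}.
        ennreal (rel_deviation T (A.V G) (A.VJ G \<omega>)))"
      by (rule A.sup_rel_deviation_tendsto)
    show "pos_semidef (sandwich (R G) (A.VJ G \<omega>))" for G \<omega>
      by (rule A.VJ_sandwich_semidef)
    show "(\<lambda>G. measure (M G) {\<omega> \<in> space (M G). jackknife_defined G (N G) (psi G) (\<lambda>n. x G n \<omega>)}) \<longlonglongrightarrow> 1"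
      using A.jackknife_defined_tendsto unfolding A.jd_def .
    show "(\<lambda>G. measure (M G) {\<omega> \<in> space (M G). pos_def (sandwich (R G) (A.VJ G \<omega>))}) \<longlonglongrightarrow> 1"
      by (rule A.pos_def_tendsto)
    show "tendsto_in_dist M
          (\<lambda>G \<omega>. if pos_def (sandwich (R G) (A.VJ G \<omega>))
                  then inv_sqrt_mat (sandwich (R G) (A.VJ G \<omega>)) *v (transpose (R G) *v (A.b G \<omega> - \<beta> G))
                  else F G \<omega>)
          std_normal_vec" if "\<forall>G\<ge>2. F G \<in> borel_measurable (M G)" for F :: "nat \<Rightarrow> 'a \<Rightarrow> real ^ 'q"
      using A.Tst_tendsto_in_dist[of F] that unfolding A.Tst_def[abs_def] by blast
    show "\<forall>\<^sub>F G in sequentially.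
           (\<lambda>\<omega>. wald_statistic (R G) (r G) (A.b G \<omega>) (A.VJ G \<omega>)) \<in> borel_measurable (M G)"
      using A.ev2 by eventually_elim (rule A.meas_wald)
    show "weak_conv_m (\<lambda>G. distr (M G) borel (\<lambda>\<omega>. wald_statistic (R G) (r G) (A.b G \<omega>) (A.VJ G \<omega>)))
        (chi_squared CARD('q))" if "\<forall>G\<ge>2. transpose (R G) *v \<beta> G = r G"
      using that by (intro A.wald_weak_conv) blast
  qed
qed

end
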